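(* Let $\xi\in(\mathbb{Z}/2\mathbb{Z})^2$, $\eta\in\mathbb{Z}/2\mathbb{Z}$, $\lambda\in\mathbb{C}^2$, $\nu\in\mathbb{C}$. If $\lambda_1-\nu+\frac n2+[\xi_1+\eta]\notin-2\mathbb{N}$ and $\nu-\lambda_2+\frac n2+[\xi_2+\eta]\notin-2\mathbb{N}$, then the operator $\mathbf{B}_{\xi,\lambda}^{\eta,\nu}:\pi_{\xi,\lambda}\to\tau_{(\xi_1,\eta,\xi_2),(\lambda_1,\nu,\lambda_2)}$ is surjective.
   Context: $\mathbb{N}=\{0,1,2,\ldots\}$. For $\varepsilon\in\mathbb{Z}/2\mathbb{Z}$, $\mu\in\mathbb{C}$, $x\in\mathbb{R}^\times$ put $|x|_\varepsilon^\mu=\operatorname{sgn}(x)^\varepsilon|x|^\mu$; $[\varepsilon]\in\{0,1\}$ denotes the representative of $\varepsilon$; $E_{i,j}$ is the elementary matrix. Let $G=\mathrm{GL}(2n,\mathbb{R})$ and $H=\mathrm{GL}(2n-1,\mathbb{R})\subseteq G$ (upper left corner). $\pi_{\xi,\lambda}$ is the left regular representation of $G$ on the space of $f\in C^\infty(G)$ with $f\big(g\begin{pmatrix}g_1&*\\0&g_2\end{pmatrix}\big)=|\det g_1|_{\xi_1}^{-\lambda_1-\frac n2}|\det g_2|_{\xi_2}^{-\lambda_2+\frac n2}f(g)$, $g_1,g_2\in\mathrm{GL}(n,\mathbb{R})$. $\tau_{\eta,\nu}$ ($\eta\in(\mathbb{Z}/2\mathbb{Z})^3,\nu\in\mathbb{C}^3$)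 is the left regular representation of $H$ on the space of $f\in C^\infty(H)$ with $f(hp)=|\det p_1|_{\eta_1}^{-\nu_1-\frac n2}|p_2|_{\eta_2}^{-\nu_2}|\det p_3|_{\eta_3}^{-\nu_3+\frac n2}f(h)$ for block upper triangular $p\in H$ with diagonal blocks $p_1\in\mathrm{GL}(n-1,\mathbb{R})$, $p_2\in\mathrm{GL}(1,\mathbb{R})$, $p_3\in\mathrm{GL}(n-1,\mathbb{R})$. $\mathbf{B}_{\xi,\lambda}^{\eta,\nu}$ is the family of $H$-intertwining operators obtained by holomorphic continuation in $(\lambda,\nu)\in\mathbb{C}^2\times\mathbb{C}$ (in the compact picture, i.e. for fixed restriction of $f$ to $O(2n)$) of $$\mathbf{B}_{\xi,\lambda}^{\eta,\nu}f(h)=\Gamma\big(\tfrac{\lambda_1-\nu+\frac n2+[\xi_1+\eta]}{2}\big)^{-1}\Gamma\big(\tfrac{\nu-\lambda_2+\frac n2+[\xi_2+\eta]}{2}\big)^{-1}\int_{\mathbb{R}^\times}|t|_{\xi_1+\eta}^{\lambda_1-\nu+\frac n2}f\big(h(I_{2n}+tE_{2n,n})\big)\frac{dt}{|t|}\qquad(h\in H),$$ the integral converging for $\operatorname{Re}(\lambda_1-\nu)>-\frac n2$, $\operatorname{Re}(\nu-\lambda_2)>-\frac n2$. *)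

theory Defs
  imports
    "Jordan_Normal_Form.Determinant"
    "HOL-Library.Z2"
    "HOL-Analysis.Analysis"
begin

hide_const (open) Determinants.det Finite_Cartesian_Product.mat

section \<open>Matrix groups\<close>

definition GL :: "nat \<Rightarrow> real mat set" where
  "GL N = {g \<in> carrier_mat N N. invertible_mat g}"

definition Orth :: "nat \<Rightarrow> real mat set" where
  "Orth N = {k \<in> carrier_mat N N. transpose_mat k * k = 1\<^sub>m N}"

text \<open>Indices are counted from 0, as everywhere for \<^typ>\<open>real mat\<close>.\<close>

definition elem_mat :: "nat \<Rightarrow> nat \<Rightarrow> nat \<Rightarrow> real mat" where
  "elem_mat N i j = mat N N (\<lambda>(r, c). of_bool (r = i \<and> c = j))"

section \<open>Smooth functions on \<open>GL(N, \<real>)\<close>\<close>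

text \<open>
  \<open>GL(N, \<real>)\<close> is an open subset of \<open>\<real>\<^bsup>N\<times>N\<^esup>\<close>, and the matrix entries are global coordinates.
  The type \<^typ>\<open>real mat\<close> carries no topology, so continuity is expressed through the
  entries, with the product topology on \<^typ>\<open>nat \<times> nat \<Rightarrow> real\<close>; \<^term>\<open>mat N N x\<close> depends on the
  coordinates \<open>x (i, j)\<close> with \<open>i, j < N\<close> only.
\<close>

definition continuous_on_GL :: "nat \<Rightarrow> (real mat \<Rightarrow> complex) \<Rightarrow> bool" where
  "continuous_on_GL N f \<longleftrightarrow>
     continuous_on {x :: nat \<times> nat \<Rightarrow> real. mat N N x \<in> GL N} (\<lambda>x. f (mat N N x))"

primrec C_on_GL :: "nat \<Rightarrow> nat \<Rightarrow> (real mat \<Rightarrow> complex) \<Rightarrow> bool" where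
  "C_on_GL 0 N f \<longleftrightarrow> continuous_on_GL N f"
| "C_on_GL (Suc k) N f \<longleftrightarrow>
     continuous_on_GL N f \<and>
     (\<forall>i<N. \<forall>j<N. \<exists>f'.
        (\<forall>g\<in>GL N. ((\<lambda>t. f (g + t \<cdot>\<^sub>m elem_mat N i j)) has_vector_derivative f' g) (at 0)) \<and>
        C_on_GL k N f')"

definition smooth_on_GL :: "nat \<Rightarrow> (real mat \<Rightarrow> complex) \<Rightarrow> bool" where
  "smooth_on_GL N f \<longleftrightarrow> (\<forall>k. C_on_GL k N f)"

section \<open>The characters \<open>|x|\<^sub>\<epsilon>\<^sup>\<mu>\<close>\<close>

text \<open>The type \<^typ>\<open>bit\<close> is the field with two elements, that is, \<open>\<int>/2\<int>\<close>.\<close>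

definition bit_rep :: "bit \<Rightarrow> nat" where
  "bit_rep \<epsilon> = (if \<epsilon> = 0 then 0 else 1)"

definition abs_char :: "bit \<Rightarrow> complex \<Rightarrow> real \<Rightarrow> complex" where
  "abs_char \<epsilon> \<mu> x = of_real (sgn x ^ bit_rep \<epsilon>) * of_real \<bar>x\<bar> powr \<mu>"

section \<open>The representation spaces\<close>

text \<open>
  Functions on a group are total functions that are \<^const>\<open>undefined\<close> off the group, so that
  equality of functions is equality on the group.
\<close>

definition pi_space :: "nat \<Rightarrow> bit \<times> bit \<Rightarrow> complex \<times> complex \<Rightarrow> (real mat \<Rightarrow> complex) set" where
  "pi_space n = (\<lambda>(\<xi>1, \<xi>2) (lam1, lam2).
     {f \<in> extensional (GL (2 * n)). smooth_on_GL (2 * n) f \<and>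
        (\<forall>g\<in>GL (2 * n). \<forall>g1\<in>GL n. \<forall>g2\<in>GL n. \<forall>X\<in>carrier_mat n n.
           f (g * four_block_mat g1 X (0\<^sub>m n n) g2) =
             abs_char \<xi>1 (- lam1 - of_nat n / 2) (det g1) *
             abs_char \<xi>2 (- lam2 + of_nat n / 2) (det g2) * f g)})"

definition tau_space ::
  "nat \<Rightarrow> bit \<times> bit \<times> bit \<Rightarrow> complex \<times> complex \<times> complex \<Rightarrow> (real mat \<Rightarrow> complex) set" where
  "tau_space n = (\<lambda>(\<eta>1, \<eta>2, \<eta>3) (\<nu>1, \<nu>2, \<nu>3).
     {f \<in> extensional (GL (2 * n - 1)). smooth_on_GL (2 * n - 1) f \<and>
        (\<forall>h\<in>GL (2 * n - 1). \<forall>p1\<in>GL (n - 1). \<forall>p2\<in>GL 1. \<forall>p3\<in>GL (n - 1).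
         \<forall>X\<in>carrier_mat (n - 1) n. \<forall>Y\<in>carrier_mat 1 (n - 1).
           f (h * four_block_mat p1 X (0\<^sub>m n (n - 1))
                    (four_block_mat p2 Y (0\<^sub>m (n - 1) 1) p3)) =
             abs_char \<eta>1 (- \<nu>1 - of_nat n / 2) (det p1) *
             abs_char \<eta>2 (- \<nu>2) (p2 $$ (0, 0)) *
             abs_char \<eta>3 (- \<nu>3 + of_nat n / 2) (det p3) * f h)})"

section \<open>The operators \<open>B\<close>\<close>

definition embed_H :: "nat \<Rightarrow> real mat \<Rightarrow> real mat" where
  "embed_H n h = four_block_mat h (0\<^sub>m (2 * n - 1) 1) (0\<^sub>m 1 (2 * n - 1)) (1\<^sub>m 1)"

text \<open>
  In the region of convergence both Gamma factors are evaluated in the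
  right half plane, where \<^const>\<open>rGamma\<close> is the reciprocal of \<^const>\<open>Gamma\<close>. With indices counted
  from 0, \<open>E\<^bsub>2n,n\<^esub>\<close> is \<^term>\<open>elem_mat (2 * n) (2 * n - 1) (n - 1)\<close>.
\<close>

definition B_integral ::
  "nat \<Rightarrow> bit \<times> bit \<Rightarrow> bit \<Rightarrow> complex \<times> complex \<Rightarrow> complex \<Rightarrow>
   (real mat \<Rightarrow> complex) \<Rightarrow> real mat \<Rightarrow> complex" where
  "B_integral n = (\<lambda>(\<xi>1, \<xi>2) \<eta> (lam1, lam2) \<nu> f h.
     rGamma ((lam1 - \<nu> + of_nat n / 2 + of_nat (bit_rep (\<xi>1 + \<eta>))) / 2) *
     rGamma ((\<nu> - lam2 + of_nat n / 2 + of_nat (bit_rep (\<xi>2 + \<eta>))) / 2) *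
     (LINT t:-{0}|lborel.
        abs_char (\<xi>1 + \<eta>) (lam1 - \<nu> + of_nat n / 2) t *
        f (embed_H n h * (1\<^sub>m (2 * n) + t \<cdot>\<^sub>m elem_mat (2 * n) (2 * n - 1) (n - 1))) /
        of_real \<bar>t\<bar>))"

definition B_region :: "nat \<Rightarrow> ((complex \<times> complex) \<times> complex) set" where
  "B_region n = {((lam1, lam2), \<nu>). Re (lam1 - \<nu>) > - real n / 2 \<and> Re (\<nu> - lam2) > - real n / 2}"

text \<open>
  Compact picture: by the decomposition of \<open>GL(2n, \<real>)\<close> as the product of \<open>O(2n)\<close> and the
  parabolic subgroup, there is exactly one element of the representation space with parameter
  \<open>lam'\<close> that has the same restriction to \<open>O(2n)\<close> as \<open>f\<close>.
\<close>

definition flat_section ::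
  "nat \<Rightarrow> bit \<times> bit \<Rightarrow> (real mat \<Rightarrow> complex) \<Rightarrow> complex \<times> complex \<Rightarrow> real mat \<Rightarrow> complex" where
  "flat_section n \<xi> f lam' = (THE f'. f' \<in> pi_space n \<xi> lam' \<and> (\<forall>k\<in>Orth (2 * n). f' k = f k))"

text \<open>Holomorphic on \<open>\<complex>\<^sup>2 \<times> \<complex>\<close>: Frechet differentiable with complex linear derivative.\<close>

definition entire_3 :: "((complex \<times> complex) \<times> complex \<Rightarrow> complex) \<Rightarrow> bool" where
  "entire_3 \<Phi> \<longleftrightarrow>
     (\<forall>p. \<exists>a b c. (\<Phi> has_derivative (\<lambda>((x, y), z). a * x + b * y + c * z)) (at p))"

text \<open>
  The value at \<open>(lam, \<nu>)\<close> of the holomorphic continuation to \<open>\<complex>\<^sup>2 \<times> \<complex>\<close> of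
  \<open>(lam', \<nu>') \<mapsto> B f\<^bsub>lam'\<^esub> (h)\<close>, where \<open>f\<^bsub>lam'\<^esub>\<close> is the section with parameter \<open>lam'\<close> that agrees
  with \<open>f\<close> on \<open>O(2n)\<close>.
\<close>

definition B_op ::
  "nat \<Rightarrow> bit \<times> bit \<Rightarrow> bit \<Rightarrow> complex \<times> complex \<Rightarrow> complex \<Rightarrow>
   (real mat \<Rightarrow> complex) \<Rightarrow> real mat \<Rightarrow> complex" where
  "B_op n \<xi> \<eta> lam \<nu> f =
     (\<lambda>h\<in>GL (2 * n - 1).
        (THE \<Phi>. entire_3 \<Phi> \<and>
                (\<forall>(lam', \<nu>')\<in>B_region n.
                   \<Phi> (lam', \<nu>') = B_integral n \<xi> \<eta> lam' \<nu>' (flat_section n \<xi> f lam') h))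
          (lam, \<nu>))"

end

theory Submission
  imports Defs "HOL-Complex_Analysis.Complex_Analysis"
begin

text \<open>
  Let \<open>u\<^sub>t = 1 + t E\<close> with \<open>E = E\<^bsub>2n,n\<^esub>\<close>, let \<open>P\<close> be the maximal parabolic subgroup of \<open>G\<close> from which
  \<open>\<pi>\<close> is induced, and \<open>Q\<close> the parabolic subgroup of \<open>H\<close> belonging to \<open>\<tau>\<close>. The operator integrates a section
  \<open>f\<close> over the cosets \<open>h u\<^sub>t P\<close>, which together with one further point, reached as \<open>t\<close> tends to infinity,
  form a projective line in \<open>G/P\<close>. The theorem says that the operator maps \<open>\<pi>\<close> into \<open>\<tau>\<close> and that it is onto;
  the two parts need quite different work.

  \<^emph>\<open>The continuation and its values.\<close> The section \<open>f\<^sub>\<lambda>\<close> with the same restriction to \<open>O(2n)\<close> as \<open>f\<close> is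
  \<open>f\<close> times a power of the Gram determinant of the first \<open>n\<close> columns and a power of \<open>|det|\<close>
  (lemma \<open>flat_section_eq\<close>). Along the line this Gram determinant is \<open>\<alpha> + \<beta> t\<^sup>2\<close> with \<open>\<alpha>, \<beta> > 0\<close>. Cut the integral at
  \<open>|t| = 1\<close> and use the coordinate \<open>1/t\<close> on the outer part. Both halves become Mellin transforms over \<open>[0, 1]\<close> of smooth
  functions (\<open>B_integral_eq_mellin\<close>). A parity argument makes these functions even in \<open>t\<close>; hence their Mellin
  transforms have simple poles, at the even integers \<open>\<le> 0\<close> only, and the two Gamma factors
  cancel them. Integration by parts gives the entire continuation explicitly (\<open>mellin_entire\<close>), and the formula is
  smooth in \<open>h\<close> (\<open>B_op_smooth\<close>). Equivariance under \<open>Q\<close> is a substitution in the integral where it converges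
  and extends to all parameters because an entire function is determined by its values on that region
  (\<open>B_op_in_tau_space\<close>).

  \<^emph>\<open>Surjectivity.\<close> The cosets \<open>h u\<^sub>t P\<close> with \<open>t \<noteq> 0\<close> form the open set \<open>H u\<^sub>1 P\<close>. If \<open>h u\<^sub>1 = h' u\<^sub>1 p\<close> with
  \<open>p \<in> P\<close>, then \<open>h = h' q\<close> with \<open>q \<in> Q\<close>, the middle entry of \<open>q\<close> is 1, and the characters of \<open>\<pi>\<close> at \<open>p\<close> and of \<open>\<tau>\<close> at
  \<open>q\<close> agree (\<open>orbit_representative_unique\<close>). Hence every \<open>F \<in> \<tau>\<close> defines a function on \<open>H u\<^sub>1 P\<close> that transforms
  like an element of \<open>\<pi>\<close>. The quotient \<open>r\<close> of the Gram determinants of the first \<open>n\<close> columns without and with their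
  last row is invariant under \<open>P\<close>, and off \<open>H u\<^sub>1 P\<close> it only takes the values 0 and 1. Multiplication by a function of
  \<open>r\<close> supported in \<open>[1/4, 3/4]\<close> therefore makes the extension by zero smooth (\<open>section_of_in_pi_space\<close>). For this
  element of \<open>\<pi>\<close> the integrand at \<open>h\<close> is just \<open>F h\<close> times the cutoff of \<open>r = \<alpha> / (\<alpha> + \<beta> t\<^sup>2)\<close>, it vanishes
  near \<open>t = 0\<close> and for large \<open>|t|\<close>, and its integral is given by the same formula for all parameters. Since
  \<open>t dr/dt = - 2 r (1 - r)\<close>, a cutoff of the form \<open>2 r (1 - r) b r\<close> turns the integral against \<open>dt/|t|\<close> into
  a multiple of the integral of \<open>b\<close>, which does not depend on \<open>h\<close>. So the operator returns \<open>F\<close> times a constant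
  (\<open>B_op_section_of\<close>), and the two assumptions say exactly that the reciprocal Gamma factors in this constant
  are not zero.
\<close>

hide_const (open) Determinants.det Finite_Cartesian_Product.mat

section \<open>Functions of class \<open>C\<^sup>k\<close> of finitely many coordinates\<close>

text \<open>
  The entries of a matrix are coordinates in a function space \<open>'i \<Rightarrow> real\<close> with the product topology, which is not
  a normed space. Differentiability is therefore expressed by partial derivatives, in the coordinates from a set \<open>I\<close>
  only: with \<open>I\<close> finite this is the usual calculus of \<open>C\<^sup>k\<close> functions, and a coordinate outside \<open>I\<close> is a parameter.
\<close>

definition has_partial :: "'i \<Rightarrow> (('i \<Rightarrow> real) \<Rightarrow> 'a::real_normed_vector) \<Rightarrow> ('i \<Rightarrow> real) \<Rightarrow> 'a \<Rightarrow> bool" where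
  "has_partial i u x d \<longleftrightarrow> ((\<lambda>t. u (x(i := x i + t))) has_vector_derivative d) (at 0)"

definition partial :: "'i \<Rightarrow> (('i \<Rightarrow> real) \<Rightarrow> 'a::real_normed_vector) \<Rightarrow> ('i \<Rightarrow> real) \<Rightarrow> 'a" where
  "partial i u x = vector_derivative (\<lambda>t. u (x(i := x i + t))) (at 0)"

primrec Ck :: "'i set \<Rightarrow> ('i \<Rightarrow> real) set \<Rightarrow> nat \<Rightarrow> (('i \<Rightarrow> real) \<Rightarrow> 'a::real_normed_vector) \<Rightarrow> bool" where
  "Ck I U 0 u \<longleftrightarrow> continuous_on U u"
| "Ck I U (Suc k) u \<longleftrightarrow> continuous_on U u \<and>
     (\<forall>i\<in>I. (\<forall>x\<in>U. has_partial i u x (partial i u x)) \<and> Ck I U k (partial i u))"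

definition smooth :: "'i set \<Rightarrow> ('i \<Rightarrow> real) set \<Rightarrow> (('i \<Rightarrow> real) \<Rightarrow> 'a::real_normed_vector) \<Rightarrow> bool" where
  "smooth I U u \<longleftrightarrow> (\<forall>k. Ck I U k u)"

lemma continuous_line:
  "continuous_on S (\<lambda>t::real. x(i := x i + t))"
proof (rule continuous_on_coordinatewise_then_product)
  show "continuous_on S (\<lambda>t. (x(i := x i + t)) j)" for j
    using continuous_on_add[OF continuous_on_const[of S "x i"] continuous_on_id]
    by (cases "j = i") simp_all
qed

lemma continuous_on_coord: "continuous_on S (\<lambda>x. x i :: real)"
  by (rule continuous_on_subset[OF continuous_on_product_coordinates subset_UNIV])

lemma eventually_line_in_open:
  fixes x :: "'i \<Rightarrow> real"
  assumes "open U" "x \<in> U"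
  shows "\<forall>\<^sub>F t in nhds 0. x(i := x i + t) \<in> U"
proof -
  have "open ((\<lambda>t. x(i := x i + t)) -` U)"
    by (rule open_vimage[OF assms(1) continuous_line])
  then show ?thesis
    using assms(2) unfolding eventually_nhds
    by (intro exI[of _ "(\<lambda>t. x(i := x i + t)) -` U"]) simp
qed

lemma partial_eqI: "has_partial i u x d \<Longrightarrow> partial i u x = d"
  unfolding partial_def has_partial_def by (rule vector_derivative_at)

lemma has_partial_cong:
  assumes "open U" "x \<in> U" "\<And>y. y \<in> U \<Longrightarrow> u y = w y" and u: "has_partial i u x d"
  shows "has_partial i w x d"
proof -
  have ev: "\<forall>\<^sub>F t in nhds 0. u (x(i := x i + t)) = w (x(i := x i + t))"
    using eventually_line_in_open[OF assms(1,2)] by eventually_elim (rule assms(3))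
  have "u (x(i := x i + 0)) = w (x(i := x i + 0))"
    using assms(2,3) by simp
  then show ?thesis
    using u ev has_vector_derivative_cong_ev[where x = 0 and S = UNIV and f = "\<lambda>t. u (x(i := x i + t))"
        and g = "\<lambda>t. w (x(i := x i + t))" and f' = d]
    unfolding has_partial_def by simp
qed

lemma Ck_cong:
  assumes "open U" "\<And>y. y \<in> U \<Longrightarrow> u y = w y" "Ck I U k u"
  shows "Ck I U k w"
  using assms(2,3)
proof (induction k arbitrary: u w)
  case 0
  then show ?case using continuous_on_cong[of U U u w] by simp
next
  case (Suc k)
  have "continuous_on U u" using Suc.prems(2) by simp
  then have c: "continuous_on U w"
    using continuous_on_cong[of U U u w] Suc.prems(1) by simp
  have d: "has_partial i w x (partial i u x)" if "i \<in> I" "x \<in> U" for i x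
    by (rule has_partial_cong[OF assms(1) that(2) Suc.prems(1)]) (use Suc.prems(2) that in simp_all)
  have e: "partial i w x = partial i u x" if "i \<in> I" "x \<in> U" for i x
    using d[OF that] by (rule partial_eqI)
  have "Ck I U k (partial i w)" if "i \<in> I" for i
    by (rule Suc.IH[OF e[OF that, symmetric]]) (use Suc.prems(2) that in simp_all)
  then show ?case using c d e by simp
qed

lemma Ck_SucI:
  assumes "open U" "continuous_on U u"
    and "\<And>i x. i \<in> I \<Longrightarrow> x \<in> U \<Longrightarrow> has_partial i u x (u' i x)"
    and "\<And>i. i \<in> I \<Longrightarrow> Ck I U k (u' i)"
  shows "Ck I U (Suc k) u"
proof -
  have e: "partial i u x = u' i x" if "i \<in> I" "x \<in> U" for i x
    using assms(3)[OF that] by (rule partial_eqI)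
  have "Ck I U k (partial i u)" if "i \<in> I" for i
    by (rule Ck_cong[OF assms(1) e[OF that, symmetric] assms(4)[OF that]])
  then show ?thesis using assms(2,3) e by simp
qed

lemma Ck_continuous: "Ck I U k u \<Longrightarrow> continuous_on U u"
  by (cases k) auto

lemma Ck_SucD: "Ck I U (Suc k) u \<Longrightarrow> Ck I U k u"
proof (induction k arbitrary: u)
  case (Suc k)
  then show ?case unfolding Ck.simps(2)[of I U "Suc k"] Ck.simps(2)[of I U k u] by blast
qed simp

lemma Ck_subset: "Ck I U k u \<Longrightarrow> V \<subseteq> U \<Longrightarrow> J \<subseteq> I \<Longrightarrow> Ck J V k u"
proof (induction k arbitrary: u)
  case 0
  then show ?case using continuous_on_subset[of U u V] by simp
next
  case (Suc k)
  have "continuous_on V u"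
    using continuous_on_subset[of U u V] Suc.prems by simp
  moreover have "Ck J V k (partial i u)" if "i \<in> J" for i
    by (rule Suc.IH) (use Suc.prems that in auto)
  moreover have "has_partial i u x (partial i u x)" if "i \<in> J" "x \<in> V" for i x
    using Suc.prems that by (simp add: subset_iff)
  ultimately show ?case by simp
qed

lemma smoothD: "smooth I U u \<Longrightarrow> Ck I U k u"
  by (simp add: smooth_def)

lemma smooth_continuous: "smooth I U u \<Longrightarrow> continuous_on U u"
  using smoothD[of I U u 0] by simp

lemma smooth_cong:
  "open U \<Longrightarrow> (\<And>y. y \<in> U \<Longrightarrow> u y = w y) \<Longrightarrow> smooth I U u \<Longrightarrow> smooth I U w"
  using Ck_cong[of U u w I] by (simp add: smooth_def)

lemma smooth_subset: "smooth I U u \<Longrightarrow> V \<subseteq> U \<Longrightarrow> J \<subseteq> I \<Longrightarrow> smooth J V u"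
  using Ck_subset[of I U _ u V J] by (simp add: smooth_def)

lemma smooth_partial: "smooth I U u \<Longrightarrow> i \<in> I \<Longrightarrow> smooth I U (partial i u)"
  using smoothD[of I U u "Suc _"] by (simp add: smooth_def)

lemma smooth_has_partial: "smooth I U u \<Longrightarrow> i \<in> I \<Longrightarrow> x \<in> U \<Longrightarrow> has_partial i u x (partial i u x)"
  using smoothD[of I U u "Suc 0"] by simp

lemma continuous_on_local:
  fixes u :: "'b::t2_space \<Rightarrow> 'a::topological_space"
  assumes "\<And>x. x \<in> U \<Longrightarrow> \<exists>V. open V \<and> x \<in> V \<and> continuous_on V u"
  shows "continuous_on U u"
  unfolding continuous_on_eq_continuous_within
proof
  fix x assume x: "x \<in> U"
  obtain V where "open V" "x \<in> V" "continuous_on V u" using assms[OF x] by (elim exE conjE)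
  then show "continuous (at x within U) u"
    using continuous_on_eq_continuous_at continuous_at_imp_continuous_at_within by blast
qed

lemma Ck_local:
  fixes u :: "('i::countable \<Rightarrow> real) \<Rightarrow> 'a::real_normed_vector"
  assumes "\<And>x. x \<in> U \<Longrightarrow> \<exists>V. open V \<and> x \<in> V \<and> Ck I V k u"
  shows "Ck I U k u"
  using assms
proof (induction k arbitrary: u)
  case 0
  show ?case unfolding Ck.simps(1) by (rule continuous_on_local) (rule 0[unfolded Ck.simps(1)])
next
  case (Suc k)
  have "continuous_on U u"
  proof (rule continuous_on_local)
    fix x assume x: "x \<in> U"
    show "\<exists>V. open V \<and> x \<in> V \<and> continuous_on V u" using Suc.prems[OF x] unfolding Ck.simps by blast
  qed
  moreover have "has_partial i u x (partial i u x)" if x: "x \<in> U" and i: "i \<in> I" for x i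
    using Suc.prems[OF x] i unfolding Ck.simps by blast
  moreover have "Ck I U k (partial i u)" if i: "i \<in> I" for i
  proof (rule Suc.IH)
    fix x assume x: "x \<in> U"
    show "\<exists>V. open V \<and> x \<in> V \<and> Ck I V k (partial i u)" using Suc.prems[OF x] i unfolding Ck.simps by blast
  qed
  ultimately show ?case by simp
qed

lemma smooth_local:
  fixes u :: "('i::countable \<Rightarrow> real) \<Rightarrow> 'a::real_normed_vector"
  assumes "\<And>x. x \<in> U \<Longrightarrow> \<exists>V. open V \<and> x \<in> V \<and> smooth I V u"
  shows "smooth I U u"
  unfolding smooth_def
proof (intro allI Ck_local)
  fix k x assume "x \<in> U"
  from assms[OF this] show "\<exists>V. open V \<and> x \<in> V \<and> Ck I V k u"
    unfolding smooth_def by blast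
qed

subsection \<open>Sums and products\<close>

lemma Ck_const: "open U \<Longrightarrow> Ck I U k (\<lambda>x. c)"
proof (induction k arbitrary: c)
  case (Suc k)
  have "has_partial i (\<lambda>x. c) x 0" for i :: 'a and x
    by (simp add: has_partial_def)
  from Ck_SucI[OF Suc.prems continuous_on_const this Suc.IH[OF Suc.prems]] show ?case .
qed simp

lemma Ck_coord: "open U \<Longrightarrow> Ck I U k (\<lambda>x. x i)"
proof (cases k)
  case (Suc k')
  assume U: "open U"
  have "has_partial j (\<lambda>x. x i) x (if j = i then 1 else 0)" for x :: "'a \<Rightarrow> real" and j
    using has_vector_derivative_add[OF has_vector_derivative_const[of "x i"] has_vector_derivative_id, of "at 0"]
    by (cases "j = i") (simp_all add: has_partial_def)
  from Ck_SucI[OF U continuous_on_coord this Ck_const[OF U]] show ?thesis unfolding Suc .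
qed (simp add: continuous_on_coord)

lemma Ck_bounded_linear:
  assumes "open U" "bounded_linear f" "Ck I U k u"
  shows "Ck I U k (\<lambda>x. f (u x))"
  using assms(3)
proof (induction k arbitrary: u)
  case 0
  then show ?case using bounded_linear.continuous_on[OF assms(2), of U u] by simp
next
  case (Suc k)
  have "continuous_on U (\<lambda>x. f (u x))"
    by (rule bounded_linear.continuous_on[OF assms(2) Ck_continuous[OF Suc.prems]])
  moreover have "has_partial i (\<lambda>x. f (u x)) x (f (partial i u x))" if "i \<in> I" "x \<in> U" for i x
  proof -
    have "has_partial i u x (partial i u x)" using Suc.prems that by simp
    from bounded_linear.has_vector_derivative[OF assms(2) this[unfolded has_partial_def]]
    show ?thesis unfolding has_partial_def .
  qed
  moreover have "Ck I U k (\<lambda>x. f (partial i u x))" if "i \<in> I" for i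
    by (rule Suc.IH) (use Suc.prems that in simp)
  ultimately show ?case by (rule Ck_SucI[OF assms(1)])
qed

lemma Ck_add:
  assumes "open U" "Ck I U k u" "Ck I U k v"
  shows "Ck I U k (\<lambda>x. u x + v x)"
  using assms(2,3)
proof (induction k arbitrary: u v)
  case (Suc k)
  have "continuous_on U (\<lambda>x. u x + v x)"
    by (rule continuous_on_add[OF Ck_continuous[OF Suc.prems(1)] Ck_continuous[OF Suc.prems(2)]])
  moreover have "has_partial i (\<lambda>x. u x + v x) x (partial i u x + partial i v x)"
    if "i \<in> I" "x \<in> U" for i x
  proof -
    have "has_partial i u x (partial i u x)" "has_partial i v x (partial i v x)"
      using Suc.prems that by simp_all
    from has_vector_derivative_add[OF this[unfolded has_partial_def]]
    show ?thesis unfolding has_partial_def .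
  qed
  moreover have "Ck I U k (\<lambda>x. partial i u x + partial i v x)" if "i \<in> I" for i
    by (rule Suc.IH) (use Suc.prems that in simp_all)
  ultimately show ?case by (rule Ck_SucI[OF assms(1)])
qed (simp add: continuous_on_add)

lemma Ck_bilinear:
  assumes "open U" "bounded_bilinear bl" "Ck I U k u" "Ck I U k v"
  shows "Ck I U k (\<lambda>x. bl (u x) (v x))"
  using assms(3,4)
proof (induction k arbitrary: u v)
  case 0
  then show ?case using bounded_bilinear.continuous_on[OF assms(2), of U u v] by simp
next
  case (Suc k)
  have 1: "has_partial i (\<lambda>x. bl (u x) (v x)) x (bl (u x) (partial i v x) + bl (partial i u x) (v x))"
    if "i \<in> I" "x \<in> U" for i x
  proof -
    have "has_partial i u x (partial i u x)" "has_partial i v x (partial i v x)"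
      using Suc.prems that by simp_all
    from bounded_bilinear.has_vector_derivative[OF assms(2) this[unfolded has_partial_def]]
    show ?thesis by (simp add: has_partial_def[of i "\<lambda>x. bl (u x) (v x)"])
  qed
  have 2: "continuous_on U (\<lambda>x. bl (u x) (v x))"
    by (intro bounded_bilinear.continuous_on[OF assms(2)] Ck_continuous[OF Suc.prems(1)] Ck_continuous[OF Suc.prems(2)])
  have "Ck I U k (partial i u)" "Ck I U k (partial i v)" if "i \<in> I" for i
    using Suc.prems that by simp_all
  then have "Ck I U k (\<lambda>x. bl (u x) (partial i v x) + bl (partial i u x) (v x))" if "i \<in> I" for i
    using that by (intro Ck_add[OF assms(1)] Suc.IH Ck_SucD[OF Suc.prems(1)] Ck_SucD[OF Suc.prems(2)])
  then show ?case by (intro Ck_SucI[OF assms(1) 2 1])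
qed

lemma smooth_const: "open U \<Longrightarrow> smooth I U (\<lambda>x. c)"
  by (simp add: smooth_def Ck_const)
lemma smooth_coord: "open U \<Longrightarrow> smooth I U (\<lambda>x. x i)"
  by (simp add: smooth_def Ck_coord)
lemma smooth_add: "open U \<Longrightarrow> smooth I U u \<Longrightarrow> smooth I U v \<Longrightarrow> smooth I U (\<lambda>x. u x + v x)"
  by (simp add: smooth_def Ck_add)
lemma smooth_mult:
  fixes u v :: "('i \<Rightarrow> real) \<Rightarrow> 'a::real_normed_algebra"
  shows "open U \<Longrightarrow> smooth I U u \<Longrightarrow> smooth I U v \<Longrightarrow> smooth I U (\<lambda>x. u x * v x)"
  by (simp add: smooth_def Ck_bilinear[OF _ bounded_bilinear_mult])
lemma smooth_bounded_linear:
  "open U \<Longrightarrow> bounded_linear f \<Longrightarrow> smooth I U u \<Longrightarrow> smooth I U (\<lambda>x. f (u x))"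
  by (simp add: smooth_def Ck_bounded_linear)
lemma smooth_of_real:
  "open U \<Longrightarrow> smooth I U u \<Longrightarrow> smooth I U (\<lambda>x. of_real (u x) :: 'a::real_normed_algebra_1)"
  by (rule smooth_bounded_linear[OF _ bounded_linear_of_real])
lemma smooth_minus: "open U \<Longrightarrow> smooth I U u \<Longrightarrow> smooth I U (\<lambda>x. - u x)"
  using smooth_bounded_linear[of U "\<lambda>x. -x" I u] by (simp add: bounded_linear_minus[OF bounded_linear_ident])
lemma smooth_diff: "open U \<Longrightarrow> smooth I U u \<Longrightarrow> smooth I U v \<Longrightarrow> smooth I U (\<lambda>x. u x - v x)"
  using smooth_add[of U I u "\<lambda>x. - v x"] smooth_minus[of U I v] by simp
lemma smooth_sum:
  "open U \<Longrightarrow> (\<And>a. a \<in> A \<Longrightarrow> smooth I U (u a)) \<Longrightarrow> smooth I U (\<lambda>x. \<Sum>a\<in>A. u a x)"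
  by (induction A rule: infinite_finite_induct) (auto intro!: smooth_const smooth_add)
lemma smooth_prod:
  fixes u :: "'b \<Rightarrow> ('i \<Rightarrow> real) \<Rightarrow> 'a::real_normed_field"
  shows "open U \<Longrightarrow> (\<And>a. a \<in> A \<Longrightarrow> smooth I U (u a)) \<Longrightarrow> smooth I U (\<lambda>x. \<Prod>a\<in>A. u a x)"
  by (induction A rule: infinite_finite_induct) (auto intro!: smooth_const smooth_mult)

lemmas smooth_intros = smooth_const smooth_coord smooth_add smooth_mult smooth_of_real
  smooth_minus smooth_diff smooth_sum smooth_prod

subsection \<open>Composition\<close>

text \<open>
  Compositions \<open>g \<circ> v\<close> with a function of one variable occur for \<open>g\<close> a power or a flat exponential. It is
  enough to know a family of functions closed under derivatives that contains \<open>g\<close>: the derivative of \<open>g \<circ> v\<close> is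
  a product of a partial derivative of \<open>v\<close> and a member of the family composed with \<open>v\<close>, and the induction on \<open>k\<close>
  applies to the whole family.
\<close>

lemma Ck_compose_family:
  fixes \<G> :: "(real \<Rightarrow> 'a::real_normed_vector) set"
  assumes "open V" and v: "Ck J V k v" "\<And>y. y \<in> V \<Longrightarrow> v y \<in> S"
    and der: "\<And>g. g \<in> \<G> \<Longrightarrow> \<exists>g'\<in>\<G>. \<forall>r\<in>S. (g has_vector_derivative g' r) (at r)"
    and "g \<in> \<G>"
  shows "Ck J V k (\<lambda>y. g (v y))"
  using v(1) \<open>g \<in> \<G>\<close>
proof (induction k arbitrary: g)
  case (0 g)
  obtain g' where "\<forall>r\<in>S. (g has_vector_derivative g' r) (at r)" using der[OF 0(2)] by blast
  then have "continuous_on S g"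
    by (meson continuous_at_imp_continuous_on has_vector_derivative_continuous)
  then show ?case using 0 v(2) by (auto intro!: continuous_on_compose2[of S g])
next
  case (Suc k g)
  obtain g' where g': "\<forall>r\<in>S. (g has_vector_derivative g' r) (at r)" "g' \<in> \<G>" using der[OF Suc.prems(2)] by blast
  have "continuous_on S g"
    using g' by (meson continuous_at_imp_continuous_on has_vector_derivative_continuous)
  then have c: "continuous_on V (\<lambda>y. g (v y))"
    using Ck_continuous[OF Suc.prems(1)] v(2) by (auto intro!: continuous_on_compose2[of S g])
  have d: "has_partial i (\<lambda>y. g (v y)) y (partial i v y *\<^sub>R g' (v y))" if "i \<in> J" "y \<in> V" for i y
  proof -
    have "has_partial i v y (partial i v y)" using Suc.prems(1) that by simp
    moreover have "(g has_vector_derivative g' (v y)) (at (v (y(i := y i + 0))))"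
      using g'(1) v(2)[OF that(2)] by simp
    ultimately show ?thesis
      unfolding has_partial_def using vector_diff_chain_at[of "\<lambda>t. v (y(i := y i + t))" "partial i v y" 0 g "g' (v y)"]
      by (simp add: o_def)
  qed
  have "Ck J V k (partial i v)" if "i \<in> J" for i using Suc.prems(1) that by simp
  then have "Ck J V k (\<lambda>y. partial i v y *\<^sub>R g' (v y))" if "i \<in> J" for i
    using that by (intro Ck_bilinear[OF assms(1) bounded_bilinear_scaleR] Suc.IH g'(2) Ck_SucD[OF Suc.prems(1)])
  then show ?case by (intro Ck_SucI[OF assms(1) c d])
qed

lemma smooth_compose_family:
  fixes \<G> :: "(real \<Rightarrow> 'a::real_normed_vector) set"
  assumes "open V" and v: "smooth J V v" "\<And>y. y \<in> V \<Longrightarrow> v y \<in> S"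
    and der: "\<And>g. g \<in> \<G> \<Longrightarrow> \<exists>g'\<in>\<G>. \<forall>r\<in>S. (g has_vector_derivative g' r) (at r)"
    and "g \<in> \<G>"
  shows "smooth J V (\<lambda>y. g (v y))"
  using Ck_compose_family[of V J _ v S \<G> g] assms by (auto simp: smooth_def)

lemma open_prod_boxE:
  assumes "open W" "(a, b) \<in> W"
  obtains A B where "open A" "open B" "a \<in> A" "b \<in> B" "A \<times> B \<subseteq> W"
  using assms by (metis mem_Sigma_iff open_prod_def)

text \<open>
  One step of the chain rule: only coordinate \<open>i\<close> moves by a controlled amount, while the base point \<open>y t\<close>
  merely converges to \<open>x0\<close>. Continuity of the partial derivative gives a bound for it near \<open>x0\<close>, uniform in the base point,
  and the mean value inequality in coordinate \<open>i\<close> does the rest.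
\<close>

lemma has_derivative_one_coordinate:
  fixes u :: "('i \<Rightarrow> real) \<Rightarrow> 'a::real_normed_vector"
  assumes U: "open U" "x0 \<in> U"
    and d: "\<And>x. x \<in> U \<Longrightarrow> has_partial i u x (D x)"
    and D: "continuous_on U D"
    and y: "(y \<longlongrightarrow> x0) (at (0::real))" "\<And>t. y t i = x0 i"
    and r: "(r has_real_derivative r') (at 0)" "r 0 = x0 i" "y 0 = x0"
  shows "((\<lambda>t. u ((y t)(i := r t)) - u (y t)) has_vector_derivative r' *\<^sub>R D x0) (at 0)"
proof -
  have rc: "(r \<longlongrightarrow> x0 i) (at 0)"
    using DERIV_isCont[OF r(1)] r(2) by (simp add: isCont_def)
  have small: "\<forall>\<^sub>F t in at 0. norm (u ((y t)(i := r t)) - u (y t) - (r t - x0 i) *\<^sub>R D x0) \<le> norm (r t - x0 i) * e"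
    if "e > 0" for e
  proof -
    define N where "N = {x\<in>U. dist (D x) (D x0) < e}"
    have "N = U \<inter> D -` (ball (D x0) e)" by (auto simp: N_def dist_commute)
    then have "open N" using D U(1) by (simp add: continuous_on_open_vimage Int_commute)
    have "continuous_on UNIV (\<lambda>(z::'i\<Rightarrow>real, s). z(i := s))"
    proof (rule continuous_on_coordinatewise_then_product)
      show "continuous_on UNIV (\<lambda>w::('i\<Rightarrow>real) \<times> real. (case w of (z, s) \<Rightarrow> z(i := s)) j)" for j
        by (cases "j = i")
          (simp_all add: case_prod_unfold continuous_on_snd continuous_on_id
            continuous_on_compose2[OF continuous_on_coord[of UNIV] continuous_on_fst[OF continuous_on_id]])
    qed
    then have oW: "open ((\<lambda>(z::'i\<Rightarrow>real, s). z(i := s)) -` N)"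
      by (rule open_vimage[OF \<open>open N\<close>])
    have "(x0, x0 i) \<in> (\<lambda>(z::'i\<Rightarrow>real, s). z(i := s)) -` N"
      using U(2) that by (auto simp: N_def)
    from open_prod_boxE[OF oW this] obtain A B where AB: "open A" "open B" "x0 \<in> A" "x0 i \<in> B"
      "A \<times> B \<subseteq> (\<lambda>(z::'i\<Rightarrow>real, s). z(i := s)) -` N" by blast
    obtain \<delta> where \<delta>: "\<delta> > 0" "ball (x0 i) \<delta> \<subseteq> B" using AB by (meson open_contains_ball)
    have "\<forall>\<^sub>F t in at 0. y t \<in> A" using y(1) AB by (metis topological_tendstoD)
    moreover have "\<forall>\<^sub>F t in at 0. r t \<in> ball (x0 i) \<delta>"
      using rc \<delta>(1) by (metis topological_tendstoD open_ball centre_in_ball)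
    ultimately show ?thesis
    proof eventually_elim
      case (elim t)
      have in_N: "(y t)(i := s) \<in> N" if "s \<in> ball (x0 i) \<delta>" for s
      proof -
        have "(y t, s) \<in> A \<times> B" using \<delta>(2) elim(1) that by blast
        from subsetD[OF AB(5) this] show ?thesis by simp
      qed
      have der: "((\<lambda>s. u ((y t)(i := s))) has_vector_derivative D ((y t)(i := s))) (at s within ball (x0 i) \<delta>)"
        if "s \<in> ball (x0 i) \<delta>" for s
      proof -
        have "has_partial i u ((y t)(i := s)) (D ((y t)(i := s)))"
          using d in_N[OF that] by (simp add: N_def)
        from this[unfolded has_partial_def fun_upd_upd fun_upd_same]
        have "((\<lambda>h. u ((y t)(i := s + h))) has_vector_derivative D ((y t)(i := s))) (at (s - s))"
          by (simp only: diff_self)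
        moreover have "((\<lambda>z. z - s) has_vector_derivative 1) (at s)"
          using has_vector_derivative_diff[OF has_vector_derivative_id has_vector_derivative_const[of s]] by simp
        ultimately have "((\<lambda>h. u ((y t)(i := s + h))) \<circ> (\<lambda>z. z - s) has_vector_derivative 1 *\<^sub>R D ((y t)(i := s))) (at s)"
          by (intro vector_diff_chain_at)
        moreover have "(\<lambda>h. u ((y t)(i := s + h))) \<circ> (\<lambda>z. z - s) = (\<lambda>z. u ((y t)(i := z)))"
          by (rule ext) simp
        ultimately show ?thesis by (simp add: has_vector_derivative_at_within)
      qed
      have bnd: "norm (D ((y t)(i := s)) - D x0) \<le> e" if "s \<in> ball (x0 i) \<delta>" for s
        using in_N[OF that] by (simp add: N_def dist_norm)
      have "norm ((u ((y t)(i := r t)) - r t *\<^sub>R D x0) - (u ((y t)(i := x0 i)) - x0 i *\<^sub>R D x0)) \<le> e * norm (r t - x0 i)"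
      proof (rule differentiable_bound)
        show "convex (ball (x0 i) \<delta>)" by simp
        show "((\<lambda>s. u ((y t)(i := s)) - s *\<^sub>R D x0) has_derivative (\<lambda>h. h *\<^sub>R (D ((y t)(i := s)) - D x0))) (at s within ball (x0 i) \<delta>)"
          if "s \<in> ball (x0 i) \<delta>" for s
          using has_vector_derivative_diff[OF der[OF that]
              bounded_linear.has_vector_derivative[OF bounded_linear_scaleR_left[of "D x0"] has_vector_derivative_id]]
          unfolding has_vector_derivative_def by simp
        show "onorm (\<lambda>h. h *\<^sub>R (D ((y t)(i := s)) - D x0)) \<le> e" if "s \<in> ball (x0 i) \<delta>" for s
        proof (rule onorm_le)
          show "norm (h *\<^sub>R (D ((y t)(i := s)) - D x0)) \<le> e * norm h" for h :: real
            using mult_left_mono[OF bnd[OF that], of "\<bar>h\<bar>"] by (simp add: mult.commute)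
        qed
        show "r t \<in> ball (x0 i) \<delta>" by (rule elim(2))
        show "x0 i \<in> ball (x0 i) \<delta>" using \<delta>(1) by simp
      qed
      moreover have "(y t)(i := x0 i) = y t" using y(2)[of t] by (simp add: fun_upd_idem)
      ultimately show ?case by (simp add: scaleR_diff_left mult.commute diff_diff_eq2 algebra_simps del: fun_upd_apply)
    qed
  qed
  define E where "E t = u ((y t)(i := r t)) - u (y t) - (r t - x0 i) *\<^sub>R D x0" for t
  have E0: "E 0 = 0" unfolding E_def r(2) r(3) by (simp only: fun_upd_triv diff_self scaleR_zero_left)
  have "(E has_derivative (\<lambda>_. 0)) (at 0)"
    unfolding has_derivative_within_alt2
  proof (intro conjI allI impI)
    fix e :: real assume "e > 0"
    have "(r has_derivative (\<lambda>h. h * r')) (at 0)"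
    proof -
      have "(*) r' = (\<lambda>h. h * r')" by (rule ext) (rule mult.commute)
      then show ?thesis using r(1) unfolding has_field_derivative_def by (simp only:)
    qed
    then have "\<forall>\<^sub>F t in at 0. norm (r t - r 0 - (t - 0) * r') \<le> 1 * norm (t - 0)"
      unfolding has_derivative_within_alt2 by (elim conjE allE[where x = 1]) simp
    moreover have "\<forall>\<^sub>F t in at 0. norm (E t) \<le> norm (r t - x0 i) * (e / (\<bar>r'\<bar> + 1))"
      unfolding E_def using \<open>e > 0\<close> by (intro small) auto
    ultimately show "\<forall>\<^sub>F t in at 0. norm (E t - E 0 - 0) \<le> e * norm (t - 0)"
    proof eventually_elim
      case (elim t)
      have "norm (r t - x0 i) \<le> norm (r t - r 0 - (t - 0) * r') + norm (t * r')"
        using r(2) norm_triangle_ineq[of "r t - r 0 - (t - 0) * r'" "t * r'"] by simp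
      also have "\<dots> \<le> norm t + norm t * \<bar>r'\<bar>"
        using elim(1) by (simp add: abs_mult)
      also have "\<dots> = (\<bar>r'\<bar> + 1) * norm t" by (simp add: algebra_simps)
      finally have "norm (r t - x0 i) * (e / (\<bar>r'\<bar> + 1)) \<le> ((\<bar>r'\<bar> + 1) * norm t) * (e / (\<bar>r'\<bar> + 1))"
        using \<open>e > 0\<close> by (intro mult_right_mono) simp_all
      also have "\<dots> = e * norm t"
      proof -
        have "\<bar>r'\<bar> + 1 \<noteq> 0" by linarith
        then show ?thesis by simp
      qed
      finally have "norm (E t) \<le> e * norm t" using elim(2) by linarith
      then show ?case by (simp add: E0)
    qed
  qed (rule bounded_linear_zero)
  then have "(E has_vector_derivative 0) (at 0)"
    by (simp add: has_vector_derivative_def)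
  moreover have "((\<lambda>t. (r t - x0 i) *\<^sub>R D x0) has_vector_derivative r' *\<^sub>R D x0) (at 0)"
    using bounded_linear.has_vector_derivative[OF bounded_linear_scaleR_left[of "D x0"]
        has_vector_derivative_diff[OF r(1)[unfolded has_real_derivative_iff_has_vector_derivative]
          has_vector_derivative_const[of "x0 i"]]] by simp
  ultimately have "((\<lambda>t. E t + (r t - x0 i) *\<^sub>R D x0) has_vector_derivative 0 + r' *\<^sub>R D x0) (at 0)"
    by (rule has_vector_derivative_add)
  then show ?thesis by (simp add: E_def)
qed

text \<open>
  The increment of \<open>u\<close> along the curve is a telescoping sum over the coordinates, which are switched one after the other from
  their values at time 0 to their values at time \<open>t\<close>; each term is an instance of the preceding lemma.
\<close>

lemma chain_rule_partials:
  fixes u :: "('i \<Rightarrow> real) \<Rightarrow> 'a::real_normed_vector"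
  assumes U: "open U" "\<gamma> 0 \<in> U"
    and d: "\<And>i x. i \<in> I \<Longrightarrow> x \<in> U \<Longrightarrow> has_partial i u x (D i x)"
    and D: "\<And>i. i \<in> I \<Longrightarrow> continuous_on U (D i)"
    and "finite I"
    and g: "\<And>i. i \<in> I \<Longrightarrow> ((\<lambda>t. \<gamma> t i) has_real_derivative \<gamma>' i) (at 0)"
    and const: "\<And>i t. i \<notin> I \<Longrightarrow> \<gamma> t i = \<gamma> 0 i"
  shows "((\<lambda>t. u (\<gamma> t)) has_vector_derivative (\<Sum>i\<in>I. \<gamma>' i *\<^sub>R D i (\<gamma> 0))) (at 0)"
proof -
  \<comment> \<open>the point whose coordinates in \<open>J\<close> have already moved\<close>
  define y where "y J t = (\<lambda>i. if i \<in> J then \<gamma> t i else \<gamma> 0 i)" for J t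
  have lim: "(y J \<longlongrightarrow> \<gamma> 0) (at 0)" if "J \<subseteq> I" for J
  proof -
    have "((\<lambda>t. y J t i) \<longlongrightarrow> \<gamma> 0 i) (at 0)" for i
      using g[of i, THEN DERIV_isCont] that by (cases "i \<in> J") (auto simp: y_def isCont_def)
    then have "limitin (product_topology (\<lambda>i. euclidean) UNIV) (y J) (\<gamma> 0) (at 0)"
      by (simp add: limitin_componentwise)
    then show ?thesis by (simp add: euclidean_product_topology)
  qed
  have "((\<lambda>t. u (y J t)) has_vector_derivative (\<Sum>i\<in>J. \<gamma>' i *\<^sub>R D i (\<gamma> 0))) (at 0)" if "J \<subseteq> I" for J
  proof -
    have "finite J" using that assms(5) by (rule finite_subset)
    then show ?thesis using that
    proof (induction J)
      case empty
      then show ?case by (simp add: y_def)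
    next
      case (insert i J)
      have "((\<lambda>t. u ((y J t)(i := \<gamma> t i)) - u (y J t)) has_vector_derivative \<gamma>' i *\<^sub>R D i (\<gamma> 0)) (at 0)"
      proof (rule has_derivative_one_coordinate[OF U])
        have i: "i \<in> I" "J \<subseteq> I" using insert.prems by simp_all
        show "\<And>x. x \<in> U \<Longrightarrow> has_partial i u x (D i x)" by (rule d[OF i(1)])
        show "continuous_on U (D i)" by (rule D[OF i(1)])
        show "((\<lambda>t. \<gamma> t i) has_real_derivative \<gamma>' i) (at 0)" by (rule g[OF i(1)])
        show "(y J \<longlongrightarrow> \<gamma> 0) (at 0)" by (rule lim[OF i(2)])
        show "y J t i = \<gamma> 0 i" for t using insert.hyps(2) by (simp add: y_def)
        show "y J 0 = \<gamma> 0" by (simp add: y_def)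
      qed (rule refl)
      moreover have "(y J t)(i := \<gamma> t i) = y (insert i J) t" for t
        by (rule ext) (simp add: y_def)
      ultimately have "((\<lambda>t. (u (y (insert i J) t) - u (y J t)) + u (y J t)) has_vector_derivative
          \<gamma>' i *\<^sub>R D i (\<gamma> 0) + (\<Sum>i\<in>J. \<gamma>' i *\<^sub>R D i (\<gamma> 0))) (at 0)"
        using insert.IH insert.prems by (intro has_vector_derivative_add) (simp_all only: insert_subset)
      then show ?case using insert.hyps by simp
    qed
  qed
  from this[OF subset_refl] have "((\<lambda>t. u (y I t)) has_vector_derivative (\<Sum>i\<in>I. \<gamma>' i *\<^sub>R D i (\<gamma> 0))) (at 0)" .
  moreover have "y I t = \<gamma> t" for t by (rule ext) (simp add: y_def const[symmetric])
  ultimately show ?thesis by (simp only:)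
qed

lemma Ck_compose:
  fixes u :: "('i \<Rightarrow> real) \<Rightarrow> 'a::real_normed_vector" and v :: "('j \<Rightarrow> real) \<Rightarrow> ('i \<Rightarrow> real)"
  assumes "open U" "open V" "finite I" "Ck I U k u"
    and v: "\<And>i. i \<in> I \<Longrightarrow> Ck J V k (\<lambda>y. v y i)" "\<And>i y. i \<notin> I \<Longrightarrow> v y i = c i" "\<And>y. y \<in> V \<Longrightarrow> v y \<in> U"
  shows "Ck J V k (\<lambda>y. u (v y))"
  using assms(4) v(1)
proof (induction k arbitrary: u)
  case 0
  have "continuous_on V (\<lambda>y. v y i)" for i
    using 0(2)[of i] v(2)[of i] by (cases "i \<in> I") auto
  then have "continuous_on V v" by (rule continuous_on_coordinatewise_then_product)
  then show ?case using 0 v(3) by (auto intro!: continuous_on_compose2[of U u])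
next
  case (Suc k)
  have "continuous_on V (\<lambda>y. v y i)" for i
    using Suc.prems(2)[of i] v(2)[of i] by (cases "i \<in> I") auto
  then have "continuous_on V v" by (rule continuous_on_coordinatewise_then_product)
  then have c: "continuous_on V (\<lambda>y. u (v y))"
    using Suc v(3) by (auto intro!: continuous_on_compose2[of U u])
  have d: "has_partial j (\<lambda>y. u (v y)) y (\<Sum>i\<in>I. partial j (\<lambda>y. v y i) y *\<^sub>R partial i u (v y))"
    if "j \<in> J" "y \<in> V" for j y
  proof -
    have "((\<lambda>t. v (y(j := y j + t)) i) has_real_derivative partial j (\<lambda>y. v y i) y) (at 0)" if "i \<in> I" for i
      using Suc.prems(2)[OF that] \<open>j \<in> J\<close> \<open>y \<in> V\<close>
      by (simp add: has_partial_def has_real_derivative_iff_has_vector_derivative)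
    moreover have "continuous_on U (partial i u)" "\<And>x. x \<in> U \<Longrightarrow> has_partial i u x (partial i u x)" if "i \<in> I" for i
      using Suc.prems(1) that Ck_continuous[of I U k "partial i u"] by simp_all
    moreover have "v (y(j := y j + 0)) \<in> U" using v(3)[OF that(2)] by simp
    ultimately have "((\<lambda>t. u (v (y(j := y j + t)))) has_vector_derivative
        (\<Sum>i\<in>I. partial j (\<lambda>y. v y i) y *\<^sub>R partial i u (v (y(j := y j + 0))))) (at 0)"
      by (intro chain_rule_partials[where U = U and \<gamma> = "\<lambda>t. v (y(j := y j + t))", OF assms(1) _ _ _ assms(3)])
        (simp_all add: v(2))
    then show ?thesis unfolding has_partial_def by (simp only: add_0_right fun_upd_triv)
  qed
  have e: "Ck J V k (\<lambda>y. \<Sum>i\<in>I. partial j (\<lambda>y. v y i) y *\<^sub>R partial i u (v y))" if "j \<in> J" for j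
  proof -
    have "Ck J V k (\<lambda>y. \<Sum>i\<in>A. partial j (\<lambda>y. v y i) y *\<^sub>R partial i u (v y))" if "A \<subseteq> I" for A
    proof -
      have "finite A" using assms(3) that by (rule rev_finite_subset)
      then show ?thesis using that
      proof (induction A)
        case (insert i A)
        have i: "i \<in> I" "A \<subseteq> I" using insert by auto
        have "Ck I U k (partial i u)" using Suc.prems(1) i by simp
        then have 1: "Ck J V k (\<lambda>y. partial i u (v y))"
          by (rule Suc.IH) (rule Ck_SucD[OF Suc.prems(2)])
        have "Ck J V k (partial j (\<lambda>y. v y i))" using Suc.prems(2)[OF i(1)] \<open>j \<in> J\<close> by simp
        from Ck_add[OF assms(2) Ck_bilinear[OF assms(2) bounded_bilinear_scaleR this 1] insert.IH[OF i(2)]]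
        show ?case using insert.hyps by simp
      qed (simp add: Ck_const assms(2))
    qed
    then show ?thesis by blast
  qed
  show ?case
    by (rule Ck_SucI[OF assms(2) c d e])
qed

lemma smooth_compose:
  fixes u :: "('i \<Rightarrow> real) \<Rightarrow> 'a::real_normed_vector" and v :: "('j \<Rightarrow> real) \<Rightarrow> ('i \<Rightarrow> real)"
  assumes "open U" "open V" "finite I" "smooth I U u"
    and "\<And>i. i \<in> I \<Longrightarrow> smooth J V (\<lambda>y. v y i)" "\<And>i y. i \<notin> I \<Longrightarrow> v y i = c i" "\<And>y. y \<in> V \<Longrightarrow> v y \<in> U"
  shows "smooth J V (\<lambda>y. u (v y))"
  using assms Ck_compose[of U V I _ u J v c] by (auto simp: smooth_def)

section \<open>Smooth functions on the general linear group\<close>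

lemma GL_iff_det: "g \<in> GL N \<longleftrightarrow> g \<in> carrier_mat N N \<and> det g \<noteq> 0"
proof
  assume g: "g \<in> GL N"
  then have c: "g \<in> carrier_mat N N" by (simp add: GL_def)
  obtain B where B: "g * B = 1\<^sub>m N" "B * g = 1\<^sub>m (dim_row B)"
    using g c unfolding GL_def invertible_mat_def inverts_mat_def by auto
  have "dim_col B = N" using arg_cong[OF B(1), of dim_col] by simp
  moreover have "dim_row B = N" using arg_cong[OF B(2), of dim_col] c by simp
  ultimately have "B \<in> carrier_mat N N" by auto
  then have "det g * det B = 1" using det_mult[OF c, of B] B(1) by simp
  then show "g \<in> carrier_mat N N \<and> det g \<noteq> 0" using c by auto
next
  assume g: "g \<in> carrier_mat N N \<and> det g \<noteq> 0"
  then obtain B where "B \<in> carrier_mat N N" "g * B = 1\<^sub>m N" "B * g = 1\<^sub>m N"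
    using det_non_zero_imp_unit[of g N] unfolding Units_def ring_mat_def by auto
  then show "g \<in> GL N" using g unfolding GL_def invertible_mat_def inverts_mat_def by auto
qed

definition entries :: "nat \<Rightarrow> (nat \<times> nat) set" where
  "entries N = {..<N} \<times> {..<N}"

definition GL_coords :: "nat \<Rightarrow> (nat \<times> nat \<Rightarrow> real) set" where
  "GL_coords N = {x. mat N N x \<in> GL N}"

lemma finite_entries: "finite (entries N)"
  by (simp add: entries_def)

lemma smooth_det:
  assumes U: "open U" and c: "\<And>y. M y \<in> carrier_mat n n"
    and M: "\<And>i j. i < n \<Longrightarrow> j < n \<Longrightarrow> smooth J U (\<lambda>y. M y $$ (i, j) :: real)"
  shows "smooth J U (\<lambda>y. det (M y))"
proof -
  have "smooth J U (\<lambda>y. \<Sum>p\<in>{p. p permutes {0..<n}}. signof p * (\<Prod>i = 0..<n. M y $$ (i, p i)))"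
    by (intro smooth_intros U M) (auto simp: permutes_in_image)
  then show ?thesis by (simp only: det_def'[OF c])
qed

lemma open_GL_coords: "open (GL_coords N)"
proof -
  have "continuous_on UNIV (\<lambda>x. det (mat N N x) :: real)"
    by (rule smooth_continuous[of "{}"], rule smooth_det[of _ _ N])
      (auto intro: smooth_coord)
  then have "open {x. det (mat N N x) \<in> - {0::real}}"
    using open_vimage[of "- {0::real}" "\<lambda>x. det (mat N N x)"] by (simp add: vimage_def open_Compl)
  moreover have "GL_coords N = {x. det (mat N N x) \<in> - {0::real}}"
    by (auto simp: GL_coords_def GL_iff_det)
  ultimately show ?thesis by simp
qed

lemma mat_fun_upd_entry:
  "i < N \<Longrightarrow> j < N \<Longrightarrow> mat N N (x((i, j) := x (i, j) + t)) = mat N N x + t \<cdot>\<^sub>m elem_mat N i j"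
  by (rule eq_matI) (auto simp: elem_mat_def)

lemma mat_index_mat: "g \<in> carrier_mat N N \<Longrightarrow> mat N N (\<lambda>p. g $$ p) = g"
  by (rule eq_matI) auto

text \<open>
  The derivatives of a function of matrices in the sense of \<^const>\<open>C_on_GL\<close> are partial derivatives in the entries,
  and \<^term>\<open>g + t \<cdot>\<^sub>m elem_mat N i j\<close> is the line in direction \<open>(i, j)\<close>.
\<close>

lemma C_on_GL_iff: "C_on_GL k N f \<longleftrightarrow> Ck (entries N) (GL_coords N) k (\<lambda>x. f (mat N N x))"
proof (induction k arbitrary: f)
  case 0
  then show ?case by (simp add: continuous_on_GL_def GL_coords_def)
next
  case (Suc k)
  have line: "has_partial (i, j) (\<lambda>x. f (mat N N x)) x d \<longleftrightarrow>
      ((\<lambda>t. f (mat N N x + t \<cdot>\<^sub>m elem_mat N i j)) has_vector_derivative d) (at 0)"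
    if "i < N" "j < N" for i j x d
    unfolding has_partial_def mat_fun_upd_entry[OF that] ..
  show ?case
  proof
    assume L: "C_on_GL (Suc k) N f"
    then have "\<forall>p\<in>entries N. \<exists>f'. (\<forall>g\<in>GL N. ((\<lambda>t. f (g + t \<cdot>\<^sub>m elem_mat N (fst p) (snd p))) has_vector_derivative f' g) (at 0)) \<and> C_on_GL k N f'"
      unfolding entries_def C_on_GL.simps(2) by (metis lessThan_iff mem_Times_iff)
    from bchoice[OF this] obtain f' where f': "\<forall>p\<in>entries N. (\<forall>g\<in>GL N.
          ((\<lambda>t. f (g + t \<cdot>\<^sub>m elem_mat N (fst p) (snd p))) has_vector_derivative f' p g) (at 0)) \<and> C_on_GL k N (f' p)"
      by blast
    show "Ck (entries N) (GL_coords N) (Suc k) (\<lambda>x. f (mat N N x))"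
    proof (rule Ck_SucI[OF open_GL_coords])
      show "continuous_on (GL_coords N) (\<lambda>x. f (mat N N x))"
        using L by (simp add: continuous_on_GL_def GL_coords_def)
      show "has_partial p (\<lambda>x. f (mat N N x)) x (f' p (mat N N x))" if p: "p \<in> entries N" and x: "x \<in> GL_coords N" for p x
      proof -
        obtain i j where ij: "p = (i, j)" "i < N" "j < N" using p by (auto simp: entries_def)
        have "mat N N x \<in> GL N" using x by (simp add: GL_coords_def)
        from conjunct1[OF bspec[OF f' p], rule_format, OF this] show ?thesis
          unfolding ij(1) line[OF ij(2,3)] fst_conv snd_conv .
      qed
      show "Ck (entries N) (GL_coords N) k (\<lambda>x. f' p (mat N N x))" if p: "p \<in> entries N" for p
        using conjunct2[OF bspec[OF f' p]] Suc.IH[of "f' p"] by simp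
    qed
  next
    assume R: "Ck (entries N) (GL_coords N) (Suc k) (\<lambda>x. f (mat N N x))"
    have "\<exists>f'. (\<forall>g\<in>GL N. ((\<lambda>t. f (g + t \<cdot>\<^sub>m elem_mat N i j)) has_vector_derivative f' g) (at 0)) \<and> C_on_GL k N f'"
      if ij: "i < N" "j < N" for i j
    proof -
      define f' where "f' g = partial (i, j) (\<lambda>x. f (mat N N x)) (\<lambda>p. g $$ p)" for g
      have p: "(i, j) \<in> entries N" using ij by (simp add: entries_def)
      have "((\<lambda>t. f (g + t \<cdot>\<^sub>m elem_mat N i j)) has_vector_derivative f' g) (at 0)" if "g \<in> GL N" for g
      proof -
        have g: "mat N N (\<lambda>p. g $$ p) = g" using that by (intro mat_index_mat) (simp add: GL_def)
        then have "(\<lambda>p. g $$ p) \<in> GL_coords N" using that by (simp add: GL_coords_def)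
        then have "has_partial (i, j) (\<lambda>x. f (mat N N x)) (\<lambda>p. g $$ p) (f' g)"
          using R p by (simp add: f'_def)
        then show ?thesis unfolding line[OF ij] g .
      qed
      moreover have "f' (mat N N x) = partial (i, j) (\<lambda>x. f (mat N N x)) x" for x
        unfolding f'_def partial_def mat_fun_upd_entry[OF ij] using mat_index_mat[of "mat N N x" N] by simp
      then have "C_on_GL k N f'" using R p Suc.IH[of f'] by simp
      ultimately show ?thesis by blast
    qed
    then show "C_on_GL (Suc k) N f"
      using R by (simp add: continuous_on_GL_def GL_coords_def)
  qed
qed

lemma smooth_on_GL_iff: "smooth_on_GL N f \<longleftrightarrow> smooth (entries N) (GL_coords N) (\<lambda>x. f (mat N N x))"
  by (simp add: smooth_on_GL_def smooth_def C_on_GL_iff)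

lemma smooth_compose_GL:
  assumes f: "smooth_on_GL N f" and V: "open V"
    and M: "\<And>i j. i < N \<Longrightarrow> j < N \<Longrightarrow> smooth J V (\<lambda>y. M y $$ (i, j))"
    and GL: "\<And>y. y \<in> V \<Longrightarrow> M y \<in> GL N"
  shows "smooth J V (\<lambda>y. f (M y))"
proof -
  define v where "v y p = (if p \<in> entries N then M y $$ p else 0)" for y p
  have v: "mat N N (v y) = M y" if "y \<in> V" for y
    using GL[OF that] by (intro eq_matI) (auto simp: v_def entries_def GL_def)
  have "smooth J V (\<lambda>y. f (mat N N (v y)))"
  proof (rule smooth_compose[OF open_GL_coords V finite_entries f[unfolded smooth_on_GL_iff]])
    show "smooth J V (\<lambda>y. v y p)" if p: "p \<in> entries N" for p
    proof -
      obtain i j where ij: "p = (i, j)" "i < N" "j < N" using p by (auto simp: entries_def)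
      then show ?thesis using M[OF ij(2,3)] p by (simp add: v_def)
    qed
    show "v y p = 0" if "p \<notin> entries N" for p y using that by (simp add: v_def)
    show "v y \<in> GL_coords N" if "y \<in> V" for y using GL[OF that] v[OF that] by (simp add: GL_coords_def)
  qed
  then show ?thesis by (rule smooth_cong[OF V, rotated]) (simp add: v)
qed

subsection \<open>Elementary functions\<close>

lemma abs_char_add: "x \<noteq> 0 \<Longrightarrow> abs_char (\<epsilon> + \<delta>) (\<mu> + \<nu>) x = abs_char \<epsilon> \<mu> x * abs_char \<delta> \<nu> x"
  by (cases \<epsilon>; cases \<delta>; cases "x > 0") (auto simp: abs_char_def bit_rep_def powr_add)

lemma abs_char_mult:
  assumes "x \<noteq> 0" "y \<noteq> 0"
  shows "abs_char \<epsilon> \<mu> (x * y) = abs_char \<epsilon> \<mu> x * abs_char \<epsilon> \<mu> y"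
proof -
  have "(of_real (\<bar>x\<bar> * \<bar>y\<bar>) :: complex) powr \<mu> = of_real \<bar>x\<bar> powr \<mu> * of_real \<bar>y\<bar> powr \<mu>"
    using assms powr_times_real[of "of_real \<bar>x\<bar>" "of_real \<bar>y\<bar>" \<mu>] by simp
  then show ?thesis by (simp add: abs_char_def sgn_mult power_mult_distrib abs_mult)
qed

lemma abs_char_nz: "x \<noteq> 0 \<Longrightarrow> abs_char \<epsilon> \<mu> x \<noteq> 0"
  by (auto simp: abs_char_def sgn_if)

lemma abs_char_1 [simp]: "abs_char \<epsilon> \<mu> 1 = 1"
  by (simp add: abs_char_def)

lemma abs_char_0 [simp]: "x \<noteq> 0 \<Longrightarrow> abs_char 0 0 x = 1"
  by (simp add: abs_char_def bit_rep_def)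

text \<open>
  Differentiation multiplies by \<open>\<mu>\<close>, lowers the exponent by 1 and changes the parity; so the multiples of the characters form a
  family closed under derivatives.
\<close>

lemma has_vector_derivative_abs_char:
  assumes "r \<noteq> 0"
  shows "(abs_char \<epsilon> \<mu> has_vector_derivative \<mu> * abs_char (\<epsilon> + 1) (\<mu> - 1) r) (at r)"
proof -
  define \<sigma> where "\<sigma> = sgn r"
  have \<sigma>: "\<sigma> = 1 \<or> \<sigma> = -1" "\<bar>r\<bar> = \<sigma> * r" "\<sigma> * r > 0" using assms by (auto simp: \<sigma>_def sgn_if)
  have "((\<lambda>x. of_real (\<sigma> * x)) has_vector_derivative (of_real (\<sigma> * 1) :: complex)) (at r)"
    by (rule has_vector_derivative_of_real) (auto intro!: derivative_eq_intros)
  moreover have "((\<lambda>z. z powr \<mu>) has_field_derivative \<mu> * of_real (\<sigma> * r) powr (\<mu> - 1)) (at (of_real (\<sigma> * r)))"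
    using \<sigma>(3) by (intro has_field_derivative_powr) (simp add: complex_nonpos_Reals_iff)
  ultimately have "((\<lambda>z. z powr \<mu>) \<circ> (\<lambda>x. of_real (\<sigma> * x)) has_vector_derivative
      of_real (\<sigma> * 1) * (\<mu> * of_real (\<sigma> * r) powr (\<mu> - 1))) (at r)"
    by (intro field_vector_diff_chain_at)
  then have d: "((\<lambda>z. z powr \<mu>) \<circ> (\<lambda>x. of_real (\<sigma> * x)) has_vector_derivative
      of_real \<sigma> * 1 * (\<mu> * of_real (\<sigma> * r) powr (\<mu> - 1))) (at r)"
    by (simp only: of_real_mult of_real_1)
  have d': "((\<lambda>x. of_real (\<sigma> ^ bit_rep \<epsilon>) * of_real (\<sigma> * x) powr \<mu>) has_vector_derivative
      of_real (\<sigma> ^ bit_rep \<epsilon>) * (of_real \<sigma> * 1 * (\<mu> * of_real (\<sigma> * r) powr (\<mu> - 1)))) (at r)"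
    using has_vector_derivative_mult_right[OF d, of "of_real (\<sigma> ^ bit_rep \<epsilon>)"] by (simp only: o_def)
  have eq: "of_real (\<sigma> ^ bit_rep \<epsilon>) * (of_real \<sigma> * 1 * (\<mu> * of_real (\<sigma> * r) powr (\<mu> - 1))) =
      \<mu> * abs_char (\<epsilon> + 1) (\<mu> - 1) r"
    using \<sigma> by (cases \<epsilon>) (auto simp: abs_char_def bit_rep_def \<sigma>_def[symmetric])
  have "open {x. \<sigma> * x > 0}" by (rule open_Collect_less) (auto intro!: continuous_intros)
  from d'[unfolded eq] show ?thesis
  proof (rule has_vector_derivative_transform_within_open[OF _ \<open>open {x. \<sigma> * x > 0}\<close>])
    show "r \<in> {x. \<sigma> * x > 0}" using \<sigma> by simp
    show "of_real (\<sigma> ^ bit_rep \<epsilon>) * of_real (\<sigma> * x) powr \<mu> = abs_char \<epsilon> \<mu> x" if "x \<in> {x. \<sigma> * x > 0}" for x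
    proof -
      have "sgn x = \<sigma>" "\<bar>x\<bar> = \<sigma> * x" using that \<sigma>(1) by (auto simp: sgn_if zero_less_mult_iff)
      then show ?thesis by (simp only: abs_char_def)
    qed
  qed
qed

lemma smooth_abs_char:
  assumes "open V" "smooth J V v" "\<And>y. y \<in> V \<Longrightarrow> v y \<noteq> 0"
  shows "smooth J V (\<lambda>y. abs_char \<epsilon> \<mu> (v y))"
proof -
  define \<G> where "\<G> = {\<lambda>r. c * abs_char \<epsilon> \<mu> r | c \<epsilon> \<mu>. True}"
  have "smooth J V (\<lambda>y. (\<lambda>r. 1 * abs_char \<epsilon> \<mu> r) (v y))"
  proof (rule smooth_compose_family[OF assms(1,2), of "- {0}" \<G>])
    show "v y \<in> - {0}" if "y \<in> V" for y using assms(3)[OF that] by simp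
    show "\<exists>g'\<in>\<G>. \<forall>r\<in>- {0}. (g has_vector_derivative g' r) (at r)" if gG: "g \<in> \<G>" for g
    proof -
      obtain c \<epsilon> \<mu> where g: "g = (\<lambda>r. c * abs_char \<epsilon> \<mu> r)" using gG unfolding \<G>_def by (elim CollectE exE conjE)
      have "(g has_vector_derivative (c * \<mu>) * abs_char (\<epsilon> + 1) (\<mu> - 1) r) (at r)" if "r \<in> - {0}" for r
        unfolding g mult.assoc using that
        by (intro has_vector_derivative_mult_right has_vector_derivative_abs_char) simp
      moreover have "(\<lambda>r. (c * \<mu>) * abs_char (\<epsilon> + 1) (\<mu> - 1) r) \<in> \<G>"
        unfolding \<G>_def by (intro CollectI exI conjI TrueI) (rule refl)
      ultimately show ?thesis by (intro bexI[of _ "\<lambda>r. (c * \<mu>) * abs_char (\<epsilon> + 1) (\<mu> - 1) r"] ballI)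
    qed
    show "(\<lambda>r. 1 * abs_char \<epsilon> \<mu> r) \<in> \<G>" unfolding \<G>_def by (intro CollectI exI conjI TrueI) (rule refl)
  qed
  then show ?thesis by simp
qed

lemma smooth_inverse:
  fixes v :: "('i \<Rightarrow> real) \<Rightarrow> real"
  assumes "open V" "smooth J V v" "\<And>y. y \<in> V \<Longrightarrow> v y \<noteq> 0"
  shows "smooth J V (\<lambda>y. inverse (v y))"
proof -
  \<comment> \<open>the reciprocal is the real part of \<open>|x|\<^sub>1\<^sup>\<mu>\<close> for \<open>\<mu> = -1\<close>\<close>
  have "smooth J V (\<lambda>y. Re (abs_char 1 (- 1) (v y)))"
    by (intro smooth_bounded_linear[OF assms(1) bounded_linear_Re] smooth_abs_char assms)
  moreover have "Re (abs_char 1 (- 1) r) = inverse r" if "r \<noteq> 0" for r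
  proof -
    have "(of_real \<bar>r\<bar> :: complex) powr (- 1) = of_real (inverse \<bar>r\<bar>)"
      using that by (simp add: powr_minus)
    then show ?thesis using that by (cases "r > 0") (simp_all add: abs_char_def bit_rep_def power2_eq_square inverse_eq_divide)
  qed
  ultimately show ?thesis
    using assms(3) by (intro smooth_cong[OF assms(1), of "\<lambda>y. Re (abs_char 1 (- 1) (v y))" "\<lambda>y. inverse (v y)" J]) metis+
qed

lemma smooth_divide:
  fixes v :: "('i \<Rightarrow> real) \<Rightarrow> real"
  assumes "open V" "smooth J V u" "smooth J V v" "\<And>y. y \<in> V \<Longrightarrow> v y \<noteq> 0"
  shows "smooth J V (\<lambda>y. u y / v y)"
  unfolding divide_inverse by (intro smooth_mult smooth_inverse assms)

subsection \<open>Integration along a coordinate\<close>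

lemma has_partial_line:
  assumes "has_partial i u (x(i := s)) d"
  shows "((\<lambda>z. u (x(i := z))) has_vector_derivative d) (at s)"
proof -
  from assms[unfolded has_partial_def fun_upd_upd fun_upd_same]
  have "((\<lambda>h. u (x(i := s + h))) has_vector_derivative d) (at (s - s))"
    by (simp only: diff_self)
  moreover have "((\<lambda>z. z - s) has_vector_derivative 1) (at s)"
    using has_vector_derivative_diff[OF has_vector_derivative_id has_vector_derivative_const[of s]] by simp
  ultimately have "((\<lambda>h. u (x(i := s + h))) \<circ> (\<lambda>z. z - s) has_vector_derivative 1 *\<^sub>R d) (at s)"
    by (intro vector_diff_chain_at)
  moreover have "(\<lambda>h. u (x(i := s + h))) \<circ> (\<lambda>z. z - s) = (\<lambda>z. u (x(i := z)))"
    by (rule ext) simp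
  ultimately show ?thesis by simp
qed

lemma continuous_on_scaled_point:
  "continuous_on S (\<lambda>(x::'i \<Rightarrow> real, u::real). x(\<tau> := u * x \<tau>))"
proof (rule continuous_on_coordinatewise_then_product)
  have c: "continuous_on S (\<lambda>p. fst p j)" for j
    by (rule continuous_on_compose2[OF continuous_on_coord[of UNIV] continuous_on_fst[OF continuous_on_id]]) simp
  show "continuous_on S (\<lambda>p. (case p of (x, u) \<Rightarrow> x(\<tau> := u * x \<tau>)) j)" for j
    by (cases "j = \<tau>") (simp_all add: case_prod_unfold c continuous_on_mult continuous_on_snd continuous_on_id)
qed

lemma continuous_on_scaled_integrand:
  fixes C :: "('i \<Rightarrow> real) \<Rightarrow> complex"
  assumes w: "continuous_on {0..1} w" and C: "continuous_on U C"
    and U: "\<And>x u. x \<in> U \<Longrightarrow> x(\<tau> := u * x \<tau>) \<in> U"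
  shows "continuous_on (U \<times> {0..1}) (\<lambda>(x, u). w u * C (x(\<tau> := u * x \<tau>)))"
  unfolding case_prod_unfold
proof (rule continuous_on_mult)
  show "continuous_on (U \<times> {0..1}) (\<lambda>p. w (snd p))"
    by (rule continuous_on_compose2[OF w continuous_on_snd[OF continuous_on_id]]) auto
  show "continuous_on (U \<times> {0..1}) (\<lambda>p. C ((fst p)(\<tau> := snd p * fst p \<tau>)))"
    by (rule continuous_on_compose2[OF C continuous_on_scaled_point[unfolded case_prod_unfold]]) (auto simp: U)
qed

text \<open>
  Differentiation under the integral sign. A derivative in a coordinate other than \<open>\<tau>\<close> passes to \<open>C\<close>; the derivative in
  \<open>\<tau>\<close> produces the factor \<open>u\<close>, so that the weight \<open>w\<close> becomes \<open>u w\<close>. Therefore the weight is arbitrary in the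
  statement.
\<close>

lemma Ck_scaled_integral:
  fixes C :: "('i \<Rightarrow> real) \<Rightarrow> complex"
  assumes oU: "open U" and U: "\<And>x s. x \<in> U \<Longrightarrow> x(\<tau> := s) \<in> U"
    and "continuous_on {0..1} w" "Ck I U k C"
  shows "Ck I U k (\<lambda>x. integral {0..1} (\<lambda>u. w u * C (x(\<tau> := u * x \<tau>))))"
  using assms(3,4)
proof (induction k arbitrary: w C)
  case 0
  show ?case unfolding Ck.simps
    by (rule integral_continuous_on_param[of U 0 "1::real" "\<lambda>x u. w u * C (x(\<tau> := u * x \<tau>))", unfolded cbox_interval])
      (rule continuous_on_scaled_integrand[OF 0(1) 0(2)[unfolded Ck.simps] U])
next
  case (Suc k)
  have cont: "continuous_on U (\<lambda>x. integral {0..1} (\<lambda>u. w u * C (x(\<tau> := u * x \<tau>))))"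
    by (rule integral_continuous_on_param[of U 0 "1::real" "\<lambda>x u. w u * C (x(\<tau> := u * x \<tau>))", unfolded cbox_interval])
      (rule continuous_on_scaled_integrand[OF Suc.prems(1) Ck_continuous[OF Suc.prems(2)] U])
  define w' where "w' i u = w u * (if i = \<tau> then of_real u else 1)" for i u
  have w': "continuous_on {0..1} (w' i)" for i
    unfolding w'_def using Suc.prems(1) by (cases "i = \<tau>") (auto intro!: continuous_intros)
  have "has_partial i (\<lambda>x. integral {0..1} (\<lambda>u. w u * C (x(\<tau> := u * x \<tau>)))) x
      (integral {0..1} (\<lambda>u. w' i u * partial i C (x(\<tau> := u * x \<tau>))))" if i: "i \<in> I" and x: "x \<in> U" for i x
  proof -
    have Ci: "continuous_on U (partial i C)" "\<And>y. y \<in> U \<Longrightarrow> has_partial i C y (partial i C y)"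
      using Suc.prems(2) i Ck_continuous[of I U k "partial i C"] by simp_all
    have "open ((\<lambda>t. x(i := x i + t)) -` U)" by (rule open_vimage[OF oU continuous_line])
    moreover have "0 \<in> (\<lambda>t. x(i := x i + t)) -` U" using x by simp
    ultimately obtain \<delta> where \<delta>: "\<delta> > 0" "ball 0 \<delta> \<subseteq> (\<lambda>t. x(i := x i + t)) -` U"
      by (meson open_contains_ball)
    have xt: "x(i := x i + t) \<in> U" if "t \<in> ball 0 \<delta>" for t using subsetD[OF \<delta>(2) that] by simp
    let ?y = "\<lambda>t u. (x(i := x i + t))(\<tau> := u * (x(i := x i + t)) \<tau>)"
    have y: "?y t u \<in> U" if "t \<in> ball 0 \<delta>" for t u by (rule U[OF xt[OF that]])
    have der: "((\<lambda>t. w u * C (?y t u)) has_vector_derivative w' i u * partial i C (?y t u)) (at t within ball 0 \<delta>)"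
      if t: "t \<in> ball 0 \<delta>" for t u
    proof -
      define f where "f = (\<lambda>z. C ((x(\<tau> := u * x \<tau>))(i := z)))"
      define c d where "c = (if i = \<tau> then u else 1)" and "d = (if i = \<tau> then u * x i else x i)"
      have yy: "?y t u = (x(\<tau> := u * x \<tau>))(i := d + c * t)" for t
        by (cases "i = \<tau>") (auto simp: c_def d_def fun_upd_twist distrib_left)
      have "has_partial i C (?y t u) (partial i C (?y t u))" by (rule Ci(2)[OF y[OF t]])
      then have "(f has_vector_derivative partial i C (?y t u)) (at (d + c * t))"
        unfolding f_def yy by (rule has_partial_line)
      moreover have "((\<lambda>t. d + c * t) has_vector_derivative c) (at t)"
        using has_vector_derivative_add[OF has_vector_derivative_const[of d]
            has_vector_derivative_mult_right[OF has_vector_derivative_id, of c]] by simp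
      ultimately have "(f \<circ> (\<lambda>t. d + c * t) has_vector_derivative c *\<^sub>R partial i C (?y t u)) (at t)"
        by (intro vector_diff_chain_at)
      from has_vector_derivative_mult_right[OF this, of "w u"]
      have "((\<lambda>t. w u * C (?y t u)) has_vector_derivative w u * (c *\<^sub>R partial i C (?y t u))) (at t)"
        unfolding o_def f_def yy .
      moreover have "w u * (c *\<^sub>R partial i C (?y t u)) = w' i u * partial i C (?y t u)"
        by (simp add: w'_def c_def scaleR_conv_of_real)
      ultimately show ?thesis by (simp only: has_vector_derivative_at_within)
    qed
    have line: "continuous_on (ball 0 \<delta> \<times> {0..1}) (\<lambda>p. (x(i := x i + fst p), snd p))"
      by (intro continuous_on_Pair continuous_on_snd continuous_on_id
          continuous_on_compose2[OF continuous_line[of UNIV x i] continuous_on_fst[OF continuous_on_id]]) simp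
    have cont': "continuous_on (ball 0 \<delta> \<times> cbox 0 1) (\<lambda>(t, u). w' i u * partial i C (?y t u))"
    proof -
      have "(\<lambda>p. (x(i := x i + fst p), snd p)) ` (ball 0 \<delta> \<times> {0..1}) \<subseteq> U \<times> {0..1}"
        using xt by (intro image_subsetI) (simp only: mem_Times_iff fst_conv snd_conv simp_thms)
      from continuous_on_compose2[OF continuous_on_scaled_integrand[OF w'[of i] Ci(1) U] line this]
      show ?thesis unfolding case_prod_unfold fst_conv snd_conv cbox_interval .
    qed
    have int: "(\<lambda>u. w u * C (?y t u)) integrable_on cbox 0 1" if t: "t \<in> ball 0 \<delta>" for t
    proof -
      have c1: "continuous_on {0..1} (\<lambda>u. (x(i := x i + t), u))"
        by (intro continuous_on_Pair continuous_on_const continuous_on_id)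
      have c2: "continuous_on (U \<times> {0..1}) (\<lambda>(x, u). w u * C (x(\<tau> := u * x \<tau>)))"
        by (rule continuous_on_scaled_integrand[OF Suc.prems(1) Ck_continuous[OF Suc.prems(2)]]) (rule U)
      have c3: "(\<lambda>u. (x(i := x i + t), u)) ` {0..1} \<subseteq> U \<times> {0..1}"
        using xt[OF t] by (intro image_subsetI) (simp only: mem_Times_iff fst_conv snd_conv simp_thms)
      from continuous_on_compose2[OF c2 c1 c3]
      have "continuous_on {0..1} (\<lambda>u. w u * C (?y t u))"
        unfolding case_prod_conv .
      then show ?thesis by (simp add: integrable_continuous_real)
    qed
    have "((\<lambda>t. integral (cbox 0 1) (\<lambda>u. w u * C (?y t u))) has_vector_derivative
        integral (cbox 0 1) (\<lambda>u. w' i u * partial i C (?y 0 u))) (at 0 within ball 0 \<delta>)"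
      by (rule leibniz_rule_vector_derivative[OF der int cont']) (use \<delta>(1) in simp_all)
    then have "((\<lambda>t. integral (cbox 0 1) (\<lambda>u. w u * C (?y t u))) has_vector_derivative
        integral (cbox 0 1) (\<lambda>u. w' i u * partial i C (?y 0 u))) (at 0)"
      using at_within_open[of "0::real" "ball 0 \<delta>"] \<delta>(1) by simp
    then show ?thesis unfolding has_partial_def by (simp only: add_0_right fun_upd_triv cbox_interval)
  qed
  moreover have "Ck I U k (\<lambda>x. integral {0..1} (\<lambda>u. w' i u * partial i C (x(\<tau> := u * x \<tau>))))" if "i \<in> I" for i
    by (rule Suc.IH[OF w']) (use Suc.prems(2) that in simp)
  ultimately show ?case by (rule Ck_SucI[OF oU cont])
qed

lemma smooth_scaled_integral:
  fixes C :: "('i \<Rightarrow> real) \<Rightarrow> complex"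
  assumes "open U" "\<And>x s. x \<in> U \<Longrightarrow> x(\<tau> := s) \<in> U" "continuous_on {0..1} w" "smooth I U C"
  shows "smooth I U (\<lambda>x. integral {0..1} (\<lambda>u. w u * C (x(\<tau> := u * x \<tau>))))"
  using assms Ck_scaled_integral[of U \<tau> w I _ C] by (simp add: smooth_def)

subsection \<open>Even and odd functions of a coordinate\<close>

text \<open>
  For a function \<open>C\<close> that is even in the coordinate \<open>\<tau>\<close>, the first integral is \<open>(1/\<tau>) dC/d\<tau>\<close>; for one that is odd
  in \<open>\<tau>\<close>, the second is \<open>C/\<tau>\<close>. The integrals define both also at \<open>\<tau> = 0\<close> and are visibly smooth.
\<close>

definition even_quot :: "'i \<Rightarrow> (('i \<Rightarrow> real) \<Rightarrow> complex) \<Rightarrow> ('i \<Rightarrow> real) \<Rightarrow> complex" where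
  "even_quot \<tau> C x = integral {0..1} (\<lambda>u. partial \<tau> (partial \<tau> C) (x(\<tau> := u * x \<tau>)))"

definition odd_quot :: "'i \<Rightarrow> (('i \<Rightarrow> real) \<Rightarrow> complex) \<Rightarrow> ('i \<Rightarrow> real) \<Rightarrow> complex" where
  "odd_quot \<tau> C x = integral {0..1} (\<lambda>u. partial \<tau> C (x(\<tau> := u * x \<tau>)))"

lemma smooth_even_quot:
  assumes "open U" "\<And>x s. x \<in> U \<Longrightarrow> x(\<tau> := s) \<in> U" "smooth I U C" "\<tau> \<in> I"
  shows "smooth I U (even_quot \<tau> C)"
proof -
  note C = smooth_partial[OF smooth_partial[OF assms(3,4)] assms(4)]
  have "smooth I U (\<lambda>x. integral {0..1} (\<lambda>u. 1 * partial \<tau> (partial \<tau> C) (x(\<tau> := u * x \<tau>))))"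
    by (rule smooth_scaled_integral[OF assms(1) _ continuous_on_const C]) (rule assms(2))
  then show ?thesis by (simp only: even_quot_def[abs_def] mult_1)
qed

lemma smooth_odd_quot:
  assumes "open U" "\<And>x s. x \<in> U \<Longrightarrow> x(\<tau> := s) \<in> U" "smooth I U C" "\<tau> \<in> I"
  shows "smooth I U (odd_quot \<tau> C)"
proof -
  note C = smooth_partial[OF assms(3,4)]
  have "smooth I U (\<lambda>x. integral {0..1} (\<lambda>u. 1 * partial \<tau> C (x(\<tau> := u * x \<tau>))))"
    by (rule smooth_scaled_integral[OF assms(1) _ continuous_on_const C]) (rule assms(2))
  then show ?thesis by (simp only: odd_quot_def[abs_def] mult_1)
qed

text \<open>
  Fundamental theorem of calculus along the segment from \<open>\<tau> = 0\<close>.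
\<close>

lemma odd_quot_mult:
  assumes U: "\<And>x s. x \<in> U \<Longrightarrow> x(\<tau> := s) \<in> U" and C: "smooth I U C" and \<tau>: "\<tau> \<in> I" and x: "x \<in> U"
  shows "of_real (x \<tau>) * odd_quot \<tau> C x = C x - C (x(\<tau> := 0))"
proof -
  have der: "((\<lambda>u. C (x(\<tau> := u * x \<tau>))) has_vector_derivative x \<tau> *\<^sub>R partial \<tau> C (x(\<tau> := u * x \<tau>))) (at u within {0..1})" for u
  proof -
    have "has_partial \<tau> C (x(\<tau> := u * x \<tau>)) (partial \<tau> C (x(\<tau> := u * x \<tau>)))"
      by (rule smooth_has_partial[OF C \<tau> U[OF x]])
    then have "((\<lambda>z. C (x(\<tau> := z))) has_vector_derivative partial \<tau> C (x(\<tau> := u * x \<tau>))) (at (u * x \<tau>))"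
      by (rule has_partial_line)
    moreover have "((\<lambda>u. u * x \<tau>) has_vector_derivative x \<tau>) (at u)"
      using has_vector_derivative_mult_left[OF has_vector_derivative_id, of "x \<tau>"] by simp
    ultimately have "((\<lambda>z. C (x(\<tau> := z))) \<circ> (\<lambda>u. u * x \<tau>) has_vector_derivative x \<tau> *\<^sub>R partial \<tau> C (x(\<tau> := u * x \<tau>))) (at u)"
      by (intro vector_diff_chain_at)
    then show ?thesis unfolding o_def by (rule has_vector_derivative_at_within)
  qed
  have "((\<lambda>u. x \<tau> *\<^sub>R partial \<tau> C (x(\<tau> := u * x \<tau>))) has_integral C (x(\<tau> := 1 * x \<tau>)) - C (x(\<tau> := 0 * x \<tau>))) {0..1}"
    by (rule fundamental_theorem_of_calculus[OF _ der]) simp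
  then have "integral {0..1} (\<lambda>u. x \<tau> *\<^sub>R partial \<tau> C (x(\<tau> := u * x \<tau>))) = C x - C (x(\<tau> := 0))"
    by (simp only: integral_unique mult_1 mult_zero_left fun_upd_triv)
  then show ?thesis by (simp only: odd_quot_def scaleR_conv_of_real integral_mult_right)
qed

lemma partial_reflect:
  fixes C :: "('i \<Rightarrow> real) \<Rightarrow> complex"
  assumes U: "\<And>x s. x \<in> U \<Longrightarrow> x(\<tau> := s) \<in> U" and C: "smooth I U C" and \<tau>: "\<tau> \<in> I"
    and e: "\<And>x. x \<in> U \<Longrightarrow> C (x(\<tau> := - x \<tau>)) = e * C x" "e * e = 1" and x: "x \<in> U"
  shows "partial \<tau> C (x(\<tau> := - x \<tau>)) = - e * partial \<tau> C x"
proof -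
  define d where "d = partial \<tau> C (x(\<tau> := - x \<tau>))"
  have "has_partial \<tau> C (x(\<tau> := - x \<tau>)) d"
    unfolding d_def by (rule smooth_has_partial[OF C \<tau> U[OF x]])
  then have "((\<lambda>z. C (x(\<tau> := z))) has_vector_derivative d) (at (- x \<tau> + (- 0)))"
    using has_partial_line[of \<tau> C x "- x \<tau>" d] by simp
  moreover have "((\<lambda>t. - x \<tau> + (- t)) has_vector_derivative (- 1)) (at 0)"
    using has_vector_derivative_add[OF has_vector_derivative_const[of "- x \<tau>"] has_vector_derivative_minus[OF has_vector_derivative_id]] by simp
  ultimately have "((\<lambda>z. C (x(\<tau> := z))) \<circ> (\<lambda>t. - x \<tau> + (- t)) has_vector_derivative (- 1) *\<^sub>R d) (at 0)"
    by (intro vector_diff_chain_at)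
  from has_vector_derivative_mult_right[OF this[unfolded o_def], of e]
  have "((\<lambda>t. e * C (x(\<tau> := - x \<tau> + (- t)))) has_vector_derivative e * ((- 1) *\<^sub>R d)) (at 0)" .
  moreover have "e * C (x(\<tau> := - x \<tau> + (- t))) = C (x(\<tau> := x \<tau> + t))" for t
  proof -
    have "C (x(\<tau> := x \<tau> + t)) = e * C (x(\<tau> := - x \<tau> + (- t)))"
      using e(1)[OF U[OF x, of "- x \<tau> + (- t)"]] by (simp only: fun_upd_same fun_upd_upd minus_add_distrib minus_minus)
    then show ?thesis by (rule sym)
  qed
  ultimately have "has_partial \<tau> C x (e * ((- 1) *\<^sub>R d))"
    unfolding has_partial_def by (simp only:)
  then have "partial \<tau> C x = - (e * d)" by (simp add: partial_eqI)
  then have "- e * partial \<tau> C x = (e * e) * d" by simp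
  then show ?thesis by (simp add: d_def e(2))
qed

lemma odd_quot_reflect:
  assumes U: "\<And>x s. x \<in> U \<Longrightarrow> x(\<tau> := s) \<in> U" and C: "smooth I U C" and \<tau>: "\<tau> \<in> I"
    and e: "\<And>x. x \<in> U \<Longrightarrow> C (x(\<tau> := - x \<tau>)) = - C x" and x: "x \<in> U"
  shows "odd_quot \<tau> C (x(\<tau> := - x \<tau>)) = odd_quot \<tau> C x"
proof -
  have "partial \<tau> C (x(\<tau> := u * - x \<tau>)) = partial \<tau> C (x(\<tau> := u * x \<tau>))" for u
  proof -
    have "partial \<tau> C ((x(\<tau> := u * x \<tau>))(\<tau> := - (x(\<tau> := u * x \<tau>)) \<tau>)) = - (- 1) * partial \<tau> C (x(\<tau> := u * x \<tau>))"
    proof (rule partial_reflect[where U = U and I = I, OF _ C \<tau> _ _ U[OF x]])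
      show "C (y(\<tau> := - y \<tau>)) = - 1 * C y" if "y \<in> U" for y
        unfolding mult_minus1 by (rule e[OF that])
    qed (rule U, assumption, simp)
    then show ?thesis by (simp only: fun_upd_same fun_upd_upd mult_minus_right minus_minus mult_1)
  qed
  then show ?thesis by (simp only: odd_quot_def fun_upd_same fun_upd_upd)
qed

lemma even_quot_reflect:
  assumes U: "\<And>x s. x \<in> U \<Longrightarrow> x(\<tau> := s) \<in> U" and C: "smooth I U C" and \<tau>: "\<tau> \<in> I"
    and e: "\<And>x. x \<in> U \<Longrightarrow> C (x(\<tau> := - x \<tau>)) = C x" and x: "x \<in> U"
  shows "even_quot \<tau> C (x(\<tau> := - x \<tau>)) = even_quot \<tau> C x"
proof -
  have refl: "partial \<tau> C (x(\<tau> := - x \<tau>)) = - partial \<tau> C x" if "x \<in> U" for x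
  proof -
    have "partial \<tau> C (x(\<tau> := - x \<tau>)) = - 1 * partial \<tau> C x"
    proof (rule partial_reflect[where U = U and I = I, OF _ C \<tau> _ _ that])
      show "C (y(\<tau> := - y \<tau>)) = 1 * C y" if "y \<in> U" for y
        unfolding mult_1 by (rule e[OF that])
    qed (rule U, assumption, simp)
    then show ?thesis by (simp only: mult_minus1)
  qed
  have 1: "odd_quot \<tau> (partial \<tau> C) (x(\<tau> := - x \<tau>)) = odd_quot \<tau> (partial \<tau> C) x"
  proof (rule odd_quot_reflect[where U = U and I = I])
    show "smooth I U (partial \<tau> C)" by (rule smooth_partial[OF C \<tau>])
    show "partial \<tau> C (y(\<tau> := - y \<tau>)) = - partial \<tau> C y" if "y \<in> U" for y by (rule refl[OF that])
  qed (rule U, assumption, rule \<tau>, rule x)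
  have "even_quot \<tau> C y = odd_quot \<tau> (partial \<tau> C) y" for y
    by (simp only: even_quot_def odd_quot_def)
  then show ?thesis using 1 by (simp only:)
qed

text \<open>
  The derivative of an even function is odd, so it vanishes at \<open>\<tau> = 0\<close> and is divisible by the coordinate.
\<close>

lemma partial_even:
  assumes U: "\<And>x s. x \<in> U \<Longrightarrow> x(\<tau> := s) \<in> U" and C: "smooth I U C" and \<tau>: "\<tau> \<in> I"
    and e: "\<And>x. x \<in> U \<Longrightarrow> C (x(\<tau> := - x \<tau>)) = C x" and x: "x \<in> U"
  shows "partial \<tau> C x = of_real (x \<tau>) * even_quot \<tau> C x"
proof -
  have "partial \<tau> C (x(\<tau> := 0)) = - partial \<tau> C (x(\<tau> := 0))"
  proof -
    have "partial \<tau> C ((x(\<tau> := 0))(\<tau> := - (x(\<tau> := 0)) \<tau>)) = - 1 * partial \<tau> C (x(\<tau> := 0))"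
    proof (rule partial_reflect[where U = U and I = I, OF _ C \<tau> _ _ U[OF x]])
      show "C (y(\<tau> := - y \<tau>)) = 1 * C y" if "y \<in> U" for y
        unfolding mult_1 by (rule e[OF that])
    qed (rule U, assumption, simp)
    then show ?thesis by (simp only: fun_upd_same fun_upd_upd minus_zero mult_minus1)
  qed
  moreover have "z = - z \<Longrightarrow> z = 0" for z :: complex by (simp add: complex_eq_iff)
  ultimately have 0: "partial \<tau> C (x(\<tau> := 0)) = 0" by blast
  have "of_real (x \<tau>) * odd_quot \<tau> (partial \<tau> C) x = partial \<tau> C x - partial \<tau> C (x(\<tau> := 0))"
    by (rule odd_quot_mult[OF _ smooth_partial[OF C \<tau>] \<tau> x]) (rule U)
  then show ?thesis by (simp only: even_quot_def odd_quot_def 0 diff_zero)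
qed

section \<open>Matrices\<close>

subsection \<open>Elementary matrices and leading blocks\<close>

lemma elem_mat_carrier [simp]: "elem_mat N a b \<in> carrier_mat N N"
  by (simp add: elem_mat_def)

lemma mult_add_elem:
  assumes "A \<in> carrier_mat r N" "a < N" "b < N" "i < r" "j < N"
  shows "(A * (1\<^sub>m N + t \<cdot>\<^sub>m elem_mat N a b)) $$ (i, j) = A $$ (i, j) + (if j = b then t * A $$ (i, a) else 0)"
proof -
  have "(A * (1\<^sub>m N + t \<cdot>\<^sub>m elem_mat N a b)) $$ (i, j) =
      (\<Sum>k = 0..<N. (if k = j then A $$ (i, k) else 0) + (if k = a then (if j = b then t * A $$ (i, k) else 0) else 0))"
    using assms by (auto simp: scalar_prod_def elem_mat_def algebra_simps intro!: sum.cong)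
  also have "\<dots> = A $$ (i, j) + (if j = b then t * A $$ (i, a) else 0)"
    using assms by (simp add: sum.distrib sum.delta)
  finally show ?thesis .
qed

lemma add_elem_mult:
  assumes "A \<in> carrier_mat N c" "a < N" "b < N" "i < N" "j < c"
  shows "((1\<^sub>m N + t \<cdot>\<^sub>m elem_mat N a b) * A) $$ (i, j) = A $$ (i, j) + (if i = a then t * A $$ (b, j) else 0)"
proof -
  have "((1\<^sub>m N + t \<cdot>\<^sub>m elem_mat N a b) * A) $$ (i, j) =
      (\<Sum>k = 0..<N. (if k = i then A $$ (k, j) else 0) + (if k = b then (if i = a then t * A $$ (k, j) else 0) else 0))"
    using assms by (auto simp: scalar_prod_def elem_mat_def algebra_simps intro!: sum.cong)
  also have "\<dots> = A $$ (i, j) + (if i = a then t * A $$ (b, j) else 0)"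
    using assms by (simp add: sum.distrib sum.delta)
  finally show ?thesis .
qed

text \<open>
  The upper left block of size \<open>n\<close>.
\<close>

definition ul :: "nat \<Rightarrow> real mat \<Rightarrow> real mat" where
  "ul n g = mat n n (\<lambda>(i, j). g $$ (i, j))"

lemma ul_carrier [simp]: "ul n g \<in> carrier_mat n n"
  by (simp add: ul_def)

lemma ul_dim [simp]: "dim_row (ul n g) = n" "dim_col (ul n g) = n"
  by (simp_all add: ul_def)

lemma ul_index [simp]: "i < n \<Longrightarrow> j < n \<Longrightarrow> ul n g $$ (i, j) = g $$ (i, j)"
  by (simp add: ul_def)

definition block_upper :: "nat \<Rightarrow> nat \<Rightarrow> real mat \<Rightarrow> bool" where
  "block_upper N m p \<longleftrightarrow> p \<in> GL N \<and> (\<forall>i j. m \<le> i \<longrightarrow> i < N \<longrightarrow> j < m \<longrightarrow> p $$ (i, j) = 0)"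

lemma GL_carrier: "g \<in> GL N \<Longrightarrow> g \<in> carrier_mat N N"
  by (simp add: GL_iff_det)

lemma GL_det: "g \<in> GL N \<Longrightarrow> det g \<noteq> 0"
  by (simp add: GL_iff_det)

lemma GL_mult: "g \<in> GL N \<Longrightarrow> h \<in> GL N \<Longrightarrow> g * h \<in> GL N"
  by (auto simp: GL_iff_det det_mult[of _ N])

lemma GL_inverse:
  assumes "g \<in> GL N"
  obtains g' where "g' \<in> GL N" "g * g' = 1\<^sub>m N" "g' * g = 1\<^sub>m N"
proof -
  have g: "g \<in> carrier_mat N N" "det g \<noteq> 0" using assms by (simp_all add: GL_iff_det)
  obtain B where B: "B \<in> carrier_mat N N" "g * B = 1\<^sub>m N" "B * g = 1\<^sub>m N"
    using det_non_zero_imp_unit[OF g] unfolding Units_def ring_mat_def by auto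
  have "det g * det B = 1" using det_mult[OF g(1) B(1)] B(2) by simp
  then have "B \<in> GL N" using B(1) by (auto simp: GL_iff_det)
  then show ?thesis using B that by blast
qed

lemma block_upper_blocks:
  assumes "block_upper N m p" "m \<le> N"
  shows "p = four_block_mat (ul m p) (mat m (N - m) (\<lambda>(i, j). p $$ (i, j + m)))
               (0\<^sub>m (N - m) m) (mat (N - m) (N - m) (\<lambda>(i, j). p $$ (i + m, j + m)))"
    (is "p = four_block_mat _ _ _ ?D")
    and "det p = det (ul m p) * det (mat (N - m) (N - m) (\<lambda>(i, j). p $$ (i + m, j + m)))"
    and "det (ul m p) \<noteq> 0"
proof -
  have c: "p \<in> carrier_mat N N" using assms by (simp add: block_upper_def GL_carrier)
  show 1: "p = four_block_mat (ul m p) (mat m (N - m) (\<lambda>(i, j). p $$ (i, j + m))) (0\<^sub>m (N - m) m) ?D"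
    using assms c by (intro eq_matI) (auto simp: block_upper_def)
  show 2: "det p = det (ul m p) * det ?D"
    by (subst 1, rule det_four_block_mat_lower_left_zero) auto
  show "det (ul m p) \<noteq> 0" using 2 GL_det[of p N] assms by (auto simp: block_upper_def)
qed

lemma ul_mult:
  assumes "A \<in> carrier_mat N N" "p \<in> carrier_mat N N" "m \<le> N"
    and "\<And>i j. m \<le> i \<Longrightarrow> i < N \<Longrightarrow> j < m \<Longrightarrow> p $$ (i, j) = 0"
  shows "ul m (A * p) = ul m A * ul m p"
proof (rule eq_matI)
  fix i j assume "i < dim_row (ul m A * ul m p)" "j < dim_col (ul m A * ul m p)"
  then have ij: "i < m" "j < m" by (simp_all add: ul_def)
  have "(A * p) $$ (i, j) = (\<Sum>k = 0..<N. A $$ (i, k) * p $$ (k, j))"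
    using assms ij by (simp add: scalar_prod_def)
  also have "\<dots> = (\<Sum>k = 0..<m. A $$ (i, k) * p $$ (k, j))"
    using assms ij by (intro sum.mono_neutral_right) auto
  finally show "ul m (A * p) $$ (i, j) = (ul m A * ul m p) $$ (i, j)"
    using ij by (simp add: scalar_prod_def ul_def)
qed (simp_all add: ul_def)

lemma block_upper_mult:
  assumes "block_upper N m p" "block_upper N m q" "m \<le> N"
  shows "block_upper N m (p * q)"
  unfolding block_upper_def
proof (intro conjI allI impI)
  show "p * q \<in> GL N" using assms by (auto simp: block_upper_def intro: GL_mult)
  fix i j assume ij: "m \<le> i" "i < N" "j < m"
  have c: "p \<in> carrier_mat N N" "q \<in> carrier_mat N N" using assms by (simp_all add: block_upper_def GL_carrier)
  have "(p * q) $$ (i, j) = (\<Sum>k = 0..<N. p $$ (i, k) * q $$ (k, j))"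
    using c ij assms(3) by (simp add: scalar_prod_def)
  also have "\<dots> = 0"
  proof (rule sum.neutral, rule ballI)
    fix k assume "k \<in> {0..<N}"
    then show "p $$ (i, k) * q $$ (k, j) = 0"
      using assms(1,2) ij by (cases "k < m") (auto simp: block_upper_def)
  qed
  finally show "(p * q) $$ (i, j) = 0" .
qed

lemma block_upper_inverse:
  assumes "block_upper N m p" "m \<le> N"
  obtains q where "block_upper N m q" "p * q = 1\<^sub>m N" "q * p = 1\<^sub>m N"
proof -
  have p: "p \<in> GL N" "p \<in> carrier_mat N N" using assms by (simp_all add: block_upper_def GL_carrier)
  obtain q where q: "q \<in> GL N" "p * q = 1\<^sub>m N" "q * p = 1\<^sub>m N" using GL_inverse[OF p(1)] by blast
  have qc: "q \<in> carrier_mat N N" using q(1) by (rule GL_carrier)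
  have "ul m p \<in> GL m" using block_upper_blocks(3)[OF assms] by (simp add: GL_iff_det)
  then obtain u where u: "u \<in> GL m" "ul m p * u = 1\<^sub>m m" by (rule GL_inverse)
  have uc: "u \<in> carrier_mat m m" using u(1) by (rule GL_carrier)
  define L where "L = mat (N - m) m (\<lambda>(i, j). q $$ (i + m, j))"
  have Lc: "L \<in> carrier_mat (N - m) m" by (simp add: L_def)
  have "L * ul m p = 0\<^sub>m (N - m) m"
  proof (rule eq_matI)
    fix i j assume "i < dim_row (0\<^sub>m (N - m) m :: real mat)" "j < dim_col (0\<^sub>m (N - m) m :: real mat)"
    then have ij: "i < N - m" "j < m" by simp_all
    have "(L * ul m p) $$ (i, j) = (\<Sum>k = 0..<m. q $$ (i + m, k) * p $$ (k, j))"
      using ij by (simp add: scalar_prod_def L_def ul_def)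
    also have "\<dots> = (\<Sum>k = 0..<N. q $$ (i + m, k) * p $$ (k, j))"
      using assms ij by (intro sum.mono_neutral_left) (auto simp: block_upper_def)
    also have "\<dots> = (q * p) $$ (i + m, j)"
      using p(2) qc ij assms(2) by (simp add: scalar_prod_def)
    also have "\<dots> = 0" using q(3) ij assms(2) by simp
    finally show "(L * ul m p) $$ (i, j) = (0\<^sub>m (N - m) m) $$ (i, j)" using ij by simp
  qed (simp_all add: L_def ul_def)
  then have "(L * ul m p) * u = 0\<^sub>m (N - m) m" using uc by simp
  then have "L = 0\<^sub>m (N - m) m" using u(2) uc Lc by (simp add: assoc_mult_mat[OF Lc ul_carrier uc])
  then have "q $$ (i, j) = 0" if "m \<le> i" "i < N" "j < m" for i j
  proof -
    have "L $$ (i - m, j) = 0" using \<open>L = 0\<^sub>m (N - m) m\<close> that by simp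
    then show ?thesis using that by (simp add: L_def)
  qed
  then have "block_upper N m q" using q(1) by (simp add: block_upper_def)
  from that[OF this q(2,3)] show ?thesis .
qed

subsection \<open>Gram determinants\<close>

text \<open>
  The Gram determinant of the first \<open>n\<close> columns, of which only the first \<open>r\<close> entries are taken. For \<open>r = 2n\<close> it is
  the positive function on \<open>G\<close> that is 1 on \<open>O(2n)\<close> and scales by the square of \<open>det p\<^sub>1\<close> under the parabolic subgroup.
\<close>

definition gram :: "nat \<Rightarrow> nat \<Rightarrow> real mat \<Rightarrow> real" where
  "gram r n g = det (mat n n (\<lambda>(i, j). \<Sum>k<r. g $$ (k, i) * g $$ (k, j)))"

lemma gram_mult:
  assumes "g \<in> carrier_mat N N" "p \<in> carrier_mat N N" "m \<le> N" "r \<le> N"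
    and "\<And>i j. m \<le> i \<Longrightarrow> i < N \<Longrightarrow> j < m \<Longrightarrow> p $$ (i, j) = 0"
  shows "gram r m (g * p) = (det (ul m p))\<^sup>2 * gram r m g"
proof -
  \<comment> \<open>the first \<open>m\<close> columns, cut off after \<open>r\<close> rows; right multiplication by \<open>p\<close> only combines these columns\<close>
  define A where "A g = mat r m (\<lambda>(i, j). g $$ (i, j) :: real)" for g
  have A: "A g \<in> carrier_mat r m" for g by (simp add: A_def)
  have gram: "gram r m g = det (transpose_mat (A g) * A g)" for g
    unfolding gram_def
    by (rule arg_cong[of _ _ det], rule eq_matI) (auto simp: A_def scalar_prod_def atLeast0LessThan)
  have "A (g * p) = A g * ul m p"
  proof (rule eq_matI)
    fix i j assume "i < dim_row (A g * ul m p)" "j < dim_col (A g * ul m p)"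
    then have ij: "i < r" "j < m" by (simp_all add: A_def ul_def)
    have "(g * p) $$ (i, j) = (\<Sum>k = 0..<N. g $$ (i, k) * p $$ (k, j))"
      using assms ij by (simp add: scalar_prod_def)
    also have "\<dots> = (\<Sum>k = 0..<m. g $$ (i, k) * p $$ (k, j))"
      using assms ij by (intro sum.mono_neutral_right) auto
    finally show "A (g * p) $$ (i, j) = (A g * ul m p) $$ (i, j)"
      using ij by (simp add: scalar_prod_def ul_def A_def)
  qed (simp_all add: ul_def A_def)
  have "gram r m (g * p) = det (transpose_mat (ul m p) * (transpose_mat (A g) * A g * ul m p))"
  proof -
    have T: "transpose_mat (A g) \<in> carrier_mat m r" "transpose_mat (ul m p) \<in> carrier_mat m m"
      using A[of g] by simp_all
    have "transpose_mat (A g * ul m p) * (A g * ul m p) =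
        transpose_mat (ul m p) * transpose_mat (A g) * (A g * ul m p)"
      by (simp only: transpose_mult[OF A ul_carrier])
    also have "\<dots> = transpose_mat (ul m p) * (transpose_mat (A g) * (A g * ul m p))"
      by (rule assoc_mult_mat[OF T(2,1) mult_carrier_mat[OF A ul_carrier]])
    also have "transpose_mat (A g) * (A g * ul m p) = transpose_mat (A g) * A g * ul m p"
      by (rule assoc_mult_mat[OF T(1) A ul_carrier, symmetric])
    finally show ?thesis by (simp only: gram \<open>A (g * p) = A g * ul m p\<close>)
  qed
  also have "\<dots> = (det (ul m p))\<^sup>2 * gram r m g"
  proof -
    have c: "transpose_mat (ul m p) \<in> carrier_mat m m" "transpose_mat (A g) * A g \<in> carrier_mat m m"
      "transpose_mat (A g) * A g * ul m p \<in> carrier_mat m m"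
      using A[of g] by (simp_all add: mult_carrier_mat[of _ m m])
    show ?thesis
      by (simp only: gram det_mult[OF c(1,3)] det_mult[OF c(2) ul_carrier]
          Determinant.det_transpose[OF ul_carrier] power2_eq_square mult.assoc mult.commute mult.left_commute)
  qed
  finally show ?thesis .
qed

text \<open>
  Gram-Schmidt in an order that suits induction: when the first \<open>k\<close> columns are orthonormal and orthogonal to all later ones,
  normalize column \<open>k\<close> and subtract its multiples from all later columns. The hypothesis and the conclusion
  concern the products of the first columns with \<^emph>\<open>all\<close> columns.
\<close>

lemma orthonormalize_step:
  assumes g: "g \<in> GL N" and k: "k < N"
    and orth: "\<And>i j. i < k \<Longrightarrow> j < N \<Longrightarrow> (\<Sum>l<N. g $$ (l, i) * g $$ (l, j)) = of_bool (i = j)"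
  shows "\<exists>r\<in>GL N. upper_triangular r \<and>
    (\<forall>i j. i < Suc k \<longrightarrow> j < N \<longrightarrow> (\<Sum>l<N. (g * r) $$ (l, i) * (g * r) $$ (l, j)) = of_bool (i = j))"
proof -
  have gc: "g \<in> carrier_mat N N" "det g \<noteq> 0" using g by (simp_all add: GL_iff_det)
  define S where "S i j = (\<Sum>l<N. g $$ (l, i) * g $$ (l, j))" for i j
  define c where "c = S k k"
  have "c \<noteq> 0"
  proof
    assume "c = 0"
    then have z: "g $$ (l, k) = 0" if "l < N" for l
      using that by (auto simp: c_def S_def sum_nonneg_eq_0_iff)
    have "det g = (\<Sum>l<N. g $$ (l, k) * cofactor g l k)"
      by (rule laplace_expansion_column[OF gc(1) k])
    also have "\<dots> = 0" using z by simp
    finally show False using gc(2) by simp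
  qed
  moreover have "c \<ge> 0" by (simp add: c_def S_def sum_nonneg)
  ultimately have c: "c > 0" by simp
  \<comment> \<open>row \<open>k\<close> of the matrix of the column operations\<close>
  define \<rho> where "\<rho> j = (if j = k then 1 / sqrt c else if k < j then - S k j / c else 0)" for j
  define r where "r = mat N N (\<lambda>(i, j). if i = k then \<rho> j else of_bool (i = j))"
  have rc: "r \<in> carrier_mat N N" by (simp add: r_def)
  have ut: "upper_triangular r" by (auto simp: r_def \<rho>_def upper_triangular_def)
  have "det r = prod_list (diag_mat r)" by (rule det_upper_triangular[OF ut rc])
  moreover have "0 \<notin> set (diag_mat r)" using c by (auto simp: diag_mat_def r_def \<rho>_def)
  ultimately have rGL: "r \<in> GL N" using rc by (simp add: GL_iff_det prod_list_zero_iff)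
  have gr: "(g * r) $$ (l, j) = (if j = k then 0 else g $$ (l, j)) + \<rho> j * g $$ (l, k)" if "l < N" "j < N" for l j
  proof -
    have "(g * r) $$ (l, j) = (\<Sum>i = 0..<N. (if i = j then (if j = k then 0 else g $$ (l, i)) else 0) + (if i = k then \<rho> j * g $$ (l, i) else 0))"
      using gc that by (auto simp: scalar_prod_def r_def intro!: sum.cong)
    also have "\<dots> = (if j = k then 0 else g $$ (l, j)) + \<rho> j * g $$ (l, k)"
      using that k by (simp add: sum.distrib sum.delta)
    finally show ?thesis .
  qed
  have gen: "(\<Sum>l<N. (g * r) $$ (l, i) * (g * r) $$ (l, j)) =
      (if i = k \<or> j = k then 0 else S i j) + (if i = k then 0 else \<rho> j * S i k) + (if j = k then 0 else \<rho> i * S k j) + \<rho> i * \<rho> j * c"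
    if "i < N" "j < N" for i j
  proof -
    have "(\<Sum>l<N. (g * r) $$ (l, i) * (g * r) $$ (l, j)) =
      (\<Sum>l<N. ((if i = k \<or> j = k then 0 else g $$ (l, i) * g $$ (l, j)) + (if i = k then 0 else \<rho> j * (g $$ (l, i) * g $$ (l, k))))
        + ((if j = k then 0 else \<rho> i * (g $$ (l, k) * g $$ (l, j))) + \<rho> i * \<rho> j * (g $$ (l, k) * g $$ (l, k))))"
      using that by (intro sum.cong) (auto simp: gr algebra_simps)
    also have "\<dots> = (if i = k \<or> j = k then 0 else S i j) + (if i = k then 0 else \<rho> j * S i k) + (if j = k then 0 else \<rho> i * S k j) + \<rho> i * \<rho> j * c"
      unfolding sum.distrib by (simp add: S_def c_def sum_distrib_left)
    finally show ?thesis .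
  qed
  have Ssym: "S i j = S j i" for i j by (simp add: S_def mult.commute)
  have S: "S i j = of_bool (i = j)" "S j i = of_bool (i = j)" if "i < k" "j < N" for i j
    using orth[OF that] Ssym[of j i] by (simp_all add: S_def)
  have "(\<Sum>l<N. (g * r) $$ (l, i) * (g * r) $$ (l, j)) = of_bool (i = j)" if ij: "i < Suc k" "j < N" for i j
  proof (cases "i = k")
    case True
    have "sqrt c * sqrt c = c" "sqrt c > 0" using c by simp_all
    then have "1 / sqrt c * c = sqrt c" by (simp add: field_simps)
    then show ?thesis
      using gen[of i j] ij k True c S(2)[of j k]
      by (cases "j = k"; cases "j < k") (auto simp: \<rho>_def field_simps)
  next
    case False
    then have "i < k" using ij by simp
    then show ?thesis
      using gen[of i j] ij k S(1)[of i] by (auto simp: \<rho>_def)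
  qed
  then show ?thesis using rGL ut by blast
qed

lemma upper_triangular_mult:
  assumes "p \<in> carrier_mat N N" "q \<in> carrier_mat N N" "upper_triangular p" "upper_triangular (q :: real mat)"
  shows "upper_triangular (p * q)"
proof (rule upper_triangularI)
  fix i j assume ij: "j < i" "i < dim_row (p * q)"
  have "(p * q) $$ (i, j) = (\<Sum>k = 0..<N. p $$ (i, k) * q $$ (k, j))"
    using assms ij by (simp add: scalar_prod_def)
  also have "\<dots> = 0"
  proof (rule sum.neutral, rule ballI)
    fix k assume "k \<in> {0..<N}"
    then show "p $$ (i, k) * q $$ (k, j) = 0"
      using assms ij by (cases "k < i") (auto simp: upper_triangular_def)
  qed
  finally show "(p * q) $$ (i, j) = 0" .
qed

text \<open>
  Consequence for the flat sections: every \<open>g\<close> is an orthogonal matrix times an element of the parabolic subgroup, since an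
  upper triangular matrix is block upper triangular for every block size.
\<close>

lemma QR_decomposition:
  assumes g: "g \<in> GL N"
  obtains r where "r \<in> GL N" "upper_triangular r" "g * r \<in> Orth N"
proof -
  have "\<exists>r\<in>GL N. upper_triangular r \<and>
    (\<forall>i j. i < k \<longrightarrow> j < N \<longrightarrow> (\<Sum>l<N. (g * r) $$ (l, i) * (g * r) $$ (l, j)) = of_bool (i = j))" if "k \<le> N" for k
    using that
  proof (induction k)
    case 0
    show ?case by (rule bexI[of _ "1\<^sub>m N"]) (auto simp: GL_iff_det)
  next
    case (Suc k)
    then obtain r where r: "r \<in> GL N" "upper_triangular r"
      "\<And>i j. i < k \<Longrightarrow> j < N \<Longrightarrow> (\<Sum>l<N. (g * r) $$ (l, i) * (g * r) $$ (l, j)) = of_bool (i = j)"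
      by auto
    have k: "k < N" using Suc.prems by simp
    from orthonormalize_step[OF GL_mult[OF g r(1)] k r(3)]
    obtain r' where r': "r' \<in> GL N" "upper_triangular r'"
      "\<forall>i j. i < Suc k \<longrightarrow> j < N \<longrightarrow> (\<Sum>l<N. (g * r * r') $$ (l, i) * (g * r * r') $$ (l, j)) = of_bool (i = j)"
      by blast
    have "g * r * r' = g * (r * r')"
      using assoc_mult_mat[OF GL_carrier[OF g] GL_carrier[OF r(1)] GL_carrier[OF r'(1)]] .
    then show ?case
      using r' r GL_mult[OF r(1) r'(1)] upper_triangular_mult[OF GL_carrier[OF r(1)] GL_carrier[OF r'(1)]]
      by (intro bexI[of _ "r * r'"]) simp_all
  qed
  from this[OF order_refl] obtain r where r: "r \<in> GL N" "upper_triangular r"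
    "\<And>i j. i < N \<Longrightarrow> j < N \<Longrightarrow> (\<Sum>l<N. (g * r) $$ (l, i) * (g * r) $$ (l, j)) = of_bool (i = j)"
    by blast
  have c: "g * r \<in> carrier_mat N N" using GL_carrier[OF GL_mult[OF g r(1)]] .
  have "transpose_mat (g * r) * (g * r) = 1\<^sub>m N"
  proof (rule eq_matI)
    fix i j assume "i < dim_row (1\<^sub>m N :: real mat)" "j < dim_col (1\<^sub>m N :: real mat)"
    then have ij: "i < N" "j < N" by simp_all
    then have "(transpose_mat (g * r) * (g * r)) $$ (i, j) = (\<Sum>l<N. (g * r) $$ (l, i) * (g * r) $$ (l, j))"
      using carrier_matD[OF c] by (simp add: scalar_prod_def atLeast0LessThan)
    then show "(transpose_mat (g * r) * (g * r)) $$ (i, j) = 1\<^sub>m N $$ (i, j)"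
      using r(3)[OF ij] ij by simp
  qed (use carrier_matD[OF c] in simp_all)
  then have "g * r \<in> Orth N" using c by (simp add: Orth_def)
  then show ?thesis using r that by blast
qed

lemma upper_triangular_block_upper:
  assumes "r \<in> GL N" "upper_triangular r"
  shows "block_upper N m r"
  using assms GL_carrier[OF assms(1)] by (auto simp: block_upper_def upper_triangular_def)

lemma gram_Orth:
  assumes "k \<in> Orth N" "m \<le> N"
  shows "gram N m k = 1"
proof -
  have c: "k \<in> carrier_mat N N" "transpose_mat k * k = 1\<^sub>m N" using assms by (simp_all add: Orth_def)
  have "mat m m (\<lambda>(i, j). \<Sum>l<N. k $$ (l, i) * k $$ (l, j)) = 1\<^sub>m m"
  proof (rule eq_matI)
    fix i j assume "i < dim_row (1\<^sub>m m :: real mat)" "j < dim_col (1\<^sub>m m :: real mat)"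
    then have ij: "i < m" "j < m" by simp_all
    have "(transpose_mat k * k) $$ (i, j) = (\<Sum>l<N. k $$ (l, i) * k $$ (l, j))"
      using c(1) ij assms(2) by (simp add: scalar_prod_def atLeast0LessThan)
    then show "mat m m (\<lambda>(i, j). \<Sum>l<N. k $$ (l, i) * k $$ (l, j)) $$ (i, j) = 1\<^sub>m m $$ (i, j)"
      using ij assms(2) c(2) by simp
  qed simp_all
  then show ?thesis by (simp add: gram_def)
qed

lemma Orth_det: "k \<in> Orth N \<Longrightarrow> \<bar>det k\<bar> = 1"
proof -
  assume k: "k \<in> Orth N"
  then have c: "k \<in> carrier_mat N N" "transpose_mat k * k = 1\<^sub>m N" by (simp_all add: Orth_def)
  have "det k * det k = 1"
    using det_mult[of "transpose_mat k" N k] c by (simp add: Determinant.det_transpose[OF c(1)])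
  then show ?thesis by (simp add: abs_square_eq_1[symmetric] power2_eq_square)
qed

lemma Orth_GL: "k \<in> Orth N \<Longrightarrow> k \<in> GL N"
  using Orth_det[of k N] by (auto simp: GL_iff_det Orth_def)

text \<open>
  An orthogonal matrix has orthonormal columns, so its Gram determinant is 1; the \<open>QR\<close> decomposition and \<open>gram_mult\<close>
  reduce to this case.
\<close>

lemma gram_pos:
  assumes g: "g \<in> GL N" and m: "m \<le> N"
  shows "gram N m g > 0"
proof -
  obtain r where r: "r \<in> GL N" "upper_triangular r" "g * r \<in> Orth N" using QR_decomposition[OF g] .
  have "block_upper N m r" by (rule upper_triangular_block_upper[OF r(1,2)])
  then have "gram N m (g * r) = (det (ul m r))\<^sup>2 * gram N m g"
    using m by (intro gram_mult[OF GL_carrier[OF g] GL_carrier[OF r(1)]]) (auto simp: block_upper_def)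
  then have "(det (ul m r))\<^sup>2 * gram N m g = 1" using gram_Orth[OF r(3) m] by simp
  then show ?thesis using mult_nonneg_nonpos[of "(det (ul m r))\<^sup>2" "gram N m g"] by fastforce
qed

subsection \<open>The principal series spaces\<close>

text \<open>
  The inducing character of \<open>\<pi>\<close>, written with \<open>det p\<close> and the determinant of the upper left block, so that it needs no
  decomposition of \<open>p\<close> into blocks.
\<close>

definition pi_char :: "nat \<Rightarrow> bit \<times> bit \<Rightarrow> complex \<times> complex \<Rightarrow> real mat \<Rightarrow> complex" where
  "pi_char n = (\<lambda>(\<xi>1, \<xi>2) (lam1, lam2) p.
     abs_char \<xi>1 (- lam1 - of_nat n / 2) (det (ul n p)) *
     abs_char \<xi>2 (- lam2 + of_nat n / 2) (det p / det (ul n p)))"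

lemma pi_char_nz:
  assumes "block_upper (2 * n) n p"
  shows "pi_char n \<xi> lam p \<noteq> 0"
  using block_upper_blocks(3)[OF assms] GL_det[of p "2 * n"] assms
  by (auto simp: pi_char_def block_upper_def abs_char_nz split: prod.split)

lemma ul_block_upper_mult:
  assumes "block_upper N m p" "block_upper N m q" "m \<le> N"
  shows "ul m (p * q) = ul m p * ul m q"
  using assms by (intro ul_mult[of _ N]) (auto simp: block_upper_def GL_carrier)

lemma pi_char_mult:
  assumes "block_upper (2 * n) n p" "block_upper (2 * n) n q"
  shows "pi_char n \<xi> lam (p * q) = pi_char n \<xi> lam p * pi_char n \<xi> lam q"
proof -
  have c: "p \<in> carrier_mat (2 * n) (2 * n)" "q \<in> carrier_mat (2 * n) (2 * n)"
    and d: "det p \<noteq> 0" "det q \<noteq> 0" "det (ul n p) \<noteq> 0" "det (ul n q) \<noteq> 0"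
    using assms block_upper_blocks(3)[OF assms(1)] block_upper_blocks(3)[OF assms(2)]
    by (auto simp: block_upper_def GL_iff_det)
  have "det (ul n (p * q)) = det (ul n p) * det (ul n q)"
    using ul_block_upper_mult[OF assms] by (simp add: det_mult[OF ul_carrier ul_carrier])
  moreover have "det (p * q) = det p * det q" by (rule det_mult[OF c])
  moreover have "det p * det q / (det (ul n p) * det (ul n q)) = (det p / det (ul n p)) * (det q / det (ul n q))"
    by simp
  ultimately show ?thesis
    using d by (simp only: pi_char_def case_prod_unfold abs_char_mult divide_eq_0_iff not_False_eq_True
        de_Morgan_disj mult.assoc mult.left_commute mult.commute simp_thms)
qed

lemma pi_space_iff:
  "f \<in> pi_space n \<xi> lam \<longleftrightarrow> f \<in> extensional (GL (2 * n)) \<and> smooth_on_GL (2 * n) f \<and>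
     (\<forall>g\<in>GL (2 * n). \<forall>p. block_upper (2 * n) n p \<longrightarrow> f (g * p) = pi_char n \<xi> lam p * f g)"
proof -
  have 1: "\<exists>g1\<in>GL n. \<exists>g2\<in>GL n. \<exists>X\<in>carrier_mat n n. p = four_block_mat g1 X (0\<^sub>m n n) g2 \<and>
      det g1 = det (ul n p) \<and> det g2 = det p / det (ul n p)" if "block_upper (2 * n) n p" for p
  proof -
    note b = block_upper_blocks[OF that]
    let ?D = "mat (2 * n - n) (2 * n - n) (\<lambda>(i, j). p $$ (i + n, j + n))"
    have "det p \<noteq> 0" using that by (auto simp: block_upper_def GL_iff_det)
    then have "det ?D \<noteq> 0" using b(2) by auto
    then have "?D \<in> GL n" by (simp add: GL_iff_det)
    moreover have "ul n p \<in> GL n" using b(3) by (simp add: GL_iff_det)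
    moreover have "det ?D = det p / det (ul n p)" using b(2,3) by (simp add: field_simps)
    moreover have "mat n (2 * n - n) (\<lambda>(i, j). p $$ (i, j + n)) \<in> carrier_mat n n" by simp
    ultimately show ?thesis using b(1) by fastforce
  qed
  have 2: "block_upper (2 * n) n (four_block_mat g1 X (0\<^sub>m n n) g2) \<and>
      ul n (four_block_mat g1 X (0\<^sub>m n n) g2) = g1 \<and>
      det (four_block_mat g1 X (0\<^sub>m n n) g2) = det g1 * det g2"
    if "g1 \<in> GL n" "g2 \<in> GL n" "X \<in> carrier_mat n n" for g1 g2 X
  proof -
    have c: "g1 \<in> carrier_mat n n" "g2 \<in> carrier_mat n n" "det g1 \<noteq> 0" "det g2 \<noteq> 0"
      using that by (simp_all add: GL_iff_det)
    have d: "det (four_block_mat g1 X (0\<^sub>m n n) g2) = det g1 * det g2"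
      by (rule det_four_block_mat_lower_left_zero) (use c that in auto)
    moreover have "ul n (four_block_mat g1 X (0\<^sub>m n n) g2) = g1"
      using c that by (intro eq_matI) auto
    moreover have "four_block_mat g1 X (0\<^sub>m n n) g2 \<in> carrier_mat (2 * n) (2 * n)"
      using four_block_carrier_mat[OF c(1,2)] by (simp add: mult_2)
    ultimately show ?thesis using c that by (auto simp: block_upper_def GL_iff_det)
  qed
  show ?thesis
  proof (cases \<xi>; cases lam)
    fix \<xi>1 \<xi>2 lam1 lam2 assume [simp]: "\<xi> = (\<xi>1, \<xi>2)" "lam = (lam1, lam2)"
    have "(\<forall>p. block_upper (2 * n) n p \<longrightarrow> f (g * p) = pi_char n \<xi> lam p * f g) \<longleftrightarrow>
      (\<forall>g1\<in>GL n. \<forall>g2\<in>GL n. \<forall>X\<in>carrier_mat n n.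
           f (g * four_block_mat g1 X (0\<^sub>m n n) g2) =
             abs_char \<xi>1 (- lam1 - of_nat n / 2) (det g1) *
             abs_char \<xi>2 (- lam2 + of_nat n / 2) (det g2) * f g)" (is "?L = ?R") for g
    proof
      assume L: ?L
      show ?R
      proof (intro ballI)
        fix g1 g2 and X :: "real mat" assume a: "g1 \<in> GL n" "g2 \<in> GL n" "X \<in> carrier_mat n n"
        have "det g1 \<noteq> 0" using a by (simp add: GL_iff_det)
        then show "f (g * four_block_mat g1 X (0\<^sub>m n n) g2) =
             abs_char \<xi>1 (- lam1 - of_nat n / 2) (det g1) *
             abs_char \<xi>2 (- lam2 + of_nat n / 2) (det g2) * f g"
          using L 2[OF a] by (simp add: pi_char_def)
      qed
    next
      assume R: ?R
      show ?L
      proof (intro allI impI)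
        fix p assume "block_upper (2 * n) n p"
        from 1[OF this] obtain g1 g2 X where a: "g1 \<in> GL n" "g2 \<in> GL n" "X \<in> carrier_mat n n"
          "p = four_block_mat g1 X (0\<^sub>m n n) g2" "det g1 = det (ul n p)" "det g2 = det p / det (ul n p)" by blast
        from R[rule_format, OF a(1,2,3)] show "f (g * p) = pi_char n \<xi> lam p * f g"
          unfolding a(4)[symmetric] a(5,6) by (simp add: pi_char_def)
      qed
    qed
    then show ?thesis by (simp add: pi_space_def)
  qed
qed

text \<open>
  The parabolic subgroup of \<open>H\<close> with blocks of sizes \<open>n - 1\<close>, \<open>1\<close>, \<open>n - 1\<close> is the intersection of two maximal ones; the
  next definition is the inducing character of \<open>\<tau>\<close> on it.
\<close>

definition H_parabolic :: "nat \<Rightarrow> real mat \<Rightarrow> bool" where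
  "H_parabolic n q \<longleftrightarrow> block_upper (2 * n - 1) (n - 1) q \<and> block_upper (2 * n - 1) n q"

definition tau_char :: "nat \<Rightarrow> bit \<times> bit \<times> bit \<Rightarrow> complex \<times> complex \<times> complex \<Rightarrow> real mat \<Rightarrow> complex" where
  "tau_char n = (\<lambda>(\<eta>1, \<eta>2, \<eta>3) (\<nu>1, \<nu>2, \<nu>3) q.
     abs_char \<eta>1 (- \<nu>1 - of_nat n / 2) (det (ul (n - 1) q)) *
     abs_char \<eta>2 (- \<nu>2) (q $$ (n - 1, n - 1)) *
     abs_char \<eta>3 (- \<nu>3 + of_nat n / 2) (det q / (det (ul (n - 1) q) * q $$ (n - 1, n - 1))))"

lemma det_ul_H_parabolic:
  assumes "H_parabolic n q" "n \<ge> 1"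
  shows "det (ul n q) = det (ul (n - 1) q) * q $$ (n - 1, n - 1)"
proof -
  have "ul n q = four_block_mat (ul (n - 1) q) (mat (n - 1) 1 (\<lambda>(i, j). q $$ (i, n - 1)))
      (0\<^sub>m 1 (n - 1)) (mat 1 1 (\<lambda>_. q $$ (n - 1, n - 1)))"
  proof (rule eq_matI)
    fix i j assume "i < dim_row (four_block_mat (ul (n - 1) q) (mat (n - 1) 1 (\<lambda>(i, j). q $$ (i, n - 1)))
      (0\<^sub>m 1 (n - 1)) (mat 1 1 (\<lambda>_. q $$ (n - 1, n - 1))))"
      "j < dim_col (four_block_mat (ul (n - 1) q) (mat (n - 1) 1 (\<lambda>(i, j). q $$ (i, n - 1)))
      (0\<^sub>m 1 (n - 1)) (mat 1 1 (\<lambda>_. q $$ (n - 1, n - 1))))"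
    then have ij: "i < n" "j < n" using assms(2) by simp_all
    then have "i < n - 1 \<or> i = n - 1" "j < n - 1 \<or> j = n - 1" by auto
    then show "ul n q $$ (i, j) = four_block_mat (ul (n - 1) q) (mat (n - 1) 1 (\<lambda>(i, j). q $$ (i, n - 1)))
      (0\<^sub>m 1 (n - 1)) (mat 1 1 (\<lambda>_. q $$ (n - 1, n - 1))) $$ (i, j)"
      using assms ij by (auto simp: H_parabolic_def block_upper_def)
  qed (use assms(2) in simp_all)
  moreover have "det (four_block_mat (ul (n - 1) q) (mat (n - 1) 1 (\<lambda>(i, j). q $$ (i, n - 1)))
      (0\<^sub>m 1 (n - 1)) (mat 1 1 (\<lambda>_. q $$ (n - 1, n - 1)))) = det (ul (n - 1) q) * det (mat 1 1 (\<lambda>_. q $$ (n - 1, n - 1)))"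
    by (rule det_four_block_mat_lower_left_zero) auto
  moreover have "det (mat 1 1 (\<lambda>_. q $$ (n - 1, n - 1))) = q $$ (n - 1, n - 1)"
    by (simp add: det_single)
  ultimately show ?thesis by simp
qed

lemma H_parabolic_nz:
  assumes "H_parabolic n q" "n \<ge> 1"
  shows "det (ul (n - 1) q) \<noteq> 0" "q $$ (n - 1, n - 1) \<noteq> 0"
  using block_upper_blocks(3)[of "2 * n - 1" n q] det_ul_H_parabolic[OF assms] assms
  by (auto simp: H_parabolic_def)

lemma tau_space_iff:
  assumes n: "n \<ge> 1"
  shows "f \<in> tau_space n \<eta> \<nu> \<longleftrightarrow> f \<in> extensional (GL (2 * n - 1)) \<and> smooth_on_GL (2 * n - 1) f \<and>
     (\<forall>h\<in>GL (2 * n - 1). \<forall>q. H_parabolic n q \<longrightarrow> f (h * q) = tau_char n \<eta> \<nu> q * f h)"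
proof -
  let ?N = "2 * n - 1"
  define bl where "bl p1 X p2 Y p3 = four_block_mat p1 X (0\<^sub>m n (n - 1)) (four_block_mat p2 Y (0\<^sub>m (n - 1) 1) p3)"
    for p1 X p2 Y and p3 :: "real mat"
  have 2: "H_parabolic n (bl p1 X p2 Y p3) \<and> ul (n - 1) (bl p1 X p2 Y p3) = p1 \<and>
      bl p1 X p2 Y p3 $$ (n - 1, n - 1) = p2 $$ (0, 0) \<and> p2 $$ (0, 0) \<noteq> 0 \<and>
      det (bl p1 X p2 Y p3) = det p1 * p2 $$ (0, 0) * det p3"
    if a: "p1 \<in> GL (n - 1)" "p2 \<in> GL 1" "p3 \<in> GL (n - 1)" "X \<in> carrier_mat (n - 1) n" "Y \<in> carrier_mat 1 (n - 1)"
    for p1 p2 p3 X Y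
  proof -
    have c: "p1 \<in> carrier_mat (n - 1) (n - 1)" "p2 \<in> carrier_mat 1 1" "p3 \<in> carrier_mat (n - 1) (n - 1)"
      "det p1 \<noteq> 0" "det p2 \<noteq> 0" "det p3 \<noteq> 0"
      using a by (simp_all add: GL_iff_det)
    have cD: "four_block_mat p2 Y (0\<^sub>m (n - 1) 1) p3 \<in> carrier_mat n n"
      using four_block_carrier_mat[OF c(2,3)] n by simp
    have dp2: "det p2 = p2 $$ (0, 0)" using c(2) by (simp add: det_single)
    have "det (four_block_mat p2 Y (0\<^sub>m (n - 1) 1) p3) = det p2 * det p3"
      by (rule det_four_block_mat_lower_left_zero) (use c a in auto)
    moreover have "det (bl p1 X p2 Y p3) = det p1 * det (four_block_mat p2 Y (0\<^sub>m (n - 1) 1) p3)"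
      unfolding bl_def by (rule det_four_block_mat_lower_left_zero) (use c a cD in auto)
    ultimately have d: "det (bl p1 X p2 Y p3) = det p1 * p2 $$ (0, 0) * det p3" by (simp add: dp2)
    have cb: "bl p1 X p2 Y p3 \<in> carrier_mat ?N ?N"
      using four_block_carrier_mat[OF c(1) cD] n by (simp add: bl_def mult_2)
    then have G: "bl p1 X p2 Y p3 \<in> GL ?N" using d c dp2 by (auto simp: GL_iff_det)
    have i1: "bl p1 X p2 Y p3 $$ (i, j) = (if i < n - 1 then (if j < n - 1 then p1 $$ (i, j) else X $$ (i, j - (n - 1)))
        else if j < n - 1 then 0 else four_block_mat p2 Y (0\<^sub>m (n - 1) 1) p3 $$ (i - (n - 1), j - (n - 1)))"
      if "i < ?N" "j < ?N" for i j
      using that c cD n unfolding bl_def by (subst index_mat_four_block) auto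
    have i2: "four_block_mat p2 Y (0\<^sub>m (n - 1) 1) p3 $$ (i, j) = (if i < 1 then (if j < 1 then p2 $$ (i, j) else Y $$ (i, j - 1))
        else if j < 1 then 0 else p3 $$ (i - 1, j - 1))" if "i < n" "j < n" for i j
      using that c n by (subst index_mat_four_block) auto
    have "ul (n - 1) (bl p1 X p2 Y p3) = p1"
      using c n by (intro eq_matI) (auto simp: i1)
    moreover have "block_upper ?N (n - 1) (bl p1 X p2 Y p3)"
      using G n by (auto simp: block_upper_def i1)
    moreover have "block_upper ?N n (bl p1 X p2 Y p3)"
      using G n by (auto simp: block_upper_def i1 i2[unfolded One_nat_def])
    moreover have "bl p1 X p2 Y p3 $$ (n - 1, n - 1) = p2 $$ (0, 0)" using n by (simp add: i1 i2[unfolded One_nat_def])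
    ultimately show ?thesis using d c dp2 by (auto simp: H_parabolic_def)
  qed
  have 1: "\<exists>p1\<in>GL (n - 1). \<exists>p2\<in>GL 1. \<exists>p3\<in>GL (n - 1). \<exists>X\<in>carrier_mat (n - 1) n. \<exists>Y\<in>carrier_mat 1 (n - 1).
      q = bl p1 X p2 Y p3" if q: "H_parabolic n q" for q
  proof -
    define p1 where "p1 = ul (n - 1) q"
    define p2 where "p2 = mat 1 1 (\<lambda>_. q $$ (n - 1, n - 1))"
    define p3 where "p3 = mat (n - 1) (n - 1) (\<lambda>(i, j). q $$ (i + n, j + n))"
    define X where "X = mat (n - 1) n (\<lambda>(i, j). q $$ (i, j + (n - 1)))"
    define Y where "Y = mat 1 (n - 1) (\<lambda>(i, j). q $$ (n - 1, j + n))"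
    have qc: "q \<in> carrier_mat ?N ?N" using q by (simp add: H_parabolic_def block_upper_def GL_carrier)
    note nz = H_parabolic_nz[OF q n]
    have "det q = det (ul n q) * det (mat (?N - n) (?N - n) (\<lambda>(i, j). q $$ (i + n, j + n)))"
      by (rule block_upper_blocks(2)) (use q n in \<open>auto simp: H_parabolic_def\<close>)
    moreover have "?N - n = n - 1" by simp
    ultimately have "det q = det (ul n q) * det p3" by (simp add: p3_def)
    moreover have "det q \<noteq> 0" using q by (auto simp: H_parabolic_def block_upper_def GL_iff_det)
    ultimately have p3: "p3 \<in> GL (n - 1)" by (auto simp: GL_iff_det p3_def)
    have p12: "p1 \<in> GL (n - 1)" "p2 \<in> GL 1" using nz by (auto simp: GL_iff_det p1_def p2_def det_single)
    have cp: "p2 \<in> carrier_mat 1 1" "p3 \<in> carrier_mat (n - 1) (n - 1)" "p1 \<in> carrier_mat (n - 1) (n - 1)"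
      by (simp_all add: p1_def p2_def p3_def)
    have cD: "four_block_mat p2 Y (0\<^sub>m (n - 1) 1) p3 \<in> carrier_mat n n"
      using four_block_carrier_mat[OF cp(1,2)] n by simp
    have "q = bl p1 X p2 Y p3"
    proof (rule eq_matI)
      fix i j assume "i < dim_row (bl p1 X p2 Y p3)" "j < dim_col (bl p1 X p2 Y p3)"
      then have ij: "i < ?N" "j < ?N" using cD n cp by (auto simp: bl_def)
      have z: "q $$ (i, j) = 0" if "n - 1 \<le> i" "j < n - 1" using q that ij by (auto simp: H_parabolic_def block_upper_def)
      have z': "q $$ (i, j) = 0" if "n \<le> i" "j < n" using q that ij by (auto simp: H_parabolic_def block_upper_def)
      show "q $$ (i, j) = bl p1 X p2 Y p3 $$ (i, j)"
      proof (cases "i < n - 1")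
        case True
        then show ?thesis using ij n cD cp unfolding bl_def
          by (subst index_mat_four_block) (auto simp: p1_def X_def)
      next
        case False
        have "bl p1 X p2 Y p3 $$ (i, j) = (if j < n - 1 then 0 else four_block_mat p2 Y (0\<^sub>m (n - 1) 1) p3 $$ (i - (n - 1), j - (n - 1)))"
          using False ij n cD cp unfolding bl_def by (subst index_mat_four_block) auto
        moreover have "four_block_mat p2 Y (0\<^sub>m (n - 1) 1) p3 $$ (i - (n - 1), j - (n - 1)) = q $$ (i, j)" if "\<not> j < n - 1"
        proof (cases "i = n - 1")
          case True
          moreover have "j = n - 1 \<or> n \<le> j" using that by auto
          ultimately show ?thesis using that ij n cp
            by (subst index_mat_four_block) (auto simp: p2_def Y_def not_less Suc_diff_le)
        next
          case F: False
          then have "n \<le> i" using False by simp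
          then show ?thesis using that ij n cp F z'
            by (subst index_mat_four_block) (auto simp: p3_def not_less)
        qed
        ultimately show ?thesis using False z by auto
      qed
    qed (use cD cp n qc in \<open>auto simp: bl_def\<close>)
    then show ?thesis using p12 p3 by (auto simp: X_def Y_def intro!: bexI)
  qed
  obtain \<eta>1 \<eta>2 \<eta>3 \<nu>1 \<nu>2 \<nu>3 where [simp]: "\<eta> = (\<eta>1, \<eta>2, \<eta>3)" "\<nu> = (\<nu>1, \<nu>2, \<nu>3)"
    by (metis prod_cases3)
  have "(\<forall>q. H_parabolic n q \<longrightarrow> f (h * q) = tau_char n \<eta> \<nu> q * f h) \<longleftrightarrow>
    (\<forall>p1\<in>GL (n - 1). \<forall>p2\<in>GL 1. \<forall>p3\<in>GL (n - 1). \<forall>X\<in>carrier_mat (n - 1) n. \<forall>Y\<in>carrier_mat 1 (n - 1).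
           f (h * bl p1 X p2 Y p3) =
             abs_char \<eta>1 (- \<nu>1 - of_nat n / 2) (det p1) *
             abs_char \<eta>2 (- \<nu>2) (p2 $$ (0, 0)) *
             abs_char \<eta>3 (- \<nu>3 + of_nat n / 2) (det p3) * f h)" (is "?L = ?R") for h
  proof -
    have t: "tau_char n \<eta> \<nu> (bl p1 X p2 Y p3) = abs_char \<eta>1 (- \<nu>1 - of_nat n / 2) (det p1) *
             abs_char \<eta>2 (- \<nu>2) (p2 $$ (0, 0)) * abs_char \<eta>3 (- \<nu>3 + of_nat n / 2) (det p3)"
      if a: "p1 \<in> GL (n - 1)" "p2 \<in> GL 1" "p3 \<in> GL (n - 1)" "X \<in> carrier_mat (n - 1) n" "Y \<in> carrier_mat 1 (n - 1)"
      for p1 p2 p3 X Y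
    proof -
      have "det p1 \<noteq> 0" using a by (simp add: GL_iff_det)
      then show ?thesis using 2[OF a] by (simp add: tau_char_def)
    qed
    show ?thesis
    proof
      assume ?L then show ?R using 2 t by simp
    next
      assume R: ?R
      show ?L
      proof (intro allI impI)
        fix q assume "H_parabolic n q"
        from 1[OF this] obtain p1 p2 p3 X Y where a: "p1 \<in> GL (n - 1)" "p2 \<in> GL 1" "p3 \<in> GL (n - 1)"
          "X \<in> carrier_mat (n - 1) n" "Y \<in> carrier_mat 1 (n - 1)" "q = bl p1 X p2 Y p3" by blast
        show "f (h * q) = tau_char n \<eta> \<nu> q * f h"
          using R[rule_format, OF a(1-5)] t[OF a(1-5)] a(6) by simp
      qed
    qed
  qed
  then show ?thesis by (simp add: tau_space_def bl_def)
qed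

text \<open>
  Indices such as \<open>n - 1\<close> and \<open>2 * n - 1\<close> occur everywhere from here on and should stay in this form.
\<close>

declare One_nat_def [simp del]

section \<open>The one-parameter families of cosets\<close>

lemma elem_mat_dim [simp]: "dim_row (elem_mat N a b) = N" "dim_col (elem_mat N a b) = N"
  by (simp_all add: elem_mat_def)

lemma det_add_elem:
  assumes "a \<noteq> b"
  shows "det (1\<^sub>m N + t \<cdot>\<^sub>m elem_mat N a b) = 1"
proof -
  let ?A = "1\<^sub>m N + t \<cdot>\<^sub>m elem_mat N a b"
  have c: "?A \<in> carrier_mat N N" by simp
  have d: "diag_mat ?A = replicate N 1"
    using assms by (intro nth_equalityI) (auto simp: diag_mat_def elem_mat_def)
  show ?thesis
  proof (cases "a < b")
    case True
    then have "upper_triangular ?A" by (auto simp: upper_triangular_def elem_mat_def)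
    from det_upper_triangular[OF this c] show ?thesis by (simp add: d)
  next
    case False
    have "det ?A = prod_list (diag_mat ?A)"
      by (rule det_lower_triangular[OF _ c]) (use False in \<open>auto simp: elem_mat_def\<close>)
    then show ?thesis by (simp add: d)
  qed
qed

lemma embed_H_carrier [simp]:
  "h \<in> carrier_mat (2 * n - 1) (2 * n - 1) \<Longrightarrow> n \<ge> 1 \<Longrightarrow> embed_H n h \<in> carrier_mat (2 * n) (2 * n)"
  using four_block_carrier_mat[of h "2 * n - 1" "2 * n - 1" "1\<^sub>m 1" 1 1] by (simp add: embed_H_def)

lemma embed_H_index:
  assumes "h \<in> carrier_mat (2 * n - 1) (2 * n - 1)" "n \<ge> 1" "i < 2 * n" "j < 2 * n"
  shows "embed_H n h $$ (i, j) = (if i = 2 * n - 1 \<or> j = 2 * n - 1 then of_bool (i = j) else h $$ (i, j))"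
  using assms unfolding embed_H_def by (subst index_mat_four_block) auto

lemma det_embed_H:
  assumes "h \<in> carrier_mat (2 * n - 1) (2 * n - 1)"
  shows "det (embed_H n h) = det h"
proof -
  have "det (embed_H n h) = det h * det (1\<^sub>m 1)"
    unfolding embed_H_def by (rule det_four_block_mat_lower_left_zero) (use assms in auto)
  then show ?thesis by simp
qed

lemma embed_H_mult:
  assumes h: "h \<in> carrier_mat (2 * n - 1) (2 * n - 1)" and q: "q \<in> carrier_mat (2 * n - 1) (2 * n - 1)"
  shows "embed_H n (h * q) = embed_H n h * embed_H n q"
proof -
  have "embed_H n h * embed_H n q = four_block_mat
      (h * q + 0\<^sub>m (2 * n - 1) 1 * 0\<^sub>m 1 (2 * n - 1)) (h * 0\<^sub>m (2 * n - 1) 1 + 0\<^sub>m (2 * n - 1) 1 * 1\<^sub>m 1)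
      (0\<^sub>m 1 (2 * n - 1) * q + 1\<^sub>m 1 * 0\<^sub>m 1 (2 * n - 1)) (0\<^sub>m 1 (2 * n - 1) * 0\<^sub>m (2 * n - 1) 1 + 1\<^sub>m 1 * 1\<^sub>m 1)"
    unfolding embed_H_def
    by (rule mult_four_block_mat) (use h q in auto)
  also have "\<dots> = embed_H n (h * q)"
    using h q by (simp add: embed_H_def)
  finally show ?thesis by simp
qed

text \<open>
  The matrix \<open>h u\<^sub>t\<close> at which the operator evaluates its argument.
\<close>

definition embed_u :: "nat \<Rightarrow> real mat \<Rightarrow> real \<Rightarrow> real mat" where
  "embed_u n h t = embed_H n h * (1\<^sub>m (2 * n) + t \<cdot>\<^sub>m elem_mat (2 * n) (2 * n - 1) (n - 1))"

lemma embed_u_index: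
  assumes "h \<in> carrier_mat (2 * n - 1) (2 * n - 1)" "n \<ge> 1" "i < 2 * n" "j < 2 * n"
  shows "embed_u n h t $$ (i, j) = (if i = 2 * n - 1 then (if j = 2 * n - 1 then 1 else if j = n - 1 then t else 0)
    else if j = 2 * n - 1 then 0 else h $$ (i, j))"
proof -
  have "embed_u n h t $$ (i, j) = embed_H n h $$ (i, j) + (if j = n - 1 then t * embed_H n h $$ (i, 2 * n - 1) else 0)"
    unfolding embed_u_def using assms by (intro mult_add_elem embed_H_carrier) auto
  then show ?thesis using assms by (auto simp: embed_H_index)
qed

lemma embed_u_GL:
  assumes "h \<in> GL (2 * n - 1)" "n \<ge> 1"
  shows "embed_u n h t \<in> GL (2 * n)" "det (embed_u n h t) = det h"
proof -
  have c: "h \<in> carrier_mat (2 * n - 1) (2 * n - 1)" using assms(1) by (rule GL_carrier)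
  have "2 * n - 1 \<noteq> n - 1" using assms(2) by auto
  then show d: "det (embed_u n h t) = det h"
    unfolding embed_u_def using c assms(2)
    by (simp add: det_mult[OF embed_H_carrier] det_embed_H det_add_elem)
  then show "embed_u n h t \<in> GL (2 * n)"
    using assms c mult_carrier_mat[OF embed_H_carrier[OF c assms(2)], of _ "2 * n"]
    by (simp add: GL_iff_det embed_u_def)
qed

text \<open>
  Conjugation moves \<open>q\<close> past \<open>u\<^sub>t\<close>: the matrix \<open>u\<^bsub>-s\<^esub> q u\<^sub>t\<close> with \<open>s = t / q\<^sub>2\<close>, where \<open>q\<^sub>2\<close> is the middle entry
  of \<open>q\<close>, is again block upper triangular. This is the source of the equivariance of the operator.
\<close>

lemma embed_u_mult_right:
  assumes h: "h \<in> GL (2 * n - 1)" and n: "n \<ge> 1" and q: "H_parabolic n q"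
  obtains p where "block_upper (2 * n) n p" "embed_u n (h * q) t = embed_u n h (t / q $$ (n - 1, n - 1)) * p"
    "det (ul n p) = det (ul (n - 1) q) * q $$ (n - 1, n - 1)" "det p = det q"
proof -
  let ?N = "2 * n" let ?U = "\<lambda>t. 1\<^sub>m (2 * n) + t \<cdot>\<^sub>m elem_mat (2 * n) (2 * n - 1) (n - 1)"
  define q2 where "q2 = q $$ (n - 1, n - 1)"
  define s where "s = t / q2"
  have q2: "q2 \<noteq> 0" using H_parabolic_nz[OF q n] by (simp add: q2_def)
  have hc: "h \<in> carrier_mat (2 * n - 1) (2 * n - 1)" using h by (rule GL_carrier)
  have qG: "q \<in> GL (2 * n - 1)" using q by (simp add: H_parabolic_def block_upper_def)
  have qc: "q \<in> carrier_mat (2 * n - 1) (2 * n - 1)" using qG by (rule GL_carrier)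
  have U: "?U t \<in> carrier_mat ?N ?N" for t by simp
  have ne: "2 * n - 1 \<noteq> n - 1" "n - 1 < ?N" "2 * n - 1 < ?N" using n by auto
  define p where "p = ?U (- s) * embed_u n q t"
  have uq: "embed_u n q t \<in> carrier_mat ?N ?N" using embed_u_GL(1)[OF qG n] by (rule GL_carrier)
  have pc: "p \<in> carrier_mat ?N ?N" unfolding p_def by (rule mult_carrier_mat[OF U uq])
  have p: "p $$ (i, j) = embed_u n q t $$ (i, j) + (if i = 2 * n - 1 then - s * embed_u n q t $$ (n - 1, j) else 0)"
    if "i < ?N" "j < ?N" for i j
    unfolding p_def using that ne by (intro add_elem_mult[OF uq]) auto
  have "?U s * ?U (- s) = 1\<^sub>m ?N"
  proof (rule eq_matI)
    fix i j assume "i < dim_row (1\<^sub>m ?N :: real mat)" "j < dim_col (1\<^sub>m ?N :: real mat)"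
    then have ij: "i < ?N" "j < ?N" by simp_all
    have "(?U s * ?U (- s)) $$ (i, j) = ?U s $$ (i, j) + (if j = n - 1 then - s * ?U s $$ (i, 2 * n - 1) else 0)"
      using ij ne by (intro mult_add_elem[OF U]) auto
    then show "(?U s * ?U (- s)) $$ (i, j) = 1\<^sub>m ?N $$ (i, j)" using ij ne by (auto simp: elem_mat_def)
  qed simp_all
  then have "?U s * p = embed_u n q t"
    unfolding p_def assoc_mult_mat[OF U U uq, symmetric] using uq by simp
  moreover have "embed_u n (h * q) t = embed_H n h * embed_u n q t"
    unfolding embed_u_def embed_H_mult[OF hc qc]
    by (rule assoc_mult_mat[OF embed_H_carrier[OF hc n] embed_H_carrier[OF qc n] U])
  ultimately have e: "embed_u n (h * q) t = embed_u n h s * p"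
    unfolding embed_u_def[of n h s] using assoc_mult_mat[OF embed_H_carrier[OF hc n] U pc, of s] by simp
  have dp: "det p = det q"
    unfolding p_def det_mult[OF U uq] using embed_u_GL(2)[OF qG n] ne by (simp add: det_add_elem)
  have z: "p $$ (i, j) = 0" if "n \<le> i" "i < ?N" "j < n" for i j
  proof (cases "i = 2 * n - 1")
    case True
    have "q $$ (n - 1, j) = 0" if "j \<noteq> n - 1"
      using q that \<open>j < n\<close> n by (auto simp: H_parabolic_def block_upper_def)
    then show ?thesis using True that n q2 by (auto simp: p embed_u_index[OF qc n] s_def q2_def)
  next
    case False
    have "q $$ (i, j) = 0" using q that False by (auto simp: H_parabolic_def block_upper_def)
    then show ?thesis using False that n by (simp add: p embed_u_index[OF qc n])
  qed
  have bp: "block_upper ?N n p" using pc dp qG z by (auto simp: block_upper_def GL_iff_det)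
  have "ul n p = ul n q"
    using n by (intro eq_matI) (auto simp: p embed_u_index[OF qc n])
  then have "det (ul n p) = det (ul (n - 1) q) * q $$ (n - 1, n - 1)"
    using det_ul_H_parabolic[OF q n] by simp
  then show ?thesis using bp e dp that by (simp add: s_def q2_def)
qed

text \<open>
  A representative of the same coset as \<open>h u\<^bsub>1/s\<^esub>\<close> for \<open>s \<noteq> 0\<close> which is also defined at \<open>s = 0\<close>; the parameter \<open>s\<close> is the coordinate
  of the projective line at infinity. With \<open>t = 1/s\<close> it arises from \<open>h u\<^sub>t\<close> by dividing column \<open>n\<close> by \<open>t\<close> and
  replacing the last column \<open>c\<close> by \<open>t c\<close> minus the former column \<open>n\<close>.
\<close>

definition embed_w :: "nat \<Rightarrow> real mat \<Rightarrow> real \<Rightarrow> real mat" where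
  "embed_w n h s = mat (2 * n) (2 * n) (\<lambda>(i, j).
     if i = 2 * n - 1 then of_bool (j = n - 1)
     else if j = n - 1 then s * h $$ (i, n - 1) else if j = 2 * n - 1 then - h $$ (i, n - 1) else h $$ (i, j))"

lemma embed_w_carrier [simp]: "embed_w n h s \<in> carrier_mat (2 * n) (2 * n)"
  by (simp add: embed_w_def)

lemma embed_u_eq_w:
  assumes h: "h \<in> GL (2 * n - 1)" and n: "n \<ge> 1" and t: "t \<noteq> 0"
  obtains p where "block_upper (2 * n) n p" "embed_u n h t = embed_w n h (1 / t) * p" "det (ul n p) = t" "det p = 1"
proof -
  let ?N = "2 * n"
  define p where "p = mat ?N ?N (\<lambda>(i, j). if i = j then (if i = n - 1 then t else if i = 2 * n - 1 then 1 / t else 1)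
      else of_bool (i = n - 1 \<and> j = 2 * n - 1))"
  have pc: "p \<in> carrier_mat ?N ?N" by (simp add: p_def)
  have hc: "h \<in> carrier_mat (2 * n - 1) (2 * n - 1)" using h by (rule GL_carrier)
  have ne: "2 * n - 1 \<noteq> n - 1" "n - 1 < ?N" "2 * n - 1 < ?N" "n - 1 < 2 * n - 1" using n by auto
  have ut: "upper_triangular p" using ne by (auto simp: upper_triangular_def p_def)
  have "embed_u n h t = embed_w n h (1 / t) * p"
  proof (rule eq_matI)
    fix i j assume "i < dim_row (embed_w n h (1 / t) * p)" "j < dim_col (embed_w n h (1 / t) * p)"
    then have ij: "i < ?N" "j < ?N" by (simp_all add: p_def embed_w_def)
    let ?w = "\<lambda>k. embed_w n h (1 / t) $$ (i, k)"
    have "(embed_w n h (1 / t) * p) $$ (i, j) = (\<Sum>k = 0..<?N.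
        (if k = j then ?w k * (if j = n - 1 then t else if j = 2 * n - 1 then 1 / t else 1) else 0) +
        (if k = n - 1 then (if j = 2 * n - 1 then ?w k else 0) else 0))"
      using ij ne pc by (auto simp: scalar_prod_def p_def embed_w_def[of n h "1 / t"] intro!: sum.cong)
    also have "\<dots> = ?w j * (if j = n - 1 then t else if j = 2 * n - 1 then 1 / t else 1) + (if j = 2 * n - 1 then ?w (n - 1) else 0)"
      using ij ne by (simp add: sum.distrib sum.delta)
    also have "\<dots> = embed_u n h t $$ (i, j)"
      using ij ne t by (auto simp: embed_u_index[OF hc n] embed_w_def)
    finally show "embed_u n h t $$ (i, j) = (embed_w n h (1 / t) * p) $$ (i, j)" by simp
  qed (use embed_u_GL(1)[OF h n, THEN GL_carrier, of t] in \<open>auto simp: p_def embed_w_def\<close>)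
  moreover have dp: "det p = 1"
  proof -
    have "det p = prod_list (diag_mat p)" by (rule det_upper_triangular[OF ut pc])
    also have "\<dots> = (\<Prod>i = 0..<?N. p $$ (i, i))"
      using pc prod.distinct_set_conv_list[of "[0..<?N]" "\<lambda>i. p $$ (i, i)"] by (simp add: diag_mat_def)
    also have "\<dots> = (\<Prod>i\<in>{n - 1, 2 * n - 1}. p $$ (i, i))"
      using ne by (intro prod.mono_neutral_right) (auto simp: p_def)
    also have "\<dots> = 1" using ne t by (simp add: p_def)
    finally show ?thesis .
  qed
  moreover have "det (ul n p) = t"
  proof -
    have "upper_triangular (ul n p)" using ut pc by (auto simp: upper_triangular_def)
    then have "det (ul n p) = prod_list (diag_mat (ul n p))" by (rule det_upper_triangular[OF _ ul_carrier])
    also have "\<dots> = (\<Prod>i = 0..<n. p $$ (i, i))"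
    proof -
      have "map (\<lambda>i. ul n p $$ (i, i)) [0..<n] = map (\<lambda>i. p $$ (i, i)) [0..<n]" by simp
      then show ?thesis
        using prod.distinct_set_conv_list[of "[0..<n]" "\<lambda>i. p $$ (i, i)"] by (simp add: diag_mat_def del: map_eq_conv)
    qed
    also have "\<dots> = (\<Prod>i\<in>{n - 1}. p $$ (i, i))"
      using ne by (intro prod.mono_neutral_right) (auto simp: p_def)
    also have "\<dots> = t" using ne by (simp add: p_def)
    finally show ?thesis .
  qed
  moreover have "block_upper ?N n p"
    using pc dp by (intro upper_triangular_block_upper[OF _ ut]) (simp add: GL_iff_det)
  ultimately show ?thesis using that by blast
qed

lemma embed_w_GL:
  assumes h: "h \<in> GL (2 * n - 1)" and n: "n \<ge> 1"
  shows "embed_w n h s \<in> GL (2 * n)" "\<bar>det (embed_w n h s)\<bar> = \<bar>det h\<bar>"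
proof -
  \<comment> \<open>the determinant does not depend on \<open>s\<close>, and at \<open>s = 1\<close> it can be read off from \<open>h u\<^sub>1\<close>\<close>
  have eq: "embed_w n h s = embed_w n h 0 * (1\<^sub>m (2 * n) + (- s) \<cdot>\<^sub>m elem_mat (2 * n) (2 * n - 1) (n - 1))" for s
  proof (rule eq_matI)
    fix i j assume "i < dim_row (embed_w n h 0 * (1\<^sub>m (2 * n) + (- s) \<cdot>\<^sub>m elem_mat (2 * n) (2 * n - 1) (n - 1)))"
      "j < dim_col (embed_w n h 0 * (1\<^sub>m (2 * n) + (- s) \<cdot>\<^sub>m elem_mat (2 * n) (2 * n - 1) (n - 1)))"
    then have ij: "i < 2 * n" "j < 2 * n" by (simp_all add: embed_w_def elem_mat_def)
    have "(embed_w n h 0 * (1\<^sub>m (2 * n) + (- s) \<cdot>\<^sub>m elem_mat (2 * n) (2 * n - 1) (n - 1))) $$ (i, j) =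
      embed_w n h 0 $$ (i, j) + (if j = n - 1 then - s * embed_w n h 0 $$ (i, 2 * n - 1) else 0)"
      using ij n by (intro mult_add_elem) auto
    also have "\<dots> = embed_w n h s $$ (i, j)"
      using ij n by (auto simp: embed_w_def)
    finally show "embed_w n h s $$ (i, j) = (embed_w n h 0 * (1\<^sub>m (2 * n) + (- s) \<cdot>\<^sub>m elem_mat (2 * n) (2 * n - 1) (n - 1))) $$ (i, j)"
      by simp
  qed (simp_all add: embed_w_def elem_mat_def)
  have "2 * n - 1 \<noteq> n - 1" using n by auto
  then have const: "det (embed_w n h s) = det (embed_w n h 0)" for s
    by (subst eq) (simp add: det_mult[OF embed_w_carrier] det_add_elem)
  obtain p where p: "block_upper (2 * n) n p" "embed_u n h 1 = embed_w n h (1 / 1) * p" "det p = 1"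
    using embed_u_eq_w[OF h n, of 1] by auto
  have "p \<in> carrier_mat (2 * n) (2 * n)" using p(1) by (simp add: block_upper_def GL_carrier)
  then have "det h = det (embed_w n h 1)"
    using embed_u_GL(2)[OF h n, of 1] p by (simp add: det_mult[OF embed_w_carrier])
  then have d: "det (embed_w n h s) = det h" using const[of s] const[of 1] by simp
  then show "\<bar>det (embed_w n h s)\<bar> = \<bar>det h\<bar>" by simp
  show "embed_w n h s \<in> GL (2 * n)" using d h by (simp add: GL_iff_det)
qed

lemma gram_embed_u_H:
  assumes "h \<in> GL (2 * n - 1)" "n \<ge> 1"
  shows "gram (2 * n - 1) n (embed_u n h t) = gram (2 * n - 1) n h"
  unfolding gram_def
  by (rule arg_cong[of _ _ det], rule eq_matI)
    (use assms in \<open>auto simp: embed_u_index GL_carrier intro!: sum.cong\<close>)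

text \<open>
  Expansion along the last row.
\<close>

lemma det_add_corner:
  assumes A: "A \<in> carrier_mat n n" and n: "n \<ge> 1"
  shows "det (mat n n (\<lambda>(i, j). A $$ (i, j) + (if i = n - 1 \<and> j = n - 1 then c else 0))) = det A + c * det (ul (n - 1) A)"
proof -
  let ?B = "mat n n (\<lambda>(i, j). A $$ (i, j) + (if i = n - 1 \<and> j = n - 1 then c else 0))"
  have l: "n - 1 < n" using n by simp
  have cof: "cofactor ?B (n - 1) j = cofactor A (n - 1) j" if "j < n" for j
  proof -
    have "mat_delete ?B (n - 1) j = mat_delete A (n - 1) j"
      using A that by (intro eq_matI) (auto simp: mat_delete_def)
    then show ?thesis by (simp add: cofactor_def)
  qed
  have "mat_delete A (n - 1) (n - 1) = ul (n - 1) A"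
    using A by (intro eq_matI) (auto simp: mat_delete_def)
  then have corner: "cofactor A (n - 1) (n - 1) = det (ul (n - 1) A)" by (simp add: cofactor_def)
  have "det ?B = (\<Sum>j<n. ?B $$ (n - 1, j) * cofactor ?B (n - 1) j)"
    by (rule laplace_expansion_row[OF _ l]) simp
  also have "\<dots> = (\<Sum>j<n. A $$ (n - 1, j) * cofactor A (n - 1) j + (if j = n - 1 then c * cofactor A (n - 1) j else 0))"
    using l by (intro sum.cong) (auto simp: cof algebra_simps)
  also have "\<dots> = det A + c * cofactor A (n - 1) (n - 1)"
    using l laplace_expansion_row[OF A l] by (simp add: sum.distrib sum.delta)
  finally show ?thesis by (simp add: corner)
qed

text \<open>
  The last row of \<open>h u\<^sub>t\<close> has the only entry \<open>t\<close> in the first \<open>n\<close> columns, so it changes the Gram matrix of \<open>h\<close> by \<open>t\<^sup>2\<close> in its last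
  corner.
\<close>

lemma gram_embed_u:
  assumes h: "h \<in> GL (2 * n - 1)" and n: "n \<ge> 1"
  shows "gram (2 * n) n (embed_u n h t) = gram (2 * n - 1) n h + gram (2 * n - 1) (n - 1) h * t\<^sup>2"
proof -
  have hc: "h \<in> carrier_mat (2 * n - 1) (2 * n - 1)" using h by (rule GL_carrier)
  define S where "S = mat n n (\<lambda>(i, j). \<Sum>k<2 * n - 1. h $$ (k, i) * h $$ (k, j))"
  have Sc: "S \<in> carrier_mat n n" by (simp add: S_def)
  have "(\<Sum>k<2 * n. embed_u n h t $$ (k, i) * embed_u n h t $$ (k, j)) =
      S $$ (i, j) + (if i = n - 1 \<and> j = n - 1 then t\<^sup>2 else 0)" if "i < n" "j < n" for i j
  proof -
    have "{..<2 * n} = insert (2 * n - 1) {..<2 * n - 1}" using n by auto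
    then have "(\<Sum>k<2 * n. embed_u n h t $$ (k, i) * embed_u n h t $$ (k, j)) =
      embed_u n h t $$ (2 * n - 1, i) * embed_u n h t $$ (2 * n - 1, j) + (\<Sum>k<2 * n - 1. embed_u n h t $$ (k, i) * embed_u n h t $$ (k, j))"
      by simp
    also have "(\<Sum>k<2 * n - 1. embed_u n h t $$ (k, i) * embed_u n h t $$ (k, j)) = S $$ (i, j)"
      using that by (auto simp: S_def embed_u_index[OF hc n] intro!: sum.cong)
    finally show ?thesis using that n by (auto simp: embed_u_index[OF hc n] power2_eq_square)
  qed
  then have "gram (2 * n) n (embed_u n h t) = det (mat n n (\<lambda>(i, j). S $$ (i, j) + (if i = n - 1 \<and> j = n - 1 then t\<^sup>2 else 0)))"
    unfolding gram_def by (intro arg_cong[of _ _ det] eq_matI) auto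
  also have "\<dots> = det S + t\<^sup>2 * det (ul (n - 1) S)" by (rule det_add_corner[OF Sc n])
  also have "det S = gram (2 * n - 1) n h" by (simp add: gram_def S_def)
  also have "ul (n - 1) S = mat (n - 1) (n - 1) (\<lambda>(i, j). \<Sum>k<2 * n - 1. h $$ (k, i) * h $$ (k, j))"
    by (rule eq_matI) (auto simp: S_def)
  then have "det (ul (n - 1) S) = gram (2 * n - 1) (n - 1) h" by (simp add: gram_def)
  finally show ?thesis by simp
qed

lemma gram_embed_w:
  assumes h: "h \<in> GL (2 * n - 1)" and n: "n \<ge> 1" and s: "s \<noteq> 0"
  shows "gram (2 * n) n (embed_w n h s) = gram (2 * n - 1) (n - 1) h + gram (2 * n - 1) n h * s\<^sup>2"
    and "gram (2 * n - 1) n (embed_w n h s) = gram (2 * n - 1) n h * s\<^sup>2"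
proof -
  obtain p where p: "block_upper (2 * n) n p" "embed_u n h (1 / s) = embed_w n h (1 / (1 / s)) * p" "det (ul n p) = 1 / s"
    using embed_u_eq_w[OF h n, of "1 / s"] s by auto
  have pc: "p \<in> carrier_mat (2 * n) (2 * n)" using p(1) by (simp add: block_upper_def GL_carrier)
  have "gram r n (embed_u n h (1 / s)) = (1 / s)\<^sup>2 * gram r n (embed_w n h s)" if "r \<le> 2 * n" for r
    using gram_mult[OF embed_w_carrier pc _ that] p s by (simp add: block_upper_def)
  then have "gram r n (embed_w n h s) = s\<^sup>2 * gram r n (embed_u n h (1 / s))" if "r \<le> 2 * n" for r
    using s that by (simp add: field_simps)
  then show "gram (2 * n) n (embed_w n h s) = gram (2 * n - 1) (n - 1) h + gram (2 * n - 1) n h * s\<^sup>2"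
    "gram (2 * n - 1) n (embed_w n h s) = gram (2 * n - 1) n h * s\<^sup>2"
  proof -
    have "s\<^sup>2 * (1 / s)\<^sup>2 = 1" using s by (simp add: power_divide)
    then have e: "s\<^sup>2 * (a + b * (1 / s)\<^sup>2) = b + a * s\<^sup>2" for a b :: real
      by (simp add: distrib_left mult.left_commute mult.commute)
    show "gram (2 * n) n (embed_w n h s) = gram (2 * n - 1) (n - 1) h + gram (2 * n - 1) n h * s\<^sup>2"
      unfolding \<open>\<And>r. r \<le> 2 * n \<Longrightarrow> gram r n (embed_w n h s) = s\<^sup>2 * gram r n (embed_u n h (1 / s))\<close>[OF order_refl]
        gram_embed_u[OF h n] by (rule e)
    have "2 * n - 1 \<le> 2 * n" by simp
    from \<open>\<And>r. r \<le> 2 * n \<Longrightarrow> gram r n (embed_w n h s) = s\<^sup>2 * gram r n (embed_u n h (1 / s))\<close>[OF this]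
    show "gram (2 * n - 1) n (embed_w n h s) = gram (2 * n - 1) n h * s\<^sup>2"
      unfolding gram_embed_u_H[OF h n] by (simp only: mult.commute)
  qed
qed

section \<open>The flat sections\<close>

text \<open>
  A complex power of the Gram determinant corrects the difference of the two parameters: \<open>gram\<close> scales by \<open>(det p\<^sub>1)\<^sup>2\<close>, so
  its power with half the exponent changes \<open>|det p\<^sub>1|\<close> relative to \<open>|det p\<^sub>2|\<close>, and the power of \<open>|det g|\<close> changes both.
  On orthogonal matrices both factors are 1.
\<close>

definition flat_formula :: "nat \<Rightarrow> complex \<times> complex \<Rightarrow> (real mat \<Rightarrow> complex) \<Rightarrow> complex \<times> complex \<Rightarrow> real mat \<Rightarrow> complex" where
  "flat_formula n = (\<lambda>(lam1, lam2) f (lam1', lam2').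
     (\<lambda>g\<in>GL (2 * n). f g * abs_char 0 ((lam1 - lam1' - lam2 + lam2') / 2) (gram (2 * n) n g) *
        abs_char 0 (lam2 - lam2') (det g)))"

lemma smooth_entry:
  assumes "i < N" "j < N"
  shows "smooth (entries N) (GL_coords N) (\<lambda>x. mat N N x $$ (i, j))"
  using smooth_coord[OF open_GL_coords, of "entries N" N "(i, j)"] assms by simp

lemma smooth_gram:
  assumes "r \<le> N" "m \<le> N" "open U" "\<And>i j. i < N \<Longrightarrow> j < N \<Longrightarrow> smooth J U (\<lambda>x. M x $$ (i, j))"
  shows "smooth J U (\<lambda>x. gram r m (M x))"
  unfolding gram_def
proof (rule smooth_det[OF assms(3), of _ m])
  fix i j assume "i < m" "j < m"
  then show "smooth J U (\<lambda>y. mat m m (\<lambda>(i, j). \<Sum>k<r. M y $$ (k, i) * M y $$ (k, j)) $$ (i, j))"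
    using assms by (auto intro!: smooth_sum smooth_mult)
qed simp

lemma abs_char_add_0: "x \<noteq> 0 \<Longrightarrow> abs_char \<epsilon> (\<mu> + \<nu>) x = abs_char \<epsilon> \<mu> x * abs_char 0 \<nu> x"
proof -
  assume "x \<noteq> 0"
  from abs_char_add[OF this, of \<epsilon> 0 \<mu> \<nu>] show ?thesis by (simp only: add_0_right)
qed

lemma abs_char_square:
  assumes "x \<noteq> 0"
  shows "abs_char 0 (\<mu> / 2) (x\<^sup>2 * y) = abs_char 0 \<mu> x * abs_char 0 (\<mu> / 2) y"
proof (cases "y = 0")
  case False
  have "abs_char 0 (\<mu> / 2) (x\<^sup>2 * y) = (abs_char 0 (\<mu> / 2) x * abs_char 0 (\<mu> / 2) x) * abs_char 0 (\<mu> / 2) y"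
    using assms False by (simp add: abs_char_mult power2_eq_square)
  also have "abs_char 0 (\<mu> / 2) x * abs_char 0 (\<mu> / 2) x = abs_char 0 \<mu> x"
    using abs_char_add[OF assms, of 0 0 "\<mu> / 2" "\<mu> / 2"] by simp
  finally show ?thesis .
qed (simp add: abs_char_def)

lemma flat_formula_in_pi_space:
  assumes f: "f \<in> pi_space n \<xi> lam"
  shows "flat_formula n lam f lam' \<in> pi_space n \<xi> lam'"
proof (cases \<xi>; cases lam; cases lam')
  fix \<xi>1 \<xi>2 l1 l2 l1' l2' assume eqs [simp]: "\<xi> = (\<xi>1, \<xi>2)" "lam = (l1, l2)" "lam' = (l1', l2')"
  let ?N = "2 * n"
  define \<mu> where "\<mu> = l1 - l1' - l2 + l2'"
  have F: "flat_formula n (l1, l2) f (l1', l2') g = f g * abs_char 0 (\<mu> / 2) (gram ?N n g) * abs_char 0 (l2 - l2') (det g)" if "g \<in> GL ?N" for g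
    using that by (simp add: flat_formula_def \<mu>_def)
  have fs: "smooth_on_GL ?N f" using f by (simp add: pi_space_iff)
  have "smooth (entries ?N) (GL_coords ?N) (\<lambda>x. f (mat ?N ?N x) * abs_char 0 (\<mu> / 2) (gram ?N n (mat ?N ?N x)) *
      abs_char 0 (l2 - l2') (det (mat ?N ?N x)))"
  proof (intro smooth_mult smooth_abs_char open_GL_coords)
    show "smooth (entries ?N) (GL_coords ?N) (\<lambda>x. f (mat ?N ?N x))" using fs by (simp add: smooth_on_GL_iff)
    show "smooth (entries ?N) (GL_coords ?N) (\<lambda>x. gram ?N n (mat ?N ?N x))"
      by (rule smooth_gram[OF _ _ open_GL_coords]) (auto intro: smooth_entry)
    show "smooth (entries ?N) (GL_coords ?N) (\<lambda>x. det (mat ?N ?N x) :: real)"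
      by (rule smooth_det[OF open_GL_coords]) (auto intro: smooth_entry)
    show "gram ?N n (mat ?N ?N x) \<noteq> 0" if "x \<in> GL_coords ?N" for x
      using gram_pos[of "mat ?N ?N x" ?N n] that by (simp add: GL_coords_def)
    show "det (mat ?N ?N x) \<noteq> (0::real)" if "x \<in> GL_coords ?N" for x
      using that by (simp add: GL_coords_def GL_iff_det)
  qed
  then have "smooth (entries ?N) (GL_coords ?N) (\<lambda>x. flat_formula n lam f lam' (mat ?N ?N x))"
    by (rule smooth_cong[OF open_GL_coords, rotated]) (simp add: F GL_coords_def)
  then have s: "smooth_on_GL ?N (flat_formula n lam f lam')" by (simp add: smooth_on_GL_iff)
  have "flat_formula n lam f lam' (g * p) = pi_char n \<xi> lam' p * flat_formula n lam f lam' g"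
    if g: "g \<in> GL ?N" and p: "block_upper ?N n p" for g p
  proof -
    have pG: "p \<in> GL ?N" using p by (simp add: block_upper_def)
    have gc: "g \<in> carrier_mat ?N ?N" "p \<in> carrier_mat ?N ?N" using g pG by (simp_all add: GL_carrier)
    define d D where "d = det (ul n p)" and "D = det p / d"
    have d: "d \<noteq> 0" using block_upper_blocks(3)[OF p] by (simp add: d_def)
    have "det p \<noteq> 0" using pG by (simp add: GL_iff_det)
    then have D: "D \<noteq> 0" "det p = D * d" using d by (simp_all add: D_def)
    have gp: "gram ?N n g \<noteq> 0" using gram_pos[OF g, of n] by simp
    have gr: "gram ?N n (g * p) = d\<^sup>2 * gram ?N n g"
      unfolding d_def using p by (intro gram_mult[OF gc]) (auto simp: block_upper_def)
    have dt: "det (g * p) = D * (d * det g)" using det_mult[OF gc] D by simp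
    have dg: "det g \<noteq> 0" using g by (simp add: GL_iff_det)
    have e1: "abs_char \<xi>1 (- l1' - of_nat n / 2) d =
        abs_char \<xi>1 (- l1 - of_nat n / 2) d * (abs_char 0 \<mu> d * abs_char 0 (l2 - l2') d)"
    proof -
      have "(- l1 - of_nat n / 2) + (\<mu> + (l2 - l2')) = - l1' - of_nat n / 2" by (simp add: \<mu>_def)
      then show ?thesis
        using abs_char_add_0[OF d, of \<xi>1 "- l1 - of_nat n / 2" "\<mu> + (l2 - l2')"] abs_char_add_0[OF d, of 0 \<mu> "l2 - l2'"]
        by (simp only:)
    qed
    have e2: "abs_char \<xi>2 (- l2' + of_nat n / 2) D = abs_char \<xi>2 (- l2 + of_nat n / 2) D * abs_char 0 (l2 - l2') D"
    proof -
      have "(- l2 + of_nat n / 2) + (l2 - l2') = - l2' + of_nat n / 2" by simp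
      then show ?thesis using abs_char_add_0[OF D(1), of \<xi>2 "- l2 + of_nat n / 2" "l2 - l2'"] by (simp only:)
    qed
    have fg: "f (g * p) = abs_char \<xi>1 (- l1 - of_nat n / 2) d * abs_char \<xi>2 (- l2 + of_nat n / 2) D * f g"
      using f g p by (simp add: pi_space_iff pi_char_def d_def D_def)
    have "flat_formula n lam f lam' (g * p) = f (g * p) * abs_char 0 (\<mu> / 2) (d\<^sup>2 * gram ?N n g) * abs_char 0 (l2 - l2') (D * (d * det g))"
      using F[OF GL_mult[OF g pG]] gr dt by simp
    also have "\<dots> = abs_char \<xi>1 (- l1' - of_nat n / 2) d * abs_char \<xi>2 (- l2' + of_nat n / 2) D * flat_formula n lam f lam' g"
    proof -
      have dd: "d * det g \<noteq> 0" using d dg by simp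
      show ?thesis
        by (simp only: eqs F[OF g] fg e1 e2 abs_char_square[OF d] abs_char_mult[OF D(1) dd] abs_char_mult[OF d dg]
            mult.assoc mult.left_commute mult.commute)
    qed
    finally show ?thesis by (simp add: pi_char_def d_def D_def)
  qed
  moreover have "flat_formula n lam f lam' \<in> extensional (GL ?N)" by (simp add: flat_formula_def)
  ultimately show ?thesis using s by (simp add: pi_space_iff)
qed

text \<open>
  Uniqueness in the compact picture, by the \<open>QR\<close> decomposition.
\<close>

lemma pi_space_eqI:
  assumes "f \<in> pi_space n \<xi> lam" "f' \<in> pi_space n \<xi> lam" "\<And>k. k \<in> Orth (2 * n) \<Longrightarrow> f k = f' k"
  shows "f = f'"
proof (rule extensionalityI)
  show "f \<in> extensional (GL (2 * n))" "f' \<in> extensional (GL (2 * n))" using assms by (simp_all add: pi_space_iff)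
  fix g assume g: "g \<in> GL (2 * n)"
  obtain r where r: "r \<in> GL (2 * n)" "upper_triangular r" "g * r \<in> Orth (2 * n)" using QR_decomposition[OF g] .
  have b: "block_upper (2 * n) n r" by (rule upper_triangular_block_upper[OF r(1,2)])
  have "f (g * r) = pi_char n \<xi> lam r * f g" "f' (g * r) = pi_char n \<xi> lam r * f' g"
    using assms(1,2) g b by (simp_all add: pi_space_iff)
  then show "f g = f' g" using assms(3)[OF r(3)] pi_char_nz[OF b] by simp
qed

lemma flat_section_eq:
  assumes f: "f \<in> pi_space n \<xi> lam"
  shows "flat_section n \<xi> f lam' = flat_formula n lam f lam'"
  unfolding flat_section_def
proof (rule the_equality)
  have K: "flat_formula n lam f lam' k = f k" if "k \<in> Orth (2 * n)" for k
    using that gram_Orth[OF that, of n] Orth_det[OF that] Orth_GL[OF that]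
    by (auto simp: flat_formula_def abs_char_def bit_rep_def split: prod.split)
  then show "flat_formula n lam f lam' \<in> pi_space n \<xi> lam' \<and> (\<forall>k\<in>Orth (2 * n). flat_formula n lam f lam' k = f k)"
    using flat_formula_in_pi_space[OF f] by simp
  show "f' = flat_formula n lam f lam'" if "f' \<in> pi_space n \<xi> lam' \<and> (\<forall>k\<in>Orth (2 * n). f' k = f k)" for f'
    using that K flat_formula_in_pi_space[OF f] by (intro pi_space_eqI[of f' n \<xi> lam']) auto
qed

section \<open>Normalized Mellin transforms\<close>

subsection \<open>Holomorphic functions of the parameters\<close>

text \<open>
  Pointwise version of \<^const>\<open>entire_3\<close>. It is closed under the operations below, which is how the
  continuation is seen to be entire.
\<close>

definition holo_at :: "((complex \<times> complex) \<times> complex \<Rightarrow> complex) \<Rightarrow> (complex \<times> complex) \<times> complex \<Rightarrow> bool" where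
  "holo_at \<Phi> p \<longleftrightarrow> (\<exists>a b c. (\<Phi> has_derivative (\<lambda>((x, y), z). a * x + b * y + c * z)) (at p))"

lemma entire_3_iff: "entire_3 \<Phi> \<longleftrightarrow> (\<forall>p. holo_at \<Phi> p)"
  by (simp add: entire_3_def holo_at_def)

lemma holo_atI:
  assumes "(\<Phi> has_derivative D) (at p)" "\<And>x y z. D ((x, y), z) = a * x + b * y + c * z"
  shows "holo_at \<Phi> p"
proof -
  have "D = (\<lambda>((x, y), z). a * x + b * y + c * z)" by (auto simp: fun_eq_iff assms(2))
  then show ?thesis using assms(1) unfolding holo_at_def by blast
qed

lemma holo_atE:
  assumes "holo_at \<Phi> p"
  obtains D a b c where "(\<Phi> has_derivative D) (at p)" "\<And>x y z. D ((x, y), z) = a * x + b * y + c * z"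
  using assms unfolding holo_at_def by fastforce

lemma holo_at_const: "holo_at (\<lambda>p. k) p"
  by (rule holo_atI[where a = 0 and b = 0 and c = 0, OF has_derivative_const]) simp

lemma holo_at_coords: "holo_at (\<lambda>p. fst (fst p)) p" "holo_at (\<lambda>p. snd (fst p)) p" "holo_at (\<lambda>p. snd p) p"
  by (rule holo_atI[OF has_derivative_fst[OF has_derivative_fst[OF has_derivative_ident]], of 1 0 0], simp)
    (rule holo_atI[OF has_derivative_snd[OF has_derivative_fst[OF has_derivative_ident]], of 0 1 0], simp,
     rule holo_atI[OF has_derivative_snd[OF has_derivative_ident], of 0 0 1], simp)

lemma holo_at_add: "holo_at \<Phi> p \<Longrightarrow> holo_at \<Psi> p \<Longrightarrow> holo_at (\<lambda>p. \<Phi> p + \<Psi> p) p"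
proof (elim holo_atE)
  fix D D' a b c a' b' c'
  assume "(\<Phi> has_derivative D) (at p)" "(\<Psi> has_derivative D') (at p)"
    and D: "\<And>x y z. D ((x, y), z) = a * x + b * y + c * z" "\<And>x y z. D' ((x, y), z) = a' * x + b' * y + c' * z"
  from has_derivative_add[OF this(1,2)] show ?thesis
    by (rule holo_atI[where a = "a + a'" and b = "b + b'" and c = "c + c'"]) (simp add: D algebra_simps)
qed

lemma holo_at_mult: "holo_at \<Phi> p \<Longrightarrow> holo_at \<Psi> p \<Longrightarrow> holo_at (\<lambda>p. \<Phi> p * \<Psi> p) p"
proof (elim holo_atE)
  fix D D' a b c a' b' c'
  assume "(\<Phi> has_derivative D) (at p)" "(\<Psi> has_derivative D') (at p)"
    and D: "\<And>x y z. D ((x, y), z) = a * x + b * y + c * z" "\<And>x y z. D' ((x, y), z) = a' * x + b' * y + c' * z"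
  from has_derivative_mult[OF this(1,2)] show ?thesis
    by (rule holo_atI[where a = "\<Phi> p * a' + \<Psi> p * a" and b = "\<Phi> p * b' + \<Psi> p * b" and c = "\<Phi> p * c' + \<Psi> p * c"])
      (simp add: D algebra_simps)
qed

lemma holo_at_minus: "holo_at \<Phi> p \<Longrightarrow> holo_at (\<lambda>p. - \<Phi> p) p"
  using holo_at_mult[OF holo_at_const[of "- 1"], of \<Phi> p] by simp

lemma holo_at_diff: "holo_at \<Phi> p \<Longrightarrow> holo_at \<Psi> p \<Longrightarrow> holo_at (\<lambda>p. \<Phi> p - \<Psi> p) p"
  using holo_at_add[OF _ holo_at_minus, of \<Phi> p \<Psi>] by simp

lemma holo_at_compose:
  assumes "holo_at \<Phi> p" "(g has_field_derivative g') (at (\<Phi> p))"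
  shows "holo_at (\<lambda>p. g (\<Phi> p)) p"
proof -
  obtain D a b c where D: "(\<Phi> has_derivative D) (at p)" "\<And>x y z. D ((x, y), z) = a * x + b * y + c * z"
    using holo_atE[OF assms(1)] by blast
  have "((\<lambda>p. g (\<Phi> p)) has_derivative (\<lambda>v. g' * D v)) (at p)"
    using has_derivative_compose[OF D(1) assms(2)[unfolded has_field_derivative_def]] .
  then show ?thesis
    by (rule holo_atI[where a = "g' * a" and b = "g' * b" and c = "g' * c"]) (simp add: D algebra_simps)
qed

lemma holo_at_compose_2:
  assumes "holo_at A p" "holo_at B p" "((\<lambda>(s, k). g s k) has_derivative (\<lambda>(x, y). u * x + v * y)) (at (A p, B p))"
  shows "holo_at (\<lambda>p. g (A p) (B p)) p"
proof -
  obtain D a b c where D: "(A has_derivative D) (at p)" "\<And>x y z. D ((x, y), z) = a * x + b * y + c * z"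
    using holo_atE[OF assms(1)] by blast
  obtain D' a' b' c' where D': "(B has_derivative D') (at p)" "\<And>x y z. D' ((x, y), z) = a' * x + b' * y + c' * z"
    using holo_atE[OF assms(2)] by blast
  have "((\<lambda>p. (\<lambda>(s, k). g s k) (A p, B p)) has_derivative (\<lambda>w. (\<lambda>(x, y). u * x + v * y) (D w, D' w))) (at p)"
    using has_derivative_compose[OF has_derivative_Pair[OF D(1) D'(1)] assms(3)] .
  then have "((\<lambda>p. g (A p) (B p)) has_derivative (\<lambda>w. u * D w + v * D' w)) (at p)" by simp
  then show ?thesis
    by (rule holo_atI[where a = "u * a + v * a'" and b = "u * b + v * b'" and c = "u * c + v * c'"])
      (simp add: D D' algebra_simps)
qed

lemma holo_at_continuous: "holo_at \<Phi> p \<Longrightarrow> isCont \<Phi> p"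
  unfolding holo_at_def using has_derivative_continuous by blast

lemma holo_at_cong:
  assumes "holo_at \<Phi> p" "\<forall>\<^sub>F q in nhds p. \<Phi> q = \<Psi> q"
  shows "holo_at \<Psi> p"
proof -
  obtain D a b c where D: "(\<Phi> has_derivative D) (at p)" "\<And>x y z. D ((x, y), z) = a * x + b * y + c * z"
    using holo_atE[OF assms(1)] by blast
  have "(\<Psi> has_derivative D) (at p)"
    using D(1) assms(2)
    by (rule has_derivative_transform_eventually[OF _ eventually_mono[OF eventually_nhds_conv_at[THEN iffD1, THEN conjunct1]]])
      (use assms(2) eventually_nhds_x_imp_x in auto)
  then show ?thesis by (rule holo_atI[OF _ D(2)])
qed

subsection \<open>The convergent integrals\<close>

lemma of_real_powr_exp: "t > 0 \<Longrightarrow> complex_of_real t powr z = exp (z * of_real (ln t))"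
  by (simp add: powr_def Ln_of_real)

text \<open>
  The power \<open>t\<^bsup>s-1\<^esup>\<close> is smooth in \<open>t\<close> away from 0 only. When the real part of \<open>s\<close> is large the kernel is
  dominated by \<open>t\<close>, and a function with this bound that is continuous for \<open>t > 0\<close> is jointly continuous up to \<open>t = 0\<close>.
\<close>

lemma continuous_on_up_to_zero:
  fixes f :: "'a::topological_space \<times> real \<Rightarrow> complex"
  assumes c: "continuous_on (S \<times> {0<..1}) f" and b: "\<And>s t. s \<in> S \<Longrightarrow> t \<in> {0..1} \<Longrightarrow> norm (f (s, t)) \<le> t"
  shows "continuous_on (S \<times> {0..1}) f"
  unfolding continuous_on_def
proof
  fix p assume p: "p \<in> S \<times> {0..1::real}"
  show "(f \<longlongrightarrow> f p) (at p within S \<times> {0..1})"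
  proof (cases "snd p = 0")
    case True
    have "((\<lambda>q. snd q) \<longlongrightarrow> snd p) (at p within S \<times> {0..1})" by (rule tendsto_snd[OF tendsto_ident_at])
    then have l: "((\<lambda>q. snd q) \<longlongrightarrow> 0) (at p within S \<times> {0..1})" by (simp only: True)
    have "(f \<longlongrightarrow> 0) (at p within S \<times> {0..1})"
    proof (rule Lim_null_comparison[OF _ l])
      show "\<forall>\<^sub>F q in at p within S \<times> {0..1}. norm (f q) \<le> snd q"
        unfolding eventually_at_filter using b by (auto simp: always_eventually)
    qed
    moreover have "f p = 0" using b[of "fst p" "snd p"] p True by (cases p) auto
    ultimately show ?thesis by simp
  next
    case False
    have "at p within S \<times> {0..1} = at p within S \<times> {0<..1}"
    proof (rule at_within_nhd)
      show "p \<in> UNIV \<times> {0<..}" using p False by (auto simp: mem_Times_iff)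
      show "open (UNIV \<times> {0::real<..} :: ('a \<times> real) set)" by (intro open_Times open_UNIV open_greaterThan)
    qed auto
    moreover have "p \<in> S \<times> {0<..1}" using p False by (auto simp: mem_Times_iff)
    from bspec[OF c[unfolded continuous_on_def] this]
    have "(f \<longlongrightarrow> f p) (at p within S \<times> {0<..1})" .
    ultimately show ?thesis by simp
  qed
qed

lemma ln_mult_le_1:
  assumes "0 < t" "t \<le> (1::real)"
  shows "\<bar>ln t\<bar> * t \<le> 1"
proof -
  have "ln (1 / t) \<le> 1 / t - 1" using assms by (intro ln_le_minus_one) simp
  then have "- ln t \<le> 1 / t" using assms by (simp add: ln_div)
  moreover have "\<bar>ln t\<bar> = - ln t" using assms by simp
  ultimately have "\<bar>ln t\<bar> * t \<le> 1 / t * t" using assms by (intro mult_right_mono) auto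
  then show ?thesis using assms by simp
qed

text \<open>
  The bound \<open>Re s > 3\<close> leaves a factor \<open>t\<close> after one power of \<open>t\<close> has absorbed the logarithm that a
  derivative in \<open>s\<close> produces.
\<close>

lemma norm_powr_bounds:
  assumes "Re s > 3" "t \<in> {0..1}"
  shows "norm (of_real t powr (s - 1) :: complex) \<le> t" "norm (of_real (ln t) * of_real t powr (s - 1) :: complex) \<le> t"
proof -
  have "norm (of_real t powr (s - 1) :: complex) \<le> t \<and> norm (of_real (ln t) * of_real t powr (s - 1) :: complex) \<le> t"
  proof (cases "t = 0")
    case False
    then have t: "0 < t" "t \<le> 1" using assms by auto
    have n: "norm (of_real t powr (s - 1) :: complex) = t powr (Re s - 1)"
      using t by (simp add: norm_powr_real_powr)
    have "t powr (Re s - 1) \<le> t powr 2" using t assms by (intro powr_mono') auto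
    also have "\<dots> = t * t" using t by (simp add: powr_numeral power2_eq_square)
    finally have le: "t powr (Re s - 1) \<le> t * t" .
    also have "\<dots> \<le> t" using t by (simp add: mult_le_one mult_left_le)
    finally have 1: "t powr (Re s - 1) \<le> t" .
    have "\<bar>ln t\<bar> * t powr (Re s - 1) \<le> \<bar>ln t\<bar> * (t * t)" using le by (intro mult_left_mono) auto
    also have "\<dots> = (\<bar>ln t\<bar> * t) * t" by simp
    also have "\<dots> \<le> 1 * t" using ln_mult_le_1[OF t] t by (intro mult_right_mono) auto
    finally show ?thesis using 1 n by (simp add: norm_mult)
  qed simp
  then show "norm (of_real t powr (s - 1) :: complex) \<le> t" "norm (of_real (ln t) * of_real t powr (s - 1) :: complex) \<le> t"
    by simp_all
qed

lemma continuous_on_powr_kernel: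
  "continuous_on ({s. Re s > 3} \<times> {0..1}) (\<lambda>(s, t). of_real t powr (s - 1) :: complex)"
  "continuous_on ({s. Re s > 3} \<times> {0..1}) (\<lambda>(s, t). of_real (ln t) * of_real t powr (s - 1) :: complex)"
proof -
  have c: "continuous_on ({s. Re s > 3} \<times> {0<..1}) (\<lambda>(s, t). of_real t powr (s - 1) :: complex)"
  proof (subst continuous_on_cong[OF refl])
    show "continuous_on ({s. Re s > 3} \<times> {0<..1}) (\<lambda>p. exp ((fst p - 1) * of_real (ln (snd p))) :: complex)"
      by (intro continuous_intros) auto
  qed (auto simp: of_real_powr_exp)
  have l: "continuous_on ({s. Re s > 3} \<times> {0<..1}) (\<lambda>p. of_real (ln (snd p)) :: complex)"
    by (intro continuous_intros) auto
  show "continuous_on ({s. Re s > 3} \<times> {0..1}) (\<lambda>(s, t). of_real t powr (s - 1) :: complex)"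
    by (rule continuous_on_up_to_zero[OF c]) (simp only: mem_Collect_eq case_prod_conv norm_powr_bounds(1))
  have "continuous_on ({s. Re s > 3} \<times> {0<..1}) (\<lambda>(s, t). of_real (ln t) * of_real t powr (s - 1) :: complex)"
    using continuous_on_mult[OF l c] by (simp only: case_prod_unfold)
  then show "continuous_on ({s. Re s > 3} \<times> {0..1}) (\<lambda>(s, t). of_real (ln t) * of_real t powr (s - 1) :: complex)"
    by (rule continuous_on_up_to_zero) (simp only: mem_Collect_eq case_prod_conv norm_powr_bounds(2))
qed

text \<open>
  The Mellin transform over \<open>[0, 1]\<close> of \<open>(\<alpha> + \<beta> t\<^sup>2)\<^sup>\<kappa> g t\<close>. The exponent \<open>\<kappa>\<close> enters because
  the flat sections vary with the parameters of the representation.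
\<close>

definition mellin :: "(real \<Rightarrow> complex) \<Rightarrow> real \<Rightarrow> real \<Rightarrow> complex \<Rightarrow> complex \<Rightarrow> complex" where
  "mellin g \<alpha> \<beta> s \<kappa> = integral {0..1} (\<lambda>t. of_real t powr (s - 1) * of_real (\<alpha> + \<beta> * t\<^sup>2) powr \<kappa> * g t)"

lemma quadratic_pos: "\<alpha> > 0 \<Longrightarrow> \<beta> > 0 \<Longrightarrow> \<alpha> + \<beta> * t\<^sup>2 > (0::real)"
  by (simp add: add_pos_nonneg)

text \<open>
  Differentiation under the integral sign in \<open>s\<close> and in \<open>\<kappa>\<close>; both derivatives of the kernel are continuous up to \<open>t = 0\<close>
  in the region \<open>Re s > 3\<close>. The region is not optimal, but integration by parts reaches it from everywhere.
\<close>

lemma mellin_has_derivative: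
  assumes ab: "\<alpha> > 0" "\<beta> > 0" and g: "continuous_on {0..1} g" and s0: "Re s0 > 3"
  shows "\<exists>u v. ((\<lambda>(s, \<kappa>). mellin g \<alpha> \<beta> s \<kappa>) has_derivative (\<lambda>(x, y). u * x + v * y)) (at (s0, \<kappa>0))"
proof -
  define X where "X = {s. Re s > 3}"
  define L where "L t = complex_of_real (ln (\<alpha> + \<beta> * t\<^sup>2))" for t
  define K where "K s \<kappa> t = of_real t powr (s - 1) * exp (\<kappa> * L t) * g t" for s \<kappa> t
  have XO: "open X" "convex X" "s0 \<in> X"
    using s0 by (auto simp: X_def open_halfspace_Re_gt convex_halfspace_Re_gt)
  have M: "mellin g \<alpha> \<beta> s \<kappa> = integral {0..1} (K s \<kappa>)" for s \<kappa>
    unfolding mellin_def K_def L_def by (simp only: of_real_powr_exp[OF quadratic_pos[OF ab]])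
  have cL: "continuous_on S (\<lambda>p. L (f p))" if "continuous_on S f" for S :: "((complex \<times> complex) \<times> real) set" and f
    unfolding L_def using that quadratic_pos[OF ab] by (intro continuous_intros) (auto simp: less_imp_neq[symmetric])
  have cP: "continuous_on ((X \<times> UNIV) \<times> {0..1}) (\<lambda>p::(complex \<times> complex) \<times> real. of_real (snd p) powr (fst (fst p) - 1) :: complex)"
    "continuous_on ((X \<times> UNIV) \<times> {0..1}) (\<lambda>p::(complex \<times> complex) \<times> real. of_real (ln (snd p)) * of_real (snd p) powr (fst (fst p) - 1) :: complex)"
  proof -
    have q: "continuous_on ((X \<times> UNIV) \<times> {0..1}) (\<lambda>p::(complex \<times> complex) \<times> real. (fst (fst p), snd p))"
      by (intro continuous_intros)
    have im: "(\<lambda>p::(complex \<times> complex) \<times> real. (fst (fst p), snd p)) ` ((X \<times> UNIV) \<times> {0..1}) \<subseteq> {s. Re s > 3} \<times> {0..1}"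
      by (auto simp: X_def)
    show "continuous_on ((X \<times> UNIV) \<times> {0..1}) (\<lambda>p::(complex \<times> complex) \<times> real. of_real (snd p) powr (fst (fst p) - 1) :: complex)"
      "continuous_on ((X \<times> UNIV) \<times> {0..1}) (\<lambda>p::(complex \<times> complex) \<times> real. of_real (ln (snd p)) * of_real (snd p) powr (fst (fst p) - 1) :: complex)"
      using continuous_on_compose2[OF continuous_on_powr_kernel(1) q im] continuous_on_compose2[OF continuous_on_powr_kernel(2) q im]
      by (simp_all add: case_prod_unfold)
  qed
  have cg: "continuous_on ((X \<times> UNIV) \<times> {0..1}) (\<lambda>p::(complex \<times> complex) \<times> real. g (snd p))"
    by (rule continuous_on_compose2[OF g continuous_on_snd[OF continuous_on_id]]) auto
  have ce: "continuous_on ((X \<times> UNIV) \<times> {0..1}) (\<lambda>p::(complex \<times> complex) \<times> real. exp (snd (fst p) * L (snd p)))"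
    by (intro continuous_on_exp continuous_on_mult cL continuous_intros)
  have cK: "continuous_on ((X \<times> UNIV) \<times> {0..1}) (\<lambda>(p, t). K (fst p) (snd p) t)"
    using continuous_on_mult[OF continuous_on_mult[OF cP(1) ce] cg] by (simp add: K_def case_prod_unfold)
  have cKs: "continuous_on ((X \<times> UNIV) \<times> {0..1}) (\<lambda>(p, t). of_real (ln t) * K (fst p) (snd p) t)"
    using continuous_on_mult[OF continuous_on_mult[OF cP(2) ce] cg] by (simp add: K_def case_prod_unfold mult.assoc)
  have cKk: "continuous_on ((X \<times> UNIV) \<times> {0..1}) (\<lambda>(p, t). L t * K (fst p) (snd p) t)"
    using continuous_on_mult[OF cL[OF continuous_on_snd[OF continuous_on_id]] cK] by (simp add: case_prod_unfold)
  have slice: "continuous_on (X \<times> {0..1}) (\<lambda>(s, t). F (s, \<kappa>) t)" "continuous_on (UNIV \<times> {0..1}) (\<lambda>(k, t). F (s, k) t)"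
    "continuous_on {0..1} (F (s, \<kappa>))"
    if "continuous_on ((X \<times> UNIV) \<times> {0..1}) (\<lambda>(p, t). F p t)" "s \<in> X" for F :: "complex \<times> complex \<Rightarrow> real \<Rightarrow> complex" and s \<kappa>
  proof -
    have 1: "continuous_on (X \<times> {0..1}) (\<lambda>q. ((fst q, \<kappa>), snd q))" "continuous_on (UNIV \<times> {0..1}) (\<lambda>q. ((s, fst q), snd q))"
      "continuous_on {0..1} (\<lambda>t. ((s, \<kappa>), t))"
      by (intro continuous_intros)+
    show "continuous_on (X \<times> {0..1}) (\<lambda>(s, t). F (s, \<kappa>) t)" "continuous_on (UNIV \<times> {0..1}) (\<lambda>(k, t). F (s, k) t)"
      "continuous_on {0..1} (F (s, \<kappa>))"
    proof -
      have im: "(\<lambda>q. ((fst q, \<kappa>), snd q)) ` (X \<times> {0..1::real}) \<subseteq> (X \<times> UNIV) \<times> {0..1}"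
        "(\<lambda>q. ((s, fst q), snd q)) ` (UNIV \<times> {0..1::real}) \<subseteq> (X \<times> UNIV) \<times> {0..1}"
        "(\<lambda>t. ((s, \<kappa>), t)) ` {0..1::real} \<subseteq> (X \<times> UNIV) \<times> {0..1}"
        using that(2) by auto
      show "continuous_on (X \<times> {0..1}) (\<lambda>(s, t). F (s, \<kappa>) t)" "continuous_on (UNIV \<times> {0..1}) (\<lambda>(k, t). F (s, k) t)"
        "continuous_on {0..1} (F (s, \<kappa>))"
        using continuous_on_compose2[OF that(1) 1(1) im(1)] continuous_on_compose2[OF that(1) 1(2) im(2)]
          continuous_on_compose2[OF that(1) 1(3) im(3)]
        by (simp_all add: case_prod_unfold)
    qed
  qed
  have int: "K s \<kappa> integrable_on {0..1}" if "s \<in> X" for s \<kappa>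
    using slice(3)[OF cK that, of \<kappa>] by (simp add: integrable_continuous_real)
  have ds: "((\<lambda>s. K s \<kappa> t) has_field_derivative of_real (ln t) * K s \<kappa> t) (at s within X)" if "t \<in> {0..1}" for s \<kappa> t
  proof (cases "t = 0")
    case True
    then show ?thesis by (simp add: K_def)
  next
    case False
    then have t: "t > 0" using that by simp
    have "((\<lambda>s. exp ((s - 1) * of_real (ln t)) * exp (\<kappa> * L t) * g t) has_field_derivative
        of_real (ln t) * (exp ((s - 1) * of_real (ln t)) * exp (\<kappa> * L t) * g t)) (at s within X)"
      by (auto intro!: derivative_eq_intros)
    then show ?thesis by (simp only: K_def of_real_powr_exp[OF t])
  qed
  have dk: "((\<lambda>\<kappa>. K s \<kappa> t) has_field_derivative L t * K s \<kappa> t) (at \<kappa> within UNIV)" for s \<kappa> t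
    unfolding K_def by (auto intro!: derivative_eq_intros)
  define a where "a = integral {0..1} (\<lambda>t. of_real (ln t) * K s0 \<kappa>0 t)"
  define b where "b p = integral {0..1} (\<lambda>t. L t * K (fst p) (snd p) t)" for p
  have "((\<lambda>s. integral (cbox 0 1) (K s \<kappa>0)) has_field_derivative integral (cbox 0 1) (\<lambda>t. of_real (ln t) * K s0 \<kappa>0 t)) (at s0 within X)"
    by (rule leibniz_rule_field_derivative[where fx = "\<lambda>s t. of_real (ln t) * K s \<kappa>0 t"])
      (use ds int slice(1)[OF cKs XO(3), of \<kappa>0] XO in auto)
  then have A: "((\<lambda>s. mellin g \<alpha> \<beta> s \<kappa>0) has_derivative (*) a) (at s0 within X)"
    by (simp add: M a_def has_field_derivative_def)
  have B: "((\<lambda>\<kappa>. mellin g \<alpha> \<beta> s \<kappa>) has_derivative blinfun_apply (blinfun_mult_right (b (s, \<kappa>)))) (at \<kappa> within UNIV)" if "s \<in> X" for s \<kappa>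
  proof -
    have "((\<lambda>\<kappa>. integral (cbox 0 1) (K s \<kappa>)) has_field_derivative integral (cbox 0 1) (\<lambda>t. L t * K s \<kappa> t)) (at \<kappa> within UNIV)"
      by (rule leibniz_rule_field_derivative[where fx = "\<lambda>\<kappa> t. L t * K s \<kappa> t"])
        (use dk int that slice(2)[OF cKk that] in auto)
    then show ?thesis by (simp add: M b_def has_field_derivative_def)
  qed
  have "continuous_on (X \<times> UNIV) b"
    unfolding b_def using integral_continuous_on_param[of "X \<times> UNIV" 0 "1::real" "\<lambda>p t. L t * K (fst p) (snd p) t"] cKk by simp
  then have "continuous_on (X \<times> UNIV) (\<lambda>p. blinfun_mult_right (b p))"
    by (rule bounded_linear.continuous_on[OF bounded_linear_blinfun_mult_right])
  then have C: "continuous (at (s0, \<kappa>0) within X \<times> UNIV) (\<lambda>(x, y). blinfun_mult_right (b (x, y)))"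
    using XO(3) by (simp add: continuous_on_eq_continuous_within case_prod_unfold)
  have "((\<lambda>(s, \<kappa>). mellin g \<alpha> \<beta> s \<kappa>) has_derivative (\<lambda>(tx, ty). a * tx + blinfun_mult_right (b (s0, \<kappa>0)) ty)) (at (s0, \<kappa>0) within X \<times> UNIV)"
    by (rule has_derivative_partialsI[OF A B C]) auto
  moreover have "at (s0, \<kappa>0) within X \<times> UNIV = at (s0, \<kappa>0)"
    using XO by (intro at_within_open open_Times) auto
  ultimately show ?thesis by (intro exI[of _ a] exI[of _ "b (s0, \<kappa>0)"]) simp
qed

subsection \<open>Analytic continuation\<close>

text \<open>
  The Mellin transform normalized by \<open>\<Gamma>(s/2)\<close>, after \<open>m\<close> integrations by parts. Here \<open>d 0\<close> is the even
  function to be transformed and \<open>d (Suc j) = (1/t) d(d j)/dt\<close>. Since the derivative of \<open>(\<alpha> + \<beta> t\<^sup>2)\<^sup>\<kappa> d 0 t\<close> is \<open>t\<close> times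
  a function of the same type, each step raises \<open>s\<close> by 2, and the factor \<open>1/s\<close> that appears is absorbed by
  \<open>\<Gamma>(s/2 + 1) = (s/2) \<Gamma>(s/2)\<close>. So no pole ever arises, and the last integral converges for \<open>Re s > - 2 m\<close>.
\<close>

primrec mellin_reg :: "nat \<Rightarrow> (nat \<Rightarrow> real \<Rightarrow> complex) \<Rightarrow> real \<Rightarrow> real \<Rightarrow> complex \<Rightarrow> complex \<Rightarrow> complex" where
  "mellin_reg 0 d \<alpha> \<beta> s \<kappa> = rGamma (s / 2) * mellin (d 0) \<alpha> \<beta> s \<kappa>"
| "mellin_reg (Suc m) d \<alpha> \<beta> s \<kappa> = rGamma (s / 2 + 1) / 2 * (of_real (\<alpha> + \<beta>) powr \<kappa> * d 0 1)
     - mellin_reg m (\<lambda>j. d (Suc j)) \<alpha> \<beta> (s + 2) \<kappa> / 2 - of_real \<beta> * \<kappa> * mellin_reg m d \<alpha> \<beta> (s + 2) (\<kappa> - 1)"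

text \<open>
  The functions obtained from an even smooth function by the operation \<open>(1/t) d/dt\<close>.
\<close>

definition even_chain :: "(nat \<Rightarrow> real \<Rightarrow> complex) \<Rightarrow> bool" where
  "even_chain d \<longleftrightarrow> (\<forall>j t. (d j has_vector_derivative of_real t * d (Suc j) t) (at t))"

definition vanishes_near_0 :: "(real \<Rightarrow> complex) \<Rightarrow> bool" where
  "vanishes_near_0 f \<longleftrightarrow> (\<exists>\<delta>>0. \<forall>t. 0 < t \<and> t < \<delta> \<longrightarrow> f t = 0)"

lemma even_chain_shift: "even_chain d \<Longrightarrow> even_chain (\<lambda>j. d (Suc j))"
  by (simp add: even_chain_def)

lemma even_chain_continuous:
  assumes "even_chain d"
  shows "continuous_on S (d j)"
proof (rule continuous_at_imp_continuous_on, rule ballI)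
  fix t
  show "isCont (d j) t"
    by (rule has_vector_derivative_continuous[OF assms[unfolded even_chain_def, rule_format]])
qed

lemma vanishes_shift:
  assumes "even_chain d" "vanishes_near_0 (d 0)"
  shows "vanishes_near_0 (d (Suc 0))"
proof -
  obtain \<delta> where \<delta>: "\<delta> > 0" "\<And>t. 0 < t \<Longrightarrow> t < \<delta> \<Longrightarrow> d 0 t = 0"
    using assms(2) by (auto simp: vanishes_near_0_def)
  have "d (Suc 0) t = 0" if t: "0 < t" "t < \<delta>" for t
  proof -
    have "(d 0 has_vector_derivative of_real t * d (Suc 0) t) (at t)" using assms(1) by (simp add: even_chain_def)
    moreover have "(d 0 has_vector_derivative 0) (at t)"
      by (rule has_vector_derivative_transform_within_open[OF has_vector_derivative_const, of "{0<..<\<delta>}"])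
        (use t \<delta> in auto)
    ultimately have "of_real t * d (Suc 0) t = 0" by (rule vector_derivative_unique_at)
    then show ?thesis using t by simp
  qed
  then show ?thesis using \<delta>(1) by (auto simp: vanishes_near_0_def)
qed

text \<open>
  At \<open>t = 0\<close> the value is 0 because \<open>0 powr z = 0\<close>, which fits the limit in both cases. The second case covers sections that
  vanish near the end of the line; for them there is no convergence problem at all.
\<close>

lemma continuous_on_powr_mult:
  assumes g: "continuous_on {0..1} g" and z: "Re z > 0 \<or> vanishes_near_0 g"
  shows "continuous_on {0..1} (\<lambda>t. of_real t powr z * g t)"
  unfolding continuous_on_def
proof
  fix t0 :: real assume t0: "t0 \<in> {0..1}"
  have pos: "continuous_on {0<..1} (\<lambda>t. of_real t powr z * g t)"
  proof (rule continuous_on_mult)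
    show "continuous_on {0<..1} (\<lambda>t. complex_of_real t powr z)"
    proof (subst continuous_on_cong[OF refl of_real_powr_exp])
      show "continuous_on {0<..1} (\<lambda>t. exp (z * complex_of_real (ln t)))" by (intro continuous_intros) auto
    qed auto
    show "continuous_on {0<..1} g" by (rule continuous_on_subset[OF g]) auto
  qed
  show "((\<lambda>t. of_real t powr z * g t) \<longlongrightarrow> of_real t0 powr z * g t0) (at t0 within {0..1})"
  proof (cases "t0 = 0")
    case False
    have "at t0 within {0..1} = at t0 within {0<..1}"
      by (rule at_within_nhd[of _ "{0<..}"]) (use t0 False in auto)
    then show ?thesis using pos t0 False by (simp add: continuous_on_def)
  next
    case True
    have "((\<lambda>t. of_real t powr z * g t) \<longlongrightarrow> 0) (at 0 within {0..1})"
      using z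
    proof
      assume z: "Re z > 0"
      have "((\<lambda>t. of_real t powr z :: complex) \<longlongrightarrow> 0) (at 0 within {0..1})"
      proof (rule Lim_null_comparison)
        show "\<forall>\<^sub>F t in at 0 within {0..1}. norm (of_real t powr z :: complex) \<le> t powr Re z"
          unfolding eventually_at_filter by (auto simp: norm_powr_real_powr intro!: always_eventually)
        have "continuous_on {0..1} (\<lambda>t::real. t powr Re z)"
          using z by (intro continuous_on_powr' continuous_intros) auto
        then show "((\<lambda>t::real. t powr Re z) \<longlongrightarrow> 0) (at 0 within {0..1})"
          by (auto simp: continuous_on_def dest!: bspec[of _ _ 0])
      qed
      moreover have "(g \<longlongrightarrow> g 0) (at 0 within {0..1})" using g by (simp add: continuous_on_def)
      ultimately show ?thesis using tendsto_mult by fastforce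
    next
      assume "vanishes_near_0 g"
      then obtain \<delta> where \<delta>: "\<delta> > 0" "\<And>t. 0 < t \<Longrightarrow> t < \<delta> \<Longrightarrow> g t = 0"
        by (auto simp: vanishes_near_0_def)
      have "\<forall>\<^sub>F t in at 0 within {0..1}. of_real t powr z * g t = 0"
        unfolding eventually_at using \<delta> by (intro exI[of _ \<delta>]) (auto simp: dist_real_def)
      then show ?thesis by (rule tendsto_eventually)
    qed
    then show ?thesis using True by simp
  qed
qed

lemma has_vector_derivative_of_real_powr:
  assumes "(f has_real_derivative f') (at t)" "f t > 0"
  shows "((\<lambda>t. complex_of_real (f t) powr z) has_vector_derivative of_real f' * (z * of_real (f t) powr (z - 1))) (at t)"
proof -
  have "((\<lambda>z'. z' powr z) has_field_derivative z * of_real (f t) powr (z - 1)) (at (complex_of_real (f t)))"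
    using assms(2) by (intro has_field_derivative_powr) (simp add: complex_nonpos_Reals_iff)
  from field_vector_diff_chain_at[OF has_vector_derivative_of_real[OF assms(1)] this]
  show ?thesis by (simp add: o_def)
qed

text \<open>
  Integration by parts on \<open>[0, 1]\<close>: the boundary term at 0 vanishes since \<open>Re s > 0\<close> or since the function is zero there.
\<close>

lemma mellin_reg_step:
  assumes ab: "\<alpha> > 0" "\<beta> > 0" and d: "even_chain d" and s: "Re s > 0 \<or> vanishes_near_0 (d 0)"
  shows "mellin_reg (Suc 0) d \<alpha> \<beta> s \<kappa> = mellin_reg 0 d \<alpha> \<beta> s \<kappa>"
proof -
  define Q where "Q t = \<alpha> + \<beta> * t\<^sup>2" for t
  have Q: "Q t > 0" for t unfolding Q_def by (rule quadratic_pos[OF ab])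
  define G where "G t = of_real (Q t) powr \<kappa> * d 0 t" for t
  define R1 where "R1 t = of_real (Q t) powr \<kappa> * d (Suc 0) t" for t
  define R2 where "R2 t = of_real (Q t) powr (\<kappa> - 1) * d 0 t" for t
  have Qd: "(Q has_real_derivative 2 * \<beta> * t) (at t)" for t
    unfolding Q_def by (auto intro!: derivative_eq_intros)
  have Qc: "continuous_on S (\<lambda>t. complex_of_real (Q t) powr z)" for S z
  proof (rule continuous_at_imp_continuous_on, rule ballI)
    show "isCont (\<lambda>t. complex_of_real (Q t) powr z) t" for t
      by (rule has_vector_derivative_continuous[OF has_vector_derivative_of_real_powr[OF Qd Q]])
  qed
  have dc: "continuous_on S (d j)" for S j by (rule even_chain_continuous[OF d])
  have c: "continuous_on {0..1} G" "continuous_on {0..1} R1" "continuous_on {0..1} R2"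
    unfolding G_def R1_def R2_def by (intro continuous_on_mult Qc dc)+
  have v: "Re s > 0 \<or> vanishes_near_0 G" "Re (s + 1) > 0 \<or> vanishes_near_0 R1" "Re (s + 1) > 0 \<or> vanishes_near_0 R2"
  proof -
    have "vanishes_near_0 (\<lambda>t. f t * g t)" if g: "vanishes_near_0 g" for f g
    proof -
      obtain \<delta> where "\<delta> > 0" "\<forall>t. 0 < t \<and> t < \<delta> \<longrightarrow> g t = 0"
        using g unfolding vanishes_near_0_def by (elim exE conjE)
      then show ?thesis unfolding vanishes_near_0_def by (intro exI[of _ \<delta>]) simp
    qed
    from this[of "d 0"] this[of "d (Suc 0)"] s vanishes_shift[OF d]
    show "Re s > 0 \<or> vanishes_near_0 G" "Re (s + 1) > 0 \<or> vanishes_near_0 R1" "Re (s + 1) > 0 \<or> vanishes_near_0 R2"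
      unfolding G_def[abs_def] R1_def[abs_def] R2_def[abs_def] by fastforce+
  qed
  have Gd: "(G has_vector_derivative of_real t * (R1 t + 2 * of_real \<beta> * \<kappa> * R2 t)) (at t)" for t
  proof -
    have "(d 0 has_vector_derivative of_real t * d (Suc 0) t) (at t)" using d by (simp add: even_chain_def)
    from has_vector_derivative_mult[OF has_vector_derivative_of_real_powr[OF Qd Q, of \<kappa>] this]
    have "(G has_vector_derivative (of_real (Q t) powr \<kappa> * (of_real t * d (Suc 0) t) +
        of_real (2 * \<beta> * t) * (\<kappa> * of_real (Q t) powr (\<kappa> - 1)) * d 0 t)) (at t)"
      unfolding G_def[abs_def] .
    moreover have "of_real (Q t) powr \<kappa> * (of_real t * d (Suc 0) t) + of_real (2 * \<beta> * t) * (\<kappa> * of_real (Q t) powr (\<kappa> - 1)) * d 0 t =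
        of_real t * (R1 t + 2 * of_real \<beta> * \<kappa> * R2 t)"
      unfolding R1_def R2_def by (simp add: algebra_simps)
    ultimately show ?thesis by (simp only:)
  qed
  \<comment> \<open>the total derivative of \<open>t\<^sup>s (\<alpha> + \<beta> t\<^sup>2)\<^sup>\<kappa> d 0 t\<close>; its three terms are the three Mellin integrands\<close>
  have F: "((\<lambda>t. of_real t powr s * G t) has_vector_derivative
      (s * (of_real t powr (s - 1) * G t) + (of_real t powr (s + 1) * R1 t + 2 * of_real \<beta> * \<kappa> * (of_real t powr (s + 1) * R2 t)))) (at t)"
    if t: "t > 0" for t
  proof -
    have p: "of_real t powr (s + 1) = of_real t powr s * complex_of_real t" using t by (simp add: powr_add)
    from has_vector_derivative_mult[OF has_vector_derivative_of_real_powr[OF DERIV_ident t, of s] Gd[of t]]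
    have "((\<lambda>t. of_real t powr s * G t) has_vector_derivative
      of_real t powr s * (of_real t * (R1 t + 2 * of_real \<beta> * \<kappa> * R2 t)) + of_real 1 * (s * of_real t powr (s - 1)) * G t) (at t)" .
    moreover have "of_real t powr s * (of_real t * (R1 t + 2 * of_real \<beta> * \<kappa> * R2 t)) + of_real 1 * (s * of_real t powr (s - 1)) * G t =
      s * (of_real t powr (s - 1) * G t) + (of_real t powr (s + 1) * R1 t + 2 * of_real \<beta> * \<kappa> * (of_real t powr (s + 1) * R2 t))"
      unfolding p by (simp add: algebra_simps)
    ultimately show ?thesis by (simp only:)
  qed
  have "((\<lambda>t. s * (of_real t powr (s - 1) * G t) + (of_real t powr (s + 1) * R1 t + 2 * of_real \<beta> * \<kappa> * (of_real t powr (s + 1) * R2 t)))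
      has_integral (of_real 1 powr s * G 1 - of_real 0 powr s * G 0)) {0..1}"
  proof (rule fundamental_theorem_of_calculus_interior[OF _ continuous_on_powr_mult[OF c(1) v(1)]])
    fix t :: real assume "t \<in> {0<..<1}"
    then have "t > 0" by simp
    then show "((\<lambda>t. of_real t powr s * G t) has_vector_derivative
      (s * (of_real t powr (s - 1) * G t) + (of_real t powr (s + 1) * R1 t + 2 * of_real \<beta> * \<kappa> * (of_real t powr (s + 1) * R2 t)))) (at t)"
      by (rule F)
  qed simp
  then have tot: "((\<lambda>t. s * (of_real t powr (s - 1) * G t) + (of_real t powr (s + 1) * R1 t + 2 * of_real \<beta> * \<kappa> * (of_real t powr (s + 1) * R2 t)))
      has_integral G 1) {0..1}" by simp
  define I1 where "I1 = integral {0..1} (\<lambda>t. of_real t powr (s + 1) * R1 t)"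
  define I2 where "I2 = integral {0..1} (\<lambda>t. of_real t powr (s + 1) * R2 t)"
  have i1: "((\<lambda>t. of_real t powr (s + 1) * R1 t) has_integral I1) {0..1}"
    and i2: "((\<lambda>t. of_real t powr (s + 1) * R2 t) has_integral I2) {0..1}"
    unfolding I1_def I2_def using continuous_on_powr_mult[OF c(2) v(2)] continuous_on_powr_mult[OF c(3) v(3)]
    by (simp_all add: integrable_continuous_real integrable_integral)
  have "((\<lambda>t. s * (of_real t powr (s - 1) * G t)) has_integral G 1 - (I1 + 2 * of_real \<beta> * \<kappa> * I2)) {0..1}"
    using has_integral_diff[OF tot has_integral_add[OF i1 has_integral_mult_right[OF i2, of "2 * of_real \<beta> * \<kappa>"]]] by simp
  then have "integral {0..1} (\<lambda>t. s * (of_real t powr (s - 1) * G t)) = G 1 - (I1 + 2 * of_real \<beta> * \<kappa> * I2)"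
    by (rule integral_unique)
  then have e: "s * mellin (d 0) \<alpha> \<beta> s \<kappa> = G 1 - (I1 + 2 * of_real \<beta> * \<kappa> * I2)"
    by (simp add: mellin_def G_def Q_def mult.assoc)
  have m: "mellin (d (Suc 0)) \<alpha> \<beta> (s + 2) \<kappa> = I1" "mellin (d 0) \<alpha> \<beta> (s + 2) (\<kappa> - 1) = I2"
    by (simp_all add: mellin_def I1_def I2_def R1_def R2_def Q_def mult.assoc add_diff_eq[symmetric])
  have r: "rGamma (s / 2) = s / 2 * rGamma (s / 2 + 1)" using rGamma_plus1[of "s / 2"] by simp
  have "(s + 2) / 2 = s / 2 + 1" by simp
  then have "mellin_reg (Suc 0) d \<alpha> \<beta> s \<kappa> = rGamma (s / 2 + 1) / 2 * (G 1 - (I1 + 2 * of_real \<beta> * \<kappa> * I2))"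
    by (simp only: mellin_reg.simps m) (simp add: G_def Q_def algebra_simps)
  also have "\<dots> = mellin_reg 0 d \<alpha> \<beta> s \<kappa>" by (simp add: e[symmetric] r)
  finally show ?thesis .
qed

lemma mellin_reg_Suc:
  assumes ab: "\<alpha> > 0" "\<beta> > 0" and "even_chain d" and "Re s + 2 * real m > 0 \<or> vanishes_near_0 (d 0)"
  shows "mellin_reg (Suc m) d \<alpha> \<beta> s \<kappa> = mellin_reg m d \<alpha> \<beta> s \<kappa>"
  using assms(3,4)
proof (induction m arbitrary: d s \<kappa>)
  case 0
  then show ?case using mellin_reg_step[OF ab 0(1), of s \<kappa>] by simp
next
  case (Suc m)
  have c: "Re (s + 2) + 2 * real m > 0 \<or> vanishes_near_0 (d 0)"
    and c': "Re (s + 2) + 2 * real m > 0 \<or> vanishes_near_0 (d (Suc 0))"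
    using Suc.prems vanishes_shift[OF Suc.prems(1)] by auto
  have "mellin_reg (Suc m) (\<lambda>j. d (Suc j)) \<alpha> \<beta> (s + 2) \<kappa> = mellin_reg m (\<lambda>j. d (Suc j)) \<alpha> \<beta> (s + 2) \<kappa>"
    by (rule Suc.IH[OF even_chain_shift[OF Suc.prems(1)] c'])
  moreover have "mellin_reg (Suc m) d \<alpha> \<beta> (s + 2) (\<kappa> - 1) = mellin_reg m d \<alpha> \<beta> (s + 2) (\<kappa> - 1)"
    by (rule Suc.IH[OF Suc.prems(1) c])
  ultimately show ?case unfolding mellin_reg.simps(2)[of "Suc m" d] mellin_reg.simps(2)[of m d] by simp
qed

text \<open>
  Further integrations by parts do not change the value: so the formulas for different \<open>m\<close> continue one another.
\<close>

lemma mellin_reg_stable: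
  assumes "\<alpha> > 0" "\<beta> > 0" "even_chain d" "Re s + 2 * real m > 0 \<or> vanishes_near_0 (d 0)" "m \<le> k"
  shows "mellin_reg k d \<alpha> \<beta> s \<kappa> = mellin_reg m d \<alpha> \<beta> s \<kappa>"
  using assms(5)
proof (induction k)
  case (Suc k)
  show ?case
  proof (cases "m = Suc k")
    case False
    then have "m \<le> k" using Suc.prems by simp
    then have "Re s + 2 * real k > 0 \<or> vanishes_near_0 (d 0)" using assms(4) by auto
    then show ?thesis using mellin_reg_Suc[OF assms(1-3)] Suc.IH[OF \<open>m \<le> k\<close>] by simp
  qed simp
qed simp

lemma holo_at_mellin_reg:
  assumes "\<alpha> > 0" "\<beta> > 0" "even_chain d" "holo_at A p" "holo_at B p" "Re (A p) + 2 * real m > 3"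
  shows "holo_at (\<lambda>q. mellin_reg m d \<alpha> \<beta> (A q) (B q)) p"
  using assms(3-6)
proof (induction m arbitrary: d A B)
  case 0
  obtain u v where "((\<lambda>(s, \<kappa>). mellin (d 0) \<alpha> \<beta> s \<kappa>) has_derivative (\<lambda>(x, y). u * x + v * y)) (at (A p, B p))"
    using mellin_has_derivative[OF assms(1,2) even_chain_continuous[OF 0(1)], of "A p" 0 "B p"] 0 by auto
  then have "holo_at (\<lambda>q. mellin (d 0) \<alpha> \<beta> (A q) (B q)) p" by (rule holo_at_compose_2[OF 0(2,3)])
  moreover have "holo_at (\<lambda>q. rGamma (A q / 2)) p"
    using holo_at_compose[OF holo_at_mult[OF 0(2) holo_at_const[of "1/2"]] has_field_derivative_rGamma] by simp
  ultimately show ?case by (simp add: holo_at_mult)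
next
  case (Suc m)
  have A2: "holo_at (\<lambda>q. A q + 2) p" by (intro holo_at_add Suc.prems holo_at_const)
  have B1: "holo_at (\<lambda>q. B q - 1) p" by (intro holo_at_diff Suc.prems holo_at_const)
  have re: "Re (A p + 2) + 2 * real m > 3" using Suc.prems by simp
  have r: "holo_at (\<lambda>q. rGamma (A q / 2 + 1)) p"
    using holo_at_compose[OF holo_at_add[OF holo_at_mult[OF Suc.prems(2) holo_at_const[of "1/2"]] holo_at_const[of 1]] has_field_derivative_rGamma] by simp
  have e: "holo_at (\<lambda>q. exp (B q * of_real (ln (\<alpha> + \<beta>)))) p"
    by (rule holo_at_compose[OF holo_at_mult[OF Suc.prems(3) holo_at_const] DERIV_exp])
  have pos: "\<alpha> + \<beta> > 0" using assms by simp
  have h: "holo_at (\<lambda>q. (1/2) * (rGamma (A q / 2 + 1) * (exp (B q * of_real (ln (\<alpha> + \<beta>))) * d 0 1))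
     - (1/2) * mellin_reg m (\<lambda>j. d (Suc j)) \<alpha> \<beta> (A q + 2) (B q) - of_real \<beta> * B q * mellin_reg m d \<alpha> \<beta> (A q + 2) (B q - 1)) p"
    by (intro holo_at_diff holo_at_mult holo_at_const r e Suc.prems(3) Suc.IH[OF even_chain_shift[OF Suc.prems(1)] A2 Suc.prems(3) re]
        Suc.IH[OF Suc.prems(1) A2 B1 re])
  show ?case unfolding mellin_reg.simps(2) of_real_powr_exp[OF pos] using h by simp
qed

text \<open>
  The number of steps is chosen to move \<open>s\<close> into the region \<open>Re s > 3\<close>, where the integral depends holomorphically on the parameters.
\<close>

definition mellin_entire :: "(nat \<Rightarrow> real \<Rightarrow> complex) \<Rightarrow> real \<Rightarrow> real \<Rightarrow> complex \<Rightarrow> complex \<Rightarrow> complex" where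
  "mellin_entire d \<alpha> \<beta> s \<kappa> = mellin_reg (nat \<lceil>(4 - Re s) / 2\<rceil>) d \<alpha> \<beta> s \<kappa>"

lemma mellin_entire_eq:
  assumes "\<alpha> > 0" "\<beta> > 0" "even_chain d" "Re s + 2 * real m > 0 \<or> vanishes_near_0 (d 0)"
  shows "mellin_entire d \<alpha> \<beta> s \<kappa> = mellin_reg m d \<alpha> \<beta> s \<kappa>"
proof -
  define k where "k = nat \<lceil>(4 - Re s) / 2\<rceil>"
  have "real k \<ge> (4 - Re s) / 2" unfolding k_def by linarith
  then have k: "Re s + 2 * real k > 0" by simp
  show ?thesis
  proof (cases "m \<le> k")
    case True
    then show ?thesis unfolding mellin_entire_def k_def[symmetric] by (rule mellin_reg_stable[OF assms(1-4)])
  next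
    case False
    then show ?thesis unfolding mellin_entire_def k_def[symmetric]
      by (intro mellin_reg_stable[OF assms(1-3) disjI1[OF k], symmetric]) simp
  qed
qed

text \<open>
  Near a given point a single \<open>m\<close> serves all parameters, although \<^const>\<open>mellin_entire\<close> is defined with a number of steps that
  jumps with \<open>Re s\<close>.
\<close>

lemma holo_at_mellin_entire:
  assumes "\<alpha> > 0" "\<beta> > 0" "even_chain d" "holo_at A p" "holo_at B p"
  shows "holo_at (\<lambda>q. mellin_entire d \<alpha> \<beta> (A q) (B q)) p"
proof -
  define m where "m = nat \<lceil>(4 - Re (A p)) / 2\<rceil>"
  have "real m \<ge> (4 - Re (A p)) / 2" unfolding m_def by linarith
  then have m: "Re (A p) + 2 * real m > 3" by simp
  have "(A \<longlongrightarrow> A p) (nhds p)"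
    by (rule tendsto_at_iff_tendsto_nhds[THEN iffD1, OF holo_at_continuous[OF assms(4), unfolded isCont_def]])
  then have "((\<lambda>q. Re (A q) + 2 * real m) \<longlongrightarrow> Re (A p) + 2 * real m) (nhds p)"
    by (rule tendsto_add[OF tendsto_Re tendsto_const])
  moreover have "Re (A p) + 2 * real m > 0" using m by simp
  ultimately have "\<forall>\<^sub>F q in nhds p. Re (A q) + 2 * real m > 0"
    by (rule order_tendstoD(1))
  then have "\<forall>\<^sub>F q in nhds p. mellin_reg m d \<alpha> \<beta> (A q) (B q) = mellin_entire d \<alpha> \<beta> (A q) (B q)"
  proof eventually_elim
    case (elim q)
    show ?case by (rule mellin_entire_eq[OF assms(1-3) disjI1[OF elim], symmetric])
  qed
  then show ?thesis by (rule holo_at_cong[OF holo_at_mellin_reg[OF assms(1-5) m]])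
qed

text \<open>
  Uniqueness of the continuation. The region contains the origin when \<open>n \<ge> 1\<close>, so every complex line through the origin meets it in an open
  set containing 0, and the identity theorem in one variable applies on this line.
\<close>

lemma entire_3_unique:
  assumes "entire_3 \<Phi>" "entire_3 \<Psi>" "n \<ge> 1" "\<And>p. p \<in> B_region n \<Longrightarrow> \<Phi> p = \<Psi> p"
  shows "\<Phi> = \<Psi>"
proof
  fix p :: "(complex \<times> complex) \<times> complex"
  obtain x y z where p: "p = ((x, y), z)" by (metis prod.exhaust)
  \<comment> \<open>the complex line through the origin and \<open>p\<close>\<close>
  define l where "l c = ((c * x, c * y), c * z)" for c
  have l: "(l has_derivative l) (at c)" for c
    unfolding l_def
    by (rule has_derivative_Pair[OF has_derivative_Pair
          [OF has_derivative_mult_left[OF has_derivative_ident] has_derivative_mult_left[OF has_derivative_ident]]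
          has_derivative_mult_left[OF has_derivative_ident]])
  have hol: "(\<lambda>c. F (l c)) holomorphic_on UNIV" if F: "entire_3 F" for F
    unfolding holomorphic_on_def field_differentiable_def
  proof
    fix c :: complex
    obtain u v w where "(F has_derivative (\<lambda>((x, y), z). u * x + v * y + w * z)) (at (l c))"
      using F[unfolded entire_3_def, rule_format, of "l c"] by (elim exE)
    from has_derivative_compose[OF l this]
    have "((\<lambda>c. F (l c)) has_derivative (\<lambda>c. (\<lambda>((x, y), z). u * x + v * y + w * z) (l c))) (at c)" .
    moreover have "(\<lambda>c. (\<lambda>((x, y), z). u * x + v * y + w * z) (l c)) = (*) (u * x + v * y + w * z)"
      by (rule ext) (simp add: l_def algebra_simps)
    ultimately have "((\<lambda>c. F (l c)) has_field_derivative (u * x + v * y + w * z)) (at c)"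
      unfolding has_field_derivative_def by (simp only:)
    then show "\<exists>f'. ((\<lambda>c. F (l c)) has_field_derivative f') (at c within UNIV)" by (rule exI)
  qed
  define S where "S = {c. Re (c * x - c * z) > - real n / 2} \<inter> {c. Re (c * z - c * y) > - real n / 2}"
  have oS: "open S" unfolding S_def
    by (intro open_Int open_Collect_less continuous_on_const continuous_on_Re continuous_on_diff
        continuous_on_mult continuous_on_id)
  have zS: "0 \<in> S" using assms(3) by (simp add: S_def)
  have "\<Phi> (l 1) = \<Psi> (l 1)"
  proof (rule analytic_continuation_open[of S UNIV "\<lambda>c. \<Phi> (l c)" "\<lambda>c. \<Psi> (l c)" 1])
    show "(\<lambda>c. \<Phi> (l c)) holomorphic_on UNIV" by (rule hol[OF assms(1)])
    show "(\<lambda>c. \<Psi> (l c)) holomorphic_on UNIV" by (rule hol[OF assms(2)])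
    show "S \<noteq> {}" using zS by blast
    show "\<Phi> (l c) = \<Psi> (l c)" if "c \<in> S" for c
      using that by (intro assms(4)) (auto simp: S_def B_region_def l_def)
  qed (simp_all add: oS connected_UNIV)
  then show "\<Phi> p = \<Psi> p" by (simp add: l_def p)
qed

subsection \<open>Smooth dependence on further variables\<close>

text \<open>
  Freezing one coordinate, such as \<open>t = 1\<close> in a boundary term.
\<close>

lemma Ck_fix_coordinate:
  assumes "open U" "\<And>x. x \<in> U \<Longrightarrow> x(\<tau> := c) \<in> U" "\<tau> \<notin> J" "J \<subseteq> I" "Ck I U k G"
  shows "Ck J U k (\<lambda>x. G (x(\<tau> := c)))"
  using assms(5)
proof (induction k arbitrary: G)
  case 0
  have "continuous_on U (\<lambda>x. x(\<tau> := c))"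
  proof (rule continuous_on_coordinatewise_then_product)
    show "continuous_on U (\<lambda>x. (x(\<tau> := c)) j)" for j
      by (cases "j = \<tau>") (simp_all add: continuous_on_coord)
  qed
  from continuous_on_compose2[OF 0[unfolded Ck.simps] this image_subsetI[OF assms(2)]]
  show ?case unfolding Ck.simps .
next
  case (Suc k)
  have "continuous_on U (\<lambda>x. G (x(\<tau> := c)))"
  proof -
    have "continuous_on U (\<lambda>x. x(\<tau> := c))"
    proof (rule continuous_on_coordinatewise_then_product)
      show "continuous_on U (\<lambda>x. (x(\<tau> := c)) j)" for j
        by (cases "j = \<tau>") (simp_all add: continuous_on_coord)
    qed
    from continuous_on_compose2[OF Ck_continuous[OF Suc.prems] this image_subsetI[OF assms(2)]] show ?thesis .
  qed
  moreover have "has_partial i (\<lambda>x. G (x(\<tau> := c))) x (partial i G (x(\<tau> := c)))" if "i \<in> J" "x \<in> U" for i x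
  proof -
    have "i \<noteq> \<tau>" "i \<in> I" using that assms(3,4) by auto
    have "has_partial i G (x(\<tau> := c)) (partial i G (x(\<tau> := c)))"
      using Suc.prems \<open>i \<in> I\<close> assms(2)[OF that(2)] by simp
    then show ?thesis
      unfolding has_partial_def fun_upd_other[OF \<open>i \<noteq> \<tau>\<close>] fun_upd_twist[OF \<open>i \<noteq> \<tau>\<close>[symmetric]] .
  qed
  moreover have "Ck J U k (\<lambda>x. partial i G (x(\<tau> := c)))" if "i \<in> J" for i
  proof (rule Suc.IH)
    show "Ck I U k (partial i G)" using Suc.prems that assms(4) by auto
  qed
  ultimately show ?case by (rule Ck_SucI[OF assms(1)])
qed

lemma smooth_fix_coordinate:
  assumes "open U" "\<And>x. x \<in> U \<Longrightarrow> x(\<tau> := c) \<in> U" "\<tau> \<notin> J" "J \<subseteq> I" "smooth I U G"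
  shows "smooth J U (\<lambda>x. G (x(\<tau> := c)))"
  using assms Ck_fix_coordinate[of U \<tau> c J I _ G] by (simp add: smooth_def)

text \<open>
  For fixed parameters the normalized transform is smooth in the remaining variables on which \<open>d\<close>, \<open>\<alpha>\<close> and \<open>\<beta>\<close>
  depend. The exponent \<open>\<kappa> = 0\<close> is the one that occurs at the parameter of the given section, and
  for it the last term of the recursion vanishes.
\<close>

lemma smooth_mellin_reg:
  fixes D :: "nat \<Rightarrow> ('i \<Rightarrow> real) \<Rightarrow> complex"
  assumes U: "open U" "\<And>x s. x \<in> U \<Longrightarrow> x(\<tau> := s) \<in> U" and J: "\<tau> \<notin> J" "J \<subseteq> I"
    and ab: "\<And>x. x \<in> U \<Longrightarrow> \<alpha> x > 0" "\<And>x. x \<in> U \<Longrightarrow> \<beta> x > 0"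
    and "\<And>j. smooth I U (D j)" "Re s + 2 * real m > 3"
  shows "smooth J U (\<lambda>x. mellin_reg m (\<lambda>j t. D j (x(\<tau> := t))) (\<alpha> x) (\<beta> x) s 0)"
  using assms(7,8)
proof (induction m arbitrary: D s)
  case 0
  have w: "continuous_on {0..1} (\<lambda>u. of_real u powr (s - 1) :: complex)"
    using continuous_on_powr_mult[OF continuous_on_const[of _ 1], of "s - 1"] 0(2) by simp
  have "smooth I U (\<lambda>x. integral {0..1} (\<lambda>u. of_real u powr (s - 1) * D 0 (x(\<tau> := u * x \<tau>))))"
    by (rule smooth_scaled_integral[OF U(1) _ w 0(1)]) (rule U(2))
  from smooth_fix_coordinate[OF U(1) _ J this, of 1]
  have "smooth J U (\<lambda>x. integral {0..1} (\<lambda>u. of_real u powr (s - 1) * D 0 (x(\<tau> := u))))"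
    using U(2) by (simp only: fun_upd_same fun_upd_upd mult_1_right)
  then have "smooth J U (\<lambda>x. rGamma (s / 2) * integral {0..1} (\<lambda>u. of_real u powr (s - 1) * D 0 (x(\<tau> := u))))"
    by (intro smooth_mult smooth_const U(1))
  then show ?case
  proof (rule smooth_cong[OF U(1), rotated])
    fix x assume x: "x \<in> U"
    have "of_real (\<alpha> x + \<beta> x * t\<^sup>2) powr 0 = (1 :: complex)" for t
    proof -
      have "complex_of_real (\<alpha> x + \<beta> x * t\<^sup>2) \<noteq> 0"
        unfolding of_real_eq_0_iff using quadratic_pos[OF ab(1)[OF x] ab(2)[OF x], of t] by linarith
      then show ?thesis by (simp only: powr_zero_eq_one if_False)
    qed
    then show "rGamma (s / 2) * integral {0..1} (\<lambda>u. of_real u powr (s - 1) * D 0 (x(\<tau> := u))) =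
        mellin_reg 0 (\<lambda>j t. D j (x(\<tau> := t))) (\<alpha> x) (\<beta> x) s 0"
      by (simp only: mellin_reg.simps(1) mellin_def mult_1_right)
  qed
next
  case (Suc m)
  have re: "Re (s + 2) + 2 * real m > 3" using Suc.prems(2) by simp
  have 1: "smooth J U (\<lambda>x. mellin_reg m (\<lambda>j t. D (Suc j) (x(\<tau> := t))) (\<alpha> x) (\<beta> x) (s + 2) 0)"
    by (rule Suc.IH[OF _ re]) (rule Suc.prems(1))
  have 2: "smooth J U (\<lambda>x. D 0 (x(\<tau> := 1)))"
    by (rule smooth_fix_coordinate[OF U(1) _ J Suc.prems(1)]) (rule U(2))
  have "smooth J U (\<lambda>x. rGamma (s / 2 + 1) / 2 * D 0 (x(\<tau> := 1)) - (1 / 2) * mellin_reg m (\<lambda>j t. D (Suc j) (x(\<tau> := t))) (\<alpha> x) (\<beta> x) (s + 2) 0)"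
    by (intro smooth_diff smooth_mult smooth_const U(1) 1 2)
  then show ?case
  proof (rule smooth_cong[OF U(1), rotated])
    fix x assume x: "x \<in> U"
    have "of_real (\<alpha> x + \<beta> x) powr 0 = (1 :: complex)"
    proof -
      have "complex_of_real (\<alpha> x + \<beta> x) \<noteq> 0"
        unfolding of_real_eq_0_iff using ab(1)[OF x] ab(2)[OF x] by linarith
      then show ?thesis by (simp only: powr_zero_eq_one if_False)
    qed
    then show "rGamma (s / 2 + 1) / 2 * D 0 (x(\<tau> := 1)) - (1 / 2) * mellin_reg m (\<lambda>j t. D (Suc j) (x(\<tau> := t))) (\<alpha> x) (\<beta> x) (s + 2) 0 =
        mellin_reg (Suc m) (\<lambda>j t. D j (x(\<tau> := t))) (\<alpha> x) (\<beta> x) s 0"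
      by (simp only: mellin_reg.simps(2) mult_1 mult_zero_right mult_zero_left diff_zero) simp
  qed
qed

section \<open>The integral over the multiplicative group as a sum of two Mellin transforms\<close>

lemma powr_mult_absolutely_integrable:
  fixes \<phi> :: "real \<Rightarrow> complex"
  assumes z: "Re z > 0" and \<phi>: "continuous_on {0..1} \<phi>"
  shows "(\<lambda>t. of_real t powr (z - 1) * \<phi> t) absolutely_integrable_on {0<..<1}"
proof -
  have "bounded (\<phi> ` {0..1})" by (rule compact_imp_bounded[OF compact_continuous_image[OF \<phi> compact_Icc]])
  then obtain B where B: "\<And>t. t \<in> {0..1} \<Longrightarrow> norm (\<phi> t) \<le> B"
    unfolding bounded_iff by blast
  have c: "continuous_on {0<..<1} (\<lambda>t. of_real t powr (z - 1) * \<phi> t)"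
  proof (rule continuous_on_mult)
    show "continuous_on {0<..<1} (\<lambda>t. complex_of_real t powr (z - 1))"
    proof (subst continuous_on_cong[OF refl of_real_powr_exp])
      show "continuous_on {0<..<1} (\<lambda>t. exp ((z - 1) * complex_of_real (ln t)))" by (intro continuous_intros) auto
    qed auto
    show "continuous_on {0<..<1} \<phi>" by (rule continuous_on_subset[OF \<phi>]) auto
  qed
  show ?thesis
  proof (rule measurable_bounded_by_integrable_imp_absolutely_integrable)
    show "(\<lambda>t. of_real t powr (z - 1) * \<phi> t) \<in> borel_measurable (lebesgue_on {0<..<1})"
      by (rule continuous_imp_measurable_on_sets_lebesgue[OF c]) simp
    have "(\<lambda>t::real. t powr (Re z - 1)) integrable_on {0<..<1}"
      using integrable_on_powr_from_0[of "Re z - 1" 1] z by (simp add: integrable_on_open_interval_real)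
    then show "(\<lambda>t::real. B * t powr (Re z - 1)) integrable_on {0<..<1}"
      by (rule integrable_on_mult_right)
    show "norm (of_real t powr (z - 1) * \<phi> t) \<le> B * t powr (Re z - 1)" if "t \<in> {0<..<1}" for t
      using that B[of t] by (simp add: norm_mult norm_powr_real_powr mult.commute mult_left_mono)
  qed simp
qed

lemma change_of_variables_complex:
  fixes f :: "real \<Rightarrow> complex" and g :: "real \<Rightarrow> real"
  assumes S: "S \<in> sets lebesgue" and g: "\<And>x. x \<in> S \<Longrightarrow> (g has_real_derivative g' x) (at x within S)"
    and inj: "inj_on g S" and int: "(\<lambda>x. \<bar>g' x\<bar> *\<^sub>R f (g x)) absolutely_integrable_on S"
  shows "f absolutely_integrable_on g ` S" "integral (g ` S) f = integral S (\<lambda>x. \<bar>g' x\<bar> *\<^sub>R f (g x))"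
  using has_absolute_integral_change_of_variables_real[OF S g inj, of f "integral S (\<lambda>x. \<bar>g' x\<bar> *\<^sub>R f (g x))"] int
  by auto

text \<open>
  The substitutions \<open>t \<mapsto> \<sigma> t\<close> and \<open>t \<mapsto> \<sigma> / t\<close> with \<open>\<sigma> = 1, -1\<close> carry the interval \<open>(0, 1)\<close> to four intervals which
  together fill \<open>\<real>\<close> up to the points \<open>0, 1, -1\<close>.
\<close>

lemma set_lebesgue_integral_four_pieces:
  fixes F :: "real \<Rightarrow> complex"
  assumes F: "continuous_on (- {0}) F" and s: "Re s > 0" and s': "Re s' > 0"
    and \<phi>: "\<And>\<sigma>. continuous_on {0..1} (\<phi> \<sigma>)" and \<psi>: "\<And>\<sigma>. continuous_on {0..1} (\<psi> \<sigma>)"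
    and near: "\<And>\<sigma> t. \<sigma> \<in> {1, - 1} \<Longrightarrow> 0 < t \<Longrightarrow> t < 1 \<Longrightarrow> F (\<sigma> * t) = of_real t powr (s - 1) * \<phi> \<sigma> t"
    and far: "\<And>\<sigma> t. \<sigma> \<in> {1, - 1} \<Longrightarrow> 0 < t \<Longrightarrow> t < 1 \<Longrightarrow> F (\<sigma> / t) / of_real (t\<^sup>2) = of_real t powr (s' - 1) * \<psi> \<sigma> t"
  shows "(LINT t:- {0}|lborel. F t) =
    integral {0..1} (\<lambda>t. of_real t powr (s - 1) * (\<phi> 1 t + \<phi> (- 1) t)) +
    integral {0..1} (\<lambda>t. of_real t powr (s' - 1) * (\<psi> 1 t + \<psi> (- 1) t))"
proof -
  let ?S = "{0<..<1::real}"
  define P where "P \<sigma> t = of_real t powr (s - 1) * \<phi> \<sigma> t" for \<sigma> t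
  define R where "R \<sigma> t = of_real t powr (s' - 1) * \<psi> \<sigma> t" for \<sigma> t
  have PR: "P \<sigma> absolutely_integrable_on ?S" "R \<sigma> absolutely_integrable_on ?S" for \<sigma>
    unfolding P_def[abs_def] R_def[abs_def] by (intro powr_mult_absolutely_integrable s s' \<phi> \<psi>)+
  have n: "F absolutely_integrable_on (\<lambda>t. \<sigma> * t) ` ?S" "integral ((\<lambda>t. \<sigma> * t) ` ?S) F = integral ?S (P \<sigma>)"
    if \<sigma>: "\<sigma> \<in> {1, - 1}" for \<sigma>
  proof -
    have 1: "((\<lambda>t. \<sigma> * t) has_real_derivative \<sigma>) (at x within ?S)" for x by (auto intro!: derivative_eq_intros)
    have 2: "inj_on (\<lambda>t. \<sigma> * t) ?S" using \<sigma> by (auto simp: inj_on_def)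
    have e: "\<bar>\<sigma>\<bar> *\<^sub>R F (\<sigma> * t) = P \<sigma> t" if "t \<in> ?S" for t using near[OF \<sigma>, of t] that \<sigma> by (auto simp: P_def)
    have 3: "(\<lambda>t. \<bar>\<sigma>\<bar> *\<^sub>R F (\<sigma> * t)) absolutely_integrable_on ?S"
      using PR(1)[of \<sigma>] set_integrable_cong[of lebesgue lebesgue ?S ?S "\<lambda>t. \<bar>\<sigma>\<bar> *\<^sub>R F (\<sigma> * t)" "P \<sigma>", OF refl refl e] by blast
    note cv = change_of_variables_complex[of ?S "\<lambda>t. \<sigma> * t" "\<lambda>_. \<sigma>" F, OF _ 1 2 3]
    show "F absolutely_integrable_on (\<lambda>t. \<sigma> * t) ` ?S" by (rule cv(1)) simp
    have "integral ((\<lambda>t. \<sigma> * t) ` ?S) F = integral ?S (\<lambda>t. \<bar>\<sigma>\<bar> *\<^sub>R F (\<sigma> * t))" by (rule cv(2)) simp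
    also have "\<dots> = integral ?S (P \<sigma>)" by (rule Henstock_Kurzweil_Integration.integral_cong) (rule e)
    finally show "integral ((\<lambda>t. \<sigma> * t) ` ?S) F = integral ?S (P \<sigma>)" .
  qed
  have m: "F absolutely_integrable_on (\<lambda>t. \<sigma> / t) ` ?S" "integral ((\<lambda>t. \<sigma> / t) ` ?S) F = integral ?S (R \<sigma>)"
    if \<sigma>: "\<sigma> \<in> {1, - 1}" for \<sigma>
  proof -
    have 1: "((\<lambda>t. \<sigma> / t) has_real_derivative - \<sigma> / x\<^sup>2) (at x within ?S)" if "x \<in> ?S" for x
      using that by (auto intro!: derivative_eq_intros simp: power2_eq_square)
    have 2: "inj_on (\<lambda>t. \<sigma> / t) ?S" using \<sigma> by (auto simp: inj_on_def)
    have e: "\<bar>- \<sigma> / t\<^sup>2\<bar> *\<^sub>R F (\<sigma> / t) = R \<sigma> t" if "t \<in> ?S" for t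
    proof -
      have "\<bar>- \<sigma> / t\<^sup>2\<bar> = 1 / t\<^sup>2" using \<sigma> by auto
      then show ?thesis using far[OF \<sigma>, of t] that by (simp add: R_def scaleR_conv_of_real)
    qed
    have 3: "(\<lambda>t. \<bar>- \<sigma> / t\<^sup>2\<bar> *\<^sub>R F (\<sigma> / t)) absolutely_integrable_on ?S"
      using PR(2)[of \<sigma>] set_integrable_cong[of lebesgue lebesgue ?S ?S "\<lambda>t. \<bar>- \<sigma> / t\<^sup>2\<bar> *\<^sub>R F (\<sigma> / t)" "R \<sigma>", OF refl refl e] by blast
    note cv = change_of_variables_complex[of ?S "\<lambda>t. \<sigma> / t" "\<lambda>t. - \<sigma> / t\<^sup>2" F, OF _ 1 2 3]
    show "F absolutely_integrable_on (\<lambda>t. \<sigma> / t) ` ?S" by (rule cv(1)) simp_all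
    have "integral ((\<lambda>t. \<sigma> / t) ` ?S) F = integral ?S (\<lambda>t. \<bar>- \<sigma> / t\<^sup>2\<bar> *\<^sub>R F (\<sigma> / t))" by (rule cv(2)) simp_all
    also have "\<dots> = integral ?S (R \<sigma>)" by (rule Henstock_Kurzweil_Integration.integral_cong) (rule e)
    finally show "integral ((\<lambda>t. \<sigma> / t) ` ?S) F = integral ?S (R \<sigma>)" .
  qed
  have img: "(\<lambda>t. 1 * t) ` ?S = {0<..<1}" "(\<lambda>t. - 1 * t) ` ?S = {- 1<..<0}"
    "(\<lambda>t. 1 / t) ` ?S = {1<..}" "(\<lambda>t. - 1 / t) ` ?S = {..< - 1}"
  proof -
    show "(\<lambda>t. 1 * t) ` ?S = {0<..<1}" by simp
    show "(\<lambda>t. - 1 * t) ` ?S = {- 1<..<0}" by simp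
    show "(\<lambda>t. 1 / t) ` ?S = {1<..}"
    proof (intro equalityI subsetI)
      fix y :: real assume "y \<in> {1<..}"
      then show "y \<in> (\<lambda>t. 1 / t) ` ?S" by (intro image_eqI[of _ _ "1 / y"]) (auto simp: field_simps)
    qed (auto simp: field_simps)
    show "(\<lambda>t. - 1 / t) ` ?S = {..< - 1}"
    proof (intro equalityI subsetI)
      fix y :: real assume "y \<in> {..< - 1}"
      then show "y \<in> (\<lambda>t. - 1 / t) ` ?S" by (intro image_eqI[of _ _ "- 1 / y"]) (auto simp: field_simps)
    qed (auto simp: field_simps)
  qed
  note i1 = n[of 1, unfolded img(1)] and i2 = n[of "- 1", unfolded img(2)]
    and i3 = m[of 1, unfolded img(3)] and i4 = m[of "- 1", unfolded img(4)]
  let ?U = "({0<..<1} \<union> {- 1<..<0}) \<union> ({1<..} \<union> {..< - 1::real})"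
  have ai12: "F absolutely_integrable_on {0<..<1} \<union> {- 1<..<0}" by (rule absolutely_integrable_Un) (use i1(1) i2(1) in simp_all)
  have ai34: "F absolutely_integrable_on {1<..} \<union> {..< - 1}" by (rule absolutely_integrable_Un) (use i3(1) i4(1) in simp_all)
  have ai: "F absolutely_integrable_on ?U" by (rule absolutely_integrable_Un[OF ai12 ai34])
  have I: "f integrable_on S" if "f absolutely_integrable_on S" for f :: "real \<Rightarrow> complex" and S
    using that by (simp add: absolutely_integrable_on_def)
  have e12: "{0<..<1} \<inter> {- 1<..<0} = ({} :: real set)" "{1<..} \<inter> {..< - 1} = ({} :: real set)"
    "({0<..<1} \<union> {- 1<..<0}) \<inter> ({1<..} \<union> {..< - 1}) = ({} :: real set)" by auto
  have v12: "integral ({0<..<1} \<union> {- 1<..<0}) F = integral {0<..<1} F + integral {- 1<..<0} F"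
    by (rule Henstock_Kurzweil_Integration.integral_Un) (use i1(1) i2(1) e12 in \<open>simp_all add: I\<close>)
  have v34: "integral ({1<..} \<union> {..< - 1}) F = integral {1<..} F + integral {..< - 1} F"
    by (rule Henstock_Kurzweil_Integration.integral_Un) (use i3(1) i4(1) e12 in \<open>simp_all add: I\<close>)
  have v: "integral ?U F = (integral {0<..<1} F + integral {- 1<..<0} F) + (integral {1<..} F + integral {..< - 1} F)"
    unfolding v12[symmetric] v34[symmetric]
    by (rule Henstock_Kurzweil_Integration.integral_Un[OF I[OF ai12] I[OF ai34]]) (simp only: e12 negligible_empty)
  have neg: "negligible {x \<in> ?U - - {0}. F x \<noteq> 0}" "negligible {x \<in> - {0} - ?U. F x \<noteq> 0}"
  proof -
    have "negligible {1, - 1 :: real}" by (rule negligible_finite) simp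
    then show "negligible {x \<in> - {0} - ?U. F x \<noteq> 0}"
      by (rule negligible_subset) (auto simp: not_less)
    show "negligible {x \<in> ?U - - {0}. F x \<noteq> 0}" by (rule negligible_subset[OF negligible_empty]) auto
  qed
  have ai0: "F absolutely_integrable_on - {0}" by (rule absolutely_integrable_spike_set[OF ai neg])
  have v0: "integral (- {0}) F = integral ?U F" by (rule integral_spike_set[OF neg(2,1)])
  have "(\<lambda>x. indicator (- {0}) x *\<^sub>R F x) \<in> borel_measurable borel"
    by (rule borel_measurable_continuous_on_indicator[OF _ F]) simp
  then have "set_integrable lborel (- {0}) F"
    using ai0 unfolding set_integrable_def by (subst (asm) integrable_completion) simp_all
  then have "(LINT t:- {0}|lborel. F t) = integral ?U F"
    using v0 by (simp add: set_borel_integral_eq_integral(2))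
  also have "\<dots> = (integral {0..1} (P 1) + integral {0..1} (P (- 1))) + (integral {0..1} (R 1) + integral {0..1} (R (- 1)))"
    unfolding v using i1(2) i2(2) i3(2) i4(2) by (simp add: integral_open_interval_real)
  also have "integral {0..1} (P 1) + integral {0..1} (P (- 1)) = integral {0..1} (\<lambda>t. of_real t powr (s - 1) * (\<phi> 1 t + \<phi> (- 1) t))"
    using PR(1)[THEN I] unfolding integrable_on_open_interval_real
    by (subst Henstock_Kurzweil_Integration.integral_add[symmetric]) (simp_all add: P_def distrib_left)
  also have "integral {0..1} (R 1) + integral {0..1} (R (- 1)) = integral {0..1} (\<lambda>t. of_real t powr (s' - 1) * (\<psi> 1 t + \<psi> (- 1) t))"
    using PR(2)[THEN I] unfolding integrable_on_open_interval_real
    by (subst Henstock_Kurzweil_Integration.integral_add[symmetric]) (simp_all add: R_def distrib_left)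
  finally show ?thesis .
qed

section \<open>Parity\<close>

text \<open>
  Here \<open>A 1\<close> and \<open>A (- 1)\<close> are mirror images of each other in the coordinate \<open>\<tau>\<close>. Integration over both half lines
  against a character of parity \<open>\<epsilon>\<close> only sees their sum or their difference. The difference is odd, hence divisible by
  \<open>\<tau>\<close>, and the quotient is even. This division accounts for the shift \<open>[\<epsilon>]\<close> in the Gamma factors.
\<close>

definition parity_part :: "bit \<Rightarrow> 'i \<Rightarrow> (real \<Rightarrow> ('i \<Rightarrow> real) \<Rightarrow> complex) \<Rightarrow> ('i \<Rightarrow> real) \<Rightarrow> complex" where
  "parity_part \<epsilon> \<tau> A = (if \<epsilon> = 0 then (\<lambda>x. A 1 x + A (- 1) x) else odd_quot \<tau> (\<lambda>x. A 1 x - A (- 1) x))"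

definition parity_chain :: "bit \<Rightarrow> 'i \<Rightarrow> (real \<Rightarrow> ('i \<Rightarrow> real) \<Rightarrow> complex) \<Rightarrow> nat \<Rightarrow> ('i \<Rightarrow> real) \<Rightarrow> complex" where
  "parity_chain \<epsilon> \<tau> A j = (even_quot \<tau> ^^ j) (parity_part \<epsilon> \<tau> A)"

locale reflected_pair =
  fixes U :: "('i \<Rightarrow> real) set" and I :: "'i set" and \<tau> :: 'i and A :: "real \<Rightarrow> ('i \<Rightarrow> real) \<Rightarrow> complex"
  assumes open_U: "open U" and full: "x \<in> U \<Longrightarrow> x(\<tau> := s) \<in> U" and \<tau>_in: "\<tau> \<in> I"
    and smooth_A: "smooth I U (A \<sigma>)" and reflect: "x \<in> U \<Longrightarrow> A \<sigma> (x(\<tau> := - x \<tau>)) = A (- \<sigma>) x"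
begin

lemma parity_part_smooth_even:
  "smooth I U (parity_part \<epsilon> \<tau> A)" "x \<in> U \<Longrightarrow> parity_part \<epsilon> \<tau> A (x(\<tau> := - x \<tau>)) = parity_part \<epsilon> \<tau> A x"
proof -
  have d: "smooth I U (\<lambda>x. A 1 x - A (- 1) x)" by (intro smooth_diff open_U smooth_A)
  show "smooth I U (parity_part \<epsilon> \<tau> A)"
  proof (cases "\<epsilon> = 0")
    case True
    then show ?thesis unfolding parity_part_def using smooth_add[OF open_U smooth_A smooth_A] by simp
  next
    case False
    have "smooth I U (odd_quot \<tau> (\<lambda>x. A 1 x - A (- 1) x))"
      by (rule smooth_odd_quot[OF open_U full d \<tau>_in])
    then show ?thesis unfolding parity_part_def using False by simp
  qed
  show "parity_part \<epsilon> \<tau> A (x(\<tau> := - x \<tau>)) = parity_part \<epsilon> \<tau> A x" if x: "x \<in> U"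
  proof (cases "\<epsilon> = 0")
    case True
    then show ?thesis unfolding parity_part_def using reflect[OF x, of 1] reflect[OF x, of "- 1"] by simp
  next
    case False
    have "odd_quot \<tau> (\<lambda>x. A 1 x - A (- 1) x) (x(\<tau> := - x \<tau>)) = odd_quot \<tau> (\<lambda>x. A 1 x - A (- 1) x) x"
    proof (rule odd_quot_reflect[where U = U and I = I])
      show "smooth I U (\<lambda>x. A 1 x - A (- 1) x)" by (rule d)
      show "A 1 (y(\<tau> := - y \<tau>)) - A (- 1) (y(\<tau> := - y \<tau>)) = - (A 1 y - A (- 1) y)" if "y \<in> U" for y
        unfolding reflect[OF that] by simp
    qed (rule full, assumption, rule \<tau>_in, rule x)
    then show ?thesis unfolding parity_part_def using False by simp
  qed
qed

lemma parity_chain_smooth_even: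
  "smooth I U (parity_chain \<epsilon> \<tau> A j) \<and> (\<forall>x\<in>U. parity_chain \<epsilon> \<tau> A j (x(\<tau> := - x \<tau>)) = parity_chain \<epsilon> \<tau> A j x)"
proof (induction j)
  case 0
  show ?case unfolding parity_chain_def funpow_0 using parity_part_smooth_even(1) by (intro conjI ballI parity_part_smooth_even(2))
next
  case (Suc j)
  have e: "parity_chain \<epsilon> \<tau> A (Suc j) = even_quot \<tau> (parity_chain \<epsilon> \<tau> A j)" by (simp add: parity_chain_def)
  have s: "smooth I U (parity_chain \<epsilon> \<tau> A j)" by (rule conjunct1[OF Suc])
  have r: "parity_chain \<epsilon> \<tau> A j (y(\<tau> := - y \<tau>)) = parity_chain \<epsilon> \<tau> A j y" if "y \<in> U" for y
    by (rule bspec[OF conjunct2[OF Suc] that])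
  show ?case unfolding e
  proof (intro conjI ballI)
    show "smooth I U (even_quot \<tau> (parity_chain \<epsilon> \<tau> A j))" by (rule smooth_even_quot[OF open_U full s \<tau>_in])
    show "even_quot \<tau> (parity_chain \<epsilon> \<tau> A j) (x(\<tau> := - x \<tau>)) = even_quot \<tau> (parity_chain \<epsilon> \<tau> A j) x" if "x \<in> U" for x
    proof (rule even_quot_reflect[where U = U and I = I])
      show "parity_chain \<epsilon> \<tau> A j (y(\<tau> := - y \<tau>)) = parity_chain \<epsilon> \<tau> A j y" if "y \<in> U" for y by (rule r[OF that])
    qed (rule full, assumption, rule s, rule \<tau>_in, rule that)
  qed
qed

text \<open>
  The chain required for the normalized Mellin transform consists of smooth functions of all variables, which is what makes
  the result smooth in \<open>h\<close>.
\<close>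

lemma even_chain_parity_chain:
  assumes x: "x \<in> U"
  shows "even_chain (\<lambda>j t. parity_chain \<epsilon> \<tau> A j (x(\<tau> := t)))"
  unfolding even_chain_def
proof (intro allI)
  fix j t
  have e: "parity_chain \<epsilon> \<tau> A (Suc j) = even_quot \<tau> (parity_chain \<epsilon> \<tau> A j)" by (simp add: parity_chain_def)
  have s: "smooth I U (parity_chain \<epsilon> \<tau> A j)" by (rule conjunct1[OF parity_chain_smooth_even])
  have r: "parity_chain \<epsilon> \<tau> A j (y(\<tau> := - y \<tau>)) = parity_chain \<epsilon> \<tau> A j y" if "y \<in> U" for y
    by (rule bspec[OF conjunct2[OF parity_chain_smooth_even] that])
  have "has_partial \<tau> (parity_chain \<epsilon> \<tau> A j) (x(\<tau> := t)) (partial \<tau> (parity_chain \<epsilon> \<tau> A j) (x(\<tau> := t)))"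
    by (rule smooth_has_partial[OF s \<tau>_in full[OF x]])
  moreover have "partial \<tau> (parity_chain \<epsilon> \<tau> A j) (x(\<tau> := t)) = of_real ((x(\<tau> := t)) \<tau>) * even_quot \<tau> (parity_chain \<epsilon> \<tau> A j) (x(\<tau> := t))"
  proof (rule partial_even[where U = U and I = I])
    show "parity_chain \<epsilon> \<tau> A j (y(\<tau> := - y \<tau>)) = parity_chain \<epsilon> \<tau> A j y" if "y \<in> U" for y by (rule r[OF that])
  qed (rule full, assumption, rule s, rule \<tau>_in, rule full[OF x])
  ultimately have "has_partial \<tau> (parity_chain \<epsilon> \<tau> A j) (x(\<tau> := t)) (of_real t * even_quot \<tau> (parity_chain \<epsilon> \<tau> A j) (x(\<tau> := t)))"
    by (simp only: fun_upd_same)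
  then show "((\<lambda>t. parity_chain \<epsilon> \<tau> A j (x(\<tau> := t))) has_vector_derivative of_real t * parity_chain \<epsilon> \<tau> A (Suc j) (x(\<tau> := t))) (at t)"
    unfolding e by (rule has_partial_line)
qed

lemma parity_chain_0:
  assumes x: "x \<in> U"
  shows "of_real t ^ bit_rep \<epsilon> * parity_chain \<epsilon> \<tau> A 0 (x(\<tau> := t)) = A 1 (x(\<tau> := t)) + (- 1) ^ bit_rep \<epsilon> * A (- 1) (x(\<tau> := t))"
proof (cases "\<epsilon> = 0")
  case True
  then show ?thesis by (simp add: parity_chain_def parity_part_def bit_rep_def)
next
  case False
  let ?C = "\<lambda>x. A 1 x - A (- 1) x"
  have d: "smooth I U ?C" by (intro smooth_diff open_U smooth_A)
  have "of_real ((x(\<tau> := t)) \<tau>) * odd_quot \<tau> ?C (x(\<tau> := t)) = ?C (x(\<tau> := t)) - ?C ((x(\<tau> := t))(\<tau> := 0))"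
    by (rule odd_quot_mult[where U = U and I = I, OF _ d \<tau>_in full[OF x]]) (rule full)
  moreover have "A 1 (x(\<tau> := 0)) = A (- 1) (x(\<tau> := 0))"
    using reflect[OF full[OF x, of 0], of "- 1"] by simp
  ultimately show ?thesis using False by (simp add: parity_chain_def parity_part_def bit_rep_def)
qed

end

section \<open>The intertwining operator\<close>

text \<open>
  The function \<open>(h, t) \<mapsto> f (h u\<^sub>t)\<close> is treated as a function of the entries of \<open>h\<close> and of one more real coordinate. The
  index pair \<open>(2 * n - 1, 2 * n - 1)\<close> is free in \<open>H\<close> and holds \<open>t\<close>.
\<close>

definition H_mat :: "nat \<Rightarrow> (nat \<times> nat \<Rightarrow> real) \<Rightarrow> real mat" where
  "H_mat n x = mat (2 * n - 1) (2 * n - 1) x"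

definition slot :: "nat \<Rightarrow> nat \<times> nat" where
  "slot n = (2 * n - 1, 2 * n - 1)"

definition near_fun :: "nat \<Rightarrow> (real mat \<Rightarrow> complex) \<Rightarrow> real \<Rightarrow> (nat \<times> nat \<Rightarrow> real) \<Rightarrow> complex" where
  "near_fun n f \<sigma> x = f (embed_u n (H_mat n x) (\<sigma> * x (slot n)))"

definition far_fun :: "nat \<Rightarrow> (real mat \<Rightarrow> complex) \<Rightarrow> real \<Rightarrow> (nat \<times> nat \<Rightarrow> real) \<Rightarrow> complex" where
  "far_fun n f \<sigma> x = f (embed_w n (H_mat n x) (\<sigma> * x (slot n)))"

lemma H_mat_carrier [simp]: "H_mat n x \<in> carrier_mat (2 * n - 1) (2 * n - 1)"
  by (simp add: H_mat_def)

lemma H_mat_slot [simp]: "H_mat n (x(slot n := t)) = H_mat n x"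
  by (rule eq_matI) (auto simp: H_mat_def slot_def)

lemma H_mat_GL: "x \<in> GL_coords (2 * n - 1) \<longleftrightarrow> H_mat n x \<in> GL (2 * n - 1)"
  by (simp add: GL_coords_def H_mat_def)

lemma GL_coords_slot: "x \<in> GL_coords (2 * n - 1) \<Longrightarrow> x(slot n := t) \<in> GL_coords (2 * n - 1)"
  by (simp add: H_mat_GL)

lemma reflected_pairs:
  assumes f: "smooth_on_GL (2 * n) f" and n: "n \<ge> 1"
  shows "reflected_pair (GL_coords (2 * n - 1)) (insert (slot n) (entries (2 * n - 1))) (slot n) (near_fun n f)"
    and "reflected_pair (GL_coords (2 * n - 1)) (insert (slot n) (entries (2 * n - 1))) (slot n) (far_fun n f)"
proof -
  let ?V = "GL_coords (2 * n - 1)" and ?I = "insert (slot n) (entries (2 * n - 1))"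
  note oV = open_GL_coords[of "2 * n - 1"]
  have c: "smooth ?I ?V (\<lambda>x. x p)" for p by (rule smooth_coord[OF oV])
  have k: "smooth ?I ?V (\<lambda>x. r)" for r :: real by (rule smooth_const[OF oV])
  have H: "smooth ?I ?V (\<lambda>x. H_mat n x $$ (i, j))" if "i < 2 * n - 1" "j < 2 * n - 1" for i j
    using c[of "(i, j)"] that by (simp add: H_mat_def)
  have "smooth ?I ?V (\<lambda>x. f (embed_u n (H_mat n x) (\<sigma> * x (slot n))))" for \<sigma>
  proof (rule smooth_compose_GL[OF f oV])
    fix i j assume ij: "i < 2 * n" "j < 2 * n"
    show "smooth ?I ?V (\<lambda>x. embed_u n (H_mat n x) (\<sigma> * x (slot n)) $$ (i, j))"
      unfolding embed_u_index[OF H_mat_carrier n ij]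
      using ij by (cases "i = 2 * n - 1"; cases "j = 2 * n - 1"; cases "j = n - 1") (simp_all add: k H smooth_mult[OF oV k c])
  next
    show "embed_u n (H_mat n x) (\<sigma> * x (slot n)) \<in> GL (2 * n)" if "x \<in> ?V" for x
      using that by (intro embed_u_GL(1) n) (simp add: H_mat_GL)
  qed
  then show "reflected_pair ?V ?I (slot n) (near_fun n f)"
    by unfold_locales (simp_all add: oV GL_coords_slot near_fun_def[abs_def])
  have "smooth ?I ?V (\<lambda>x. f (embed_w n (H_mat n x) (\<sigma> * x (slot n))))" for \<sigma>
  proof (rule smooth_compose_GL[OF f oV])
    fix i j assume ij: "i < 2 * n" "j < 2 * n"
    have "smooth ?I ?V (\<lambda>x. \<sigma> * x (slot n) * H_mat n x $$ (i, n - 1))" "smooth ?I ?V (\<lambda>x. - H_mat n x $$ (i, n - 1))" if "i < 2 * n - 1"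
      using that n by (intro smooth_mult smooth_minus oV k c H; simp)+
    then show "smooth ?I ?V (\<lambda>x. embed_w n (H_mat n x) (\<sigma> * x (slot n)) $$ (i, j))"
      using ij by (cases "i = 2 * n - 1"; cases "j = 2 * n - 1"; cases "j = n - 1") (simp_all add: embed_w_def k H)
  next
    show "embed_w n (H_mat n x) (\<sigma> * x (slot n)) \<in> GL (2 * n)" if "x \<in> ?V" for x
      using that by (intro embed_w_GL(1) n) (simp add: H_mat_GL)
  qed
  then show "reflected_pair ?V ?I (slot n) (far_fun n f)"
    by unfold_locales (simp_all add: oV GL_coords_slot far_fun_def[abs_def])
qed

lemma abs_char_sign:
  assumes "\<sigma> \<in> {1, - 1}" "t > 0"
  shows "abs_char \<epsilon> s (\<sigma> * t) = of_real (\<sigma> ^ bit_rep \<epsilon>) * of_real t powr s"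
  using assms by (auto simp: abs_char_def)

lemma abs_char_0_pos: "r > 0 \<Longrightarrow> abs_char 0 \<mu> r = of_real r powr \<mu>"
  by (simp add: abs_char_def bit_rep_def)

lemma abs_char_inverse: "x \<noteq> 0 \<Longrightarrow> abs_char \<epsilon> \<mu> (1 / x) = abs_char \<epsilon> (- \<mu>) x"
proof -
  assume x: "x \<noteq> 0"
  have "abs_char \<epsilon> (- \<mu>) x * abs_char \<epsilon> \<mu> x = abs_char (\<epsilon> + \<epsilon>) (- \<mu> + \<mu>) x"
    by (rule abs_char_add[OF x, symmetric])
  also have "\<dots> = 1" using x by (cases \<epsilon>) simp_all
  finally have 1: "abs_char \<epsilon> (- \<mu>) x * abs_char \<epsilon> \<mu> x = 1" .
  have "abs_char \<epsilon> \<mu> (1 / x) * abs_char \<epsilon> \<mu> x = 1"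
    using abs_char_mult[of "1 / x" x \<epsilon> \<mu>] x by simp
  then show ?thesis using 1 abs_char_nz[OF x, of \<epsilon> \<mu>] by (metis mult_cancel_right)
qed

text \<open>
  On the line, the flat section differs from \<open>f\<close> by a power of the quadratic polynomial from \<open>gram_embed_u\<close>, with the
  roles of its coefficients exchanged in the coordinate at infinity.
\<close>

lemma flat_formula_embed:
  assumes h: "h \<in> GL (2 * n - 1)" and n: "n \<ge> 1"
  defines "\<alpha> \<equiv> gram (2 * n - 1) n h" and "\<beta> \<equiv> gram (2 * n - 1) (n - 1) h"
  shows "\<alpha> > 0" "\<beta> > 0"
    and "flat_formula n (l1, l2) f (l1', l2') (embed_u n h t) = f (embed_u n h t) *
      of_real (\<alpha> + \<beta> * t\<^sup>2) powr ((l1 - l1' - l2 + l2') / 2) * abs_char 0 (l2 - l2') (det h)"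
    and "t \<noteq> 0 \<Longrightarrow> flat_formula n (l1, l2) f (l1', l2') (embed_w n h t) = f (embed_w n h t) *
      of_real (\<beta> + \<alpha> * t\<^sup>2) powr ((l1 - l1' - l2 + l2') / 2) * abs_char 0 (l2 - l2') (det h)"
proof -
  show p: "\<alpha> > 0" "\<beta> > 0" unfolding \<alpha>_def \<beta>_def using gram_pos[OF h] n by simp_all
  show "flat_formula n (l1, l2) f (l1', l2') (embed_u n h t) = f (embed_u n h t) *
      of_real (\<alpha> + \<beta> * t\<^sup>2) powr ((l1 - l1' - l2 + l2') / 2) * abs_char 0 (l2 - l2') (det h)"
    unfolding flat_formula_def using embed_u_GL[OF h n, of t]
    by (simp add: gram_embed_u[OF h n] \<alpha>_def[symmetric] \<beta>_def[symmetric] abs_char_0_pos[OF quadratic_pos[OF p]])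
  have d: "abs_char 0 \<mu> x = abs_char 0 \<mu> y" if "\<bar>x\<bar> = \<bar>y\<bar>" for \<mu> x y using that by (simp add: abs_char_def bit_rep_def)
  show "flat_formula n (l1, l2) f (l1', l2') (embed_w n h t) = f (embed_w n h t) *
      of_real (\<beta> + \<alpha> * t\<^sup>2) powr ((l1 - l1' - l2 + l2') / 2) * abs_char 0 (l2 - l2') (det h)" if "t \<noteq> 0"
    unfolding flat_formula_def using embed_w_GL(1)[OF h n, of t]
    by (simp add: gram_embed_w(1)[OF h n that] \<alpha>_def[symmetric] \<beta>_def[symmetric] abs_char_0_pos[OF quadratic_pos[OF p(2,1)]]
        d[OF embed_w_GL(2)[OF h n]])
qed

text \<open>
  Both sides are the integrand at the same point of the projective line, in its two coordinates \<open>y\<close> and \<open>1/y\<close>. The factor in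
  the parabolic subgroup that relates the two representatives contributes exactly the difference of the exponents, and this is why the
  outer part of the integral has the parameters of the second Gamma factor.
\<close>

lemma near_far_transition:
  assumes F: "F \<in> pi_space n (\<xi>1, \<xi>2) (l1, l2)" and h: "h \<in> GL (2 * n - 1)" and n: "n \<ge> 1" and y: "y \<noteq> 0"
  shows "abs_char (\<xi>1 + \<eta>) (l1 - \<nu> + of_nat n / 2) y * F (embed_u n h y) =
    abs_char (\<xi>2 + \<eta>) (\<nu> - l2 + of_nat n / 2) (1 / y) * F (embed_w n h (1 / y))"
proof -
  obtain p where p: "block_upper (2 * n) n p" "embed_u n h y = embed_w n h (1 / y) * p" "det (ul n p) = y" "det p = 1"
    using embed_u_eq_w[OF h n y] .
  have "F (embed_u n h y) = pi_char n (\<xi>1, \<xi>2) (l1, l2) p * F (embed_w n h (1 / y))"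
    using F embed_w_GL(1)[OF h n] p(1,2) by (simp add: pi_space_iff)
  also have "pi_char n (\<xi>1, \<xi>2) (l1, l2) p = abs_char \<xi>1 (- l1 - of_nat n / 2) y * abs_char \<xi>2 (l2 - of_nat n / 2) y"
    by (simp add: pi_char_def p(3,4) abs_char_inverse[OF y])
  finally have "abs_char (\<xi>1 + \<eta>) (l1 - \<nu> + of_nat n / 2) y * F (embed_u n h y) =
     (abs_char (\<xi>1 + \<eta>) (l1 - \<nu> + of_nat n / 2) y * (abs_char \<xi>1 (- l1 - of_nat n / 2) y * abs_char \<xi>2 (l2 - of_nat n / 2) y)) *
     F (embed_w n h (1 / y))" by simp
  also have "abs_char (\<xi>1 + \<eta>) (l1 - \<nu> + of_nat n / 2) y * (abs_char \<xi>1 (- l1 - of_nat n / 2) y * abs_char \<xi>2 (l2 - of_nat n / 2) y) =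
     abs_char ((\<xi>1 + \<eta>) + (\<xi>1 + \<xi>2)) ((l1 - \<nu> + of_nat n / 2) + ((- l1 - of_nat n / 2) + (l2 - of_nat n / 2))) y"
    by (simp only: abs_char_add[OF y])
  also have "(\<xi>1 + \<eta>) + (\<xi>1 + \<xi>2) = \<xi>2 + \<eta>" by (cases \<xi>1; cases \<xi>2; cases \<eta>) simp_all
  also have "(l1 - \<nu> + of_nat n / 2) + ((- l1 - of_nat n / 2) + (l2 - of_nat n / 2)) = - (\<nu> - l2 + of_nat n / 2)"
    by (simp add: field_simps)
  also have "abs_char (\<xi>2 + \<eta>) (- (\<nu> - l2 + of_nat n / 2)) y = abs_char (\<xi>2 + \<eta>) (\<nu> - l2 + of_nat n / 2) (1 / y)"
    by (rule abs_char_inverse[OF y, symmetric])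
  finally show ?thesis .
qed

lemma (in reflected_pair) continuous_line_A:
  assumes x: "x \<in> U"
  shows "continuous_on S (\<lambda>t. A \<sigma> (x(\<tau> := t)))"
proof (rule continuous_at_imp_continuous_on, rule ballI)
  fix t
  have "has_partial \<tau> (A \<sigma>) (x(\<tau> := t)) (partial \<tau> (A \<sigma>) (x(\<tau> := t)))"
    by (rule smooth_has_partial[OF smooth_A \<tau>_in full[OF x]])
  from has_vector_derivative_continuous[OF has_partial_line[OF this]]
  show "isCont (\<lambda>t. A \<sigma> (x(\<tau> := t))) t" .
qed

lemma continuous_on_abs_char: "continuous_on (- {0}) (abs_char \<epsilon> \<mu>)"
proof (rule continuous_at_imp_continuous_on, rule ballI)
  fix t :: real assume "t \<in> - {0}"
  then have "t \<noteq> 0" by simp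
  from has_vector_derivative_continuous[OF has_vector_derivative_abs_char[OF this]]
  show "isCont (abs_char \<epsilon> \<mu>) t" .
qed

lemma continuous_on_quadratic_powr:
  assumes "\<alpha> > 0" "\<beta> > 0"
  shows "continuous_on S (\<lambda>t. complex_of_real (\<alpha> + \<beta> * t\<^sup>2) powr \<kappa>)"
proof -
  have "\<alpha> + \<beta> * t\<^sup>2 > 0" for t :: real by (rule quadratic_pos[OF assms])
  moreover have "continuous_on S (\<lambda>t. exp (\<kappa> * complex_of_real (ln (\<alpha> + \<beta> * t\<^sup>2))))"
    using calculation by (intro continuous_intros) (auto simp: less_imp_neq[symmetric])
  ultimately show ?thesis by (simp only: of_real_powr_exp)
qed

text \<open>
  The contributions of \<open>t\<close> and \<open>- t\<close> combine to \<open>t\<^bsup>[\<epsilon>]\<^esup>\<close> times an even function, so that \<open>s\<close> is shifted by \<open>[\<epsilon>]\<close>.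
\<close>

lemma mellin_parity:
  fixes A1 A2 d0 :: "real \<Rightarrow> complex"
  assumes "\<And>t. of_real t ^ bit_rep \<epsilon> * d0 t = A1 t + (- 1) ^ bit_rep \<epsilon> * A2 t"
  shows "integral {0..1} (\<lambda>t. of_real t powr (s - 1) *
      (of_real (1 ^ bit_rep \<epsilon>) * (A1 t * of_real (\<alpha> + \<beta> * t\<^sup>2) powr \<kappa> * c) +
       of_real ((- 1) ^ bit_rep \<epsilon>) * (A2 t * of_real (\<alpha> + \<beta> * t\<^sup>2) powr \<kappa> * c))) =
    c * mellin d0 \<alpha> \<beta> (s + of_nat (bit_rep \<epsilon>)) \<kappa>"
proof -
  have "of_real t powr (s - 1) *
      (of_real (1 ^ bit_rep \<epsilon>) * (A1 t * of_real (\<alpha> + \<beta> * t\<^sup>2) powr \<kappa> * c) +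
       of_real ((- 1) ^ bit_rep \<epsilon>) * (A2 t * of_real (\<alpha> + \<beta> * t\<^sup>2) powr \<kappa> * c)) =
     c * (of_real t powr (s + of_nat (bit_rep \<epsilon>) - 1) * of_real (\<alpha> + \<beta> * t\<^sup>2) powr \<kappa> * d0 t)"
    if t: "t \<in> {0..1}" for t
  proof (cases "t = 0")
    case False
    then have t0: "t > 0" using t by simp
    have p: "complex_of_real t powr (s + of_nat (bit_rep \<epsilon>) - 1) = of_real t powr (s - 1) * of_real t ^ bit_rep \<epsilon>"
    proof -
      have "s + of_nat (bit_rep \<epsilon>) - 1 = (s - 1) + of_nat (bit_rep \<epsilon>)" by simp
      then show ?thesis using t0 by (simp only: powr_add) (simp add: powr_nat')
    qed
    have "of_real (1 ^ bit_rep \<epsilon>) * (A1 t * of_real (\<alpha> + \<beta> * t\<^sup>2) powr \<kappa> * c) +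
       of_real ((- 1) ^ bit_rep \<epsilon>) * (A2 t * of_real (\<alpha> + \<beta> * t\<^sup>2) powr \<kappa> * c) =
       c * of_real (\<alpha> + \<beta> * t\<^sup>2) powr \<kappa> * (A1 t + (- 1) ^ bit_rep \<epsilon> * A2 t)"
      unfolding power_one of_real_1 of_real_power of_real_minus
      by (simp only: mult_1 distrib_left distrib_right mult.assoc mult.left_commute mult.commute)
    also have "\<dots> = c * of_real (\<alpha> + \<beta> * t\<^sup>2) powr \<kappa> * (of_real t ^ bit_rep \<epsilon> * d0 t)"
      by (simp only: assms)
    finally show ?thesis unfolding p by (simp only: mult.assoc mult.left_commute mult.commute)
  qed simp
  then have "integral {0..1} (\<lambda>t. of_real t powr (s - 1) *
      (of_real (1 ^ bit_rep \<epsilon>) * (A1 t * of_real (\<alpha> + \<beta> * t\<^sup>2) powr \<kappa> * c) +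
       of_real ((- 1) ^ bit_rep \<epsilon>) * (A2 t * of_real (\<alpha> + \<beta> * t\<^sup>2) powr \<kappa> * c))) =
    integral {0..1} (\<lambda>t. c * (of_real t powr (s + of_nat (bit_rep \<epsilon>) - 1) * of_real (\<alpha> + \<beta> * t\<^sup>2) powr \<kappa> * d0 t))"
    by (rule Henstock_Kurzweil_Integration.integral_cong)
  then show ?thesis by (simp only: mellin_def integral_mult_right)
qed

text \<open>
  The coefficients of the quadratic polynomial \<open>gram (2 * n) n (h u\<^sub>t) = \<alpha> + \<beta> t\<^sup>2\<close>, as functions of the entries of \<open>h\<close>.
\<close>

definition alpha :: "nat \<Rightarrow> (nat \<times> nat \<Rightarrow> real) \<Rightarrow> real" where
  "alpha n x = gram (2 * n - 1) n (H_mat n x)"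

definition beta :: "nat \<Rightarrow> (nat \<times> nat \<Rightarrow> real) \<Rightarrow> real" where
  "beta n x = gram (2 * n - 1) (n - 1) (H_mat n x)"

definition near_seq :: "nat \<Rightarrow> bit \<Rightarrow> (real mat \<Rightarrow> complex) \<Rightarrow> (nat \<times> nat \<Rightarrow> real) \<Rightarrow> nat \<Rightarrow> real \<Rightarrow> complex" where
  "near_seq n \<epsilon> f x j t = parity_chain \<epsilon> (slot n) (near_fun n f) j (x(slot n := t))"

definition far_seq :: "nat \<Rightarrow> bit \<Rightarrow> (real mat \<Rightarrow> complex) \<Rightarrow> (nat \<times> nat \<Rightarrow> real) \<Rightarrow> nat \<Rightarrow> real \<Rightarrow> complex" where
  "far_seq n \<epsilon> f x j t = parity_chain \<epsilon> (slot n) (far_fun n f) j (x(slot n := t))"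

lemma alpha_beta_pos:
  assumes "x \<in> GL_coords (2 * n - 1)" "n \<ge> 1"
  shows "alpha n x > 0" "beta n x > 0"
  using gram_pos[of "H_mat n x" "2 * n - 1"] assms by (simp_all add: alpha_def beta_def H_mat_GL)

text \<open>
  The integral in its region of convergence, split at \<open>|t| = 1\<close>.
\<close>

lemma B_integral_eq_mellin:
  fixes \<xi>1 \<xi>2 \<eta> :: bit
  assumes f: "f \<in> pi_space n (\<xi>1, \<xi>2) (l1, l2)" and n: "n \<ge> 1" and x: "x \<in> GL_coords (2 * n - 1)"
    and reg: "((l1', l2'), \<nu>') \<in> B_region n"
  defines "s \<equiv> l1' - \<nu>' + of_nat n / 2" and "s' \<equiv> \<nu>' - l2' + of_nat n / 2" and "\<kappa> \<equiv> (l1 - l1' - l2 + l2') / 2"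
    and "\<epsilon>1 \<equiv> \<xi>1 + \<eta>" and "\<epsilon>2 \<equiv> \<xi>2 + \<eta>"
  shows "B_integral n (\<xi>1, \<xi>2) \<eta> (l1', l2') \<nu>' (flat_formula n (l1, l2) f (l1', l2')) (H_mat n x) =
    rGamma ((s + of_nat (bit_rep \<epsilon>1)) / 2) * rGamma ((s' + of_nat (bit_rep \<epsilon>2)) / 2) *
    (abs_char 0 (l2 - l2') (det (H_mat n x)) *
      (mellin (near_seq n \<epsilon>1 f x 0) (alpha n x) (beta n x) (s + of_nat (bit_rep \<epsilon>1)) \<kappa> +
       mellin (far_seq n \<epsilon>2 f x 0) (beta n x) (alpha n x) (s' + of_nat (bit_rep \<epsilon>2)) \<kappa>))"
proof -
  let ?h = "H_mat n x" let ?V = "GL_coords (2 * n - 1)" let ?I = "insert (slot n) (entries (2 * n - 1))"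
  define \<alpha> \<beta> where "\<alpha> = alpha n x" and "\<beta> = beta n x"
  define c where "c = abs_char 0 (l2 - l2') (det ?h)"
  define fl where "fl = flat_formula n (l1, l2) f (l1', l2')"
  have ab: "\<alpha> > 0" "\<beta> > 0" using alpha_beta_pos[OF x n] by (simp_all add: \<alpha>_def \<beta>_def)
  have h: "?h \<in> GL (2 * n - 1)" using x by (simp add: H_mat_GL)
  have fs: "smooth_on_GL (2 * n) f" using f by (simp add: pi_space_iff)
  interpret N: reflected_pair ?V ?I "slot n" "near_fun n f" by (rule reflected_pairs(1)[OF fs n])
  interpret W: reflected_pair ?V ?I "slot n" "far_fun n f" by (rule reflected_pairs(2)[OF fs n])
  have re: "Re s > 0" "Re s' > 0" using reg by (simp_all add: B_region_def s_def s'_def)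
  have Nf: "near_fun n f \<sigma> (x(slot n := t)) = f (embed_u n ?h (\<sigma> * t))" for \<sigma> t by (simp add: near_fun_def)
  have Wf: "far_fun n f \<sigma> (x(slot n := t)) = f (embed_w n ?h (\<sigma> * t))" for \<sigma> t by (simp add: far_fun_def)
  have flu: "fl (embed_u n ?h t) = f (embed_u n ?h t) * of_real (\<alpha> + \<beta> * t\<^sup>2) powr \<kappa> * c" for t
    unfolding fl_def \<alpha>_def \<beta>_def alpha_def beta_def \<kappa>_def c_def by (rule flat_formula_embed(3)[OF h n])
  have flw: "fl (embed_w n ?h t) = f (embed_w n ?h t) * of_real (\<beta> + \<alpha> * t\<^sup>2) powr \<kappa> * c" if "t \<noteq> 0" for t
    unfolding fl_def \<alpha>_def \<beta>_def alpha_def beta_def \<kappa>_def c_def by (rule flat_formula_embed(4)[OF h n that])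
  have flpi: "fl \<in> pi_space n (\<xi>1, \<xi>2) (l1', l2')" unfolding fl_def by (rule flat_formula_in_pi_space[OF f])
  define F where "F t = abs_char \<epsilon>1 s t * fl (embed_u n ?h t) / of_real \<bar>t\<bar>" for t
  define \<phi> where "\<phi> \<sigma> t = of_real (\<sigma> ^ bit_rep \<epsilon>1) * (near_fun n f \<sigma> (x(slot n := t)) * of_real (\<alpha> + \<beta> * t\<^sup>2) powr \<kappa> * c)" for \<sigma> t
  define \<psi> where "\<psi> \<sigma> t = of_real (\<sigma> ^ bit_rep \<epsilon>2) * (far_fun n f \<sigma> (x(slot n := t)) * of_real (\<beta> + \<alpha> * t\<^sup>2) powr \<kappa> * c)" for \<sigma> t
  have flc: "continuous_on S (\<lambda>t. fl (embed_u n ?h t))" for S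
  proof -
    have "continuous_on S (\<lambda>t. near_fun n f 1 (x(slot n := t)) * of_real (\<alpha> + \<beta> * t\<^sup>2) powr \<kappa> * c)"
      by (intro continuous_on_mult continuous_on_const N.continuous_line_A[OF x] continuous_on_quadratic_powr[OF ab])
    then show ?thesis by (simp only: Nf flu mult_1)
  qed
  have "(LINT t:- {0}|lborel. F t) =
    integral {0..1} (\<lambda>t. of_real t powr (s - 1) * (\<phi> 1 t + \<phi> (- 1) t)) +
    integral {0..1} (\<lambda>t. of_real t powr (s' - 1) * (\<psi> 1 t + \<psi> (- 1) t))"
  proof (rule set_lebesgue_integral_four_pieces[OF _ re])
    show "continuous_on (- {0}) F"
      unfolding F_def[abs_def]
      by (intro continuous_on_divide continuous_on_mult flc continuous_on_abs_char continuous_on_of_real continuous_intros) auto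
    show "continuous_on {0..1} (\<phi> \<sigma>)" for \<sigma>
      unfolding \<phi>_def[abs_def]
      by (intro continuous_on_mult continuous_on_const N.continuous_line_A[OF x] continuous_on_quadratic_powr[OF ab])
    show "continuous_on {0..1} (\<psi> \<sigma>)" for \<sigma>
      unfolding \<psi>_def[abs_def]
      by (intro continuous_on_mult continuous_on_const W.continuous_line_A[OF x] continuous_on_quadratic_powr[OF ab(2,1)])
    fix \<sigma> t :: real assume \<sigma>: "\<sigma> \<in> {1, - 1}" and t: "0 < t" "t < 1"
    have sq: "(\<sigma> * t)\<^sup>2 = t\<^sup>2" "\<bar>\<sigma> * t\<bar> = t" "1 / (\<sigma> / t) = \<sigma> * t" "\<bar>\<sigma> / t\<bar> = 1 / t" "\<sigma> / t \<noteq> 0" "\<sigma> * t \<noteq> 0"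
      using \<sigma> t by auto
    have p: "complex_of_real t powr z / of_real t = of_real t powr (z - 1)" for z
      using t by (simp add: powr_diff)
    have "F (\<sigma> * t) = (of_real t powr s / of_real t) *
        (of_real (\<sigma> ^ bit_rep \<epsilon>1) * (f (embed_u n ?h (\<sigma> * t)) * of_real (\<alpha> + \<beta> * t\<^sup>2) powr \<kappa> * c))"
      unfolding F_def flu sq abs_char_sign[OF \<sigma> t(1)] by simp
    then show "F (\<sigma> * t) = of_real t powr (s - 1) * \<phi> \<sigma> t" by (simp only: p \<phi>_def Nf)
    have "F (\<sigma> / t) / of_real (t\<^sup>2) = abs_char \<epsilon>2 s' (\<sigma> * t) * fl (embed_w n ?h (\<sigma> * t)) * (of_real t / of_real (t\<^sup>2))"
      unfolding F_def s_def \<epsilon>1_def near_far_transition[OF flpi h n sq(5)] sq \<epsilon>2_def s'_def by simp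
    also have "of_real t / of_real (t\<^sup>2) = 1 / complex_of_real t" using t by (simp add: power2_eq_square)
    also have "abs_char \<epsilon>2 s' (\<sigma> * t) * fl (embed_w n ?h (\<sigma> * t)) * (1 / complex_of_real t) = (of_real t powr s' / of_real t) *
        (of_real (\<sigma> ^ bit_rep \<epsilon>2) * (f (embed_w n ?h (\<sigma> * t)) * of_real (\<beta> + \<alpha> * t\<^sup>2) powr \<kappa> * c))"
      unfolding flw[OF sq(6)] sq(1) abs_char_sign[OF \<sigma> t(1)] by simp
    finally show "F (\<sigma> / t) / of_real (t\<^sup>2) = of_real t powr (s' - 1) * \<psi> \<sigma> t" by (simp only: p \<psi>_def Wf)
  qed
  also have "integral {0..1} (\<lambda>t. of_real t powr (s - 1) * (\<phi> 1 t + \<phi> (- 1) t)) = c * mellin (near_seq n \<epsilon>1 f x 0) \<alpha> \<beta> (s + of_nat (bit_rep \<epsilon>1)) \<kappa>"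
    unfolding \<phi>_def by (rule mellin_parity) (unfold near_seq_def, rule N.parity_chain_0[OF x])
  also have "integral {0..1} (\<lambda>t. of_real t powr (s' - 1) * (\<psi> 1 t + \<psi> (- 1) t)) = c * mellin (far_seq n \<epsilon>2 f x 0) \<beta> \<alpha> (s' + of_nat (bit_rep \<epsilon>2)) \<kappa>"
    unfolding \<psi>_def by (rule mellin_parity) (unfold far_seq_def, rule W.parity_chain_0[OF x])
  finally have L: "(LINT t:- {0}|lborel. F t) = c * (mellin (near_seq n \<epsilon>1 f x 0) \<alpha> \<beta> (s + of_nat (bit_rep \<epsilon>1)) \<kappa> +
      mellin (far_seq n \<epsilon>2 f x 0) \<beta> \<alpha> (s' + of_nat (bit_rep \<epsilon>2)) \<kappa>)" by (simp only: distrib_left)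
  have "B_integral n (\<xi>1, \<xi>2) \<eta> (l1', l2') \<nu>' fl ?h =
    rGamma ((s + of_nat (bit_rep \<epsilon>1)) / 2) * rGamma ((s' + of_nat (bit_rep \<epsilon>2)) / 2) * (LINT t:- {0}|lborel. F t)"
    unfolding B_integral_def case_prod_conv F_def embed_u_def s_def s'_def \<epsilon>1_def \<epsilon>2_def ..
  then show ?thesis unfolding L fl_def \<alpha>_def \<beta>_def c_def .
qed

text \<open>
  The continuation to all parameters \<open>((l1', l2'), \<nu>')\<close>, for \<open>f\<close> in the representation with parameter \<open>(l1, l2)\<close>. Each
  Mellin transform absorbs one of the two Gamma factors and is multiplied by the other.
\<close>

definition B_cont :: "nat \<Rightarrow> bit \<times> bit \<Rightarrow> bit \<Rightarrow> complex \<times> complex \<Rightarrow> (real mat \<Rightarrow> complex) \<Rightarrow> (nat \<times> nat \<Rightarrow> real) \<Rightarrow>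
    (complex \<times> complex) \<times> complex \<Rightarrow> complex" where
  "B_cont n = (\<lambda>(\<xi>1, \<xi>2) \<eta> (l1, l2) f x ((l1', l2'), \<nu>').
     abs_char 0 (l2 - l2') (det (H_mat n x)) *
     (mellin_entire (near_seq n (\<xi>1 + \<eta>) f x) (alpha n x) (beta n x)
        (l1' - \<nu>' + of_nat n / 2 + of_nat (bit_rep (\<xi>1 + \<eta>))) ((l1 - l1' - l2 + l2') / 2) *
      rGamma ((\<nu>' - l2' + of_nat n / 2 + of_nat (bit_rep (\<xi>2 + \<eta>))) / 2) +
      rGamma ((l1' - \<nu>' + of_nat n / 2 + of_nat (bit_rep (\<xi>1 + \<eta>))) / 2) *
      mellin_entire (far_seq n (\<xi>2 + \<eta>) f x) (beta n x) (alpha n x)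
        (\<nu>' - l2' + of_nat n / 2 + of_nat (bit_rep (\<xi>2 + \<eta>))) ((l1 - l1' - l2 + l2') / 2)))"

lemma even_chain_seqs:
  assumes f: "smooth_on_GL (2 * n) f" and n: "n \<ge> 1" and x: "x \<in> GL_coords (2 * n - 1)"
  shows "even_chain (near_seq n \<epsilon> f x)" "even_chain (far_seq n \<epsilon> f x)"
  unfolding near_seq_def[abs_def] far_seq_def[abs_def]
  by (rule reflected_pair.even_chain_parity_chain[OF reflected_pairs(1)[OF f n] x],
      rule reflected_pair.even_chain_parity_chain[OF reflected_pairs(2)[OF f n] x])

lemma holo_at_abs_char:
  assumes "holo_at A p" "x \<noteq> 0"
  shows "holo_at (\<lambda>q. abs_char \<epsilon> (A q) x) p"
proof -
  have "holo_at (\<lambda>q. of_real (sgn x ^ bit_rep \<epsilon>) * exp (A q * of_real (ln \<bar>x\<bar>))) p"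
    by (intro holo_at_mult holo_at_const holo_at_compose[OF holo_at_mult[OF assms(1) holo_at_const] DERIV_exp])
  moreover have "\<bar>x\<bar> > 0" using assms(2) by simp
  ultimately show ?thesis by (simp only: abs_char_def of_real_powr_exp)
qed

lemma entire_B_cont:
  assumes f: "smooth_on_GL (2 * n) f" and n: "n \<ge> 1" and x: "x \<in> GL_coords (2 * n - 1)"
  shows "entire_3 (B_cont n (\<xi>1, \<xi>2) \<eta> (l1, l2) f x)"
  unfolding entire_3_iff
proof
  fix p :: "(complex \<times> complex) \<times> complex"
  let ?L1 = "\<lambda>q::(complex \<times> complex) \<times> complex. fst (fst q)" and ?L2 = "\<lambda>q::(complex \<times> complex) \<times> complex. snd (fst q)"
    and ?N = "\<lambda>q::(complex \<times> complex) \<times> complex. snd q"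
  note ab = alpha_beta_pos[OF x n] and ec = even_chain_seqs[OF f n x]
  have d: "det (H_mat n x) \<noteq> 0" using x by (simp add: H_mat_GL GL_iff_det)
  have z: "holo_at (\<lambda>q. ?L1 q - ?N q + of_nat n / 2 + of_nat (bit_rep (\<xi>1 + \<eta>))) p"
    "holo_at (\<lambda>q. ?N q - ?L2 q + of_nat n / 2 + of_nat (bit_rep (\<xi>2 + \<eta>))) p"
    by (intro holo_at_add holo_at_diff holo_at_const holo_at_coords)+
  have k: "holo_at (\<lambda>q. (l1 - ?L1 q - l2 + ?L2 q) * (1 / 2)) p"
    by (intro holo_at_mult holo_at_add holo_at_diff holo_at_const holo_at_coords)
  then have k: "holo_at (\<lambda>q. (l1 - ?L1 q - l2 + ?L2 q) / 2) p" by simp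
  have r: "holo_at (\<lambda>q. rGamma (Z q / 2)) p" if "holo_at Z p" for Z
    using holo_at_compose[OF holo_at_mult[OF that holo_at_const[of "1 / 2"]] has_field_derivative_rGamma] by simp
  have "holo_at (\<lambda>q. abs_char 0 (l2 - ?L2 q) (det (H_mat n x)) *
     (mellin_entire (near_seq n (\<xi>1 + \<eta>) f x) (alpha n x) (beta n x)
        (?L1 q - ?N q + of_nat n / 2 + of_nat (bit_rep (\<xi>1 + \<eta>))) ((l1 - ?L1 q - l2 + ?L2 q) / 2) *
      rGamma ((?N q - ?L2 q + of_nat n / 2 + of_nat (bit_rep (\<xi>2 + \<eta>))) / 2) +
      rGamma ((?L1 q - ?N q + of_nat n / 2 + of_nat (bit_rep (\<xi>1 + \<eta>))) / 2) *
      mellin_entire (far_seq n (\<xi>2 + \<eta>) f x) (beta n x) (alpha n x)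
        (?N q - ?L2 q + of_nat n / 2 + of_nat (bit_rep (\<xi>2 + \<eta>))) ((l1 - ?L1 q - l2 + ?L2 q) / 2))) p"
    by (rule holo_at_mult[OF holo_at_abs_char[OF holo_at_diff[OF holo_at_const holo_at_coords(2)] d]
          holo_at_add[OF holo_at_mult[OF holo_at_mellin_entire[OF ab(1,2) ec(1) z(1) k] r[OF z(2)]]
            holo_at_mult[OF r[OF z(1)] holo_at_mellin_entire[OF ab(2,1) ec(2) z(2) k]]]])
  then show "holo_at (B_cont n (\<xi>1, \<xi>2) \<eta> (l1, l2) f x) p"
    by (simp only: B_cont_def case_prod_unfold fst_conv snd_conv)
qed

lemma B_cont_region:
  assumes f: "f \<in> pi_space n (\<xi>1, \<xi>2) (l1, l2)" and n: "n \<ge> 1" and x: "x \<in> GL_coords (2 * n - 1)"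
    and reg: "((l1', l2'), \<nu>') \<in> B_region n"
  shows "B_cont n (\<xi>1, \<xi>2) \<eta> (l1, l2) f x ((l1', l2'), \<nu>') =
    B_integral n (\<xi>1, \<xi>2) \<eta> (l1', l2') \<nu>' (flat_section n (\<xi>1, \<xi>2) f (l1', l2')) (H_mat n x)"
proof -
  have fs: "smooth_on_GL (2 * n) f" using f by (simp add: pi_space_iff)
  note ab = alpha_beta_pos[OF x n] and ec = even_chain_seqs[OF fs n x]
  have re: "Re (l1' - \<nu>' + of_nat n / 2 + of_nat k) + 2 * real 0 > 0" "Re (\<nu>' - l2' + of_nat n / 2 + of_nat k) + 2 * real 0 > 0" for k
    using reg by (auto simp: B_region_def)
  show ?thesis
    unfolding flat_section_eq[OF f] B_integral_eq_mellin[OF f n x reg] B_cont_def case_prod_conv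
      mellin_entire_eq[OF ab(1,2) ec(1) disjI1[OF re(1)]] mellin_entire_eq[OF ab(2,1) ec(2) disjI1[OF re(2)]] mellin_reg.simps(1)
    by (simp only: distrib_left distrib_right mult.assoc mult.left_commute mult.commute)
qed

lemma B_op_eq:
  assumes f: "f \<in> pi_space n (\<xi>1, \<xi>2) (l1, l2)" and n: "n \<ge> 1" and x: "x \<in> GL_coords (2 * n - 1)"
  shows "B_op n (\<xi>1, \<xi>2) \<eta> (l1, l2) \<nu> f (H_mat n x) = B_cont n (\<xi>1, \<xi>2) \<eta> (l1, l2) f x ((l1, l2), \<nu>)"
proof -
  have fs: "smooth_on_GL (2 * n) f" using f by (simp add: pi_space_iff)
  let ?P = "\<lambda>\<Phi>. entire_3 \<Phi> \<and> (\<forall>(lam', \<nu>')\<in>B_region n.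
      \<Phi> (lam', \<nu>') = B_integral n (\<xi>1, \<xi>2) \<eta> lam' \<nu>' (flat_section n (\<xi>1, \<xi>2) f lam') (H_mat n x))"
  have P: "?P (B_cont n (\<xi>1, \<xi>2) \<eta> (l1, l2) f x)"
    using entire_B_cont[OF fs n x] B_cont_region[OF f n x] by auto
  have "(THE \<Phi>. ?P \<Phi>) = B_cont n (\<xi>1, \<xi>2) \<eta> (l1, l2) f x"
  proof (rule the_equality[where P = ?P, OF P])
    fix \<Phi> assume Q: "?P \<Phi>"
    show "\<Phi> = B_cont n (\<xi>1, \<xi>2) \<eta> (l1, l2) f x"
    proof (rule entire_3_unique[OF conjunct1[OF Q] conjunct1[OF P] n])
      fix p assume "p \<in> B_region n"
      then show "\<Phi> p = B_cont n (\<xi>1, \<xi>2) \<eta> (l1, l2) f x p"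
        using bspec[OF conjunct2[OF Q]] bspec[OF conjunct2[OF P]] by (cases p) fastforce
    qed
  qed
  moreover have "H_mat n x \<in> GL (2 * n - 1)" using x by (simp add: H_mat_GL)
  ultimately show ?thesis by (simp add: B_op_def)
qed

lemma H_mat_entries: "h \<in> carrier_mat (2 * n - 1) (2 * n - 1) \<Longrightarrow> H_mat n (\<lambda>p. h $$ p) = h"
  unfolding H_mat_def by (rule mat_index_mat)

text \<open>
  At the parameter of \<open>f\<close> itself the exponent of the quadratic polynomial is 0, and one number \<open>m\<close> of integrations by parts serves all
  \<open>h\<close>.
\<close>

lemma B_op_smooth:
  assumes f: "f \<in> pi_space n (\<xi>1, \<xi>2) (l1, l2)" and n: "n \<ge> 1"
  shows "smooth_on_GL (2 * n - 1) (B_op n (\<xi>1, \<xi>2) \<eta> (l1, l2) \<nu> f)"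
proof -
  let ?V = "GL_coords (2 * n - 1)" let ?J = "entries (2 * n - 1)" let ?I = "insert (slot n) ?J"
  have fs: "smooth_on_GL (2 * n) f" using f by (simp add: pi_space_iff)
  note N = reflected_pairs(1)[OF fs n] and W = reflected_pairs(2)[OF fs n]
  note oV = open_GL_coords[of "2 * n - 1"]
  define z z' where "z = l1 - \<nu> + of_nat n / 2 + of_nat (bit_rep (\<xi>1 + \<eta>))" and "z' = \<nu> - l2 + of_nat n / 2 + of_nat (bit_rep (\<xi>2 + \<eta>))"
  obtain m :: nat where "real m > 4 + \<bar>Re z\<bar> + \<bar>Re z'\<bar>" using reals_Archimedean2 by blast
  then have m: "Re z + 2 * real m > 3" "Re z' + 2 * real m > 3" by linarith+
  have m0: "Re z + 2 * real m > 0" "Re z' + 2 * real m > 0" using m by linarith+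
  have nI: "slot n \<notin> ?J" by (simp add: slot_def entries_def)
  have 1: "smooth ?J ?V (\<lambda>x. mellin_reg m (near_seq n (\<xi>1 + \<eta>) f x) (alpha n x) (beta n x) z 0)"
    unfolding near_seq_def[abs_def]
    by (rule smooth_mellin_reg[OF oV _ nI, where I = ?I])
      (use GL_coords_slot alpha_beta_pos[OF _ n] conjunct1[OF reflected_pair.parity_chain_smooth_even[OF N]] m(1) in \<open>auto intro: subset_insertI\<close>)
  have 2: "smooth ?J ?V (\<lambda>x. mellin_reg m (far_seq n (\<xi>2 + \<eta>) f x) (beta n x) (alpha n x) z' 0)"
    unfolding far_seq_def[abs_def]
    by (rule smooth_mellin_reg[OF oV _ nI, where I = ?I])
      (use GL_coords_slot alpha_beta_pos[OF _ n] conjunct1[OF reflected_pair.parity_chain_smooth_even[OF W]] m(2) in \<open>auto intro: subset_insertI\<close>)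
  have "smooth ?J ?V (\<lambda>x. mellin_reg m (near_seq n (\<xi>1 + \<eta>) f x) (alpha n x) (beta n x) z 0 * rGamma (z' / 2) +
      rGamma (z / 2) * mellin_reg m (far_seq n (\<xi>2 + \<eta>) f x) (beta n x) (alpha n x) z' 0)"
    by (intro smooth_add smooth_mult smooth_const oV 1 2)
  then have "smooth ?J ?V (\<lambda>x. B_op n (\<xi>1, \<xi>2) \<eta> (l1, l2) \<nu> f (mat (2 * n - 1) (2 * n - 1) x))"
  proof (rule smooth_cong[OF oV, rotated])
    fix x assume x: "x \<in> ?V"
    note ab = alpha_beta_pos[OF x n] and ec = even_chain_seqs[OF fs n x]
    have d: "det (H_mat n x) \<noteq> 0" using x by (simp add: H_mat_GL GL_iff_det)
    have "B_op n (\<xi>1, \<xi>2) \<eta> (l1, l2) \<nu> f (H_mat n x) = abs_char 0 (l2 - l2) (det (H_mat n x)) *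
      (mellin_reg m (near_seq n (\<xi>1 + \<eta>) f x) (alpha n x) (beta n x) z ((l1 - l1 - l2 + l2) / 2) * rGamma (z' / 2) +
      rGamma (z / 2) * mellin_reg m (far_seq n (\<xi>2 + \<eta>) f x) (beta n x) (alpha n x) z' ((l1 - l1 - l2 + l2) / 2))"
      unfolding B_op_eq[OF f n x] B_cont_def case_prod_conv z_def[symmetric] z'_def[symmetric]
        mellin_entire_eq[OF ab(1,2) ec(1) disjI1[OF m0(1)]] mellin_entire_eq[OF ab(2,1) ec(2) disjI1[OF m0(2)]] ..
    also have "(l1 - l1 - l2 + l2) / 2 = 0" by simp
    also have "l2 - l2 = 0" by simp
    finally show "mellin_reg m (near_seq n (\<xi>1 + \<eta>) f x) (alpha n x) (beta n x) z 0 * rGamma (z' / 2) +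
      rGamma (z / 2) * mellin_reg m (far_seq n (\<xi>2 + \<eta>) f x) (beta n x) (alpha n x) z' 0 =
      B_op n (\<xi>1, \<xi>2) \<eta> (l1, l2) \<nu> f (mat (2 * n - 1) (2 * n - 1) x)"
      by (simp only: H_mat_def[symmetric] abs_char_0[OF d] mult_1)
  qed
  then show ?thesis by (simp add: smooth_on_GL_iff)
qed

text \<open>
  The substitution \<open>t \<mapsto> q\<^sub>2 t\<close> after \<open>embed_u_mult_right\<close>. The character of \<open>\<tau>\<close> appears as the product of the
  character of \<open>\<pi>\<close> with the factor that the kernel acquires.
\<close>

lemma B_integral_equivariant:
  assumes g: "g \<in> pi_space n (\<xi>1, \<xi>2) (l1, l2)" and n: "n \<ge> 1" and h: "h \<in> GL (2 * n - 1)" and q: "H_parabolic n q"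
  shows "B_integral n (\<xi>1, \<xi>2) \<eta> (l1, l2) \<nu> g (h * q) =
    tau_char n (\<xi>1, \<eta>, \<xi>2) (l1, \<nu>, l2) q * B_integral n (\<xi>1, \<xi>2) \<eta> (l1, l2) \<nu> g h"
proof -
  define d1 q2 where "d1 = det (ul (n - 1) q)" and "q2 = q $$ (n - 1, n - 1)"
  have nz: "d1 \<noteq> 0" "q2 \<noteq> 0" using H_parabolic_nz[OF q n] by (simp_all add: d1_def q2_def)
  define D where "D = det q / (d1 * q2)"
  define s where "s = l1 - \<nu> + of_nat n / 2"
  define \<epsilon> where "\<epsilon> = \<xi>1 + \<eta>"
  define X where "X = abs_char \<xi>1 (- l1 - of_nat n / 2) (d1 * q2) * abs_char \<xi>2 (- l2 + of_nat n / 2) D"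
  have gq: "g (embed_u n (h * q) t) = X * g (embed_u n h (t / q2))" for t
  proof -
    obtain p where p: "block_upper (2 * n) n p" "embed_u n (h * q) t = embed_u n h (t / q $$ (n - 1, n - 1)) * p"
      "det (ul n p) = det (ul (n - 1) q) * q $$ (n - 1, n - 1)" "det p = det q"
      using embed_u_mult_right[OF h n q, of t] .
    have "g (embed_u n h (t / q2) * p) = pi_char n (\<xi>1, \<xi>2) (l1, l2) p * g (embed_u n h (t / q2))"
      using g embed_u_GL(1)[OF h n] p(1) by (simp add: pi_space_iff)
    moreover have "pi_char n (\<xi>1, \<xi>2) (l1, l2) p = X"
      unfolding pi_char_def case_prod_conv p(3,4) X_def D_def d1_def q2_def ..
    ultimately show ?thesis using p(2) by (simp only: q2_def)
  qed
  define G where "G t = abs_char \<epsilon> s t * g (embed_u n h t) / of_real \<bar>t\<bar>" for t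
  have "(LINT t:- {0}|lborel. abs_char \<epsilon> s t * g (embed_u n (h * q) t) / of_real \<bar>t\<bar>) =
      (\<integral>t. indicator (- {0}) t *\<^sub>R (abs_char \<epsilon> s t * g (embed_u n (h * q) t) / of_real \<bar>t\<bar>) \<partial>lborel)"
    by (simp only: set_lebesgue_integral_def)
  also have "\<dots> = \<bar>q2\<bar> *\<^sub>R (\<integral>t. indicator (- {0}) (0 + q2 * t) *\<^sub>R (abs_char \<epsilon> s (0 + q2 * t) * g (embed_u n (h * q) (0 + q2 * t)) / of_real \<bar>0 + q2 * t\<bar>) \<partial>lborel)"
    by (rule lborel_integral_real_affine[OF nz(2)])
  also have "(\<lambda>t. indicator (- {0}) (0 + q2 * t) *\<^sub>R (abs_char \<epsilon> s (0 + q2 * t) * g (embed_u n (h * q) (0 + q2 * t)) / of_real \<bar>0 + q2 * t\<bar>)) =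
      (\<lambda>t. (X * abs_char \<epsilon> s q2 / of_real \<bar>q2\<bar>) * (indicator (- {0}) t *\<^sub>R G t))"
  proof
    fix t :: real
    show "indicator (- {0}) (0 + q2 * t) *\<^sub>R (abs_char \<epsilon> s (0 + q2 * t) * g (embed_u n (h * q) (0 + q2 * t)) / of_real \<bar>0 + q2 * t\<bar>) =
       (X * abs_char \<epsilon> s q2 / of_real \<bar>q2\<bar>) * (indicator (- {0}) t *\<^sub>R G t)"
    proof (cases "t = 0")
      case False
      then show ?thesis using nz by (simp add: gq abs_char_mult G_def abs_mult)
    qed simp
  qed
  also have "\<bar>q2\<bar> *\<^sub>R (\<integral>t. (X * abs_char \<epsilon> s q2 / of_real \<bar>q2\<bar>) * (indicator (- {0}) t *\<^sub>R G t) \<partial>lborel) =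
      (X * abs_char \<epsilon> s q2) * (LINT t:- {0}|lborel. G t)"
    using nz unfolding set_lebesgue_integral_def by (simp add: scaleR_conv_of_real)
  finally have I: "(LINT t:- {0}|lborel. abs_char \<epsilon> s t * g (embed_u n (h * q) t) / of_real \<bar>t\<bar>) =
      (X * abs_char \<epsilon> s q2) * (LINT t:- {0}|lborel. abs_char \<epsilon> s t * g (embed_u n h t) / of_real \<bar>t\<bar>)"
    unfolding G_def .
  have "X * abs_char \<epsilon> s q2 = tau_char n (\<xi>1, \<eta>, \<xi>2) (l1, \<nu>, l2) q"
  proof -
    have "abs_char \<xi>1 (- l1 - of_nat n / 2) q2 * abs_char (\<xi>1 + \<eta>) (l1 - \<nu> + of_nat n / 2) q2 =
        abs_char (\<xi>1 + (\<xi>1 + \<eta>)) ((- l1 - of_nat n / 2) + (l1 - \<nu> + of_nat n / 2)) q2"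
      by (rule abs_char_add[OF nz(2), symmetric])
    also have "\<xi>1 + (\<xi>1 + \<eta>) = \<eta>" by (cases \<xi>1; cases \<eta>) simp_all
    also have "(- l1 - of_nat n / 2) + (l1 - \<nu> + of_nat n / 2) = - \<nu>" by simp
    finally have e: "abs_char \<xi>1 (- l1 - of_nat n / 2) q2 * abs_char (\<xi>1 + \<eta>) (l1 - \<nu> + of_nat n / 2) q2 = abs_char \<eta> (- \<nu>) q2" .
    have "X * abs_char \<epsilon> s q2 = abs_char \<xi>1 (- l1 - of_nat n / 2) d1 *
       (abs_char \<xi>1 (- l1 - of_nat n / 2) q2 * abs_char (\<xi>1 + \<eta>) (l1 - \<nu> + of_nat n / 2) q2) * abs_char \<xi>2 (- l2 + of_nat n / 2) D"
      unfolding X_def \<epsilon>_def s_def abs_char_mult[OF nz] by (simp only: mult.assoc mult.left_commute mult.commute)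
    then have "X * abs_char \<epsilon> s q2 = abs_char \<xi>1 (- l1 - of_nat n / 2) d1 * abs_char \<eta> (- \<nu>) q2 * abs_char \<xi>2 (- l2 + of_nat n / 2) D"
      by (simp only: e)
    then show ?thesis unfolding tau_char_def case_prod_conv d1_def q2_def D_def .
  qed
  note I = I[unfolded this, unfolded \<epsilon>_def s_def]
  show ?thesis
    unfolding B_integral_def case_prod_conv embed_u_def[symmetric] I by (simp only: mult.left_commute)
qed

text \<open>
  Both sides of the equivariance are entire in the parameters and agree in the region of convergence.
\<close>

lemma B_op_in_tau_space:
  assumes f: "f \<in> pi_space n (\<xi>1, \<xi>2) (l1, l2)" and n: "n \<ge> 1"
  shows "B_op n (\<xi>1, \<xi>2) \<eta> (l1, l2) \<nu> f \<in> tau_space n (\<xi>1, \<eta>, \<xi>2) (l1, \<nu>, l2)"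
  unfolding tau_space_iff[OF n]
proof (intro conjI ballI allI impI)
  show "B_op n (\<xi>1, \<xi>2) \<eta> (l1, l2) \<nu> f \<in> extensional (GL (2 * n - 1))" by (simp add: B_op_def)
  show "smooth_on_GL (2 * n - 1) (B_op n (\<xi>1, \<xi>2) \<eta> (l1, l2) \<nu> f)" by (rule B_op_smooth[OF f n])
  fix h q assume h: "h \<in> GL (2 * n - 1)" and q: "H_parabolic n q"
  have fs: "smooth_on_GL (2 * n) f" using f by (simp add: pi_space_iff)
  have hq: "h * q \<in> GL (2 * n - 1)" using h q by (intro GL_mult) (simp_all add: H_parabolic_def block_upper_def)
  define x y where "x = (\<lambda>p. h $$ p)" and "y = (\<lambda>p. (h * q) $$ p)"
  have Hx: "H_mat n x = h" "H_mat n y = h * q"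
    unfolding x_def y_def by (rule H_mat_entries, rule GL_carrier, rule h, rule H_mat_entries, rule GL_carrier, rule hq)
  then have x: "x \<in> GL_coords (2 * n - 1)" "y \<in> GL_coords (2 * n - 1)" using h hq by (simp_all add: H_mat_GL)
  \<comment> \<open>the character of \<open>\<tau>\<close> at \<open>q\<close> as an entire function of all parameters\<close>
  define tc where "tc = (\<lambda>p::(complex \<times> complex) \<times> complex. tau_char n (\<xi>1, \<eta>, \<xi>2) (fst (fst p), snd p, snd (fst p)) q)"
  have "det q \<noteq> 0" using q by (auto simp: H_parabolic_def block_upper_def GL_iff_det)
  note nz = H_parabolic_nz[OF q n] this
  have tc: "holo_at tc p" for p
    unfolding tc_def tau_char_def case_prod_conv
    by (intro holo_at_mult holo_at_abs_char holo_at_add holo_at_diff holo_at_minus holo_at_const holo_at_coords) (use nz in simp_all)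
  have ent: "entire_3 (\<lambda>p. tc p * B_cont n (\<xi>1, \<xi>2) \<eta> (l1, l2) f x p)"
    using entire_B_cont[OF fs n x(1), of \<xi>1 \<xi>2 \<eta> l1 l2] tc unfolding entire_3_iff by (blast intro: holo_at_mult)
  have "B_cont n (\<xi>1, \<xi>2) \<eta> (l1, l2) f y = (\<lambda>p. tc p * B_cont n (\<xi>1, \<xi>2) \<eta> (l1, l2) f x p)"
  proof (rule entire_3_unique[OF entire_B_cont[OF fs n x(2)] ent n])
    fix p assume p: "p \<in> B_region n"
    obtain l1' l2' \<nu>' where p': "p = ((l1', l2'), \<nu>')" by (metis prod.exhaust)
    have "flat_section n (\<xi>1, \<xi>2) f (l1', l2') \<in> pi_space n (\<xi>1, \<xi>2) (l1', l2')"
      unfolding flat_section_eq[OF f] by (rule flat_formula_in_pi_space[OF f])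
    from B_integral_equivariant[OF this n h q, of \<eta> \<nu>']
    show "B_cont n (\<xi>1, \<xi>2) \<eta> (l1, l2) f y p = tc p * B_cont n (\<xi>1, \<xi>2) \<eta> (l1, l2) f x p"
      unfolding p' B_cont_region[OF f n x(1) p[unfolded p']] B_cont_region[OF f n x(2) p[unfolded p']] Hx tc_def fst_conv snd_conv .
  qed
  then show "B_op n (\<xi>1, \<xi>2) \<eta> (l1, l2) \<nu> f (h * q) = tau_char n (\<xi>1, \<eta>, \<xi>2) (l1, \<nu>, l2) q * B_op n (\<xi>1, \<xi>2) \<eta> (l1, l2) \<nu> f h"
    using B_op_eq[OF f n x(1), of \<eta> \<nu>] B_op_eq[OF f n x(2), of \<eta> \<nu>] by (simp add: Hx tc_def)
qed

hide_const (open) Finite_Cartesian_Product.vec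
no_notation vec_nth (infixl "$" 90)
no_notation fps_nth (infixl "$" 75)

section \<open>Surjectivity\<close>

subsection \<open>A bump function\<close>

text \<open>
  The functions \<open>p (1/x) exp (- 1/x)\<close>, continued by 0, form a family closed under derivatives; so they are smooth.
\<close>

definition exp_flat :: "real poly \<Rightarrow> real \<Rightarrow> real" where
  "exp_flat p x = (if x > 0 then poly p (1 / x) * exp (- (1 / x)) else 0)"

lemma exp_flat_tendsto_0: "(exp_flat p \<longlongrightarrow> 0) (at 0)"
proof -
  have "((\<lambda>y. poly p y / exp y) \<longlongrightarrow> 0) at_top"
  proof -
    have "((\<lambda>y::real. \<Sum>i\<le>degree p. coeff p i * (y ^ i / exp y)) \<longlongrightarrow> (\<Sum>i\<le>degree p. coeff p i * 0)) at_top"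
      by (intro tendsto_sum tendsto_mult tendsto_const tendsto_power_div_exp_0)
    then show ?thesis by (simp add: poly_altdef sum_divide_distrib)
  qed
  then have "((\<lambda>x. poly p (inverse x) / exp (inverse x)) \<longlongrightarrow> 0) (at_right 0)"
    by (rule filterlim_compose[OF _ filterlim_inverse_at_top_right])
  then have "(exp_flat p \<longlongrightarrow> 0) (at_right 0)"
    by (rule Lim_transform_eventually)
      (auto simp: exp_flat_def eventually_at_filter exp_minus field_simps)
  moreover have "(exp_flat p \<longlongrightarrow> 0) (at_left 0)"
    by (rule Lim_transform_eventually[OF tendsto_const]) (auto simp: exp_flat_def eventually_at_filter)
  ultimately show ?thesis by (simp add: filterlim_at_split)
qed

lemma exp_flat_has_derivative:
  "(exp_flat p has_vector_derivative exp_flat ([:0, 0, 1:] * (p - pderiv p)) x) (at x)"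
proof -
  consider "x > 0" | "x < 0" | "x = 0" by linarith
  then have "(exp_flat p has_real_derivative exp_flat ([:0, 0, 1:] * (p - pderiv p)) x) (at x)"
  proof cases
    case 1
    have "((\<lambda>x. poly p (1 / x) * exp (- (1 / x))) has_real_derivative exp_flat ([:0, 0, 1:] * (p - pderiv p)) x) (at x)"
      using 1 by (auto intro!: derivative_eq_intros DERIV_chain2[OF poly_DERIV] simp: exp_flat_def field_simps power2_eq_square)
    then show ?thesis
      by (rule has_field_derivative_transform_within_open[of _ _ _ "{0<..}"]) (use 1 in \<open>auto simp: exp_flat_def\<close>)
  next
    case 2
    have "((\<lambda>x. 0) has_real_derivative exp_flat ([:0, 0, 1:] * (p - pderiv p)) x) (at x)"
      using 2 by (simp add: exp_flat_def)
    then show ?thesis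
      by (rule has_field_derivative_transform_within_open[of _ _ _ "{..<0}"]) (use 2 in \<open>auto simp: exp_flat_def\<close>)
  next
    case 3
    have "(\<lambda>y. (exp_flat p y - exp_flat p 0) / (y - 0)) = exp_flat ([:0, 1:] * p)"
      by (auto simp: exp_flat_def fun_eq_iff field_simps)
    then show ?thesis
      using exp_flat_tendsto_0[of "[:0, 1:] * p"] 3 by (simp add: has_field_derivative_iff exp_flat_def)
  qed
  then show ?thesis by (simp add: has_real_derivative_iff_has_vector_derivative)
qed

text \<open>
  A smooth function, positive between 1/4 and 3/4 and zero elsewhere.
\<close>

definition bump :: "real \<Rightarrow> real" where
  "bump q = exp_flat 1 (q - 1 / 4) * exp_flat 1 (3 / 4 - q)"

lemma smooth_bump:
  assumes V: "open V" and v: "smooth J V v"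
  shows "smooth J V (\<lambda>y. bump (v y))"
proof -
  have e: "smooth J V (\<lambda>y. exp_flat 1 (w y))" if "smooth J V w" for w
  proof (rule smooth_compose_family[OF V that, of UNIV "range exp_flat"])
    fix g assume "g \<in> range exp_flat"
    then obtain p where g: "g = exp_flat p" by (rule rangeE)
    show "\<exists>g'\<in>range exp_flat. \<forall>r\<in>UNIV. (g has_vector_derivative g' r) (at r)"
      unfolding g by (rule bexI, rule ballI, rule exp_flat_has_derivative, rule rangeI)
  qed (rule UNIV_I, rule rangeI)
  show ?thesis unfolding bump_def by (intro smooth_mult e smooth_diff smooth_const v V)
qed

lemma bump_0: "q \<le> 1 / 4 \<or> q \<ge> 3 / 4 \<Longrightarrow> bump q = 0"
  by (auto simp: bump_def exp_flat_def)

lemma continuous_bump: "continuous_on S bump"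
proof -
  have "continuous_on UNIV (exp_flat 1)"
    by (rule continuous_at_imp_continuous_on, rule ballI, rule has_vector_derivative_continuous, rule exp_flat_has_derivative)
  note c = continuous_on_compose2[OF this _ subset_UNIV]
  show ?thesis unfolding bump_def by (intro continuous_on_mult c continuous_intros)
qed

text \<open>
  A primitive of \<open>bump\<close> on \<open>[0, 1]\<close>; its increment over this interval is the constant produced by the operator.
\<close>

definition bump_cdf :: "real \<Rightarrow> real" where
  "bump_cdf q = integral {0..q} bump"

lemma bump_cdf_derivative_within:
  assumes "q \<in> {0..1}"
  shows "(bump_cdf has_vector_derivative bump q) (at q within {0..1})"
  unfolding bump_cdf_def[abs_def] by (rule integral_has_vector_derivative[OF continuous_bump assms])

lemma bump_cdf_derivative:
  assumes "0 < q" "q < 1"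
  shows "(bump_cdf has_real_derivative bump q) (at q)"
  using bump_cdf_derivative_within[of q] assms at_within_interior[of q "{0..1}"]
  by (simp add: has_real_derivative_iff_has_vector_derivative interior_atLeastAtMost_real)

lemma continuous_bump_cdf: "continuous_on {0..1} bump_cdf"
  unfolding continuous_on_eq_continuous_within
  by (rule ballI, rule has_vector_derivative_continuous, rule bump_cdf_derivative_within)

lemma bump_cdf_nonconstant: "bump_cdf 1 \<noteq> bump_cdf 0"
proof
  assume "bump_cdf 1 = bump_cdf 0"
  then have "(bump has_integral 0) (cbox 0 1)"
    using integrable_integral[OF integrable_continuous_real[OF continuous_bump[of "{0..1}"]]] by (simp add: bump_cdf_def)
  moreover have "0 \<le> bump q" for q by (simp add: bump_def exp_flat_def)
  ultimately have "bump (1 / 2) = 0"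
    by (intro has_integral_0_cbox_imp_0[OF continuous_bump]) (auto simp: box_ne_empty)
  then show False by (simp add: bump_def exp_flat_def)
qed

subsection \<open>The open double coset\<close>

text \<open>
  The element \<open>q = r h\<close> with \<open>r\<close> the inverse of \<open>h'\<close> satisfies \<open>q u\<^sub>1 = u\<^sub>1 p\<close>. Comparison of entries shows that \<open>q\<close> and \<open>p\<close> agree off
  the last row and column and that row \<open>n\<close> of \<open>q\<close> starts with \<open>0, \<dots>, 0, 1\<close>. As the middle entry of \<open>q\<close> is 1, its
  character in \<open>\<tau>\<close> does not involve \<open>\<eta>\<close> and \<open>\<nu>\<close>.
\<close>

lemma orbit_representative_unique:
  assumes h: "h \<in> GL (2 * n - 1)" and h': "h' \<in> GL (2 * n - 1)" and n: "n \<ge> 1" and p: "block_upper (2 * n) n p"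
    and e: "embed_u n h 1 = embed_u n h' 1 * p"
  obtains q where "H_parabolic n q" "h = h' * q"
    "tau_char n (\<xi>1, \<eta>, \<xi>2) (l1, \<nu>, l2) q = pi_char n (\<xi>1, \<xi>2) (l1, l2) p"
proof -
  let ?N = "2 * n" let ?M = "2 * n - 1"
  let ?U = "1\<^sub>m ?N + 1 \<cdot>\<^sub>m elem_mat ?N (2 * n - 1) (n - 1)"
  obtain r where r: "r \<in> GL ?M" "h' * r = 1\<^sub>m ?M" "r * h' = 1\<^sub>m ?M" using GL_inverse[OF h'] by blast
  note hc = GL_carrier[OF h] and hc' = GL_carrier[OF h'] and rc = GL_carrier[OF r(1)]
  have pc: "p \<in> carrier_mat ?N ?N" using p by (simp add: block_upper_def GL_carrier)
  have U: "?U \<in> carrier_mat ?N ?N" by simp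
  have ne: "2 * n - 1 \<noteq> n - 1" "n - 1 < ?N" "2 * n - 1 < ?N" using n by auto
  define q where "q = r * h"
  have qG: "q \<in> GL ?M" unfolding q_def by (rule GL_mult[OF r(1) h])
  note qc = GL_carrier[OF qG]
  have hq: "h = h' * q" unfolding q_def assoc_mult_mat[OF hc' rc hc, symmetric] r(2) using hc by simp
  note E = embed_H_carrier[OF hc' n] embed_H_carrier[OF rc n] embed_H_carrier[OF qc n]
  have one: "embed_H n (1\<^sub>m ?M) = 1\<^sub>m ?N"
    by (rule eq_matI, unfold carrier_matD[OF embed_H_carrier[OF one_carrier_mat n]]) (use n in \<open>auto simp: embed_H_index\<close>)
  have "embed_H n r * embed_u n h 1 = embed_u n q 1"
  proof -
    have "embed_H n r * (embed_H n h * ?U) = embed_H n (r * h) * ?U"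
      unfolding embed_H_mult[OF rc hc] by (rule assoc_mult_mat[OF E(2) embed_H_carrier[OF hc n] U, symmetric])
    then show ?thesis by (simp only: embed_u_def q_def)
  qed
  moreover have "embed_H n r * (embed_u n h' 1 * p) = ?U * p"
  proof -
    have "embed_H n r * (embed_H n h' * ?U) = embed_H n (r * h') * ?U"
      unfolding embed_H_mult[OF rc hc'] by (rule assoc_mult_mat[OF E(2,1) U, symmetric])
    also have "\<dots> = ?U" unfolding r(3) one using U by (rule left_mult_one_mat)
    finally show ?thesis unfolding embed_u_def
      using assoc_mult_mat[OF E(2) mult_carrier_mat[OF E(1) U] pc] by simp
  qed
  ultimately have eq: "embed_u n q 1 = ?U * p" using e by simp
  have ent: "embed_u n q 1 $$ (i, j) = p $$ (i, j) + (if i = 2 * n - 1 then p $$ (n - 1, j) else 0)" if "i < ?N" "j < ?N" for i j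
    unfolding eq using add_elem_mult[OF pc _ ne(2) that, of "2 * n - 1" 1] ne by simp
  have qp: "q $$ (i, j) = p $$ (i, j)" if "i < ?M" "j < ?M" for i j
    using ent[of i j] that by (simp add: embed_u_index[OF qc n])
  have pz: "p $$ (i, j) = 0" if "n \<le> i" "i < ?N" "j < n" for i j using p that by (simp add: block_upper_def)
  have row: "p $$ (n - 1, j) = of_bool (j = n - 1)" if "j < n" for j
    using ent[of "2 * n - 1" j] pz[of "2 * n - 1" j] that n by (auto simp: embed_u_index[OF qc n] split: if_splits)
  have HP: "H_parabolic n q"
    unfolding H_parabolic_def block_upper_def
  proof (intro conjI allI impI qG)
    show "q $$ (i, j) = 0" if "n \<le> i" "i < ?M" "j < n" for i j using qp[of i j] pz[of i j] that by simp
    show "q $$ (i, j) = 0" if "n - 1 \<le> i" "i < ?M" "j < n - 1" for i j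
      using qp[of i j] pz[of i j] row[of j] that by (cases "i = n - 1") auto
  qed
  have q1: "q $$ (n - 1, n - 1) = 1" using qp[of "n - 1" "n - 1"] row[of "n - 1"] n by simp
  have "ul n p = ul n q" by (rule eq_matI) (use qp n in auto)
  then have d: "det (ul n p) = det (ul (n - 1) q)" using det_ul_H_parabolic[OF HP n] q1 by simp
  have "det (?U * p) = det p" unfolding det_mult[OF U pc] det_add_elem[OF ne(1)] by simp
  then have "det p = det q" using embed_u_GL(2)[OF qG n, of 1] by (simp add: eq)
  then have "tau_char n (\<xi>1, \<eta>, \<xi>2) (l1, \<nu>, l2) q = pi_char n (\<xi>1, \<xi>2) (l1, l2) p"
    by (simp add: tau_char_def pi_char_def d q1)
  with HP hq show ?thesis by (rule that)
qed

text \<open>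
  Solving \<open>g = h u\<^sub>1 p\<close> for \<open>h\<close>: normalize column \<open>n\<close> of \<open>g\<close> by its last entry and clear the last row of the other columns with
  it. This is one choice of \<open>h\<close> in its class, and it depends smoothly on \<open>g\<close>.
\<close>

definition chart :: "nat \<Rightarrow> real mat \<Rightarrow> real mat" where
  "chart n g = mat (2 * n - 1) (2 * n - 1) (\<lambda>(i, k). if k = n - 1 then g $$ (i, n - 1) / g $$ (2 * n - 1, n - 1)
     else g $$ (i, k) - g $$ (i, n - 1) * g $$ (2 * n - 1, k) / g $$ (2 * n - 1, n - 1))"

definition chart_domain :: "nat \<Rightarrow> real mat \<Rightarrow> bool" where
  "chart_domain n g \<longleftrightarrow> g \<in> GL (2 * n) \<and> g $$ (2 * n - 1, n - 1) \<noteq> 0 \<and> det (ul (2 * n - 1) g) \<noteq> 0"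

text \<open>
  The first \<open>2n - 1\<close> columns of \<open>p\<close> can be written down: they are those of the identity with row \<open>n\<close> replaced by the last row of
  \<open>g\<close>. The last column of \<open>p\<close> is whatever it has to be.
\<close>

lemma chart_factorization:
  assumes g: "chart_domain n g" and n: "n \<ge> 1"
  obtains p where "chart n g \<in> GL (2 * n - 1)" "block_upper (2 * n) n p" "g = embed_u n (chart n g) 1 * p"
    "det (ul n p) = g $$ (2 * n - 1, n - 1)" "det p = det g / det (chart n g)"
proof -
  let ?N = "2 * n" let ?M = "2 * n - 1"
  define c where "c = g $$ (2 * n - 1, n - 1)"
  define h where "h = chart n g"
  \<comment> \<open>agrees with \<open>p\<close> in all columns but the last one\<close>
  define p' where "p' = mat ?N ?N (\<lambda>(i, j). if i = n - 1 then g $$ (2 * n - 1, j) else of_bool (i = j))"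
  have c: "c \<noteq> 0" and gG: "g \<in> GL ?N" using g by (simp_all add: chart_domain_def c_def)
  note gc = GL_carrier[OF gG]
  have ne: "2 * n - 1 \<noteq> n - 1" "n - 1 < ?N" "2 * n - 1 < ?N" "n - 1 < ?M" using n by auto
  have hc: "h \<in> carrier_mat ?M ?M" by (simp add: h_def chart_def)
  have hij: "h $$ (i, k) = (if k = n - 1 then g $$ (i, n - 1) / c else g $$ (i, k) - g $$ (i, n - 1) * g $$ (2 * n - 1, k) / c)"
    if "i < ?M" "k < ?M" for i k using that by (simp add: h_def chart_def c_def)
  have pc': "p' \<in> carrier_mat ?N ?N" by (simp add: p'_def)
  have mult: "(\<Sum>k<?M. h $$ (i, k) * p' $$ (k, j)) = g $$ (i, j)" if "i < ?M" "j < ?M" for i j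
  proof -
    have "(\<Sum>k<?M. h $$ (i, k) * p' $$ (k, j)) = (\<Sum>k<?M. (if k = n - 1 then h $$ (i, k) * g $$ (2 * n - 1, j) else 0) +
        (if k = j then (if j = n - 1 then 0 else h $$ (i, k)) else 0))"
      using that by (intro sum.cong) (auto simp: p'_def)
    also have "\<dots> = h $$ (i, n - 1) * g $$ (2 * n - 1, j) + (if j = n - 1 then 0 else h $$ (i, j))"
      using ne that by (simp add: sum.distrib sum.delta)
    also have "\<dots> = g $$ (i, j)" using that ne c by (simp add: hij c_def)
    finally show ?thesis .
  qed
  have "h * ul ?M p' = ul ?M g"
    by (rule eq_matI) (use hc mult in \<open>auto simp: scalar_prod_def atLeast0LessThan intro!: sum.cong\<close>)
  then have "det h * det (ul ?M p') = det (ul ?M g)" using det_mult[OF hc, of "ul ?M p'"] by simp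
  then have hG: "h \<in> GL ?M" using g hc by (auto simp: GL_iff_det chart_domain_def)
  define m where "m = embed_u n h 1"
  have mG: "m \<in> GL ?N" "det m = det h" unfolding m_def by (rule embed_u_GL[OF hG n])+
  note mc = GL_carrier[OF mG(1)]
  obtain r where r: "r \<in> GL ?N" "m * r = 1\<^sub>m ?N" "r * m = 1\<^sub>m ?N" using GL_inverse[OF mG(1)] by blast
  note rc = GL_carrier[OF r(1)]
  have mp': "(m * p') $$ (i, j) = g $$ (i, j)" if "i < ?N" "j < ?M" for i j
  proof -
    have S: "{..<?N} = insert ?M {..<?M}" using n by auto
    have "(m * p') $$ (i, j) = (\<Sum>k<?N. m $$ (i, k) * p' $$ (k, j))"
      using mc pc' that by (simp add: scalar_prod_def atLeast0LessThan)
    also have "\<dots> = m $$ (i, ?M) * p' $$ (?M, j) + (\<Sum>k<?M. m $$ (i, k) * p' $$ (k, j))" by (simp add: S)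
    also have "p' $$ (?M, j) = 0" using that ne by (simp add: p'_def)
    also have "(\<Sum>k<?M. m $$ (i, k) * p' $$ (k, j)) = g $$ (i, j)"
    proof (cases "i = ?M")
      case True
      have "(\<Sum>k<?M. m $$ (i, k) * p' $$ (k, j)) = (\<Sum>k<?M. if k = n - 1 then p' $$ (n - 1, j) else 0)"
        using True n by (intro sum.cong) (auto simp: m_def embed_u_index[OF hc n])
      also have "\<dots> = p' $$ (n - 1, j)" using ne by (simp add: sum.delta)
      also have "\<dots> = g $$ (i, j)" using True ne that by (simp add: p'_def)
      finally show ?thesis .
    next
      case False
      have "(\<Sum>k<?M. m $$ (i, k) * p' $$ (k, j)) = (\<Sum>k<?M. h $$ (i, k) * p' $$ (k, j))"
        using False that by (intro sum.cong) (auto simp: m_def embed_u_index[OF hc n])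
      then show ?thesis using mult[of i j] False that by simp
    qed
    finally show ?thesis by simp
  qed
  define p where "p = r * g"
  have pG: "p \<in> GL ?N" unfolding p_def by (rule GL_mult[OF r(1) gG])
  have mp: "g = m * p" unfolding p_def assoc_mult_mat[OF mc rc gc, symmetric] r(2) using gc by simp
  have pp': "p $$ (i, j) = p' $$ (i, j)" if "i < ?N" "j < ?M" for i j
  proof -
    have "p' = r * (m * p')" unfolding assoc_mult_mat[OF rc mc pc', symmetric] r(3) using pc' by simp
    then have "p' $$ (i, j) = (r * (m * p')) $$ (i, j)" by simp
    also have "\<dots> = (\<Sum>k<?N. r $$ (i, k) * (m * p') $$ (k, j))"
      using that rc carrier_matD[OF mult_carrier_mat[OF mc pc']]
      by (subst index_mult_mat(1)) (auto simp del: index_mult_mat(1) simp: scalar_prod_def atLeast0LessThan intro!: sum.cong)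
    also have "\<dots> = (\<Sum>k<?N. r $$ (i, k) * g $$ (k, j))" using that by (intro sum.cong refl) (simp only: mp' lessThan_iff)
    also have "\<dots> = p $$ (i, j)" using that rc gc by (simp add: p_def scalar_prod_def atLeast0LessThan)
    finally show ?thesis by simp
  qed
  have bu: "block_upper ?N n p"
    using pG pp' n by (auto simp: block_upper_def p'_def)
  have "det (ul n p) = prod_list (diag_mat (ul n p))"
  proof (rule det_lower_triangular)
    show "ul n p $$ (i, j) = 0" if "i < j" "j < n" for i j
      using pp'[of i j] that n by (auto simp: p'_def)
  qed simp
  also have "diag_mat (ul n p) = map (\<lambda>i. if i = n - 1 then c else 1) [0..<n]"
    using pp' n by (intro nth_equalityI) (auto simp: diag_mat_def p'_def c_def)
  also have "prod_list \<dots> = (\<Prod>i = 0..<n. if i = n - 1 then c else 1)" by (simp add: prod.distinct_set_conv_list[symmetric])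
  also have "\<dots> = c" using n by (simp add: prod.delta)
  finally have dc: "det (ul n p) = c" .
  have "det g = det m * det p" unfolding mp by (rule det_mult[OF mc GL_carrier[OF pG]])
  then have "det p = det g / det h" using GL_det[OF hG] mG(2) by simp
  with hG bu mp dc show ?thesis unfolding m_def h_def c_def by (intro that)
qed

text \<open>
  The minor in question is, up to the factor \<open>det g\<close>, the last entry of the inverse of \<open>g\<close>, that is the last entry of \<open>y\<close>. The proof
  shows directly that the minor has no kernel: a kernel vector, extended by 0, is a multiple of \<open>y\<close>.
\<close>

lemma det_ul_nonzero:
  assumes g: "g \<in> GL (Suc N)" and y: "y \<in> carrier_vec (Suc N)" "g *\<^sub>v y = unit_vec (Suc N) N" "y $ N \<noteq> 0"
  shows "det (ul N g) \<noteq> 0"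
proof
  assume "det (ul N g) = 0"
  then obtain v where v: "v \<in> carrier_vec N" "v \<noteq> 0\<^sub>v N" "ul N g *\<^sub>v v = 0\<^sub>v N"
    using det_0_iff_vec_prod_zero[OF ul_carrier, of N g] by auto
  note gc = GL_carrier[OF g]
  define w where "w = vec (Suc N) (\<lambda>i. if i < N then v $ i else 0)"
  have wc: "w \<in> carrier_vec (Suc N)" by (simp add: w_def)
  define s where "s = (g *\<^sub>v w) $ N"
  have "(g *\<^sub>v w) $ i = (ul N g *\<^sub>v v) $ i" if "i < N" for i
    using that gc v(1) by (simp add: scalar_prod_def w_def)
  then have "g *\<^sub>v w = s \<cdot>\<^sub>v unit_vec (Suc N) N"
    using v gc by (intro eq_vecI) (auto simp: s_def less_Suc_eq)
  then have e: "g *\<^sub>v w = g *\<^sub>v (s \<cdot>\<^sub>v y)" using mult_mat_vec[OF gc y(1), of s] y(2) by simp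
  obtain r where r: "r \<in> GL (Suc N)" "r * g = 1\<^sub>m (Suc N)" using GL_inverse[OF g] by blast
  have "w = s \<cdot>\<^sub>v y"
  proof -
    have "u = r *\<^sub>v (g *\<^sub>v u)" if "u \<in> carrier_vec (Suc N)" for u
      using assoc_mult_mat_vec[OF GL_carrier[OF r(1)] gc that] that r(2) by simp
    then show ?thesis using e wc y(1) by (metis smult_carrier_vec)
  qed
  then have i: "w $ i = s * y $ i" if "i < Suc N" for i using y(1) that by simp
  have "s = 0" using i[of N] y(3) by (simp add: w_def)
  then have "v $ i = 0" if "i < N" for i using i[of i] that by (simp add: w_def)
  then have "v = 0\<^sub>v N" using v(1) by (intro eq_vecI) auto
  with v(2) show False by simp
qed

lemma gram_zero_if_kernel:
  assumes z: "z \<in> carrier_vec m" "z \<noteq> 0\<^sub>v m" "\<And>k. k < r \<Longrightarrow> (\<Sum>j<m. g $$ (k, j) * z $ j) = 0"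
  shows "gram r m g = 0"
proof -
  let ?G = "mat m m (\<lambda>(i, j). \<Sum>k<r. g $$ (k, i) * g $$ (k, j))"
  have "(?G *\<^sub>v z) $ i = 0" if "i < m" for i
  proof -
    have "(?G *\<^sub>v z) $ i = (\<Sum>j<m. (\<Sum>k<r. g $$ (k, i) * g $$ (k, j)) * z $ j)"
      using that z(1) by (simp add: scalar_prod_def atLeast0LessThan)
    also have "\<dots> = (\<Sum>k<r. g $$ (k, i) * (\<Sum>j<m. g $$ (k, j) * z $ j))"
      unfolding sum_distrib_right sum_distrib_left by (subst sum.swap) (simp only: mult.assoc)
    finally show ?thesis using z(3) by simp
  qed
  then have "?G *\<^sub>v z = 0\<^sub>v m" by (intro eq_vecI) auto
  then show ?thesis unfolding gram_def using z det_0_iff_vec_prod_zero[of ?G m] by auto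
qed

lemma block_upper_add_elem:
  assumes "a \<noteq> b" "a < m \<or> m \<le> b"
  shows "block_upper N m (1\<^sub>m N + t \<cdot>\<^sub>m elem_mat N a b)"
  using assms det_add_elem[OF assms(1), of N t] by (auto simp: block_upper_def GL_iff_det elem_mat_def)

text \<open>
  The two hypotheses say that the span \<open>V\<close> of the first \<open>n\<close> columns does not contain the last basis vector and that it is not
  contained in the hyperplane spanned by the others. The second one provides a column operation among the first \<open>n\<close> columns that makes the last
  entry of column \<open>n\<close> nonzero. The first one says that the solution \<open>y\<close> of \<open>g y = e\<close>, with \<open>e\<close> the last basis
  vector, has a nonzero entry among the last \<open>n\<close>; a column operation among the last \<open>n\<close> columns makes its last entry
  nonzero, and then \<open>det_ul_nonzero\<close> applies.
\<close>

lemma chart_domain_reached: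
  assumes g: "g \<in> GL (2 * n)" and n: "n \<ge> 1"
    and Q: "gram (2 * n - 1) n g \<noteq> 0" "gram (2 * n - 1) n g \<noteq> gram (2 * n) n g"
  obtains p where "block_upper (2 * n) n p" "chart_domain n (g * p)"
proof -
  let ?N = "2 * n" let ?M = "2 * n - 1"
  have one: "block_upper ?N n (1\<^sub>m ?N)" by (auto simp: block_upper_def GL_iff_det)
  have S: "Suc ?M = ?N" "?M < ?N" "n - 1 < ?N" "n - 1 \<noteq> ?M" "n - 1 < n" "n \<le> ?M" using n by auto
  note gc = GL_carrier[OF g]
  have "\<exists>j<n. g $$ (?M, j) \<noteq> 0"
  proof (rule ccontr)
    assume "\<not> ?thesis"
    then have "g $$ (?M, j) = 0" if "j < n" for j using that by blast
    moreover have "{..<?N} = insert ?M {..<?M}" using n by auto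
    ultimately have "gram ?M n g = gram ?N n g"
      unfolding gram_def by (intro arg_cong[of _ _ det] eq_matI) auto
    with Q(2) show False ..
  qed
  then obtain j where j: "j < n" "g $$ (?M, j) \<noteq> 0" by blast
  have "\<exists>p1. block_upper ?N n p1 \<and> (g * p1) $$ (?M, n - 1) \<noteq> 0"
  proof (cases "g $$ (?M, n - 1) = 0")
    case False
    then show ?thesis using one gc by (intro exI[of _ "1\<^sub>m ?N"]) simp
  next
    case True
    then have "j \<noteq> n - 1" using j by auto
    have "(g * (1\<^sub>m ?N + 1 \<cdot>\<^sub>m elem_mat ?N j (n - 1))) $$ (?M, n - 1) = g $$ (?M, n - 1) + (if n - 1 = n - 1 then 1 * g $$ (?M, j) else 0)"
      by (rule mult_add_elem[OF gc]) (use j S in auto)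
    then show ?thesis using block_upper_add_elem[OF \<open>j \<noteq> n - 1\<close>, of n ?N 1] j True by auto
  qed
  then obtain p1 where p1: "block_upper ?N n p1" "(g * p1) $$ (?M, n - 1) \<noteq> 0" by blast
  have p1G: "p1 \<in> GL ?N" using p1(1) by (simp add: block_upper_def)
  define a where "a = g * p1"
  have aG: "a \<in> GL ?N" unfolding a_def by (rule GL_mult[OF g p1G])
  note ac = GL_carrier[OF aG]
  have "gram ?M n a = (det (ul n p1))\<^sup>2 * gram ?M n g"
    unfolding a_def using p1(1) by (intro gram_mult[OF gc GL_carrier[OF p1G]]) (auto simp: block_upper_def)
  then have Qa: "gram ?M n a \<noteq> 0" using Q(1) block_upper_blocks(3)[OF p1(1)] by simp
  obtain r where r: "r \<in> GL ?N" "a * r = 1\<^sub>m ?N" using GL_inverse[OF aG] by blast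
  define y where "y = r *\<^sub>v unit_vec ?N ?M"
  have yc: "y \<in> carrier_vec ?N" using GL_carrier[OF r(1)] by (simp add: y_def)
  have ay: "a *\<^sub>v y = unit_vec ?N ?M"
    unfolding y_def using assoc_mult_mat_vec[OF ac GL_carrier[OF r(1)], of "unit_vec ?N ?M"] r(2) by simp
  have "\<exists>l. n \<le> l \<and> l < ?N \<and> y $ l \<noteq> 0"
  proof (rule ccontr)
    assume "\<not> ?thesis"
    then have z: "y $ l = 0" if "n \<le> l" "l < ?N" for l using that by blast
    define z where "z = vec n (\<lambda>i. y $ i)"
    have az: "(\<Sum>j<n. a $$ (k, j) * z $ j) = (a *\<^sub>v y) $ k" if "k < ?N" for k
    proof -
      have "(a *\<^sub>v y) $ k = (\<Sum>j<?N. a $$ (k, j) * y $ j)"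
        using that ac yc by (simp add: scalar_prod_def atLeast0LessThan)
      also have "\<dots> = (\<Sum>j<n. a $$ (k, j) * y $ j)"
        by (rule sum.mono_neutral_right) (auto intro: z)
      finally show ?thesis by (simp add: z_def)
    qed
    have "z \<noteq> 0\<^sub>v n"
    proof
      assume "z = 0\<^sub>v n"
      then have "(\<Sum>j<n. a $$ (?M, j) * z $ j) = 0" by simp
      then show False using az[of ?M] ay S(2) by simp
    qed
    moreover have "z \<in> carrier_vec n" by (simp add: z_def)
    ultimately have "gram ?M n a = 0"
      by (intro gram_zero_if_kernel[of z]) (use az ay in auto)
    with Qa show False ..
  qed
  then obtain l where l: "n \<le> l" "l < ?N" "y $ l \<noteq> 0" by blast
  have "\<exists>p2. block_upper ?N n p2 \<and> (a * p2) $$ (?M, n - 1) \<noteq> 0 \<and> det (ul ?M (a * p2)) \<noteq> 0"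
  proof (cases "y $ ?M = 0")
    case False
    then have "det (ul ?M a) \<noteq> 0" using det_ul_nonzero[of a ?M y] aG yc ay by (simp add: S(1))
    then show ?thesis using one ac p1(2)[folded a_def] by (intro exI[of _ "1\<^sub>m ?N"]) simp
  next
    case True
    then have ne: "?M \<noteq> l" using l by auto
    let ?E = "1\<^sub>m ?N + 1 \<cdot>\<^sub>m elem_mat ?N ?M l"
    have bu: "block_upper ?N n ?E" by (rule block_upper_add_elem[OF ne]) (use l in simp)
    then have EG: "?E \<in> GL ?N" by (simp add: block_upper_def)
    have aE: "a * ?E \<in> GL ?N" by (rule GL_mult[OF aG EG])
    \<comment> \<open>the solution for the new matrix; it differs from \<open>y\<close> in the last entry, which is now \<open>- y\<^sub>l\<close>\<close>
    define y' where "y' = vec ?N (\<lambda>i. if i = ?M then - y $ l else y $ i)"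
    have y'c: "y' \<in> carrier_vec ?N" by (simp add: y'_def)
    have "?E *\<^sub>v y' = y"
    proof (rule eq_vecI)
      fix i assume "i < dim_vec y"
      then have i: "i < ?N" using yc by simp
      have "(?E *\<^sub>v y') $ i = (\<Sum>k<?N. (if k = i then y' $ k else 0) + (if k = l then (if i = ?M then y' $ k else 0) else 0))"
        using i by (auto simp: scalar_prod_def elem_mat_def y'_def atLeast0LessThan intro!: sum.cong)
      also have "\<dots> = y' $ i + (if i = ?M then y' $ l else 0)" using i l by (simp add: sum.distrib sum.delta)
      also have "\<dots> = y $ i" using i l ne True by (auto simp: y'_def)
      finally show "(?E *\<^sub>v y') $ i = y $ i" .
    qed (use yc in simp)
    then have "(a * ?E) *\<^sub>v y' = unit_vec ?N ?M"
      using assoc_mult_mat_vec[OF ac GL_carrier[OF EG] y'c] ay by simp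
    then have "det (ul ?M (a * ?E)) \<noteq> 0"
      using det_ul_nonzero[of "a * ?E" ?M y'] aE y'c l(3) S by (simp add: y'_def)
    moreover have "(a * ?E) $$ (?M, n - 1) = a $$ (?M, n - 1) + (if n - 1 = l then 1 * a $$ (?M, ?M) else 0)"
      by (rule mult_add_elem[OF ac]) (use l S in auto)
    ultimately show ?thesis using bu p1(2) l S by (intro exI[of _ ?E]) (auto simp: a_def)
  qed
  then obtain p2 where p2: "block_upper ?N n p2" "(a * p2) $$ (?M, n - 1) \<noteq> 0" "det (ul ?M (a * p2)) \<noteq> 0" by blast
  have p2G: "p2 \<in> GL ?N" using p2(1) by (simp add: block_upper_def)
  have "g * (p1 * p2) = a * p2"
    unfolding a_def by (rule assoc_mult_mat[OF gc GL_carrier[OF p1G] GL_carrier[OF p2G], symmetric])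
  then have "chart_domain n (g * (p1 * p2))" using p2 GL_mult[OF aG p2G] by (simp add: chart_domain_def)
  moreover have "block_upper ?N n (p1 * p2)" by (rule block_upper_mult[OF p1(1) p2(1)]) simp
  ultimately show ?thesis by (intro that)
qed

subsection \<open>Extending functions from the open double coset\<close>

text \<open>
  For \<open>g = h u\<^sub>t\<close> this is \<open>\<alpha> / (\<alpha> + \<beta> t\<^sup>2)\<close>. It is invariant under the parabolic subgroup, and its values 0 and 1 mark the
  complement of the open double coset.
\<close>

definition rel_height :: "nat \<Rightarrow> real mat \<Rightarrow> real" where
  "rel_height n g = gram (2 * n - 1) n g / gram (2 * n) n g"

lemma rel_height_mult:
  assumes g: "g \<in> GL (2 * n)" and p: "block_upper (2 * n) n p"
  shows "rel_height n (g * p) = rel_height n g"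
proof -
  have "gram r n (g * p) = (det (ul n p))\<^sup>2 * gram r n g" if "r \<le> 2 * n" for r
    using p that by (intro gram_mult[OF GL_carrier[OF g]]) (auto simp: block_upper_def GL_carrier)
  then show ?thesis using block_upper_blocks(3)[OF p] by (simp add: rel_height_def)
qed

lemma smooth_rel_height: "smooth (entries (2 * n)) (GL_coords (2 * n)) (\<lambda>x. rel_height n (mat (2 * n) (2 * n) x))"
  unfolding rel_height_def
proof (intro smooth_divide smooth_gram open_GL_coords)
  fix x assume "x \<in> GL_coords (2 * n)"
  then have "gram (2 * n) n (mat (2 * n) (2 * n) x) > 0" by (intro gram_pos) (simp_all add: GL_coords_def)
  then show "gram (2 * n) n (mat (2 * n) (2 * n) x) \<noteq> 0" by simp
qed (auto intro: smooth_entry)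

lemma rel_height_embed_u:
  assumes h: "h \<in> GL (2 * n - 1)" and n: "n \<ge> 1"
  shows "rel_height n (embed_u n h t) = gram (2 * n - 1) n h / (gram (2 * n - 1) n h + gram (2 * n - 1) (n - 1) h * t\<^sup>2)"
  by (simp add: rel_height_def gram_embed_u[OF h n] gram_embed_u_H[OF h n])

text \<open>
  The factor \<open>2 q (1 - q)\<close> is the Jacobian of the substitution \<open>q = \<alpha> / (\<alpha> + \<beta> t\<^sup>2)\<close> with respect to \<open>dt/t\<close>,
  up to sign; the constant \<open>a\<close> serves to normalize.
\<close>

definition cutoff :: "complex \<Rightarrow> real \<Rightarrow> complex" where
  "cutoff a q = a * of_real (2 * q * (1 - q) * bump q)"

lemma cutoff_0: "q \<le> 1 / 4 \<or> q \<ge> 3 / 4 \<Longrightarrow> cutoff a q = 0"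
  by (simp add: cutoff_def bump_0)

lemma smooth_cutoff: "open V \<Longrightarrow> smooth J V v \<Longrightarrow> smooth J V (\<lambda>y. cutoff a (v y))"
  unfolding cutoff_def by (intro smooth_mult smooth_const smooth_of_real smooth_diff smooth_bump)

definition coset_rep :: "nat \<Rightarrow> real mat \<Rightarrow> real mat \<times> real mat \<Rightarrow> bool" where
  "coset_rep n g = (\<lambda>(h, p). h \<in> GL (2 * n - 1) \<and> block_upper (2 * n) n p \<and> g = embed_u n h 1 * p)"

text \<open>
  The extension of \<open>F\<close> from \<open>H u\<^sub>1 P\<close> by zero. The choice of \<open>(h, p)\<close> does not matter by
  \<open>orbit_representative_unique\<close>; off the double coset it is arbitrary, but there the cutoff is zero.
\<close>

definition section_of :: "nat \<Rightarrow> bit \<times> bit \<Rightarrow> complex \<times> complex \<Rightarrow> complex \<Rightarrow> (real mat \<Rightarrow> complex) \<Rightarrow> real mat \<Rightarrow> complex" where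
  "section_of n \<xi> lam a F = (\<lambda>g\<in>GL (2 * n).
     (let (h, p) = SOME hp. coset_rep n g hp in pi_char n \<xi> lam p * F h) * cutoff a (rel_height n g))"

lemma section_of_eq:
  assumes F: "F \<in> tau_space n (\<xi>1, \<eta>, \<xi>2) (l1, \<nu>, l2)" and n: "n \<ge> 1"
    and h: "h \<in> GL (2 * n - 1)" and p: "block_upper (2 * n) n p" and g: "g = embed_u n h 1 * p"
  shows "section_of n (\<xi>1, \<xi>2) (l1, l2) a F g = pi_char n (\<xi>1, \<xi>2) (l1, l2) p * F h * cutoff a (rel_height n g)"
proof -
  have pG: "p \<in> GL (2 * n)" using p by (simp add: block_upper_def)
  have gG: "g \<in> GL (2 * n)" unfolding g by (rule GL_mult[OF embed_u_GL(1)[OF h n] pG])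
  obtain h' p' where sm: "(SOME hp. coset_rep n g hp) = (h', p')" by (metis prod.exhaust)
  have "coset_rep n g (h, p)" using h p g by (simp add: coset_rep_def)
  then have "coset_rep n g (h', p')" using sm someI[of "coset_rep n g" "(h, p)"] by simp
  then have h': "h' \<in> GL (2 * n - 1)" and p': "block_upper (2 * n) n p'" and g': "g = embed_u n h' 1 * p'"
    by (simp_all add: coset_rep_def)
  have p'G: "p' \<in> GL (2 * n)" using p' by (simp add: block_upper_def)
  obtain r where r: "block_upper (2 * n) n r" "p * r = 1\<^sub>m (2 * n)" "r * p = 1\<^sub>m (2 * n)"
    using block_upper_inverse[OF p] by auto
  have rG: "r \<in> GL (2 * n)" using r by (simp add: block_upper_def)
  note c = GL_carrier[OF pG] GL_carrier[OF p'G] GL_carrier[OF rG] GL_carrier[OF embed_u_GL(1)[OF h n, of 1]] GL_carrier[OF embed_u_GL(1)[OF h' n, of 1]]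
  have "embed_u n h 1 = embed_u n h 1 * (p * r)" unfolding r(2) by (rule right_mult_one_mat[OF c(4), symmetric])
  also have "\<dots> = embed_u n h' 1 * p' * r"
    by (simp only: assoc_mult_mat[OF c(4,1,3), symmetric] g[symmetric] g'[symmetric])
  also have "\<dots> = embed_u n h' 1 * (p' * r)" by (rule assoc_mult_mat[OF c(5,2,3)])
  finally have e: "embed_u n h 1 = embed_u n h' 1 * (p' * r)" .
  have bu: "block_upper (2 * n) n (p' * r)" by (rule block_upper_mult[OF p' r(1)]) simp
  obtain q where q: "H_parabolic n q" "h = h' * q" "tau_char n (\<xi>1, \<eta>, \<xi>2) (l1, \<nu>, l2) q = pi_char n (\<xi>1, \<xi>2) (l1, l2) (p' * r)"
    using orbit_representative_unique[OF h h' n bu e] by blast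
  have "F h = pi_char n (\<xi>1, \<xi>2) (l1, l2) (p' * r) * F h'"
    using F h' q by (simp add: tau_space_iff[OF n])
  then have "pi_char n (\<xi>1, \<xi>2) (l1, l2) p * F h = pi_char n (\<xi>1, \<xi>2) (l1, l2) (p' * r) * pi_char n (\<xi>1, \<xi>2) (l1, l2) p * F h'"
    by simp
  also have "pi_char n (\<xi>1, \<xi>2) (l1, l2) (p' * r) * pi_char n (\<xi>1, \<xi>2) (l1, l2) p = pi_char n (\<xi>1, \<xi>2) (l1, l2) p'"
    unfolding pi_char_mult[OF bu p, symmetric] assoc_mult_mat[OF c(2,3,1)] r(3) using c by simp
  finally have "pi_char n (\<xi>1, \<xi>2) (l1, l2) p * F h = pi_char n (\<xi>1, \<xi>2) (l1, l2) p' * F h'" .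
  then show ?thesis unfolding section_of_def restrict_apply if_P[OF gG] sm by (simp only: Let_def case_prod_conv)
qed

lemma rel_height_outside:
  assumes "g \<in> GL (2 * n)" "n \<ge> 1" "\<not> (gram (2 * n - 1) n g \<noteq> 0 \<and> gram (2 * n - 1) n g \<noteq> gram (2 * n) n g)"
  shows "rel_height n g = 0 \<or> rel_height n g = 1"
  using gram_pos[OF assms(1), of n] assms(3) by (auto simp: rel_height_def)

lemma coset_rep_exists:
  assumes g: "g \<in> GL (2 * n)" and n: "n \<ge> 1" and Q: "rel_height n g \<noteq> 0" "rel_height n g \<noteq> 1"
  obtains h p where "h \<in> GL (2 * n - 1)" "block_upper (2 * n) n p" "g = embed_u n h 1 * p"
proof -
  from rel_height_outside[OF g n] Q
  have "gram (2 * n - 1) n g \<noteq> 0" "gram (2 * n - 1) n g \<noteq> gram (2 * n) n g" by auto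
  then obtain p where p: "block_upper (2 * n) n p" "chart_domain n (g * p)"
    by (rule chart_domain_reached[OF g n])
  obtain p' where p': "chart n (g * p) \<in> GL (2 * n - 1)" "block_upper (2 * n) n p'" "g * p = embed_u n (chart n (g * p)) 1 * p'"
    using chart_factorization[OF p(2) n] by blast
  obtain r where r: "block_upper (2 * n) n r" "p * r = 1\<^sub>m (2 * n)" using block_upper_inverse[OF p(1)] by auto
  have c: "g \<in> carrier_mat (2 * n) (2 * n)" "p \<in> carrier_mat (2 * n) (2 * n)" "p' \<in> carrier_mat (2 * n) (2 * n)" "r \<in> carrier_mat (2 * n) (2 * n)"
    using g p p' r by (simp_all add: block_upper_def GL_carrier)
  have "g = g * (p * r)" using c r(2) by simp
  also have "\<dots> = embed_u n (chart n (g * p)) 1 * p' * r" using p'(3) by (simp add: assoc_mult_mat[OF c(1,2,4), symmetric])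
  also have "\<dots> = embed_u n (chart n (g * p)) 1 * (p' * r)"
    by (rule assoc_mult_mat[OF GL_carrier[OF embed_u_GL(1)[OF p'(1) n]] c(3,4)])
  finally have "g = embed_u n (chart n (g * p)) 1 * (p' * r)" .
  moreover have "block_upper (2 * n) n (p' * r)" by (rule block_upper_mult[OF p'(2) r(1)]) simp
  ultimately show ?thesis using p'(1) by (intro that)
qed

lemma section_of_equivariant:
  assumes F: "F \<in> tau_space n (\<xi>1, \<eta>, \<xi>2) (l1, \<nu>, l2)" and n: "n \<ge> 1"
    and g: "g \<in> GL (2 * n)" and p: "block_upper (2 * n) n p"
  shows "section_of n (\<xi>1, \<xi>2) (l1, l2) a F (g * p) =
    pi_char n (\<xi>1, \<xi>2) (l1, l2) p * section_of n (\<xi>1, \<xi>2) (l1, l2) a F g"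
proof (cases "rel_height n g = 0 \<or> rel_height n g = 1")
  case True
  have "g * p \<in> GL (2 * n)" using g p by (intro GL_mult) (simp_all add: block_upper_def)
  then show ?thesis using True g rel_height_mult[OF g p] by (auto simp: section_of_def cutoff_0)
next
  case False
  then obtain h p' where *: "h \<in> GL (2 * n - 1)" "block_upper (2 * n) n p'" "g = embed_u n h 1 * p'"
    using coset_rep_exists[OF g n] by auto
  have "g * p = embed_u n h 1 * (p' * p)"
    unfolding *(3)
    by (rule assoc_mult_mat[OF GL_carrier[OF embed_u_GL(1)[OF *(1) n]]], rule GL_carrier, use *(2) in \<open>simp add: block_upper_def\<close>,
        rule GL_carrier, use p in \<open>simp add: block_upper_def\<close>)
  moreover have "block_upper (2 * n) n (p' * p)" by (rule block_upper_mult[OF *(2) p]) simp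
  ultimately have "section_of n (\<xi>1, \<xi>2) (l1, l2) a F (g * p) =
      pi_char n (\<xi>1, \<xi>2) (l1, l2) (p' * p) * F h * cutoff a (rel_height n (g * p))"
    by (intro section_of_eq[OF F n *(1)])
  then show ?thesis
    unfolding section_of_eq[OF F n *] pi_char_mult[OF *(2) p] rel_height_mult[OF g p] by (simp only: mult.assoc mult.left_commute)
qed

lemma section_of_on_chart:
  assumes F: "F \<in> tau_space n (\<xi>1, \<eta>, \<xi>2) (l1, \<nu>, l2)" and n: "n \<ge> 1" and g: "chart_domain n g"
  shows "section_of n (\<xi>1, \<xi>2) (l1, l2) a F g =
    abs_char \<xi>1 (- l1 - of_nat n / 2) (g $$ (2 * n - 1, n - 1)) *
    abs_char \<xi>2 (- l2 + of_nat n / 2) (det g / det (chart n g) / g $$ (2 * n - 1, n - 1)) *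
    F (chart n g) * cutoff a (rel_height n g)"
proof -
  obtain p where p: "chart n g \<in> GL (2 * n - 1)" "block_upper (2 * n) n p" "g = embed_u n (chart n g) 1 * p"
    "det (ul n p) = g $$ (2 * n - 1, n - 1)" "det p = det g / det (chart n g)"
    using chart_factorization[OF g n] .
  show ?thesis unfolding section_of_eq[OF F n p(1-3)] by (simp only: pi_char_def case_prod_conv p(4,5))
qed

text \<open>
  A point where the quotient \<open>rel_height\<close> is not 0 or 1 is moved into the domain of the chart by a fixed \<open>p\<close>, and there the
  function is a composition of smooth ones. Near all other points the cutoff is zero.
\<close>

lemma smooth_section_of:
  assumes F: "F \<in> tau_space n (\<xi>1, \<eta>, \<xi>2) (l1, \<nu>, l2)" and n: "n \<ge> 1"
  shows "smooth_on_GL (2 * n) (section_of n (\<xi>1, \<xi>2) (l1, l2) a F)"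
  unfolding smooth_on_GL_iff
proof (rule smooth_local)
  let ?N = "2 * n" let ?M = "2 * n - 1" let ?J = "entries (2 * n)" let ?U = "GL_coords (2 * n)"
  let ?f = "section_of n (\<xi>1, \<xi>2) (l1, l2) a F" let ?m = "\<lambda>x. mat (2 * n) (2 * n) x"
  let ?Q = "\<lambda>x. rel_height n (?m x)"
  have Fs: "smooth_on_GL ?M F" using F by (simp add: tau_space_iff[OF n])
  fix x0 assume x0: "x0 \<in> ?U"
  then have g0: "?m x0 \<in> GL ?N" by (simp add: GL_coords_def)
  show "\<exists>V. open V \<and> x0 \<in> V \<and> smooth ?J V (\<lambda>x. ?f (?m x))"
  proof (cases "gram ?M n (?m x0) \<noteq> 0 \<and> gram ?M n (?m x0) \<noteq> gram ?N n (?m x0)")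
    case True
    then obtain p where p: "block_upper ?N n p" "chart_domain n (?m x0 * p)"
      using chart_domain_reached[OF g0 n] by blast
    have pG: "p \<in> GL ?N" using p(1) by (simp add: block_upper_def)
    have pc: "p \<in> carrier_mat ?N ?N" by (rule GL_carrier[OF pG])
    have S: "?M < ?N" "n - 1 < ?N" "n - 1 < ?M" using n by auto
    define g where "g x = ?m x * p" for x
    have gc: "g x \<in> carrier_mat ?N ?N" for x unfolding g_def by (rule mult_carrier_mat[OF _ pc]) simp
    have gG: "g x \<in> GL ?N" if "x \<in> ?U" for x unfolding g_def using that by (intro GL_mult pG) (simp add: GL_coords_def)
    have ge: "g x $$ (i, j) = (\<Sum>k<?N. x (i, k) * p $$ (k, j))" if "i < ?N" "j < ?N" for x i j
      using that pc by (simp add: g_def scalar_prod_def atLeast0LessThan)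
    have sg: "smooth ?J W (\<lambda>x. g x $$ (i, j))" if "open W" "i < ?N" "j < ?N" for W i j
      unfolding ge[OF that(2,3)] by (intro smooth_sum smooth_mult smooth_coord smooth_const that)
    define V where "V = {x \<in> ?U. g x $$ (?M, n - 1) * det (ul ?M (g x)) \<noteq> 0}"
    have sd: "smooth ?J ?U (\<lambda>x. g x $$ (?M, n - 1) * det (ul ?M (g x)))"
      by (intro smooth_mult smooth_det[of _ _ ?M] sg open_GL_coords S) (simp_all add: sg open_GL_coords)
    have oV: "open V"
    proof -
      have "open (?U \<inter> (\<lambda>x. g x $$ (?M, n - 1) * det (ul ?M (g x))) -` (- {0}))"
        using smooth_continuous[OF sd] open_GL_coords by (simp add: continuous_on_open_vimage open_Compl Int_commute)
      also have "\<dots> = V" by (auto simp: V_def)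
      finally show ?thesis .
    qed
    have VU: "x \<in> ?U" "chart_domain n (g x)" if "x \<in> V" for x using that gG by (auto simp: V_def chart_domain_def)
    have nz: "g x $$ (?M, n - 1) \<noteq> 0" if "x \<in> V" for x using VU(2)[OF that] by (simp add: chart_domain_def)
    have hG: "chart n (g x) \<in> GL ?M" if "x \<in> V" for x using chart_factorization[OF VU(2)[OF that] n] by blast
    have sh: "smooth ?J V (\<lambda>x. chart n (g x) $$ (i, k))" if "i < ?M" "k < ?M" for i k
    proof (cases "k = n - 1")
      case True
      have "smooth ?J V (\<lambda>x. g x $$ (i, n - 1) / g x $$ (?M, n - 1))"
        by (intro smooth_divide sg oV nz) (use that S in auto)
      then show ?thesis using True that by (simp add: chart_def)
    next
      case False
      have "smooth ?J V (\<lambda>x. g x $$ (i, k) - g x $$ (i, n - 1) * g x $$ (?M, k) / g x $$ (?M, n - 1))"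
        by (intro smooth_divide smooth_diff smooth_mult sg oV nz) (use that S in auto)
      then show ?thesis using False that by (simp add: chart_def)
    qed
    have sdh: "smooth ?J V (\<lambda>x. det (chart n (g x)))"
      by (rule smooth_det[OF oV _ sh]) (simp_all add: chart_def)
    have dh: "det (chart n (g x)) \<noteq> 0" if "x \<in> V" for x by (rule GL_det[OF hG[OF that]])
    have dg: "det (g x) \<noteq> 0" if "x \<in> V" for x by (rule GL_det[OF gG[OF VU(1)[OF that]]])
    have "smooth ?J V (\<lambda>x. (1 / pi_char n (\<xi>1, \<xi>2) (l1, l2) p) *
       (abs_char \<xi>1 (- l1 - of_nat n / 2) (g x $$ (?M, n - 1)) *
        abs_char \<xi>2 (- l2 + of_nat n / 2) (det (g x) / det (chart n (g x)) / g x $$ (?M, n - 1)) *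
        F (chart n (g x)) * cutoff a (rel_height n (?m x))))"
    proof (intro smooth_mult smooth_const smooth_abs_char smooth_divide smooth_cutoff oV sg S sdh)
      show "smooth ?J V (\<lambda>x. det (g x))" by (rule smooth_det[OF oV gc sg[OF oV]])
      show "smooth ?J V (\<lambda>x. F (chart n (g x)))" by (rule smooth_compose_GL[OF Fs oV sh hG])
      show "smooth ?J V (\<lambda>x. rel_height n (?m x))" by (rule smooth_subset[OF smooth_rel_height]) (use VU in auto)
    qed (simp_all add: nz dh dg)
    then have "smooth ?J V (\<lambda>x. ?f (?m x))"
    proof (rule smooth_cong[OF oV, rotated])
      fix x assume x: "x \<in> V"
      have mG: "?m x \<in> GL ?N" using VU(1)[OF x] by (simp add: GL_coords_def)
      have "?f (g x) = pi_char n (\<xi>1, \<xi>2) (l1, l2) p * ?f (?m x)"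
        unfolding g_def by (rule section_of_equivariant[OF F n mG p(1)])
      then have "?f (?m x) = (1 / pi_char n (\<xi>1, \<xi>2) (l1, l2) p) * ?f (g x)"
        using pi_char_nz[OF p(1)] by simp
      then show "(1 / pi_char n (\<xi>1, \<xi>2) (l1, l2) p) *
       (abs_char \<xi>1 (- l1 - of_nat n / 2) (g x $$ (?M, n - 1)) *
        abs_char \<xi>2 (- l2 + of_nat n / 2) (det (g x) / det (chart n (g x)) / g x $$ (?M, n - 1)) *
        F (chart n (g x)) * cutoff a (rel_height n (?m x))) = ?f (?m x)"
        using section_of_on_chart[OF F n VU(2)[OF x], of a] rel_height_mult[OF mG p(1)] by (simp add: g_def)
    qed
    moreover have "x0 \<in> V" using x0 p(2) by (simp add: V_def chart_domain_def g_def)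
    ultimately show ?thesis using oV by blast
  next
    case False
    define V where "V = ?Q -` (- {1 / 4..3 / 4}) \<inter> ?U"
    have "open V" unfolding V_def
      by (rule iffD1[OF continuous_on_open_vimage[OF open_GL_coords] smooth_continuous[OF smooth_rel_height], rule_format])
        (rule open_Compl, rule closed_atLeastAtMost)
    moreover have "x0 \<in> V"
    proof -
      have "?Q x0 \<in> - {1 / 4..3 / 4}" using rel_height_outside[OF g0 n False] by auto
      then show ?thesis using x0 by (simp add: V_def)
    qed
    moreover have "smooth ?J V (\<lambda>x. ?f (?m x))"
    proof (rule smooth_cong[where u = "\<lambda>x. 0"])
      show "open V" by fact
      then show "smooth ?J V (\<lambda>x. 0 :: complex)" by (rule smooth_const)
      fix x assume x: "x \<in> V"
      have m: "?m x \<in> GL ?N" using x by (simp add: V_def GL_coords_def)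
      have "?Q x \<notin> {1 / 4..3 / 4}" using x by (simp only: V_def Int_iff vimage_eq Compl_iff not_False_eq_True)
      then have "?Q x \<le> 1 / 4 \<or> ?Q x \<ge> 3 / 4" unfolding atLeastAtMost_iff by linarith
      then have "cutoff a (?Q x) = 0" by (rule cutoff_0)
      then show "0 = ?f (?m x)" unfolding section_of_def restrict_apply if_P[OF m] by (simp only: mult_zero_right)
    qed
    ultimately show ?thesis by blast
  qed
qed

lemma section_of_in_pi_space:
  assumes "F \<in> tau_space n (\<xi>1, \<eta>, \<xi>2) (l1, \<nu>, l2)" "n \<ge> 1"
  shows "section_of n (\<xi>1, \<xi>2) (l1, l2) a F \<in> pi_space n (\<xi>1, \<xi>2) (l1, l2)"
  unfolding pi_space_iff
proof (intro conjI ballI allI impI)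
  show "section_of n (\<xi>1, \<xi>2) (l1, l2) a F \<in> extensional (GL (2 * n))" by (simp add: section_of_def)
qed (rule smooth_section_of[OF assms], rule section_of_equivariant[OF assms])

subsection \<open>Values of the operator on the extensions\<close>

text \<open>
  With \<open>q\<close> the diagonal matrix with middle entry \<open>1/t\<close>, the cosets of \<open>h u\<^sub>t\<close> and \<open>h q u\<^sub>1\<close> agree. The transformation law
  of \<open>F\<close> under \<open>q\<close> and the character of \<open>\<pi>\<close> give a power of \<open>t\<close> that cancels the kernel of the operator.
\<close>

lemma section_of_embed_u:
  assumes F: "F \<in> tau_space n (\<xi>1, \<eta>, \<xi>2) (l1, \<nu>, l2)" and n: "n \<ge> 1" and h: "h \<in> GL (2 * n - 1)" and t: "t \<noteq> 0"
  shows "abs_char (\<xi>1 + \<eta>) (l1 - \<nu> + of_nat n / 2) t * section_of n (\<xi>1, \<xi>2) (l1, l2) a F (embed_u n h t) =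
    F h * cutoff a (rel_height n (embed_u n h t))"
proof -
  let ?M = "2 * n - 1" let ?f = "section_of n (\<xi>1, \<xi>2) (l1, l2) a F"
  define q where "q = mat ?M ?M (\<lambda>(i, j). if i = j then (if i = n - 1 then 1 / t else 1) else 0)"
  have qc: "q \<in> carrier_mat ?M ?M" by (simp add: q_def)
  have "upper_triangular q" by (auto simp: upper_triangular_def q_def)
  then have "det q = prod_list (diag_mat q)" by (rule det_upper_triangular[OF _ qc])
  also have "\<dots> = (\<Prod>i = 0..<?M. if i = n - 1 then 1 / t else 1)"
    unfolding prod_list_diag_prod by (rule prod.cong) (auto simp: q_def)
  also have "\<dots> = 1 / t" using n by (simp add: prod.delta)
  finally have dq: "det q = 1 / t" .
  have qG: "q \<in> GL ?M" using qc dq t by (simp add: GL_iff_det)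
  have q: "H_parabolic n q" using qG by (auto simp: H_parabolic_def block_upper_def q_def)
  have q11: "q $$ (n - 1, n - 1) = 1 / t" using n by (simp add: q_def)
  have ulq: "ul (n - 1) q = 1\<^sub>m (n - 1)" by (rule eq_matI) (auto simp: q_def)
  have hq: "h * q \<in> GL ?M" by (rule GL_mult[OF h qG])
  obtain p where p: "block_upper (2 * n) n p" "embed_u n (h * q) 1 = embed_u n h (1 / q $$ (n - 1, n - 1)) * p"
    "det (ul n p) = det (ul (n - 1) q) * q $$ (n - 1, n - 1)" "det p = det q"
    using embed_u_mult_right[OF h n q, of 1] .
  have e: "embed_u n (h * q) 1 = embed_u n h t * p" using p(2) by (simp add: q11)
  have dp: "det (ul n p) = 1 / t" "det p = 1 / t" using p(3,4) by (simp_all add: q11 ulq dq)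
  have one: "block_upper (2 * n) n (1\<^sub>m (2 * n))" by (auto simp: block_upper_def GL_iff_det)
  have "ul n (1\<^sub>m (2 * n)) = 1\<^sub>m n" by (rule eq_matI) auto
  then have pc1: "pi_char n (\<xi>1, \<xi>2) (l1, l2) (1\<^sub>m (2 * n)) = 1" by (simp add: pi_char_def)
  have "?f (embed_u n (h * q) 1) = 1 * F (h * q) * cutoff a (rel_height n (embed_u n (h * q) 1))"
    unfolding pc1[symmetric]
    by (rule section_of_eq[OF F n hq one], rule right_mult_one_mat[OF GL_carrier[OF embed_u_GL(1)[OF hq n]], symmetric])
  moreover have "?f (embed_u n (h * q) 1) = pi_char n (\<xi>1, \<xi>2) (l1, l2) p * ?f (embed_u n h t)"
    unfolding e by (rule section_of_equivariant[OF F n embed_u_GL(1)[OF h n] p(1)])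
  moreover have "rel_height n (embed_u n (h * q) 1) = rel_height n (embed_u n h t)"
    unfolding e by (rule rel_height_mult[OF embed_u_GL(1)[OF h n] p(1)])
  moreover have "F (h * q) = tau_char n (\<xi>1, \<eta>, \<xi>2) (l1, \<nu>, l2) q * F h"
    using F h q by (simp add: tau_space_iff[OF n])
  moreover have "pi_char n (\<xi>1, \<xi>2) (l1, l2) p = abs_char \<xi>1 (l1 + of_nat n / 2) t"
    using abs_char_inverse[OF t, of \<xi>1 "- l1 - of_nat n / 2"] t by (simp add: pi_char_def dp add.commute)
  moreover have "tau_char n (\<xi>1, \<eta>, \<xi>2) (l1, \<nu>, l2) q = abs_char \<eta> \<nu> t"
    using abs_char_inverse[OF t, of \<eta> "- \<nu>"] t by (simp add: tau_char_def ulq q11 dq)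
  ultimately have 1: "abs_char \<xi>1 (l1 + of_nat n / 2) t * ?f (embed_u n h t) = abs_char \<eta> \<nu> t * F h * cutoff a (rel_height n (embed_u n h t))"
    by simp
  have 2: "abs_char \<eta> (- \<nu>) t * abs_char \<eta> \<nu> t = 1"
  proof -
    have "abs_char \<eta> (- \<nu>) t * abs_char \<eta> \<nu> t = abs_char (\<eta> + \<eta>) (- \<nu> + \<nu>) t" by (rule abs_char_add[OF t, symmetric])
    also have "\<dots> = 1" using t by (cases \<eta>) simp_all
    finally show ?thesis .
  qed
  have "abs_char (\<xi>1 + \<eta>) ((l1 + of_nat n / 2) + - \<nu>) t = abs_char \<xi>1 (l1 + of_nat n / 2) t * abs_char \<eta> (- \<nu>) t"
    by (rule abs_char_add[OF t])
  also have "(l1 + of_nat n / 2) + - \<nu> = l1 - \<nu> + of_nat n / 2" by simp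
  finally have "abs_char (\<xi>1 + \<eta>) (l1 - \<nu> + of_nat n / 2) t * ?f (embed_u n h t) =
      abs_char \<eta> (- \<nu>) t * (abs_char \<xi>1 (l1 + of_nat n / 2) t * ?f (embed_u n h t))"
    by (simp only: mult.assoc mult.left_commute)
  also have "\<dots> = (abs_char \<eta> (- \<nu>) t * abs_char \<eta> \<nu> t) * (F h * cutoff a (rel_height n (embed_u n h t)))"
    unfolding 1 by (simp only: mult.assoc)
  finally show ?thesis unfolding 2 by (simp only: mult_1)
qed

lemma section_of_embed_w:
  assumes F: "F \<in> tau_space n (\<xi>1, \<eta>, \<xi>2) (l1, \<nu>, l2)" and n: "n \<ge> 1" and h: "h \<in> GL (2 * n - 1)" and t: "t \<noteq> 0"
  shows "abs_char (\<xi>2 + \<eta>) (\<nu> - l2 + of_nat n / 2) t * section_of n (\<xi>1, \<xi>2) (l1, l2) a F (embed_w n h t) =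
    F h * cutoff a (rel_height n (embed_u n h (1 / t)))"
proof -
  have t': "1 / t \<noteq> 0" "1 / (1 / t) = t" using t by simp_all
  show ?thesis
    using near_far_transition[OF section_of_in_pi_space[OF F n] h n t'(1), of \<eta> \<nu> a] section_of_embed_u[OF F n h t'(1), of a]
    by (simp only: t'(2))
qed

lemma abs_char_mult_zero: "t \<noteq> 0 \<Longrightarrow> abs_char \<epsilon> s t * z = 0 \<Longrightarrow> z = 0"
  using abs_char_nz[of t \<epsilon> s] by simp

text \<open>
  If the kernel times the section does not depend on the sign of \<open>t\<close>, both half lines contribute the same amount.
\<close>

lemma mellin_of_profile:
  fixes A :: "real \<Rightarrow> real \<Rightarrow> complex"
  assumes ab: "\<alpha> > 0" "\<beta> > 0"
    and d: "\<And>t. of_real t ^ bit_rep \<epsilon> * d0 t = A 1 t + (- 1) ^ bit_rep \<epsilon> * A (- 1) t"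
    and A: "\<And>\<sigma> t. \<sigma> \<in> {1, - 1} \<Longrightarrow> t > 0 \<Longrightarrow> abs_char \<epsilon> s (\<sigma> * t) * A \<sigma> t = P t"
  shows "mellin d0 \<alpha> \<beta> (s + of_nat (bit_rep \<epsilon>)) 0 = integral {0..1} (\<lambda>t. 2 * (P t / of_real t))"
proof -
  have "of_real t powr (s + of_nat (bit_rep \<epsilon>) - 1) * of_real (\<alpha> + \<beta> * t\<^sup>2) powr 0 * d0 t = 2 * (P t / of_real t)"
    if t: "t \<in> {0..1}" for t
  proof (cases "t = 0")
    case False
    then have t0: "t > 0" using t by simp
    have "complex_of_real (\<alpha> + \<beta> * t\<^sup>2) \<noteq> 0" using quadratic_pos[OF ab, of t] by (metis less_numeral_extra(3) of_real_eq_0_iff)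
    then have k: "complex_of_real (\<alpha> + \<beta> * t\<^sup>2) powr 0 = 1" by (simp only: powr_def if_False mult_zero_left exp_zero)
    have "complex_of_real t powr (s + of_nat (bit_rep \<epsilon>) - 1) = of_real t powr (s - 1) * of_real t ^ bit_rep \<epsilon>"
    proof -
      have "s + of_nat (bit_rep \<epsilon>) - 1 = (s - 1) + of_nat (bit_rep \<epsilon>)" by simp
      then show ?thesis using t0 by (simp only: powr_add) (simp add: powr_nat')
    qed
    also have "of_real t powr (s - 1) = of_real t powr s / of_real t" using t0 by (simp add: powr_diff)
    finally have "of_real t powr (s + of_nat (bit_rep \<epsilon>) - 1) * of_real (\<alpha> + \<beta> * t\<^sup>2) powr 0 * d0 t =
        (of_real t powr s / of_real t) * (of_real t ^ bit_rep \<epsilon> * d0 t)"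
      unfolding k by (simp only: mult.assoc mult_1_right mult_1)
    also have "\<dots> = (of_real t powr s * A 1 t + (- 1) ^ bit_rep \<epsilon> * of_real t powr s * A (- 1) t) / of_real t"
      unfolding d by (simp add: algebra_simps add_divide_distrib)
    also have "of_real t powr s * A 1 t = P t"
      using A[of 1 t] abs_char_sign[of 1 t \<epsilon> s] t0 by simp
    also have "(- 1) ^ bit_rep \<epsilon> * of_real t powr s * A (- 1) t = P t"
      using A[of "- 1" t] abs_char_sign[of "- 1" t \<epsilon> s] t0 by simp
    finally show ?thesis by simp
  qed simp
  then show ?thesis unfolding mellin_def by (rule Henstock_Kurzweil_Integration.integral_cong)
qed

text \<open>
  The function \<open>q\<close> solves \<open>t dq/dt = \<sigma> 2 q (1 - q)\<close>, so the integrand is the derivative of \<open>\<sigma> bump_cdf (q t)\<close>.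
\<close>

lemma logistic_substitution:
  fixes q :: "real \<Rightarrow> real"
  assumes q: "continuous_on {0..1} q" "\<And>t. 0 \<le> t \<Longrightarrow> t \<le> 1 \<Longrightarrow> q t \<in> {0..1}"
    and dq: "\<And>t. 0 < t \<Longrightarrow> t < 1 \<Longrightarrow> 0 < q t \<and> q t < 1 \<and> (q has_real_derivative \<sigma> * (2 * q t * (1 - q t) / t)) (at t)"
    and \<sigma>: "\<sigma> * \<sigma> = 1"
  shows "integral {0..1} (\<lambda>t. 2 * (c * cutoff a (q t) / of_real t)) = 2 * c * a * of_real (\<sigma> * (bump_cdf (q 1) - bump_cdf (q 0)))"
proof -
  have "((\<lambda>t. 2 * q t * (1 - q t) * bump (q t) / t) has_integral \<sigma> * bump_cdf (q 1) - \<sigma> * bump_cdf (q 0)) {0..1}"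
  proof (rule fundamental_theorem_of_calculus_interior)
    show "continuous_on {0..1} (\<lambda>t. \<sigma> * bump_cdf (q t))"
      by (intro continuous_on_mult continuous_on_const continuous_on_compose2[OF continuous_bump_cdf q(1)]) (use q(2) in auto)
    fix t :: real assume "t \<in> {0<..<1}"
    then have t: "0 < t" "t < 1" by simp_all
    have "((\<lambda>t. bump_cdf (q t)) has_real_derivative bump (q t) * (\<sigma> * (2 * q t * (1 - q t) / t))) (at t)"
      by (rule DERIV_chain2) (use bump_cdf_derivative dq[OF t] in auto)
    then have "((\<lambda>t. \<sigma> * bump_cdf (q t)) has_real_derivative \<sigma> * (bump (q t) * (\<sigma> * (2 * q t * (1 - q t) / t)))) (at t)"
      by (rule DERIV_cmult)
    moreover have "\<sigma> * (bump (q t) * (\<sigma> * (2 * q t * (1 - q t) / t))) = (\<sigma> * \<sigma>) * (2 * q t * (1 - q t) * bump (q t) / t)"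
      by simp
    ultimately show "((\<lambda>t. \<sigma> * bump_cdf (q t)) has_vector_derivative 2 * q t * (1 - q t) * bump (q t) / t) (at t)"
      unfolding \<sigma> mult_1 by (simp only: has_real_derivative_iff_has_vector_derivative)
  qed simp
  from has_integral_mult_right[OF has_integral_linear[OF this bounded_linear_of_real], of "2 * c * a"]
  have "((\<lambda>t. 2 * c * a * of_real (2 * q t * (1 - q t) * bump (q t) / t)) has_integral
      2 * c * a * of_real (\<sigma> * bump_cdf (q 1) - \<sigma> * bump_cdf (q 0))) {0..1}" by (simp only: o_def)
  moreover have "(\<lambda>t. 2 * c * a * of_real (2 * q t * (1 - q t) * bump (q t) / t)) = (\<lambda>t. 2 * (c * cutoff a (q t) / of_real t))"
    by (auto simp: cutoff_def)
  ultimately show ?thesis by (simp only: right_diff_distrib integral_unique)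
qed

lemma logistic_ratio_derivative:
  fixes \<alpha> \<beta> t :: real
  assumes "\<alpha> > 0" "\<beta> > 0" "t > 0"
  shows "((\<lambda>t. \<alpha> / (\<alpha> + \<beta> * t\<^sup>2)) has_real_derivative
      - 1 * (2 * (\<alpha> / (\<alpha> + \<beta> * t\<^sup>2)) * (1 - \<alpha> / (\<alpha> + \<beta> * t\<^sup>2)) / t)) (at t)"
    and "((\<lambda>t. \<alpha> * t\<^sup>2 / (\<beta> + \<alpha> * t\<^sup>2)) has_real_derivative
      1 * (2 * (\<alpha> * t\<^sup>2 / (\<beta> + \<alpha> * t\<^sup>2)) * (1 - \<alpha> * t\<^sup>2 / (\<beta> + \<alpha> * t\<^sup>2)) / t)) (at t)"
proof -
  have p: "\<alpha> + \<beta> * t\<^sup>2 \<noteq> 0" "\<beta> + \<alpha> * t\<^sup>2 \<noteq> 0" using quadratic_pos[of \<alpha> \<beta> t] quadratic_pos[of \<beta> \<alpha> t] assms by auto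
  have 1: "2 * (\<alpha> / (\<alpha> + \<beta> * t\<^sup>2)) * (1 - \<alpha> / (\<alpha> + \<beta> * t\<^sup>2)) / t = 2 * \<alpha> * \<beta> * t / (\<alpha> + \<beta> * t\<^sup>2)\<^sup>2"
    using p(1) assms(3) by (simp add: diff_divide_eq_iff power2_eq_square)
  have 2: "2 * (\<alpha> * t\<^sup>2 / (\<beta> + \<alpha> * t\<^sup>2)) * (1 - \<alpha> * t\<^sup>2 / (\<beta> + \<alpha> * t\<^sup>2)) / t = 2 * \<alpha> * \<beta> * t / (\<beta> + \<alpha> * t\<^sup>2)\<^sup>2"
    using p(2) assms(3) by (simp add: diff_divide_eq_iff power2_eq_square)
  show "((\<lambda>t. \<alpha> / (\<alpha> + \<beta> * t\<^sup>2)) has_real_derivative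
      - 1 * (2 * (\<alpha> / (\<alpha> + \<beta> * t\<^sup>2)) * (1 - \<alpha> / (\<alpha> + \<beta> * t\<^sup>2)) / t)) (at t)"
    unfolding 1 using p(1) by (auto intro!: derivative_eq_intros simp: power2_eq_square)
  show "((\<lambda>t. \<alpha> * t\<^sup>2 / (\<beta> + \<alpha> * t\<^sup>2)) has_real_derivative
      1 * (2 * (\<alpha> * t\<^sup>2 / (\<beta> + \<alpha> * t\<^sup>2)) * (1 - \<alpha> * t\<^sup>2 / (\<beta> + \<alpha> * t\<^sup>2)) / t)) (at t)"
    unfolding 2 using p(2) by (auto intro!: derivative_eq_intros simp: power2_eq_square) (simp add: algebra_simps)
qed

lemma small_square_bound:
  fixes \<alpha> \<beta> t :: real
  assumes "\<alpha> > 0" "\<beta> > 0" "0 < t" "t < min 1 (\<alpha> / (3 * \<beta>))"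
  shows "3 * \<beta> * t\<^sup>2 \<le> \<alpha>"
proof -
  have "t\<^sup>2 \<le> t" using assms by (simp add: power2_eq_square mult_left_le)
  then have "3 * \<beta> * t\<^sup>2 \<le> 3 * \<beta> * t" using assms by simp
  also have "\<dots> \<le> \<alpha>" using assms by (simp add: field_simps)
  finally show ?thesis .
qed

lemma vanishes_near_0_of_parts:
  fixes A :: "real \<Rightarrow> real \<Rightarrow> complex"
  assumes d: "\<And>t. of_real t ^ bit_rep \<epsilon> * d0 t = A 1 t + (- 1) ^ bit_rep \<epsilon> * A (- 1) t"
    and A: "\<And>\<sigma> t. \<sigma> \<in> {1, - 1} \<Longrightarrow> t > 0 \<Longrightarrow> abs_char \<epsilon> s (\<sigma> * t) * A \<sigma> t = P t"
    and P: "\<delta> > 0" "\<And>t. 0 < t \<Longrightarrow> t < \<delta> \<Longrightarrow> P t = 0"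
  shows "vanishes_near_0 d0"
  unfolding vanishes_near_0_def
proof (intro exI conjI allI impI)
  show "\<delta> > 0" by fact
  fix t assume t: "0 < t \<and> t < \<delta>"
  have "A \<sigma> t = 0" if "\<sigma> \<in> {1, - 1}" for \<sigma>
    by (rule abs_char_mult_zero[of "\<sigma> * t" \<epsilon> s]) (use A[OF that] P(2) t that in auto)
  then have "of_real t ^ bit_rep \<epsilon> * d0 t = 0" unfolding d by simp
  then show "d0 t = 0" using t by simp
qed

text \<open>
  The integrals over \<open>|t| < 1\<close> and \<open>|t| > 1\<close> are the increments of \<open>bump_cdf\<close> over \<open>[q\<^sub>1, 1]\<close> and \<open>[0, q\<^sub>1]\<close>, where
  \<open>q\<^sub>1 = \<alpha> / (\<alpha> + \<beta>)\<close> is the value at \<open>|t| = 1\<close>. Their sum does not depend on \<open>h\<close>.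
\<close>

lemma B_op_section_of:
  assumes F: "F \<in> tau_space n (\<xi>1, \<eta>, \<xi>2) (l1, \<nu>, l2)" and n: "n \<ge> 1" and h: "h \<in> GL (2 * n - 1)"
  shows "B_op n (\<xi>1, \<xi>2) \<eta> (l1, l2) \<nu> (section_of n (\<xi>1, \<xi>2) (l1, l2) a F) h =
    rGamma ((l1 - \<nu> + of_nat n / 2 + of_nat (bit_rep (\<xi>1 + \<eta>))) / 2) *
    rGamma ((\<nu> - l2 + of_nat n / 2 + of_nat (bit_rep (\<xi>2 + \<eta>))) / 2) * (2 * a * of_real (bump_cdf 1 - bump_cdf 0)) * F h"
proof -
  define f where "f = section_of n (\<xi>1, \<xi>2) (l1, l2) a F"
  define x where "x = (\<lambda>p. h $$ p)"
  have Hx: "H_mat n x = h" unfolding x_def by (rule H_mat_entries[OF GL_carrier[OF h]])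
  have x: "x \<in> GL_coords (2 * n - 1)" using h by (simp add: H_mat_GL Hx)
  define \<alpha> \<beta> where "\<alpha> = alpha n x" and "\<beta> = beta n x"
  have ab: "\<alpha> > 0" "\<beta> > 0" unfolding \<alpha>_def \<beta>_def by (rule alpha_beta_pos[OF x n])+
  define s s' where "s = l1 - \<nu> + of_nat n / 2" and "s' = \<nu> - l2 + of_nat n / 2"
  have fpi: "f \<in> pi_space n (\<xi>1, \<xi>2) (l1, l2)" unfolding f_def by (rule section_of_in_pi_space[OF F n])
  then have fs: "smooth_on_GL (2 * n) f" by (simp add: pi_space_iff)
  note ec = even_chain_seqs[OF fs n x]
  have Q: "rel_height n (embed_u n h t) = \<alpha> / (\<alpha> + \<beta> * t\<^sup>2)" for t
    by (simp add: rel_height_embed_u[OF h n] \<alpha>_def \<beta>_def alpha_def beta_def Hx)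
  have Q': "rel_height n (embed_u n h (1 / t)) = \<alpha> * t\<^sup>2 / (\<beta> + \<alpha> * t\<^sup>2)" if "t > 0" for t
    unfolding Q using that ab by (simp add: field_simps power_divide)
  \<comment> \<open>the quotient \<open>rel_height\<close> along the line in the coordinates \<open>t\<close> and \<open>1/t\<close>\<close>
  define q q' where "q t = \<alpha> / (\<alpha> + \<beta> * t\<^sup>2)" and "q' t = \<alpha> * t\<^sup>2 / (\<beta> + \<alpha> * t\<^sup>2)" for t
  have d: "of_real t ^ bit_rep \<epsilon> * near_seq n \<epsilon> f x 0 t = near_fun n f 1 (x(slot n := t)) + (- 1) ^ bit_rep \<epsilon> * near_fun n f (- 1) (x(slot n := t))"
    "of_real t ^ bit_rep \<epsilon> * far_seq n \<epsilon> f x 0 t = far_fun n f 1 (x(slot n := t)) + (- 1) ^ bit_rep \<epsilon> * far_fun n f (- 1) (x(slot n := t))" for t \<epsilon>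
    unfolding near_seq_def far_seq_def
    by (rule reflected_pair.parity_chain_0[OF reflected_pairs(1)[OF fs n] x], rule reflected_pair.parity_chain_0[OF reflected_pairs(2)[OF fs n] x])
  have N: "abs_char (\<xi>1 + \<eta>) s (\<sigma> * t) * near_fun n f \<sigma> (x(slot n := t)) = F h * cutoff a (q t)"
    if "\<sigma> \<in> {1, - 1}" "t > 0" for \<sigma> t
  proof -
    have "\<sigma> * t \<noteq> 0" "(\<sigma> * t)\<^sup>2 = t\<^sup>2" using that by auto
    with section_of_embed_u[OF F n h this(1), of a] show ?thesis
      by (simp add: near_fun_def Hx f_def s_def Q q_def)
  qed
  have W: "abs_char (\<xi>2 + \<eta>) s' (\<sigma> * t) * far_fun n f \<sigma> (x(slot n := t)) = F h * cutoff a (q' t)"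
    if "\<sigma> \<in> {1, - 1}" "t > 0" for \<sigma> t
  proof -
    have nz: "\<sigma> * t \<noteq> 0" "(1 / (\<sigma> * t))\<^sup>2 = (1 / t)\<^sup>2" using that by (auto simp: power_divide)
    have "rel_height n (embed_u n h (1 / (\<sigma> * t))) = q' t" using Q'[OF that(2)] unfolding Q nz(2) q'_def .
    with section_of_embed_w[OF F n h nz(1), of a] show ?thesis
      by (simp add: far_fun_def Hx f_def s'_def)
  qed
  have vN: "vanishes_near_0 (near_seq n (\<xi>1 + \<eta>) f x 0)"
  proof (rule vanishes_near_0_of_parts[OF d(1) N])
    show "0 < min 1 (\<alpha> / (3 * \<beta>))" using ab by simp
    fix t assume t: "0 < t" "t < min 1 (\<alpha> / (3 * \<beta>))"
    have "q t \<ge> 3 / 4" unfolding q_def using small_square_bound[OF ab t] quadratic_pos[OF ab, of t] by (simp add: field_simps)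
    then show "F h * cutoff a (q t) = 0" by (simp add: cutoff_0)
  qed
  have vW: "vanishes_near_0 (far_seq n (\<xi>2 + \<eta>) f x 0)"
  proof (rule vanishes_near_0_of_parts[OF d(2) W])
    show "0 < min 1 (\<beta> / (3 * \<alpha>))" using ab by simp
    fix t assume t: "0 < t" "t < min 1 (\<beta> / (3 * \<alpha>))"
    have "q' t \<le> 1 / 4" unfolding q'_def using small_square_bound[OF ab(2,1) t] quadratic_pos[OF ab(2,1), of t] by (simp add: field_simps)
    then show "F h * cutoff a (q' t) = 0" by (simp add: cutoff_0)
  qed
  have cq: "continuous_on {0..1} q" "continuous_on {0..1} q'"
    unfolding q_def q'_def using quadratic_pos[OF ab] quadratic_pos[OF ab(2,1)]
    by (auto intro!: continuous_intros simp: less_imp_neq[symmetric])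
  have rq: "q t \<in> {0..1}" "q' t \<in> {0..1}" for t
    unfolding q_def q'_def using ab quadratic_pos[OF ab, of t] quadratic_pos[OF ab(2,1), of t] by (auto simp: field_simps)
  have sq: "0 < q t \<and> q t < 1" "0 < q' t \<and> q' t < 1" if "t > 0" for t
    unfolding q_def q'_def using that ab quadratic_pos[OF ab, of t] quadratic_pos[OF ab(2,1), of t] by (auto simp: field_simps)
  have "mellin (near_seq n (\<xi>1 + \<eta>) f x 0) \<alpha> \<beta> (s + of_nat (bit_rep (\<xi>1 + \<eta>))) 0 = integral {0..1} (\<lambda>t. 2 * (F h * cutoff a (q t) / of_real t))"
    by (rule mellin_of_profile[OF ab d(1) N])
  also have "\<dots> = 2 * F h * a * of_real (- 1 * (bump_cdf (q 1) - bump_cdf (q 0)))"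
    by (rule logistic_substitution[OF cq(1) rq(1)]) (use sq(1) logistic_ratio_derivative(1)[OF ab] in \<open>auto simp: q_def\<close>)
  finally have MN: "mellin (near_seq n (\<xi>1 + \<eta>) f x 0) \<alpha> \<beta> (s + of_nat (bit_rep (\<xi>1 + \<eta>))) 0 = 2 * F h * a * of_real (- 1 * (bump_cdf (q 1) - bump_cdf (q 0)))" .
  have "mellin (far_seq n (\<xi>2 + \<eta>) f x 0) \<beta> \<alpha> (s' + of_nat (bit_rep (\<xi>2 + \<eta>))) 0 = integral {0..1} (\<lambda>t. 2 * (F h * cutoff a (q' t) / of_real t))"
    by (rule mellin_of_profile[OF ab(2,1) d(2) W])
  also have "\<dots> = 2 * F h * a * of_real (1 * (bump_cdf (q' 1) - bump_cdf (q' 0)))"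
    by (rule logistic_substitution[OF cq(2) rq(2)]) (use sq(2) logistic_ratio_derivative(2)[OF ab] in \<open>auto simp: q'_def\<close>)
  finally have MW: "mellin (far_seq n (\<xi>2 + \<eta>) f x 0) \<beta> \<alpha> (s' + of_nat (bit_rep (\<xi>2 + \<eta>))) 0 = 2 * F h * a * of_real (1 * (bump_cdf (q' 1) - bump_cdf (q' 0)))" .
  have "q' 1 = q 1" "q 0 = 1" "q' 0 = 0" using ab by (simp_all add: q_def q'_def add.commute)
  then have sum: "2 * F h * a * of_real (- 1 * (bump_cdf (q 1) - bump_cdf (q 0))) + 2 * F h * a * of_real (1 * (bump_cdf (q' 1) - bump_cdf (q' 0))) =
      (2 * a * of_real (bump_cdf 1 - bump_cdf 0)) * F h"
    by (simp add: algebra_simps)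
  have z: "(l1 - l1 - l2 + l2) / 2 = 0" "l2 - l2 = 0" by simp_all
  have "det h \<noteq> 0" by (rule GL_det[OF h])
  then have a0: "abs_char 0 0 (det h) = 1" by simp
  have "B_op n (\<xi>1, \<xi>2) \<eta> (l1, l2) \<nu> f h = abs_char 0 (l2 - l2) (det h) *
    (mellin_reg 0 (near_seq n (\<xi>1 + \<eta>) f x) \<alpha> \<beta> (s + of_nat (bit_rep (\<xi>1 + \<eta>))) ((l1 - l1 - l2 + l2) / 2) *
       rGamma ((s' + of_nat (bit_rep (\<xi>2 + \<eta>))) / 2) +
     rGamma ((s + of_nat (bit_rep (\<xi>1 + \<eta>))) / 2) *
       mellin_reg 0 (far_seq n (\<xi>2 + \<eta>) f x) \<beta> \<alpha> (s' + of_nat (bit_rep (\<xi>2 + \<eta>))) ((l1 - l1 - l2 + l2) / 2))"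
    using B_op_eq[OF fpi n x, of \<eta> \<nu>]
    unfolding B_cont_def case_prod_conv Hx \<alpha>_def[symmetric] \<beta>_def[symmetric] s_def[symmetric] s'_def[symmetric]
      mellin_entire_eq[OF ab(1,2) ec(1) disjI2[OF vN], where m = 0] mellin_entire_eq[OF ab(2,1) ec(2) disjI2[OF vW], where m = 0] .
  also have "\<dots> = rGamma ((s + of_nat (bit_rep (\<xi>1 + \<eta>))) / 2) * rGamma ((s' + of_nat (bit_rep (\<xi>2 + \<eta>))) / 2) *
    (mellin (near_seq n (\<xi>1 + \<eta>) f x 0) \<alpha> \<beta> (s + of_nat (bit_rep (\<xi>1 + \<eta>))) 0 +
     mellin (far_seq n (\<xi>2 + \<eta>) f x 0) \<beta> \<alpha> (s' + of_nat (bit_rep (\<xi>2 + \<eta>))) 0)"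
    unfolding z a0 mellin_reg.simps(1) by (simp only: mult_1 distrib_left distrib_right mult.assoc mult.left_commute mult.commute)
  also have "\<dots> = rGamma ((s + of_nat (bit_rep (\<xi>1 + \<eta>))) / 2) * rGamma ((s' + of_nat (bit_rep (\<xi>2 + \<eta>))) / 2) *
      ((2 * a * of_real (bump_cdf 1 - bump_cdf 0)) * F h)"
    unfolding MN MW sum ..
  finally show ?thesis unfolding f_def s_def s'_def by (simp only: mult.assoc)
qed

lemma rGamma_half_nonzero:
  assumes "z \<notin> {- 2 * of_nat k | k. True}"
  shows "rGamma (z / 2 :: complex) \<noteq> 0"
proof
  assume "rGamma (z / 2) = 0"
  then obtain k where "z / 2 = - of_nat k" by (auto simp: rGamma_eq_zero_iff elim!: nonpos_Ints_cases')
  then have "z = - 2 * of_nat k" by (simp add: field_simps)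
  with assms show False by blast
qed

theorem proposition3p5:
  fixes n :: nat and \<xi>1 \<xi>2 \<eta> :: bit and lam1 lam2 \<nu> :: complex
  assumes "n \<ge> 1"
    and "lam1 - \<nu> + of_nat n / 2 + of_nat (bit_rep (\<xi>1 + \<eta>)) \<notin> {- 2 * of_nat k | k. True}"
    and "\<nu> - lam2 + of_nat n / 2 + of_nat (bit_rep (\<xi>2 + \<eta>)) \<notin> {- 2 * of_nat k | k. True}"
  shows "B_op n (\<xi>1, \<xi>2) \<eta> (lam1, lam2) \<nu> ` pi_space n (\<xi>1, \<xi>2) (lam1, lam2) =
         tau_space n (\<xi>1, \<eta>, \<xi>2) (lam1, \<nu>, lam2)"
proof (intro equalityI subsetI)
  fix F assume "F \<in> B_op n (\<xi>1, \<xi>2) \<eta> (lam1, lam2) \<nu> ` pi_space n (\<xi>1, \<xi>2) (lam1, lam2)"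
  then obtain f where f: "f \<in> pi_space n (\<xi>1, \<xi>2) (lam1, lam2)" "F = B_op n (\<xi>1, \<xi>2) \<eta> (lam1, lam2) \<nu> f" by blast
  show "F \<in> tau_space n (\<xi>1, \<eta>, \<xi>2) (lam1, \<nu>, lam2)"
    unfolding f(2) by (rule B_op_in_tau_space[OF f(1) assms(1)])
next
  fix F assume F: "F \<in> tau_space n (\<xi>1, \<eta>, \<xi>2) (lam1, \<nu>, lam2)"
  define G1 G2 where "G1 = rGamma ((lam1 - \<nu> + of_nat n / 2 + of_nat (bit_rep (\<xi>1 + \<eta>))) / 2)"
    and "G2 = rGamma ((\<nu> - lam2 + of_nat n / 2 + of_nat (bit_rep (\<xi>2 + \<eta>))) / 2)"
  have G: "G1 \<noteq> 0" "G2 \<noteq> 0" unfolding G1_def G2_def by (rule rGamma_half_nonzero[OF assms(2)], rule rGamma_half_nonzero[OF assms(3)])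
  define a where "a = 1 / (2 * G1 * G2 * of_real (bump_cdf 1 - bump_cdf 0))"
  define f where "f = section_of n (\<xi>1, \<xi>2) (lam1, lam2) a F"
  have "complex_of_real (bump_cdf 1 - bump_cdf 0) \<noteq> 0" using bump_cdf_nonconstant by simp
  then have c: "G1 * G2 * (2 * a * of_real (bump_cdf 1 - bump_cdf 0)) = 1" using G by (simp add: a_def)
  have "B_op n (\<xi>1, \<xi>2) \<eta> (lam1, lam2) \<nu> f = F"
  proof (rule extensionalityI[where A = "GL (2 * n - 1)"])
    show "B_op n (\<xi>1, \<xi>2) \<eta> (lam1, lam2) \<nu> f \<in> extensional (GL (2 * n - 1))" by (simp add: B_op_def)
    show "F \<in> extensional (GL (2 * n - 1))" using F by (simp add: tau_space_iff[OF assms(1)])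
    fix h assume "h \<in> GL (2 * n - 1)"
    from B_op_section_of[OF F assms(1) this, of a]
    show "B_op n (\<xi>1, \<xi>2) \<eta> (lam1, lam2) \<nu> f h = F h"
      unfolding f_def[symmetric] G1_def[symmetric] G2_def[symmetric] c by (simp only: mult_1)
  qed
  moreover have "f \<in> pi_space n (\<xi>1, \<xi>2) (lam1, lam2)" unfolding f_def by (rule section_of_in_pi_space[OF F assms(1)])
  ultimately show "F \<in> B_op n (\<xi>1, \<xi>2) \<eta> (lam1, lam2) \<nu> ` pi_space n (\<xi>1, \<xi>2) (lam1, lam2)" by blast
qed

end
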